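(* Let $m,p$ be positive integers, let $n=mp$, and assume that the integer $$d(m,p)=\frac{1!\,2!\cdots(p-1)!\,(mp)!}{m!\,(m+1)!\cdots(m+p-1)!}$$ is even. Then the pole placement map $\chi$ is not generically surjective over $\mathbb{R}$ (for these $m,p,n$) if and only if there exist a real system $(\bar A,\bar B,\bar C)$ (real matrices of sizes $n\times n$, $n\times m$, $p\times n$) and a monic polynomial $\bar\phi\in\mathbb{R}[s]$ of degree $n$ such that the fiber $\tilde\chi_{(\bar A,\bar B,\bar C)}^{-1}(\bar\phi)\subset\mathbb{C}^{mp}$ of the complexified pole placement map consists of $d(m,p)$ different complex points, none of them real.
   Context: For real matrices $A,B,C$ of sizes $n\times n$, $n\times m$, $p\times n$, the real pole placement map is $$\chi_{(A,B,C)}:\mathbb{R}^{mp}\to\mathbb{R}^n,\qquad K\mapsto\det(sI-A-BKC),$$ where $\mathbb{R}^{mp}$ is the space of real $m\times p$ matrices $K$ and $\mathbb{R}^n$ is identified with the set of monic real polynomials $s^n+a_{n-1}s^{n-1}+\cdots+a_0$ of degree $n$. The complexified map $\tilde\chi_{(A,B,C)}:\mathbb{C}^{mp}\to\mathbb{C}^n$ is given by the same formula with complex $m\times p$ matrices $K$ and monic complex polynomials. Systems $(A,B,C)$ of the given sizes form the vector space $V=\mathbb{R}^{n(n+m+p)}$. A subset $G\subset V$ is generic if some non-trivial (not identically zero) polynomial on $V$ vanishes on the complement $V\setminus G$. One says that $\chi$ is generically surjective over $\mathbb{R}$ (for given $m,p,n$) if the set of systems $(A,B,C)\in V$ for which $\chi_{(A,B,C)}$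 is surjective is generic (equivalently, contains a generic set). *)

theory Defs
  imports "HOL-Analysis.Analysis" "HOL-Computational_Algebra.Polynomial"
begin

(* A system (A, B, C) has n states, m inputs and p outputs, where n, m, p are the cardinalities
   of the index types 'n, 'm, 'p.  In "'a ^ 'c ^ 'r" the rows are indexed by 'r and the columns
   by 'c, so A is n x n, B is n x m, C is p x n, and a feedback K :: "'a ^ 'p ^ 'm" is m x p. *)
type_synonym ('a, 'n, 'm, 'p) linsys =
  "(('a, 'n) vec, 'n) vec \<times> (('a, 'm) vec, 'n) vec \<times> (('a, 'n) vec, 'p) vec"

(* det (s I - M), computed in the polynomial ring with s = [:0, 1:]. *)
definition charpoly :: "'a::comm_ring_1 ^ 'n ^ 'n \<Rightarrow> 'a poly" where
  "charpoly M = det (mat [:0, 1:] - map_matrix (\<lambda>x. [:x:]) M)"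

definition monic_polys :: "nat \<Rightarrow> 'a::comm_ring_1 poly set" where
  "monic_polys n = {q. degree q = n \<and> lead_coeff q = 1}"

definition pole_placement ::
  "('a::comm_ring_1, 'n::finite, 'm::finite, 'p::finite) linsys \<Rightarrow> 'a ^ 'p ^ 'm \<Rightarrow> 'a poly" where
  "pole_placement = (\<lambda>(A, B, C) K. charpoly (A + B ** K ** C))"

definition pole_placement_surj ::
  "('a::comm_ring_1, 'n::finite, 'm::finite, 'p::finite) linsys \<Rightarrow> bool" where
  "pole_placement_surj S \<longleftrightarrow> range (pole_placement S) = monic_polys CARD('n)"

definition complexify_matrix :: "real ^ 'c ^ 'r \<Rightarrow> complex ^ 'c ^ 'r" where
  "complexify_matrix = map_matrix complex_of_real"

definition complexify_sys ::
  "(real, 'n::finite, 'm::finite, 'p::finite) linsys \<Rightarrow> (complex, 'n, 'm, 'p) linsys" where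
  "complexify_sys = (\<lambda>(A, B, C). (complexify_matrix A, complexify_matrix B, complexify_matrix C))"

definition complex_fiber ::
  "(real, 'n::finite, 'm::finite, 'p::finite) linsys \<Rightarrow> real poly \<Rightarrow> (complex ^ 'p ^ 'm) set" where
  "complex_fiber S \<phi> =
     {K. pole_placement (complexify_sys S) K = map_poly complex_of_real \<phi>}"

(* G need not itself be Zariski open: it only has to contain the complement of the zero set
   of some nonzero polynomial. *)
definition generic :: "'v::real_normed_vector set \<Rightarrow> bool" where
  "generic G \<longleftrightarrow>
     (\<exists>f. real_polynomial_function f \<and> (\<exists>x. f x \<noteq> 0) \<and> (\<forall>x. x \<notin> G \<longrightarrow> f x = 0))"

(* The division is exact: the quotient is the degree of the Grassmannian Gr(p, m + p) in its
   Pluecker embedding. *)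
definition grassmann_degree :: "nat \<Rightarrow> nat \<Rightarrow> nat" where
  "grassmann_degree m p = (\<Prod>i=1..<p. fact i) * fact (m * p) div (\<Prod>i<p. fact (m + i))"

end

theory Submission
  imports Defs "HOL-Library.Function_Algebras" "Jordan_Normal_Form.Determinant" "Jordan_Normal_Form.Char_Poly"
begin

text \<open>
  By Laplace expansion the coefficients of \<open>det (s I - A - B K C)\<close> are linear combinations of the maximal minors
  of \<open>[I, -K]\<close>, i.e. of Pluecker coordinates. For one special system, built from the osculating flag of the
  rational normal curve, the coefficient of \<open>s ^ (n - r)\<close> involves exactly the minors of weight \<open>r\<close>, where the
  entry \<open>K i j\<close> has weight \<open>m + j - i\<close>. The straightening relations show that these coefficients are a
  homogeneous system of parameters, so comparing the numbers of monomials upstairs and downstairs gives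
  \<open>n! / (\<Prod>i j. m + j - i) = d(m, p)\<close> points in every unramified fibre.

  The same relations, perturbed, show that the complex map is proper outside a hypersurface of systems; as the
  complement of a complex hypersurface is connected, every system and polynomial outside some hypersurface
  has exactly \<open>d(m, p)\<close> preimages.

  If a fibre has \<open>d(m, p)\<close> points, none of them real, then a real solution for a nearby system and the same
  polynomial would, after a small perturbation to a generic pair, yield \<open>d(m, p) + 1\<close> preimages. So surjectivity
  fails on an open set of systems, on which no nonzero polynomial vanishes. Conversely, if surjectivity is not
  generic, it fails for some real system in the proper generic locus; the polynomials it misses form an open
  set, which contains a generic one, and the fibre over it has \<open>d(m, p)\<close> points and no real ones.
\<close>

section \<open>Polynomial functions in complex coordinates\<close>

text \<open>Local inversion uses two-point functions: a difference \<open>f u - f v\<close> is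
  written as a sum of \<open>g i (u, v) * (x i u - x i v)\<close>. The determinant of these
  quotients is the Jacobian on the diagonal; off the diagonal its nonvanishing forces points with
  equal images to coincide, and invariance of domain turns this into local homeomorphy. The degree
  comes from growth rates. In \<open>n\<close> variables of weights \<open>w i\<close> there are
  asymptotically \<open>t ^ n / (n! * prod w)\<close> monomials of weight at most \<open>t\<close>.
  A fibre of \<open>c\<close> simple points makes the polynomials in \<open>K\<close> comparable, up
  to a bounded shift of \<open>t\<close>, with \<open>c\<close> copies of those in the coefficients,
  whose weights are \<open>1, ..., n\<close>; hence \<open>c * prod w = n!\<close>. A given fibre
  with \<open>d(m, p)\<close> points may lie over a pair at which neither properness nor simplicity
  is known, so it cannot be continued directly to nearby pairs. What is used instead is that its
  points are isolated and that generic fibres nearby have no more than \<open>d(m, p)\<close>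
  points.\<close>

inductive_set polyfun :: "('a \<Rightarrow> complex) set \<Rightarrow> ('a \<Rightarrow> complex) set" for C where
  const: "(\<lambda>_. c) \<in> polyfun C"
| base: "f \<in> C \<Longrightarrow> f \<in> polyfun C"
| add: "f \<in> polyfun C \<Longrightarrow> g \<in> polyfun C \<Longrightarrow> (\<lambda>x. f x + g x) \<in> polyfun C"
| mult: "f \<in> polyfun C \<Longrightarrow> g \<in> polyfun C \<Longrightarrow> (\<lambda>x. f x * g x) \<in> polyfun C"

lemma polyfun_uminus: "f \<in> polyfun C \<Longrightarrow> (\<lambda>x. - f x) \<in> polyfun C"
  using polyfun.mult[OF polyfun.const[of "-1"], of f] by simp

lemma polyfun_diff: "f \<in> polyfun C \<Longrightarrow> g \<in> polyfun C \<Longrightarrow> (\<lambda>x. f x - g x) \<in> polyfun C"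
  using polyfun.add[OF _ polyfun_uminus, of f C g] by simp

lemma polyfun_scale: "f \<in> polyfun C \<Longrightarrow> (\<lambda>x. c * f x) \<in> polyfun C"
  by (rule polyfun.mult[OF polyfun.const])

lemma polyfun_sum: "(\<And>i. i \<in> A \<Longrightarrow> f i \<in> polyfun C) \<Longrightarrow> (\<lambda>x. \<Sum>i\<in>A. f i x) \<in> polyfun C"
  by (induction A rule: infinite_finite_induct) (auto intro: polyfun.intros)

lemma polyfun_prod: "(\<And>i. i \<in> A \<Longrightarrow> f i \<in> polyfun C) \<Longrightarrow> (\<lambda>x. \<Prod>i\<in>A. f i x) \<in> polyfun C"
  by (induction A rule: infinite_finite_induct) (auto intro: polyfun.intros)

lemma polyfun_power: "f \<in> polyfun C \<Longrightarrow> (\<lambda>x. f x ^ k) \<in> polyfun C"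
  by (induction k) (auto intro: polyfun.intros)

lemma polyfun_compose:
  assumes "f \<in> polyfun C" "\<And>c. c \<in> C \<Longrightarrow> (\<lambda>x. c (h x)) \<in> polyfun C'"
  shows "(\<lambda>x. f (h x)) \<in> polyfun C'"
  using assms(1) by induction (auto intro: polyfun.intros assms(2))

lemma polyfun_continuous:
  assumes "f \<in> polyfun C" "\<And>c. c \<in> C \<Longrightarrow> continuous_on UNIV c"
  shows "continuous_on UNIV f"
  using assms(1) by induction (auto intro: continuous_intros assms(2))

lemma polyfun_line:
  assumes "f \<in> polyfun C" "\<And>c. c \<in> C \<Longrightarrow> \<exists>a b. \<forall>t. c (l t) = a + b * t"
  shows "\<exists>q. \<forall>t. f (l t) = poly q t"
  using assms(1)
proof induction
  case (const c)
  show ?case by (rule exI[of _ "[:c:]"]) simp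
next
  case (base f)
  then obtain a b where "\<forall>t. f (l t) = a + b * t" using assms(2) by blast
  then show ?case by (intro exI[of _ "[:a, b:]"]) (simp add: mult.commute)
next
  case (add f g)
  then obtain p q where "\<forall>t. f (l t) = poly p t" "\<forall>t. g (l t) = poly q t" by blast
  then show ?case by (intro exI[of _ "p + q"]) simp
next
  case (mult f g)
  then obtain p q where "\<forall>t. f (l t) = poly p t" "\<forall>t. g (l t) = poly q t" by blast
  then show ?case by (intro exI[of _ "p * q"]) simp
qed

text \<open>The product rule in finite-difference form, by induction on how \<open>f\<close> is
  built. \<open>C\<close> holds the coordinates on which \<open>u\<close> and \<open>v\<close> agree
  (the parameters of a family), \<open>x\<close> those in which they may differ; the quotients
  \<open>g i\<close> are again polynomial, now in the pair of points.\<close>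

lemma polyfun_hadamard:
  assumes "f \<in> polyfun (C \<union> x ` {..<N::nat})"
  shows "\<exists>g. (\<forall>i<N. g i \<in> polyfun ((\<lambda>c uv. c (fst uv)) ` (C \<union> x ` {..<N}) \<union> (\<lambda>c uv. c (snd uv)) ` (C \<union> x ` {..<N})))
    \<and> (\<forall>u v. (\<forall>c\<in>C. c u = c v) \<longrightarrow> f u - f v = (\<Sum>i<N. g i (u, v) * (x i u - x i v)))"
    (is "\<exists>g. (\<forall>i<N. g i \<in> ?P) \<and> _")
  using assms
proof induction
  case (const c)
  show ?case by (rule exI[of _ "\<lambda>_ _. 0"]) (auto intro: polyfun.const)
next
  case (base f)
  show ?case
  proof (cases "f \<in> C")
    case True
    then show ?thesis by (intro exI[of _ "\<lambda>_ _. 0"]) (auto intro: polyfun.const)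
  next
    case False
    then obtain k where k: "k < N" "f = x k" using base by auto
    have "f u - f v = (\<Sum>i<N. (if i = k then 1 else 0) * (x i u - x i v))" for u v
      using k by (simp add: if_distrib[of "\<lambda>z. z * _"] cong: if_cong)
    then show ?thesis by (intro exI[of _ "\<lambda>i _. if i = k then 1 else 0"]) (auto intro: polyfun.const)
  qed
next
  case (add f f')
  then obtain g g' where g: "\<forall>i<N. g i \<in> ?P" "\<forall>u v. (\<forall>c\<in>C. c u = c v) \<longrightarrow> f u - f v = (\<Sum>i<N. g i (u, v) * (x i u - x i v))"
    and g': "\<forall>i<N. g' i \<in> ?P" "\<forall>u v. (\<forall>c\<in>C. c u = c v) \<longrightarrow> f' u - f' v = (\<Sum>i<N. g' i (u, v) * (x i u - x i v))"
    by blast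
  have "f u + f' u - (f v + f' v) = (\<Sum>i<N. (g i (u,v) + g' i (u, v)) * (x i u - x i v))" if "\<forall>c\<in>C. c u = c v" for u v
  proof -
    have "f u - f v = (\<Sum>i<N. g i (u, v) * (x i u - x i v))" "f' u - f' v = (\<Sum>i<N. g' i (u, v) * (x i u - x i v))"
      using g(2) g'(2) that by blast+
    moreover have "(\<Sum>i<N. (g i (u,v) + g' i (u, v)) * (x i u - x i v))
      = (\<Sum>i<N. g i (u, v) * (x i u - x i v)) + (\<Sum>i<N. g' i (u, v) * (x i u - x i v))"
      by (simp add: distrib_right sum.distrib)
    ultimately show ?thesis by (metis add_diff_add)
  qed
  then show ?case using g(1) g'(1)
    by (intro exI[of _ "\<lambda>i uv. g i uv + g' i uv"]) (auto intro: polyfun.add)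
next
  case (mult f f')
  then obtain g g' where g: "\<forall>i<N. g i \<in> ?P" "\<forall>u v. (\<forall>c\<in>C. c u = c v) \<longrightarrow> f u - f v = (\<Sum>i<N. g i (u, v) * (x i u - x i v))"
    and g': "\<forall>i<N. g' i \<in> ?P" "\<forall>u v. (\<forall>c\<in>C. c u = c v) \<longrightarrow> f' u - f' v = (\<Sum>i<N. g' i (u, v) * (x i u - x i v))"
    by blast
  have fP: "(\<lambda>uv. f' (fst uv)) \<in> ?P"
    by (rule polyfun_compose[OF mult(2)]) (auto intro!: polyfun.base)
  have fP': "(\<lambda>uv. f (snd uv)) \<in> ?P"
    by (rule polyfun_compose[OF mult(1)]) (auto intro!: polyfun.base)
  have "f u * f' u - f v * f' v = (\<Sum>i<N. (g i (u,v) * f' u + f v * g' i (u, v)) * (x i u - x i v))" if "\<forall>c\<in>C. c u = c v" for u v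
  proof -
    have "f u * f' u - f v * f' v = (f u - f v) * f' u + f v * (f' u - f' v)" by (simp add: algebra_simps)
    also have "\<dots> = (\<Sum>i<N. g i (u, v) * (x i u - x i v)) * f' u + f v * (\<Sum>i<N. g' i (u, v) * (x i u - x i v))"
      using g(2) g'(2) that by simp
    also have "\<dots> = (\<Sum>i<N. (g i (u,v) * f' u + f v * g' i (u, v)) * (x i u - x i v))"
      by (simp add: sum_distrib_left sum_distrib_right sum.distrib[symmetric] algebra_simps)
    finally show ?thesis .
  qed
  then show ?case using g(1) g'(1)
    by (intro exI[of _ "\<lambda>i uv. g i uv * f' (fst uv) + f (snd uv) * g' i uv"])
      (auto intro!: polyfun.add polyfun.mult fP fP')
qed

section \<open>Linear dependence of families of complex-valued functions\<close>

lemma sum_fun_apply: "(\<Sum>i\<in>A. f i) x = (\<Sum>i\<in>A. f i x)"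
  by (induction A rule: infinite_finite_induct) auto

interpretation fs: vector_space "\<lambda>(c::complex) (f::'a \<Rightarrow> complex) x. c * f x"
  by unfold_locales (auto simp: fun_eq_iff algebra_simps)

text \<open>Repetitions have to count as dependence, since the families are indexed by exponent
  vectors, which may yield equal functions; the set of values would lose them. Hence the separate
  case of two equal members.\<close>

lemma family_dependent:
  fixes y :: "'e \<Rightarrow> 'a \<Rightarrow> complex"
  assumes "finite E" "finite T" "\<And>e. e \<in> E \<Longrightarrow> y e \<in> fs.span T" "card T < card E"
  shows "\<exists>c. (\<exists>e\<in>E. c e \<noteq> 0) \<and> (\<forall>x. (\<Sum>e\<in>E. c e * y e x) = 0)"
proof (cases "inj_on y E")
  case False
  then obtain a b where ab: "a \<in> E" "b \<in> E" "a \<noteq> b" "y a = y b" by (auto simp: inj_on_def)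
  define c where "c = (\<lambda>e. if e = a then 1 else if e = b then -1 else (0::complex))"
  have "(\<Sum>e\<in>E. c e * y e x) = (\<Sum>e\<in>{a,b}. c e * y e x)" for x
    by (rule sum.mono_neutral_right) (use ab assms(1) in \<open>auto simp: c_def\<close>)
  also have "\<dots> x = 0" for x using ab by (simp add: c_def)
  finally have "\<forall>x. (\<Sum>e\<in>E. c e * y e x) = 0" by simp
  moreover have "c a \<noteq> 0" by (simp add: c_def)
  ultimately show ?thesis using ab(1) by blast
next
  case True
  have fin: "finite (y ` E)" using assms(1) by simp
  have "fs.dependent (y ` E)"
  proof (rule ccontr)
    assume "\<not> fs.dependent (y ` E)"
    with fs.independent_span_bound[OF assms(2) this] assms(3) have "card (y ` E) \<le> card T" by blast
    with assms(4) card_image[OF True] show False by simp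
  qed
  then obtain u v where uv: "v \<in> y ` E" "u v \<noteq> 0" "(\<Sum>v\<in>y ` E. (\<lambda>x. u v * v x)) = 0"
    unfolding fs.dependent_finite[OF fin] by blast
  have "(\<Sum>e\<in>E. u (y e) * y e x) = 0" for x
  proof -
    have "(\<Sum>e\<in>E. u (y e) * y e x) = (\<Sum>v\<in>y ` E. u v * v x)" by (simp add: sum.reindex[OF True])
    also have "\<dots> = (\<Sum>v\<in>y ` E. (\<lambda>x. u v * v x)) x" by (simp add: sum_fun_apply)
    finally show ?thesis by (simp add: uv(3))
  qed
  then show ?thesis using uv(1,2) by (intro exI[of _ "u \<circ> y"]) auto
qed

text \<open>The underlying spaces are only real Euclidean spaces. Their complex structure is encoded
  by \<open>N\<close> real-linear functions that jointly form a bijection onto complex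
  \<open>N\<close>-tuples.\<close>

definition coords :: "nat \<Rightarrow> (nat \<Rightarrow> 'a::euclidean_space \<Rightarrow> complex) \<Rightarrow> bool" where
  "coords N x \<longleftrightarrow> (\<forall>i<N. linear (x i)) \<and> (\<forall>c. \<exists>v. \<forall>i<N. x i v = c i) \<and> (\<forall>v. (\<forall>i<N. x i v = 0) \<longrightarrow> v = 0)"

lemma coords_linear: "coords N x \<Longrightarrow> i < N \<Longrightarrow> linear (x i)"
  by (auto simp: coords_def)

lemma coords_continuous: "coords N x \<Longrightarrow> i < N \<Longrightarrow> continuous_on A (x i)"
  using coords_linear linear_continuous_on linear_conv_bounded_linear by blast

lemma coords_ex: "coords N x \<Longrightarrow> \<exists>v. \<forall>i<N. x i v = c i"
  by (auto simp: coords_def)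

lemma coords_inj:
  assumes "coords N x" "\<And>i. i < N \<Longrightarrow> x i u = x i v"
  shows "u = v"
proof -
  have "x i (u - v) = 0" if "i < N" for i
    using coords_linear[OF assms(1) that] assms(2)[OF that] by (simp add: linear_diff)
  then show ?thesis using assms(1) unfolding coords_def by (metis eq_iff_diff_eq_0)
qed

definition coords_prod :: "nat \<Rightarrow> (nat \<Rightarrow> 'a \<Rightarrow> complex) \<Rightarrow> (nat \<Rightarrow> 'b \<Rightarrow> complex) \<Rightarrow> nat \<Rightarrow> 'a \<times> 'b \<Rightarrow> complex" where
  "coords_prod M x y = (\<lambda>i v. if i < M then x i (fst v) else y (i - M) (snd v))"

lemma coords_prod: 
  assumes x: "coords M x" and y: "coords N y"
  shows "coords (M + N) (coords_prod M x y)"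
  unfolding coords_def
proof (intro conjI allI impI)
  fix i assume i: "i < M + N"
  show "linear (coords_prod M x y i)"
  proof (cases "i < M")
    case True
    then show ?thesis using linear_compose[OF linear_fst coords_linear[OF x True]]
      by (simp add: coords_prod_def o_def)
  next
    case False
    then have "i - M < N" using i by simp
    from linear_compose[OF linear_snd coords_linear[OF y this]] False show ?thesis
      by (simp add: coords_prod_def o_def)
  qed
next
  fix c :: "nat \<Rightarrow> complex"
  obtain u where u: "\<forall>i<M. x i u = c i" using coords_ex[OF x] by blast
  obtain v where v: "\<forall>i<N. y i v = c (i + M)" using coords_ex[OF y, of "\<lambda>i. c (i + M)"] by blast
  show "\<exists>v. \<forall>i<M + N. coords_prod M x y i v = c i"
    by (rule exI[of _ "(u, v)"]) (use u v in \<open>auto simp: coords_prod_def\<close>)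
next
  fix v :: "'a \<times> 'b" assume h: "\<forall>i<M + N. coords_prod M x y i v = 0"
  have "x i (fst v) = 0" if "i < M" for i using h that by (auto simp: coords_prod_def dest: spec[of _ i])
  moreover have "y i (snd v) = 0" if "i < N" for i using h[rule_format, of "i + M"] that by (auto simp: coords_prod_def)
  ultimately show "v = 0" using x y unfolding coords_def by (metis prod.collapse zero_prod_def)
qed

lemma coords_prod_image:
  "coords_prod M x y ` {..<M + N} = (\<lambda>c v. c (fst v)) ` x ` {..<M} \<union> (\<lambda>c v. c (snd v)) ` y ` {..<N}" (is "?L = ?R")
proof
  show "?L \<subseteq> ?R"
  proof
    fix f assume "f \<in> ?L"
    then obtain i where i: "i < M + N" "f = coords_prod M x y i" by auto
    show "f \<in> ?R"
    proof (cases "i < M")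
      case True then show ?thesis using i by (auto simp: coords_prod_def)
    next
      case False
      then have "i - M < N" "f = (\<lambda>v. y (i - M) (snd v))" using i by (auto simp: coords_prod_def)
      then show ?thesis by blast
    qed
  qed
  show "?R \<subseteq> ?L"
  proof
    fix f assume "f \<in> ?R"
    then consider i where "i < M" "f = (\<lambda>v. x i (fst v))" | i where "i < N" "f = (\<lambda>v. y i (snd v))" by auto
    then show "f \<in> ?L"
    proof cases
      case 1 then show ?thesis by (intro image_eqI[of _ _ i]) (auto simp: coords_prod_def)
    next
      case 2 then show ?thesis by (intro image_eqI[of _ _ "i + M"]) (auto simp: coords_prod_def)
    qed
  qed
qed

text \<open>\<open>cs t\<close> plays the role of \<open>t * v\<close> for complex \<open>t\<close>,
  a product that the type \<open>'a\<close> does not offer. It provides the complex lines along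
  which polynomial functions become polynomials in one variable.\<close>

lemma coords_complex_scaling:
  assumes "coords N x"
  obtains cs where "\<And>i t. i < N \<Longrightarrow> x i (cs t) = t * x i v" "linear cs" "cs 1 = v"
proof -
  have "\<exists>w. \<forall>i<N. x i w = t * x i v" for t
    by (rule coords_ex[OF assms])
  then obtain cs where cs: "\<And>i t. i < N \<Longrightarrow> x i (cs t) = t * x i v" by metis
  have "linear cs"
  proof
    fix s t :: complex and r :: real
    show "cs (s + t) = cs s + cs t"
      by (rule coords_inj[OF assms]) (simp add: cs linear_add[OF coords_linear[OF assms]] distrib_right)
    show "cs (r *\<^sub>R s) = r *\<^sub>R cs s"
      by (rule coords_inj[OF assms]) (simp add: cs linear_scale[OF coords_linear[OF assms]])
  qed
  moreover have "cs 1 = v" by (rule coords_inj[OF assms]) (simp add: cs)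
  ultimately show ?thesis using that cs by blast
qed

lemma polyfun_coords_continuous:
  assumes "coords N x" "f \<in> polyfun (x ` {..<N})"
  shows "continuous_on A f"
  using polyfun_continuous[OF assms(2)] coords_continuous[OF assms(1)] continuous_on_subset by blast

lemma polyfun_complex_line:
  assumes "coords N x" "f \<in> polyfun (x ` {..<N})" "linear cs" "\<And>i t. i < N \<Longrightarrow> x i (cs t) = t * x i v"
  shows "\<exists>q. \<forall>t. f (a + cs t) = poly q t"
proof (rule polyfun_line[OF assms(2)])
  fix c assume "c \<in> x ` {..<N}"
  then obtain i where i: "i < N" "c = x i" by auto
  show "\<exists>a' b. \<forall>t. c (a + cs t) = a' + b * t"
    by (rule exI[of _ "x i a"], rule exI[of _ "x i v"]) (use i assms(4) in \<open>simp add: linear_add[OF coords_linear[OF assms(1)]]\<close>)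
qed

text \<open>On the complex line from \<open>w\<close> to \<open>a\<close>, \<open>f\<close> is a
  one-variable polynomial that is nonzero at \<open>t = 1\<close>, so only finitely many points near
  \<open>t = 0\<close> can be zeros.\<close>

lemma polyfun_nonzero_dense:
  assumes "coords N x" "f \<in> polyfun (x ` {..<N})" "f a \<noteq> 0" "open W" "w \<in> W"
  shows "\<exists>v\<in>W. f v \<noteq> 0"
proof -
  obtain cs where cs: "\<And>i t. i < N \<Longrightarrow> x i (cs t) = t * x i (a - w)" "linear cs" "cs 1 = a - w"
    using coords_complex_scaling[OF assms(1)] by blast
  obtain q where q: "\<And>t. f (w + cs t) = poly q t"
    using polyfun_complex_line[OF assms(1,2) cs(2,1)] by blast
  have "q \<noteq> 0" using q[of 1] assms(3) cs(3) by auto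
  then have fin: "finite {t. poly q t = 0}" by (rule poly_roots_finite)
  have "open ((\<lambda>t. w + cs t) -` W)"
    by (intro open_vimage[OF assms(4)] continuous_intros linear_continuous_on)
      (use cs(2) linear_conv_bounded_linear in blast)
  moreover have "0 \<in> (\<lambda>t. w + cs t) -` W" using assms(5) by (simp add: linear_0[OF cs(2)])
  ultimately obtain e where e: "e > 0" "ball 0 e \<subseteq> (\<lambda>t. w + cs t) -` W" using open_contains_ball by blast
  have "infinite (ball (0::complex) e)" using e(1) by (simp add: uncountable_infinite uncountable_ball)
  then obtain t where "t \<in> ball 0 e" "poly q t \<noteq> 0" using fin by (metis (mono_tags) finite_subset mem_Collect_eq subsetI)
  then show ?thesis using q e(2) by (intro bexI[of _ "w + cs t"]) auto
qed

text \<open>By density the open set where \<open>f\<close> does not vanish cannot lie in the zero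
  set of \<open>g\<close>. This absence of zero divisors is what allows factors to be cancelled
  later.\<close>

lemma polyfun_mult_nonzero:
  assumes "coords N x" "f \<in> polyfun (x ` {..<N})" "g \<in> polyfun (x ` {..<N})" "f a \<noteq> 0" "g b \<noteq> 0"
  shows "\<exists>v. f v * g v \<noteq> 0"
proof -
  have "open {v. f v \<noteq> 0}"
    using open_vimage[OF _ polyfun_coords_continuous[OF assms(1,2)], of "- {0}"]
    by (simp add: vimage_def open_Compl)
  from polyfun_nonzero_dense[OF assms(1,3,5) this] assms(4) show ?thesis by auto
qed

text \<open>Two points lie on a complex line, whose part in \<open>W\<close> is a convex open set of
  the plane; deleting the finitely many zeros of \<open>f\<close> leaves it connected. The analogue
  on real lines fails, which is why fibres are counted over the complex numbers.\<close>

lemma connected_polyfun_nonzero: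
  assumes "coords N x" "f \<in> polyfun (x ` {..<N})" "convex W" "open W"
  shows "connected (W \<inter> {v. f v \<noteq> 0})"
  unfolding connected_iff_connected_component
proof (intro ballI)
  fix a b assume a: "a \<in> W \<inter> {v. f v \<noteq> 0}" and b: "b \<in> W \<inter> {v. f v \<noteq> 0}"
  obtain cs where cs: "\<And>i t. i < N \<Longrightarrow> x i (cs t) = t * x i (b - a)" "linear cs" "cs 1 = b - a"
    using coords_complex_scaling[OF assms(1)] by blast
  obtain q where q: "\<And>t. f (a + cs t) = poly q t"
    using polyfun_complex_line[OF assms(1,2) cs(2,1)] by blast
  have "q \<noteq> 0" using q[of 0] a by (auto simp: linear_0[OF cs(2)])
  then have fin: "finite {t. poly q t = 0}" by (rule poly_roots_finite)
  define T where "T = (\<lambda>t. a + cs t) -` W"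
  have contl: "continuous_on A (\<lambda>t. a + cs t)" for A
    by (intro continuous_intros linear_continuous_on) (use cs(2) linear_conv_bounded_linear in blast)
  have oT: "open T" unfolding T_def by (rule open_vimage[OF assms(4) contl])
  have "T = cs -` ((+) (- a) ` W)" unfolding T_def by (force simp: image_iff)
  then have cT: "convex T" using convex_linear_vimage[OF cs(2) convex_translation[OF assms(3), of "- a"]] by (simp only:)
  have t01: "0 \<in> T" "1 \<in> T" using a b by (auto simp: T_def linear_0[OF cs(2)] cs(3))
  have "connected (T - {t. poly q t = 0})"
    by (rule connected_open_diff_countable)
      (use oT cT t01 fin convex_connected countable_finite in auto)
  then have "connected ((\<lambda>t. a + cs t) ` (T - {t. poly q t = 0}))"
    by (rule connected_continuous_image[OF contl])
  moreover have "(\<lambda>t. a + cs t) ` (T - {t. poly q t = 0}) \<subseteq> W \<inter> {v. f v \<noteq> 0}"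
    using q by (auto simp: T_def)
  moreover have "a \<in> (\<lambda>t. a + cs t) ` (T - {t. poly q t = 0})"
    using a t01 q[of 0] by (intro image_eqI[of _ _ 0]) (auto simp: linear_0[OF cs(2)])
  moreover have "b \<in> (\<lambda>t. a + cs t) ` (T - {t. poly q t = 0})"
    using b t01 q[of 1] cs(3) by (intro image_eqI[of _ _ 1]) auto
  ultimately show "connected_component (W \<inter> {v. f v \<noteq> 0}) a b"
    unfolding connected_component_def by blast
qed

section \<open>Weighted monomials and the filtration by weight\<close>

definition mon :: "nat \<Rightarrow> (nat \<Rightarrow> 'a \<Rightarrow> complex) \<Rightarrow> (nat \<Rightarrow> nat) \<Rightarrow> 'a \<Rightarrow> complex" where
  "mon N x \<alpha> = (\<lambda>v. \<Prod>i<N. x i v ^ \<alpha> i)"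

text \<open>Exponent vectors are total functions that are \<open>0\<close> from \<open>N\<close> on,
  so every monomial has exactly one index. The bound is \<open>\<le> t\<close> and not
  \<open>= t\<close>: the spans form a filtration, which also accommodates inhomogeneous polynomials
  such as interpolants.\<close>

definition wset :: "nat \<Rightarrow> (nat \<Rightarrow> nat) \<Rightarrow> nat \<Rightarrow> (nat \<Rightarrow> nat) set" where
  "wset N w t = {\<alpha>. (\<forall>i\<ge>N. \<alpha> i = 0) \<and> (\<Sum>i<N. w i * \<alpha> i) \<le> t}"

lemma finite_wset:
  assumes "\<And>i. i < N \<Longrightarrow> w i > 0"
  shows "finite (wset N w t)"
proof (rule finite_subset)
  show "wset N w t \<subseteq> {f. \<forall>i. (i \<in> {..<N} \<longrightarrow> f i \<in> {..t}) \<and> (i \<notin> {..<N} \<longrightarrow> f i = 0)}"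
  proof clarify
    fix \<alpha> i assume a: "\<alpha> \<in> wset N w t"
    have "\<alpha> i \<le> t" if "i < N"
    proof -
      have "\<alpha> i \<le> w i * \<alpha> i" using assms[OF that] by simp
      also have "\<dots> \<le> (\<Sum>i<N. w i * \<alpha> i)" using that by (intro member_le_sum) auto
      also have "\<dots> \<le> t" using a by (simp add: wset_def)
      finally show ?thesis .
    qed
    then show "(i \<in> {..<N} \<longrightarrow> \<alpha> i \<in> {..t}) \<and> (i \<notin> {..<N} \<longrightarrow> \<alpha> i = 0)"
      using a by (auto simp: wset_def)
  qed
  show "finite {f::nat\<Rightarrow>nat. \<forall>i. (i \<in> {..<N} \<longrightarrow> f i \<in> {..t}) \<and> (i \<notin> {..<N} \<longrightarrow> f i = 0)}"
    by (rule finite_set_of_finite_funs) auto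
qed

lemma mon_polyfun: "mon N x \<alpha> \<in> polyfun (x ` {..<N})"
  unfolding mon_def by (intro polyfun_prod polyfun_power polyfun.base) auto

lemma mon_0: "mon N x (\<lambda>_. 0) = (\<lambda>_. 1)"
  by (simp add: mon_def)

lemma mon_add: "mon N x (\<lambda>i. \<alpha> i + \<beta> i) v = mon N x \<alpha> v * mon N x \<beta> v"
  by (simp add: mon_def power_add prod.distrib)

lemma mon_single: "i < N \<Longrightarrow> mon N x (\<lambda>j. if j = i then 1 else 0) v = x i v"
  unfolding mon_def by (subst prod.remove[of _ i]) auto

text \<open>Induction on the number of variables: with the first \<open>N\<close> values fixed, the
  sum is a polynomial in the last one, all of whose coefficients vanish. The coefficient of degree
  \<open>k = \<alpha> N\<close> involves only the exponents in \<open>E'\<close>, and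
  \<open>r\<close> clears their last entry.\<close>

lemma mon_independent_aux:
  assumes "finite E" "\<And>\<alpha> i. \<alpha> \<in> E \<Longrightarrow> i \<ge> N \<Longrightarrow> \<alpha> i = 0"
    "\<And>z :: nat \<Rightarrow> complex. (\<Sum>\<alpha>\<in>E. c \<alpha> * (\<Prod>i<N. z i ^ \<alpha> i)) = 0" "\<alpha> \<in> E"
  shows "c \<alpha> = 0"
  using assms
proof (induction N arbitrary: E c \<alpha>)
  case 0
  have "E \<subseteq> {\<lambda>_. 0}" using 0(2) by auto
  with 0(4) have "E = {\<alpha>}" by auto
  then show ?case using 0(3) by simp
next
  case (Suc N)
  define k where "k = \<alpha> N"
  define E' where "E' = {\<beta> \<in> E. \<beta> N = k}"
  define r where "r = (\<lambda>\<beta>::nat\<Rightarrow>nat. \<beta>(N := 0))"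
  have inj: "inj_on r E'" unfolding r_def E'_def inj_on_def by (metis (mono_tags, lifting) fun_upd_triv fun_upd_upd mem_Collect_eq)
  have z0: "(\<Sum>\<beta>\<in>r ` E'. c (\<beta>(N := k)) * (\<Prod>i<N. z i ^ \<beta> i)) = 0" for z :: "nat \<Rightarrow> complex"
  proof -
    define D where "D = (\<lambda>\<beta>. \<beta> N) ` E"
    define q where "q = (\<Sum>\<beta>\<in>E. monom (c \<beta> * (\<Prod>i<N. z i ^ \<beta> i)) (\<beta> N))"
    have "poly q y = 0" for y
    proof -
      have "poly q y = (\<Sum>\<beta>\<in>E. c \<beta> * (\<Prod>i<Suc N. (z(N := y)) i ^ \<beta> i))"
        unfolding q_def by (simp add: poly_sum poly_monom mult.assoc)
      then show ?thesis using Suc.prems(3)[of "z(N := y)"] by (simp only:)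
    qed
    then have "q = 0" using poly_all_0_iff_0 by blast
    then have "0 = coeff q k" by simp
    also have "\<dots> = (\<Sum>\<beta>\<in>E. if \<beta> N = k then c \<beta> * (\<Prod>i<N. z i ^ \<beta> i) else 0)"
      unfolding q_def by (simp add: coeff_sum)
    also have "\<dots> = (\<Sum>\<beta>\<in>E'. c \<beta> * (\<Prod>i<N. z i ^ \<beta> i))"
      unfolding E'_def using Suc.prems(1) by (simp add: sum.inter_filter)
    also have "\<dots> = (\<Sum>\<beta>\<in>r ` E'. c (\<beta>(N := k)) * (\<Prod>i<N. z i ^ \<beta> i))"
      unfolding sum.reindex[OF inj] o_def
    proof (rule sum.cong[OF refl])
      fix \<beta> assume "\<beta> \<in> E'"
      then have "(r \<beta>)(N := k) = \<beta>" by (auto simp: r_def E'_def)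
      moreover have "(\<Prod>i<N. z i ^ r \<beta> i) = (\<Prod>i<N. z i ^ \<beta> i)" by (rule prod.cong) (auto simp: r_def)
      ultimately show "c \<beta> * (\<Prod>i<N. z i ^ \<beta> i) = c ((r \<beta>)(N := k)) * (\<Prod>i<N. z i ^ r \<beta> i)" by simp
    qed
    finally show ?thesis by simp
  qed
  have "c ((r \<alpha>)(N := k)) = 0"
  proof (rule Suc.IH[of "r ` E'" "\<lambda>\<beta>. c (\<beta>(N := k))" "r \<alpha>"])
    show "finite (r ` E')" using Suc.prems(1) by (simp add: E'_def)
    show "\<beta> i = 0" if b: "\<beta> \<in> r ` E'" "i \<ge> N" for \<beta> i
    proof -
      obtain \<gamma> where g: "\<gamma> \<in> E" "\<beta> = r \<gamma>" using b(1) by (auto simp: E'_def)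
      show ?thesis using g b(2) Suc.prems(2)[of \<gamma> i] by (cases "i = N") (auto simp: r_def)
    qed
    show "(\<Sum>\<beta>\<in>r ` E'. c (\<beta>(N := k)) * (\<Prod>i<N. z i ^ \<beta> i)) = 0" for z :: "nat \<Rightarrow> complex" by (rule z0)
    show "r \<alpha> \<in> r ` E'" using Suc.prems(4) by (auto simp: E'_def k_def)
  qed
  moreover have "(r \<alpha>)(N := k) = \<alpha>" by (auto simp: r_def k_def)
  ultimately show ?case by simp
qed

lemma mon_independent:
  assumes "coords N x" "finite E" "E \<subseteq> {\<alpha>. \<forall>i\<ge>N. \<alpha> i = 0}"
    "\<And>v. (\<Sum>\<alpha>\<in>E. c \<alpha> * mon N x \<alpha> v) = 0" "\<alpha> \<in> E"
  shows "c \<alpha> = 0"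
proof (rule mon_independent_aux[OF assms(2) _ _ assms(5)])
  show "\<beta> i = 0" if "\<beta> \<in> E" "i \<ge> N" for \<beta> i using that assms(3) by auto
  fix z :: "nat \<Rightarrow> complex"
  obtain v where v: "\<forall>i<N. x i v = z i" using coords_ex[OF assms(1)] by blast
  show "(\<Sum>\<beta>\<in>E. c \<beta> * (\<Prod>i<N. z i ^ \<beta> i)) = 0"
    using assms(4)[of v] v unfolding mon_def by simp
qed

lemma span_mult:
  assumes "f \<in> fs.span A" "g \<in> fs.span B" "\<And>a b. a \<in> A \<Longrightarrow> b \<in> B \<Longrightarrow> (\<lambda>v. a v * b v) \<in> fs.span D"
  shows "(\<lambda>v. f v * g v) \<in> fs.span D"
proof -
  have 1: "(\<lambda>v. a v * g v) \<in> fs.span D" if a: "a \<in> A" for a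
    using assms(2)
  proof (induction rule: fs.span_induct_alt)
    case base
    then show ?case using fs.span_zero by (simp add: zero_fun_def)
  next
    case (step c b h)
    have "(\<lambda>v. c * (a v * b v)) + (\<lambda>v. a v * h v) \<in> fs.span D"
      by (intro fs.span_add fs.span_scale assms(3)[OF a step(1)] step(2))
    then show ?case by (simp add: plus_fun_def algebra_simps)
  qed
  from assms(1) show ?thesis
  proof (induction rule: fs.span_induct_alt)
    case base
    then show ?case using fs.span_zero by (simp add: zero_fun_def)
  next
    case (step c a h)
    have "(\<lambda>v. c * (a v * g v)) + (\<lambda>v. h v * g v) \<in> fs.span D"
      by (intro fs.span_add fs.span_scale 1[OF step(1)] step(2))
    then show ?case by (simp add: plus_fun_def algebra_simps)
  qed
qed

lemma span_mon_mult:
  assumes "f \<in> fs.span (mon N x ` wset N w s)" "g \<in> fs.span (mon N x ` wset N w t)"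
  shows "(\<lambda>v. f v * g v) \<in> fs.span (mon N x ` wset N w (s + t))"
proof (rule span_mult[OF assms])
  fix a b assume "a \<in> mon N x ` wset N w s" "b \<in> mon N x ` wset N w t"
  then obtain \<alpha> \<beta> where ab: "\<alpha> \<in> wset N w s" "\<beta> \<in> wset N w t" "a = mon N x \<alpha>" "b = mon N x \<beta>" by blast
  have "(\<lambda>i. \<alpha> i + \<beta> i) \<in> wset N w (s + t)"
    using ab(1,2) by (auto simp: wset_def distrib_left sum.distrib)
  moreover have "(\<lambda>v. a v * b v) = mon N x (\<lambda>i. \<alpha> i + \<beta> i)" by (simp add: ab(3,4) mon_add fun_eq_iff)
  ultimately show "(\<lambda>v. a v * b v) \<in> fs.span (mon N x ` wset N w (s + t))"
    by (auto intro: fs.span_base)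
qed

lemma span_mon_mono: "s \<le> t \<Longrightarrow> f \<in> fs.span (mon N x ` wset N w s) \<Longrightarrow> f \<in> fs.span (mon N x ` wset N w t)"
  by (rule subsetD[OF fs.span_mono]) (auto simp: wset_def)

lemma span_mon_const: "(\<lambda>_. c) \<in> fs.span (mon N x ` wset N w t)"
proof -
  have "(\<lambda>_. 1) \<in> fs.span (mon N x ` wset N w t)"
    by (rule fs.span_base) (auto intro!: image_eqI[of _ _ "\<lambda>_. 0"] simp: mon_0 wset_def)
  from fs.span_scale[OF this, of c] show ?thesis by simp
qed

lemma span_mon_coord:
  assumes "i < N" "w i \<le> t"
  shows "x i \<in> fs.span (mon N x ` wset N w t)"
proof (rule fs.span_base, rule image_eqI[of _ _ "\<lambda>j. if j = i then 1 else 0"])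
  show "x i = mon N x (\<lambda>j. if j = i then 1 else 0)" using mon_single[OF assms(1), of x] by (auto simp: fun_eq_iff)
  show "(\<lambda>j. if j = i then 1 else 0) \<in> wset N w t"
    using assms by (auto simp: wset_def if_distrib cong: if_cong)
qed

lemma polyfun_span_mon:
  assumes "f \<in> polyfun (x ` {..<N})"
  shows "\<exists>t. f \<in> fs.span (mon N x ` wset N w t)"
  using assms
proof induction
  case (const c)
  show ?case using span_mon_const by blast
next
  case (base f)
  then show ?case using span_mon_coord by blast
next
  case (add f g)
  then obtain s t where "f \<in> fs.span (mon N x ` wset N w s)" "g \<in> fs.span (mon N x ` wset N w t)" by blast
  then have "f + g \<in> fs.span (mon N x ` wset N w (max s t))"
    by (intro fs.span_add) (auto intro: span_mon_mono[of s] span_mon_mono[of t])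
  then show ?case by (auto simp: plus_fun_def)
next
  case (mult f g)
  then show ?case using span_mon_mult by blast
qed

lemma span_mon_polyfun:
  assumes "f \<in> fs.span (mon N x ` E)"
  shows "f \<in> polyfun (x ` {..<N})"
  using assms
proof (induction rule: fs.span_induct_alt)
  case base
  then show ?case by (simp add: zero_fun_def polyfun.const)
next
  case (step c b h)
  have "b \<in> polyfun (x ` {..<N})" using step(1) mon_polyfun by blast
  then show ?case using polyfun.add[OF polyfun_scale step(2)] by (simp add: plus_fun_def)
qed

lemma span_compose:
  assumes "f \<in> fs.span A"
  shows "(\<lambda>v. f (h v)) \<in> fs.span ((\<lambda>a v. a (h v)) ` A)"
  using assms
proof (induction rule: fs.span_induct_alt)
  case base
  then show ?case using fs.span_zero by (simp add: zero_fun_def)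
next
  case (step c a g)
  have "(\<lambda>v. a (h v)) \<in> fs.span ((\<lambda>a v. a (h v)) ` A)" using step(1) by (intro fs.span_base) blast
  then have "(\<lambda>v. c * a (h v)) + (\<lambda>v. g (h v)) \<in> fs.span ((\<lambda>a v. a (h v)) ` A)"
    by (intro fs.span_add fs.span_scale step(2))
  then show ?case by (simp add: plus_fun_def)
qed

lemma span_image_sum:
  assumes "f \<in> fs.span (y ` E)" "finite E"
  shows "\<exists>c. \<forall>v. f v = (\<Sum>e\<in>E. c e * y e v)"
  using assms(1)
proof (induction rule: fs.span_induct_alt)
  case base
  then show ?case by (intro exI[of _ "\<lambda>_. 0"]) simp
next
  case (step c b h)
  then obtain d e where d: "\<forall>v. h v = (\<Sum>e\<in>E. d e * y e v)" and e: "e \<in> E" "b = y e" by blast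
  have "(\<Sum>i\<in>E. (d i + (if i = e then c else 0)) * y i v) = (\<Sum>i\<in>E. d i * y i v) + (\<Sum>i\<in>E. if i = e then c * y i v else 0)" for v
    by (simp add: distrib_right sum.distrib if_distrib[of "\<lambda>z. z * _"] cong: if_cong)
  then have "((\<lambda>x. c * b x) + h) v = (\<Sum>i\<in>E. (d i + (if i = e then c else 0)) * y i v)" for v
    using e assms(2) d by simp
  then show ?case by (intro exI[of _ "\<lambda>i. d i + (if i = e then c else 0)"]) simp
qed

lemma span_sum_fun: "(\<And>i. i \<in> A \<Longrightarrow> f i \<in> fs.span B) \<Longrightarrow> (\<lambda>v. \<Sum>i\<in>A. f i v) \<in> fs.span B"
proof -
  assume "\<And>i. i \<in> A \<Longrightarrow> f i \<in> fs.span B"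
  then have "(\<Sum>i\<in>A. f i) \<in> fs.span B" by (rule fs.span_sum)
  moreover have "(\<Sum>i\<in>A. f i) = (\<lambda>v. \<Sum>i\<in>A. f i v)" by (simp add: fun_eq_iff sum_fun_apply)
  ultimately show ?thesis by simp
qed

section \<open>Determinants indexed by natural numbers\<close>

no_notation Matrix.vec_index (infixl "$" 100)

text \<open>Index ranges \<open>{..<n}\<close> instead of index types let the size be any expression
  such as \<open>m + p + n\<close> or \<open>n - 1\<close>, as block decompositions, minors and
  Cramer's rule require.\<close>

definition fdet :: "nat \<Rightarrow> (nat \<Rightarrow> nat \<Rightarrow> 'a::comm_ring_1) \<Rightarrow> 'a" where
  "fdet n a = (\<Sum>\<pi> | \<pi> permutes {..<n}. of_int (sign \<pi>) * (\<Prod>i<n. a i (\<pi> i)))"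

abbreviation fmat :: "nat \<Rightarrow> (nat \<Rightarrow> nat \<Rightarrow> 'a) \<Rightarrow> 'a mat" where
  "fmat n a \<equiv> Matrix.mat n n (\<lambda>(i, j). a i j)"

lemma permutes_less: "\<pi> permutes {..<n} \<Longrightarrow> i < n \<Longrightarrow> \<pi> i < n"
  using permutes_in_image[of \<pi> "{..<n}" i] by simp

lemma fdet_mat: "Determinant.det (fmat n a) = fdet n a"
proof -
  have "(\<Prod>i<n. fmat n a $$ (i, \<pi> i)) = (\<Prod>i<n. a i (\<pi> i))" if "\<pi> permutes {..<n}" for \<pi>
    using permutes_less[OF that] by simp
  then show ?thesis
    unfolding fdet_def Determinant.det_def atLeast0LessThan by (auto intro!: sum.cong simp: sign_def)
qed

lemma fdet_cong: "(\<And>i j. i < n \<Longrightarrow> j < n \<Longrightarrow> a i j = b i j) \<Longrightarrow> fdet n a = fdet n b"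
  unfolding fdet_def
  by (intro sum.cong prod.cong refl arg_cong2[of _ _ _ _ "(*)"]) (auto intro: permutes_less)

lemma finite_permutes: "finite {\<pi>. \<pi> permutes {..<n::nat}}"
  by (simp add: finite_permutations)

lemma fdet_polyfun:
  assumes "\<And>i j. i < n \<Longrightarrow> j < n \<Longrightarrow> (\<lambda>v. a v i j) \<in> polyfun C"
  shows "(\<lambda>v. fdet n (a v)) \<in> polyfun C"
  unfolding fdet_def
  by (intro polyfun_sum polyfun_scale polyfun_prod)
    (auto intro: assms permutes_less)

text \<open>Entry \<open>(i, j)\<close> of the adjugate: row \<open>j\<close> and column
  \<open>i\<close> are deleted. The explicit formula makes its polynomial dependence on the matrix
  visible.\<close>

definition fadj :: "nat \<Rightarrow> (nat \<Rightarrow> nat \<Rightarrow> 'a::comm_ring_1) \<Rightarrow> nat \<Rightarrow> nat \<Rightarrow> 'a" where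
  "fadj n a i j = (-1) ^ (i + j) * fdet (n - 1) (\<lambda>k l. a (if k < j then k else Suc k) (if l < i then l else Suc l))"

lemma fadj_polyfun:
  assumes "\<And>i j. i < n \<Longrightarrow> j < n \<Longrightarrow> (\<lambda>v. a v i j) \<in> polyfun C" "i < n" "j < n"
  shows "(\<lambda>v. fadj n (a v) i j) \<in> polyfun C"
  unfolding fadj_def by (intro polyfun_scale fdet_polyfun) (auto intro!: assms)

lemma adj_mat_fadj:
  assumes "i < n" "j < n"
  shows "adj_mat (fmat n a) $$ (i, j) = fadj n a i j"
proof -
  have "mat_delete (fmat n a) j i = fmat (n - 1) (\<lambda>k l. a (if k < j then k else Suc k) (if l < i then l else Suc l))"
    unfolding mat_delete_def by (rule eq_matI) auto
  then show ?thesis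
    using assms unfolding adj_mat_def cofactor_def fadj_def by (simp add: fdet_mat add.commute)
qed

lemma fadj_mult:
  assumes "i < n" "k < n"
  shows "(\<Sum>j<n. fadj n a i j * a j k) = (if i = k then fdet n a else 0)"
proof -
  have "adj_mat (fmat n a) * fmat n a = Determinant.det (fmat n a) \<cdot>\<^sub>m 1\<^sub>m n"
    by (rule adj_mat(3)) auto
  from arg_cong[OF this, of "\<lambda>A. A $$ (i, k)"] show ?thesis
    using assms adj_mat(1)[of "fmat n a" n]
    by (auto simp: scalar_prod_def fdet_mat adj_mat_fadj atLeast0LessThan intro!: sum.cong split: if_splits)
qed

lemma fdet_zero_kernel:
  fixes a :: "nat \<Rightarrow> nat \<Rightarrow> 'a::field"
  assumes "fdet n a = 0"
  shows "\<exists>v. (\<exists>j<n. v j \<noteq> 0) \<and> (\<forall>i<n. (\<Sum>j<n. a i j * v j) = 0)"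
proof -
  have "Determinant.det (fmat n a) = 0" using assms by (simp add: fdet_mat)
  then obtain v where v: "v \<in> carrier_vec n" "v \<noteq> 0\<^sub>v n" "fmat n a *\<^sub>v v = 0\<^sub>v n"
    using det_0_iff_vec_prod_zero_field[of "fmat n a" n] by auto
  have "\<exists>j<n. Matrix.vec_index v j \<noteq> 0" using v(1,2) by (metis carrier_vecD eq_vecI index_zero_vec(1) index_zero_vec(2))
  moreover have "(\<Sum>j<n. a i j * Matrix.vec_index v j) = 0" if "i < n" for i
    using arg_cong[OF v(3), of "\<lambda>w. Matrix.vec_index w i"] that v(1) by (auto simp: scalar_prod_def atLeast0LessThan)
  ultimately show ?thesis by (intro exI[of _ "\<lambda>j. Matrix.vec_index v j"]) auto
qed

lemma fdet_kernel_zero: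
  fixes a :: "nat \<Rightarrow> nat \<Rightarrow> 'a::field"
  assumes "fdet n a \<noteq> 0" "\<And>i. i < n \<Longrightarrow> (\<Sum>j<n. a i j * v j) = 0" "j < n"
  shows "v j = 0"
proof -
  have "0 = (\<Sum>i<n. fadj n a j i * (\<Sum>k<n. a i k * v k))" using assms(2) by simp
  also have "\<dots> = (\<Sum>k<n. (\<Sum>i<n. fadj n a j i * a i k) * v k)"
    unfolding sum_distrib_left sum_distrib_right by (subst sum.swap) (simp add: mult.assoc)
  also have "\<dots> = (\<Sum>k<n. (if j = k then fdet n a else 0) * v k)"
    by (intro sum.cong refl arg_cong2[of _ _ _ _ "(*)"] fadj_mult assms(3)) simp
  also have "\<dots> = fdet n a * v j" using assms(3) by (simp add: if_distrib[of "\<lambda>z. z * _"] cong: if_cong)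
  finally show ?thesis using assms(1) by simp
qed

section \<open>Determinant identities: permutations, block forms, Laplace expansion, row
  exchange\<close>

lemma fdet_permute_rows:
  assumes "\<sigma> permutes {..<n}"
  shows "fdet n (\<lambda>i. a (\<sigma> i)) = of_int (sign \<sigma>) * fdet n a"
proof -
  have "Determinant.det (Matrix.mat n n (\<lambda>(i,j). fmat n a $$ (\<sigma> i, j))) = signof \<sigma> * Determinant.det (fmat n a)"
    by (rule det_permute_rows) (use assms in \<open>auto simp: atLeast0LessThan\<close>)
  moreover have "Matrix.mat n n (\<lambda>(i,j). fmat n a $$ (\<sigma> i, j)) = fmat n (\<lambda>i. a (\<sigma> i))"
    using permutes_less[OF assms] by (auto intro!: eq_matI)
  ultimately show ?thesis by (simp add: fdet_mat sign_def)
qed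

lemma fdet_identical_rows:
  assumes "i < n" "j < n" "i \<noteq> j" "\<And>k. k < n \<Longrightarrow> a i k = a j k"
  shows "fdet n a = 0"
  unfolding fdet_mat[symmetric]
  by (rule det_identical_rows[of _ n i j]) (use assms in \<open>auto intro!: eq_vecI\<close>)

lemma fdet_transpose: "fdet n (\<lambda>i j. a j i) = fdet n a"
proof -
  have "transpose_mat (fmat n a) = fmat n (\<lambda>i j. a j i)" by (auto intro!: eq_matI)
  then show ?thesis using det_transpose[of "fmat n a" n] by (simp add: fdet_mat)
qed

lemma fdet_mult: "fdet n (\<lambda>i j. \<Sum>k<n. a i k * b k j) = fdet n a * fdet n b"
proof -
  have "fmat n a * fmat n b = fmat n (\<lambda>i j. \<Sum>k<n. a i k * b k j)"
    by (auto intro!: eq_matI sum.cong simp: scalar_prod_def atLeast0LessThan)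
  then show ?thesis using det_mult[of "fmat n a" n "fmat n b"] by (simp add: fdet_mat)
qed

lemma fdet_upper_triangular:
  assumes "\<And>i j. j < i \<Longrightarrow> i < n \<Longrightarrow> a i j = 0"
  shows "fdet n a = (\<Prod>i<n. a i i)"
  unfolding fdet_mat[symmetric]
  by (subst det_upper_triangular[of _ n])
    (use assms in \<open>auto simp: diag_mat_def prod.list_conv_set_nth atLeast0LessThan intro!: prod.cong upper_triangularI\<close>)

lemma fdet_lower_triangular:
  assumes "\<And>i j. i < j \<Longrightarrow> j < n \<Longrightarrow> a i j = 0"
  shows "fdet n a = (\<Prod>i<n. a i i)"
  using fdet_upper_triangular[of n "\<lambda>i j. a j i"] assms unfolding fdet_transpose[of n a] by simp

lemma fdet_block_lower_zero:
  fixes a :: "nat \<Rightarrow> nat \<Rightarrow> 'a::idom"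
  assumes "\<And>i j. n \<le> i \<Longrightarrow> i < n + k \<Longrightarrow> j < n \<Longrightarrow> a i j = 0"
  shows "fdet (n + k) a = fdet n a * fdet k (\<lambda>i j. a (i + n) (j + n))"
proof -
  have "fmat (n + k) a = four_block_mat (fmat n a) (Matrix.mat n k (\<lambda>(i,j). a i (j + n))) (0\<^sub>m k n) (fmat k (\<lambda>i j. a (i + n) (j + n)))"
    by (rule eq_matI) (use assms in \<open>auto simp: Let_def\<close>)
  then have "Determinant.det (fmat (n + k) a) = Determinant.det (fmat n a) * Determinant.det (fmat k (\<lambda>i j. a (i + n) (j + n)))"
    by (simp only:) (rule det_four_block_mat_lower_left_zero[of _ n _ k], auto)
  then show ?thesis by (simp only: fdet_mat)
qed

lemma fdet_block_upper_zero:
  fixes a :: "nat \<Rightarrow> nat \<Rightarrow> 'a::idom"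
  assumes "\<And>i j. i < n \<Longrightarrow> n \<le> j \<Longrightarrow> j < n + k \<Longrightarrow> a i j = 0"
  shows "fdet (n + k) a = fdet n a * fdet k (\<lambda>i j. a (i + n) (j + n))"
  using fdet_block_lower_zero[of n k "\<lambda>i j. a j i"] assms
  unfolding fdet_transpose[of n a] fdet_transpose[of "n + k" a] fdet_transpose[of k "\<lambda>i j. a (i + n) (j + n)"]
  by simp

text \<open>Multilinear expansion in the first \<open>m\<close> rows; \<open>m = n\<close> is the unsymmetrised Cauchy--Binet formula.\<close>

lemma fdet_expand_rows:
  fixes M :: nat
  assumes "m \<le> n"
  shows "fdet n (\<lambda>i j. if i < m then \<Sum>q<M. x i q * w q j else z i j)
    = (\<Sum>f\<in>{..<m} \<rightarrow>\<^sub>E {..<M}. (\<Prod>i<m. x i (f i)) * fdet n (\<lambda>i j. if i < m then w (f i) j else z i j))"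
proof -
  have split: "(\<Prod>i<n. g i) = (\<Prod>i<m. g i) * (\<Prod>i\<in>{m..<n}. g i)" for g :: "nat \<Rightarrow> 'a"
    using assms by (metis atLeast0LessThan prod.atLeastLessThan_concat zero_le)
  let ?F = "{..<m} \<rightarrow>\<^sub>E {..<M}"
  have "fdet n (\<lambda>i j. if i < m then \<Sum>q<M. x i q * w q j else z i j)
    = (\<Sum>\<pi> | \<pi> permutes {..<n}. of_int (sign \<pi>) * ((\<Prod>i<m. \<Sum>q<M. x i q * w q (\<pi> i)) * (\<Prod>i\<in>{m..<n}. z i (\<pi> i))))"
    unfolding fdet_def split by (intro sum.cong refl arg_cong2[of _ _ _ _ "(*)"] prod.cong) auto
  also have "\<dots> = (\<Sum>\<pi> | \<pi> permutes {..<n}. \<Sum>f\<in>?F. (\<Prod>i<m. x i (f i)) *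
      (of_int (sign \<pi>) * ((\<Prod>i<m. w (f i) (\<pi> i)) * (\<Prod>i\<in>{m..<n}. z i (\<pi> i)))))"
  proof (rule sum.cong[OF refl])
    fix \<pi>
    have *: "(\<Prod>i<m. \<Sum>q<M. x i q * w q (\<pi> i)) = (\<Sum>f\<in>?F. (\<Prod>i<m. x i (f i)) * (\<Prod>i<m. w (f i) (\<pi> i)))"
      by (subst prod_sum_PiE) (auto simp: prod.distrib)
    show "of_int (sign \<pi>) * ((\<Prod>i<m. \<Sum>q<M. x i q * w q (\<pi> i)) * (\<Prod>i\<in>{m..<n}. z i (\<pi> i))) =
      (\<Sum>f\<in>?F. (\<Prod>i<m. x i (f i)) * (of_int (sign \<pi>) * ((\<Prod>i<m. w (f i) (\<pi> i)) * (\<Prod>i\<in>{m..<n}. z i (\<pi> i)))))"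
      unfolding * sum_distrib_left sum_distrib_right by (intro sum.cong refl) (simp only: mult_ac)
  qed
  also have "\<dots> = (\<Sum>f\<in>?F. (\<Prod>i<m. x i (f i)) *
      (\<Sum>\<pi> | \<pi> permutes {..<n}. of_int (sign \<pi>) * ((\<Prod>i<m. w (f i) (\<pi> i)) * (\<Prod>i\<in>{m..<n}. z i (\<pi> i)))))"
    by (subst sum.swap) (simp add: sum_distrib_left)
  also have "\<dots> = (\<Sum>f\<in>?F. (\<Prod>i<m. x i (f i)) * fdet n (\<lambda>i j. if i < m then w (f i) j else z i j))"
    unfolding fdet_def split by (intro sum.cong refl arg_cong2[of _ _ _ _ "(*)"] prod.cong) auto
  finally show ?thesis .
qed

lemma PiE_comp_permutes_bij:
  assumes "\<sigma> permutes {..<m::nat}"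
  shows "bij_betw (\<lambda>f. f \<circ> \<sigma>) ({..<m} \<rightarrow>\<^sub>E B) ({..<m} \<rightarrow>\<^sub>E B)"
proof -
  have *: "f \<circ> \<sigma> \<in> {..<m} \<rightarrow>\<^sub>E B" if "f \<in> {..<m} \<rightarrow>\<^sub>E B" "\<sigma> permutes {..<m}" for f \<sigma>
    using that permutes_in_image[OF that(2)] by (auto simp: PiE_iff extensional_def)
  show ?thesis
    by (rule bij_betw_byWitness[of _ "\<lambda>f. f \<circ> Hilbert_Choice.inv \<sigma>"])
      (use assms * permutes_inv[OF assms] permutes_inv_o[OF assms] in \<open>auto simp: o_assoc[symmetric]\<close>)
qed

text \<open>Symmetrisation: composing with \<open>\<pi>\<close> permutes the index set, so summing
  over all \<open>\<pi>\<close> builds the determinant from the products, the sign being absorbed by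
  the alternating \<open>c\<close>. The factor \<open>fact m\<close> stays on the left because the
  ring may not allow division.\<close>

lemma PiE_alternating_sum:
  fixes x :: "nat \<Rightarrow> nat \<Rightarrow> 'a::comm_ring_1"
  assumes "\<And>f \<sigma>. f \<in> {..<m} \<rightarrow>\<^sub>E {..<M} \<Longrightarrow> \<sigma> permutes {..<m} \<Longrightarrow> c (f \<circ> \<sigma>) = of_int (sign \<sigma>) * c f"
  shows "of_nat (fact m) * (\<Sum>f\<in>{..<m} \<rightarrow>\<^sub>E {..<M}. (\<Prod>i<m. x i (f i)) * c f)
    = (\<Sum>f\<in>{..<m} \<rightarrow>\<^sub>E {..<M}. fdet m (\<lambda>i k. x i (f k)) * c f)"
proof -
  let ?F = "{..<m} \<rightarrow>\<^sub>E {..<M}"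
  have "(\<Sum>f\<in>?F. fdet m (\<lambda>i k. x i (f k)) * c f)
    = (\<Sum>f\<in>?F. \<Sum>\<pi> | \<pi> permutes {..<m}. (\<Prod>i<m. x i ((f \<circ> \<pi>) i)) * c (f \<circ> \<pi>))"
    unfolding fdet_def sum_distrib_right
  proof (intro sum.cong refl)
    fix f \<pi> assume "f \<in> ?F" "\<pi> \<in> {\<pi>. \<pi> permutes {..<m}}"
    then show "of_int (sign \<pi>) * (\<Prod>i<m. x i (f (\<pi> i))) * c f = (\<Prod>i<m. x i ((f \<circ> \<pi>) i)) * c (f \<circ> \<pi>)"
      by (simp only: assms mem_Collect_eq o_apply mult_ac)
  qed
  also have "\<dots> = (\<Sum>\<pi> | \<pi> permutes {..<m}. \<Sum>f\<in>?F. (\<Prod>i<m. x i ((f \<circ> \<pi>) i)) * c (f \<circ> \<pi>))"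
    by (rule sum.swap)
  also have "\<dots> = (\<Sum>\<pi> | \<pi> permutes {..<m}. \<Sum>f\<in>?F. (\<Prod>i<m. x i (f i)) * c f)"
  proof (rule sum.cong[OF refl])
    fix \<pi> assume "\<pi> \<in> {\<pi>. \<pi> permutes {..<m}}"
    then have "bij_betw (\<lambda>f. f \<circ> \<pi>) ?F ?F" by (intro PiE_comp_permutes_bij) simp
    from sum.reindex_bij_betw[OF this, of "\<lambda>f. (\<Prod>i<m. x i (f i)) * c f"]
    show "(\<Sum>f\<in>?F. (\<Prod>i<m. x i ((f \<circ> \<pi>) i)) * c (f \<circ> \<pi>)) = (\<Sum>f\<in>?F. (\<Prod>i<m. x i (f i)) * c f)" .
  qed
  also have "\<dots> = of_nat (fact m) * (\<Sum>f\<in>?F. (\<Prod>i<m. x i (f i)) * c f)"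
  proof -
    have "card {\<pi>. \<pi> permutes {..<m}} = fact m" by (rule card_permutations) simp_all
    then show ?thesis by (simp only: sum_constant)
  qed
  finally show ?thesis by (rule sym)
qed

text \<open>The Pluecker exchange identity. By Cramer's rule the row \<open>u a\<close> times
  \<open>fdet m v\<close> is the combination of the rows of \<open>v\<close> with coefficients
  \<open>fdet m (v(k := u a))\<close>; linearity of \<open>fdet\<close> in row \<open>a\<close>
  gives the rest, also when \<open>fdet m v\<close> is zero.\<close>

lemma fdet_replace_expand:
  fixes u v :: "nat \<Rightarrow> nat \<Rightarrow> 'a::field"
  assumes "a < m"
  shows "fdet m u * fdet m v = (\<Sum>k<m. fdet m (u(a := v k)) * fdet m (v(k := u a)))"
proof -
  have lin: "fdet m (u(a := (\<lambda>j. \<Sum>k<m. t k * v k j))) = (\<Sum>k<m. t k * fdet m (u(a := v k)))" for t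
  proof -
    have pr: "(\<Prod>i<m. (u(a := y)) i (\<pi> i)) = y (\<pi> a) * (\<Prod>i\<in>{..<m} - {a}. u i (\<pi> i))" for y \<pi>
      using assms by (subst prod.remove[of _ a]) (auto intro!: arg_cong[of _ _ "\<lambda>z. _ * z"] prod.cong)
    show ?thesis
      unfolding fdet_def pr
      by (simp add: sum_distrib_left sum_distrib_right mult_ac) (rule sum.swap)
  qed
  define t where "t = (\<lambda>k. fdet m (v(k := u a)))"
  have t: "(\<Sum>k<m. t k * v k j) = fdet m v * u a j" if "j < m" for j
  proof -
    have adj: "t k = (\<Sum>l<m. u a l * fadj m v l k)" if k: "k < m" for k
    proof -
      let ?v = "v(k := u a)"
      have fa: "fadj m v l k = fadj m ?v l k" for l
        unfolding fadj_def by (intro arg_cong[of _ _ "\<lambda>z. _ * z"] fdet_cong) auto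
      have "(\<Sum>l<m. ?v k l * fadj m ?v l k) = fdet m ?v"
      proof -
        have "fmat m ?v * adj_mat (fmat m ?v) = Determinant.det (fmat m ?v) \<cdot>\<^sub>m 1\<^sub>m m"
          by (rule adj_mat(2)) auto
        from arg_cong[OF this, of "\<lambda>A. A $$ (k, k)"] show ?thesis
          using k adj_mat(1)[of "fmat m ?v" m]
          by (auto simp: scalar_prod_def fdet_mat adj_mat_fadj atLeast0LessThan simp del: fun_upd_apply intro!: sum.cong)
      qed
      then show ?thesis by (simp add: t_def fa)
    qed
    have "(\<Sum>k<m. t k * v k j) = (\<Sum>k<m. \<Sum>l<m. u a l * (fadj m v l k * v k j))"
      by (simp add: adj sum_distrib_right mult.assoc)
    also have "\<dots> = (\<Sum>l<m. u a l * (\<Sum>k<m. fadj m v l k * v k j))"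
      by (subst sum.swap) (simp add: sum_distrib_left)
    also have "\<dots> = (\<Sum>l<m. u a l * (if l = j then fdet m v else 0))"
      by (intro sum.cong refl arg_cong2[of _ _ _ _ "(*)"] fadj_mult that) simp
    finally show ?thesis using that by (simp add: if_distrib[of "\<lambda>z. _ * z"] mult.commute cong: if_cong)
  qed
  have "(\<Sum>k<m. fdet m (u(a := v k)) * fdet m (v(k := u a))) = fdet m (u(a := (\<lambda>j. \<Sum>k<m. t k * v k j)))"
    unfolding lin t_def by (simp only: mult.commute)
  also have "\<dots> = fdet m (u(a := (\<lambda>j. \<Sum>k<(1::nat). fdet m v * u a j)))"
    by (rule fdet_cong) (use t in auto)
  also have "\<dots> = fdet m v * fdet m u"
  proof -
    have pr: "(\<Prod>i<m. (u(a := y)) i (\<pi> i)) = y (\<pi> a) * (\<Prod>i\<in>{..<m} - {a}. u i (\<pi> i))" for y \<pi>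
      using assms by (subst prod.remove[of _ a]) (auto intro!: arg_cong[of _ _ "\<lambda>z. _ * z"] prod.cong)
    have pr': "(\<Prod>i<m. u i (\<pi> i)) = u a (\<pi> a) * (\<Prod>i\<in>{..<m} - {a}. u i (\<pi> i))" for \<pi>
      using assms by (subst prod.remove[of _ a]) auto
    show ?thesis unfolding fdet_def[of _ "u(a := _)"] fdet_def[of _ u] pr pr' by (simp add: sum_distrib_left mult_ac)
  qed
  finally show ?thesis by simp
qed

lemma vec_det_fdet:
  fixes A :: "'a::comm_ring_1 ^ 'n ^ 'n"
  assumes b: "bij_betw b {..<CARD('n)} (UNIV :: 'n set)"
  shows "Determinants.det A = fdet CARD('n) (\<lambda>i j. A $ b i $ b j)"
proof -
  let ?P = "\<lambda>\<pi> x. if x \<in> UNIV then b (\<pi> (inv_into {..<CARD('n)} b x)) else x"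
  have inj: "inj_on b {..<CARD('n)}" using b by (simp add: bij_betw_def)
  have P: "?P \<pi> = map_permutation {..<CARD('n)} b \<pi>" for \<pi>
    using b by (auto simp: map_permutation_def restrict_id_def fun_eq_iff bij_betw_def)
  have ev: "?P \<pi> (b i) = b (\<pi> i)" if "i < CARD('n)" for \<pi> i
    using that inj by (simp add: inv_into_f_f)
  have "Determinants.det A = (\<Sum>\<pi> | \<pi> permutes {..<CARD('n)}. of_int (sign (?P \<pi>)) * (\<Prod>i\<in>UNIV. A $ i $ ?P \<pi> i))"
    unfolding Determinants.det_def
    by (rule sum.reindex_bij_betw[OF bij_betw_permutations[OF b], symmetric])
  also have "\<dots> = fdet CARD('n) (\<lambda>i j. A $ b i $ b j)"
    unfolding fdet_def
  proof (intro sum.cong refl)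
    fix \<pi> assume "\<pi> \<in> {\<pi>. \<pi> permutes {..<CARD('n)}}"
    then have pi: "\<pi> permutes {..<CARD('n)}" by simp
    have "sign (?P \<pi>) = sign \<pi>" unfolding P by (rule sign_map_permutation[OF inj pi]) simp
    moreover have "(\<Prod>i\<in>UNIV. A $ i $ ?P \<pi> i) = (\<Prod>i<CARD('n). A $ b i $ ?P \<pi> (b i))"
      by (rule prod.reindex_bij_betw[OF b, symmetric])
    moreover have "\<dots> = (\<Prod>i<CARD('n). A $ b i $ b (\<pi> i))"
      by (rule prod.cong[OF refl]) (simp only: ev lessThan_iff)
    ultimately show "of_int (sign (?P \<pi>)) * (\<Prod>i\<in>UNIV. A $ i $ ?P \<pi> i) = of_int (sign \<pi>) * (\<Prod>i<CARD('n). A $ b i $ b (\<pi> i))"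
      by simp
  qed
  finally show ?thesis .
qed

section \<open>Counting monomials and critical values\<close>

lemma card_wset_1: "card (wset N (\<lambda>_. 1) t) = (t + N) choose N"
proof (induction N arbitrary: t)
  case 0
  have "wset 0 (\<lambda>_. 1) t = {\<lambda>_. 0}" by (auto simp: wset_def)
  then show ?case by simp
next
  case (Suc N)
  have eq: "wset (Suc N) (\<lambda>_. 1) t = (\<Union>b\<in>{..t}. (\<lambda>\<alpha>. \<alpha>(N := b)) ` wset N (\<lambda>_. 1) (t - b))"
  proof (intro equalityI subsetI)
    fix \<alpha> assume a: "\<alpha> \<in> wset (Suc N) (\<lambda>_. 1) t"
    then have *: "\<alpha> N \<le> t" "\<alpha>(N := 0) \<in> wset N (\<lambda>_. 1) (t - \<alpha> N)"
      by (auto simp: wset_def)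
    show "\<alpha> \<in> (\<Union>b\<in>{..t}. (\<lambda>\<alpha>. \<alpha>(N := b)) ` wset N (\<lambda>_. 1) (t - b))"
      by (rule UN_I[of "\<alpha> N"], use * in simp, rule image_eqI[OF _ *(2)]) auto
  next
    fix \<alpha> assume "\<alpha> \<in> (\<Union>b\<in>{..t}. (\<lambda>\<alpha>. \<alpha>(N := b)) ` wset N (\<lambda>_. 1) (t - b))"
    then obtain b \<beta> where "b \<le> t" "\<beta> \<in> wset N (\<lambda>_. 1) (t - b)" "\<alpha> = \<beta>(N := b)" by auto
    then show "\<alpha> \<in> wset (Suc N) (\<lambda>_. 1) t" by (auto simp: wset_def)
  qed
  have inj: "inj_on (\<lambda>\<alpha>. \<alpha>(N := b)) (wset N (\<lambda>_. 1) (t - b))" for b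
  proof (rule inj_onI)
    fix \<alpha> \<beta> assume ab: "\<alpha> \<in> wset N (\<lambda>_. 1) (t - b)" "\<beta> \<in> wset N (\<lambda>_. 1) (t - b)" "\<alpha>(N := b) = \<beta>(N := b)"
    have "\<alpha> i = \<beta> i" for i
      using fun_cong[OF ab(3), of i] ab(1,2) by (cases "i = N") (auto simp: wset_def)
    then show "\<alpha> = \<beta>" by blast
  qed
  have "card (wset (Suc N) (\<lambda>_. 1) t) = (\<Sum>b\<le>t. card ((\<lambda>\<alpha>. \<alpha>(N := b)) ` wset N (\<lambda>_. 1) (t - b)))"
    unfolding eq
  proof (rule card_UN_disjoint)
    show "\<forall>i\<in>{..t}. finite ((\<lambda>\<alpha>. \<alpha>(N := i)) ` wset N (\<lambda>_. 1) (t - i))" by (simp add: finite_wset)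
    show "\<forall>i\<in>{..t}. \<forall>j\<in>{..t}. i \<noteq> j \<longrightarrow> (\<lambda>\<alpha>. \<alpha>(N := i)) ` wset N (\<lambda>_. 1) (t - i) \<inter> (\<lambda>\<alpha>. \<alpha>(N := j)) ` wset N (\<lambda>_. 1) (t - j) = {}"
      by (auto dest: fun_cong[of _ _ N])
  qed simp
  also have "\<dots> = (\<Sum>b\<le>t. (t - b + N) choose N)" by (simp only: card_image[OF inj] Suc.IH)
  also have "\<dots> = (\<Sum>b\<le>t. (b + N) choose N)" using sum.nat_diff_reindex[of "\<lambda>b. (b + N) choose N" "Suc t"] by (simp only: lessThan_Suc_atMost diff_Suc_Suc)
  also have "\<dots> = (t + Suc N) choose Suc N"
    by (induction t) (simp_all add: add.commute)
  finally show ?case .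
qed

text \<open>Division with remainder: an exponent vector \<open>\<alpha>\<close> and remainders
  \<open>r i < w i\<close> are encoded in the single vector \<open>w i * \<alpha> i + r i\<close>,
  whose degree exceeds the weight of \<open>\<alpha>\<close> by at most the sum of the
  weights.\<close>

lemma card_wset_scale_le:
  assumes "\<And>i. i < N \<Longrightarrow> w i > 0"
  shows "(\<Prod>i<N. w i) * card (wset N w t) \<le> card (wset N (\<lambda>_. 1) (t + (\<Sum>i<N. w i)))"
proof -
  define R where "R = PiE {..<N} (\<lambda>i. {..<w i})"
  define h where "h = (\<lambda>(\<alpha>, r) i. if i < N then w i * \<alpha> i + r i else (0::nat))"
  have "inj_on h (wset N w t \<times> R)"
  proof (rule inj_onI, clarify)
    fix \<alpha> r \<beta> s assume a: "\<alpha> \<in> wset N w t" "r \<in> R" "\<beta> \<in> wset N w t" "s \<in> R" "h (\<alpha>, r) = h (\<beta>, s)"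
    have eq: "\<alpha> i = \<beta> i \<and> r i = s i" if "i < N" for i
    proof -
      have e: "w i * \<alpha> i + r i = w i * \<beta> i + s i" using fun_cong[OF a(5), of i] that by (simp add: h_def)
      have l: "r i < w i" "s i < w i" using a(2,4) that by (auto simp: R_def)
      from arg_cong[OF e, of "\<lambda>z. z div w i"] arg_cong[OF e, of "\<lambda>z. z mod w i"] l show ?thesis by simp
    qed
    moreover have "r i = s i" if "\<not> i < N" for i using a(2,4) that by (auto simp: R_def PiE_iff extensional_def)
    moreover have "\<alpha> i = \<beta> i" if "\<not> i < N" for i using a(1,3) that by (auto simp: wset_def)
    ultimately show "\<alpha> = \<beta> \<and> r = s" by blast
  qed
  moreover have "h ` (wset N w t \<times> R) \<subseteq> wset N (\<lambda>_. 1) (t + (\<Sum>i<N. w i))"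
  proof clarify
    fix \<alpha> r assume a: "\<alpha> \<in> wset N w t" "r \<in> R"
    have "(\<Sum>i<N. w i * \<alpha> i + r i) \<le> t + (\<Sum>i<N. w i)"
      unfolding sum.distrib by (intro add_mono sum_mono) (use a in \<open>auto simp: wset_def R_def PiE_iff less_imp_le\<close>)
    then show "h (\<alpha>, r) \<in> wset N (\<lambda>_. 1) (t + (\<Sum>i<N. w i))" by (simp add: wset_def h_def)
  qed
  ultimately have "card (wset N w t \<times> R) \<le> card (wset N (\<lambda>_. 1) (t + (\<Sum>i<N. w i)))"
    by (rule card_inj_on_le) (simp add: finite_wset)
  moreover have "card R = (\<Prod>i<N. w i)" by (simp add: R_def card_PiE)
  ultimately show ?thesis by (simp add: card_cartesian_product mult.commute)
qed

text \<open>The same encoding read backwards: the quotients by \<open>w i\<close> have weight at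
  most \<open>t\<close>, and the remainders leave \<open>\<Prod>i<N. w i\<close> choices. Up to a
  shift of \<open>t\<close>, weighted counts are thus unweighted ones divided by the product of the
  weights.\<close>

lemma card_wset_1_le:
  assumes "\<And>i. i < N \<Longrightarrow> w i > 0"
  shows "card (wset N (\<lambda>_. 1) t) \<le> (\<Prod>i<N. w i) * card (wset N w t)"
proof -
  define R where "R = PiE {..<N} (\<lambda>i. {..<w i})"
  define h where "h = (\<lambda>\<gamma>. ((\<lambda>i. if i < N then \<gamma> i div w i else (0::nat)), restrict (\<lambda>i. \<gamma> i mod w i) {..<N}))"
  have "inj_on h (wset N (\<lambda>_. 1) t)"
  proof (rule inj_onI)
    fix \<alpha> \<beta> assume a: "\<alpha> \<in> wset N (\<lambda>_. 1) t" "\<beta> \<in> wset N (\<lambda>_. 1) t" "h \<alpha> = h \<beta>"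
    have "\<alpha> i = \<beta> i" for i
    proof (cases "i < N")
      case True
      have "fst (h \<alpha>) i = fst (h \<beta>) i" "snd (h \<alpha>) i = snd (h \<beta>) i" by (simp_all only: a(3))
      then have "\<alpha> i div w i = \<beta> i div w i" "\<alpha> i mod w i = \<beta> i mod w i"
        using True by (simp_all add: h_def)
      then show ?thesis by (metis div_mult_mod_eq)
    next
      case False
      then show ?thesis using a(1,2) by (auto simp: wset_def)
    qed
    then show "\<alpha> = \<beta>" by blast
  qed
  moreover have "h ` wset N (\<lambda>_. 1) t \<subseteq> wset N w t \<times> R"
  proof (rule image_subsetI)
    fix \<gamma> assume a: "\<gamma> \<in> wset N (\<lambda>_. 1) t"
    have "(\<Sum>i<N. w i * (\<gamma> i div w i)) \<le> (\<Sum>i<N. \<gamma> i)" by (intro sum_mono) simp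
    then show "h \<gamma> \<in> wset N w t \<times> R"
      using a assms by (auto simp: h_def wset_def R_def)
  qed
  moreover have "finite (wset N w t \<times> R)" by (simp add: R_def finite_wset assms finite_PiE)
  ultimately have "card (wset N (\<lambda>_. 1) t) \<le> card (wset N w t \<times> R)" by (rule card_inj_on_le)
  moreover have "card R = (\<Prod>i<N. w i)" by (simp add: R_def card_PiE)
  ultimately show ?thesis by (simp add: card_cartesian_product mult.commute)
qed

lemma binomial_shift_ratio_limit:
  "(\<lambda>t. real ((t + E + N) choose N) / real ((t + N) choose N)) \<longlonglongrightarrow> 1"
proof -
  have b: "real ((a + N) choose N) = (\<Prod>i=0..<N. real a + 1 + real i) / fact N" for a
    by (simp add: binomial_gbinomial gbinomial_pochhammer' pochhammer_prod)
  have "real ((t + E + N) choose N) / real ((t + N) choose N) = (\<Prod>i=0..<N. (real t + 1 + real i + real E) / (real t + 1 + real i))" for t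
    unfolding b[of "t + E"] b[of t] by (simp add: prod_dividef add_ac)
  moreover have "(\<lambda>t. \<Prod>i=0..<N. (real t + 1 + real i + real E) / (real t + 1 + real i)) \<longlonglongrightarrow> (\<Prod>i=0..<N. 1)"
  proof (rule tendsto_prod)
    fix i
    have at: "filterlim (\<lambda>t. real t + (1 + real i)) at_top sequentially"
      using filterlim_tendsto_add_at_top[OF tendsto_const[of "1 + real i"] filterlim_real_sequentially] by (simp add: add.commute)
    have "(\<lambda>t. 1 + real E / (real t + (1 + real i))) \<longlonglongrightarrow> 1 + 0"
      by (intro tendsto_add tendsto_const real_tendsto_divide_at_top[OF tendsto_const at])
    moreover have "1 + real E / (real t + (1 + real i)) = (real t + 1 + real i + real E) / (real t + 1 + real i)" for t
    proof -
      have "real t + (1 + real i) \<noteq> 0" by linarith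
      then have "(real t + (1 + real i) + real E) / (real t + (1 + real i)) = 1 + real E / (real t + (1 + real i))"
        by (metis add_divide_distrib divide_self)
      then show ?thesis by (simp only: add.assoc)
    qed
    ultimately show "(\<lambda>t. (real t + 1 + real i + real E) / (real t + 1 + real i)) \<longlonglongrightarrow> 1" by simp
  qed
  ultimately show ?thesis by simp
qed

text \<open>A constant shift of \<open>t\<close> does not change the leading term of the binomial
  coefficient, so the quotient tends to \<open>1\<close> and only the factors \<open>a\<close> and
  \<open>b\<close> survive.\<close>

lemma binomial_shift_le_imp_le:
  assumes "\<And>t. a * ((t + N) choose N) \<le> b * ((t + E + N) choose N)"
  shows "a \<le> (b::nat)"
proof -
  have "(\<lambda>t. real b * (real ((t + E + N) choose N) / real ((t + N) choose N))) \<longlonglongrightarrow> real b * 1"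
    by (intro tendsto_mult tendsto_const binomial_shift_ratio_limit)
  moreover have "real a \<le> real b * (real ((t + E + N) choose N) / real ((t + N) choose N))" for t
  proof -
    have "0 < real ((t + N) choose N)" by (simp add: zero_less_binomial_iff)
    moreover have "real a * real ((t + N) choose N) \<le> real b * real ((t + E + N) choose N)"
      using assms[of t] by (simp only: of_nat_mult[symmetric] of_nat_le_iff)
    ultimately show ?thesis by (simp add: field_simps)
  qed
  ultimately have "real a \<le> real b * 1" by (intro LIMSEQ_le_const) auto
  then show ?thesis by simp
qed

text \<open>Both counts grow like \<open>t ^ N\<close>, with leading coefficients inverse to the
  products of the weights. The shifts \<open>e\<close> and \<open>e'\<close> disappear in the limit,
  so two one-sided bounds determine \<open>c\<close> exactly.\<close>

lemma weighted_count_eq: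
  assumes w: "\<And>i. i < N \<Longrightarrow> w i > 0" and d: "\<And>i. i < N \<Longrightarrow> d i > 0"
    and up: "\<And>t. c * card (wset N d t) \<le> card (wset N w (t + e))"
    and lo: "\<And>t. card (wset N w t) \<le> c * card (wset N d (t + e'))"
  shows "c * (\<Prod>i<N. w i) = (\<Prod>i<N. d i)"
proof (rule antisym)
  let ?W = "\<Prod>i<N. w i" and ?D = "\<Prod>i<N. d i"
  show "c * ?W \<le> ?D"
  proof (rule binomial_shift_le_imp_le)
    fix t
    have "c * ?W * ((t + N) choose N) = c * ?W * card (wset N (\<lambda>_. 1) t)" by (simp only: card_wset_1)
    also have "\<dots> \<le> c * ?W * (?D * card (wset N d t))" by (intro mult_left_mono card_wset_1_le d) auto
    also have "\<dots> = ?W * ?D * (c * card (wset N d t))" by simp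
    also have "\<dots> \<le> ?W * ?D * card (wset N w (t + e))" by (intro mult_left_mono up) auto
    also have "\<dots> = ?D * (?W * card (wset N w (t + e)))" by simp
    also have "\<dots> \<le> ?D * card (wset N (\<lambda>_. 1) (t + e + (\<Sum>i<N. w i)))" by (intro mult_left_mono card_wset_scale_le w) auto
    finally show "c * ?W * ((t + N) choose N) \<le> ?D * ((t + (e + (\<Sum>i<N. w i)) + N) choose N)"
      by (simp only: card_wset_1 add.assoc)
  qed
  show "?D \<le> c * ?W"
  proof (rule binomial_shift_le_imp_le)
    fix t
    have "?D * ((t + N) choose N) = ?D * card (wset N (\<lambda>_. 1) t)" by (simp only: card_wset_1)
    also have "\<dots> \<le> ?D * (?W * card (wset N w t))" by (intro mult_left_mono card_wset_1_le w) auto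
    also have "\<dots> \<le> ?D * (?W * (c * card (wset N d (t + e'))))" by (intro mult_left_mono lo) auto
    also have "\<dots> = c * ?W * (?D * card (wset N d (t + e')))" by simp
    also have "\<dots> \<le> c * ?W * card (wset N (\<lambda>_. 1) (t + e' + (\<Sum>i<N. d i)))" by (intro mult_left_mono card_wset_scale_le d) auto
    finally show "?D * ((t + N) choose N) \<le> c * ?W * ((t + (e' + (\<Sum>i<N. d i)) + N) choose N)"
      by (simp only: card_wset_1 add.assoc)
  qed
qed

lemma card_wset_box: "card (wset N (\<lambda>_. 1) t) \<le> (t + 1) ^ N"
proof -
  have "inj_on (\<lambda>\<alpha>. restrict \<alpha> {..<N}) (wset N (\<lambda>_. 1) t)"
  proof (rule inj_onI)
    fix \<alpha> \<beta> assume a: "\<alpha> \<in> wset N (\<lambda>_. 1) t" "\<beta> \<in> wset N (\<lambda>_. 1) t" "restrict \<alpha> {..<N} = restrict \<beta> {..<N}"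
    have "\<alpha> i = \<beta> i" for i
      using fun_cong[OF a(3), of i] a(1,2) by (cases "i < N") (auto simp: wset_def)
    then show "\<alpha> = \<beta>" by blast
  qed
  moreover have "(\<lambda>\<alpha>. restrict \<alpha> {..<N}) ` wset N (\<lambda>_. 1) t \<subseteq> PiE {..<N} (\<lambda>_. {..t})"
  proof clarsimp
    fix \<alpha> i assume "\<alpha> \<in> wset N (\<lambda>_. Suc 0) t" "i < N"
    then have "(\<Sum>i<N. \<alpha> i) \<le> t" by (simp add: wset_def)
    moreover have "\<alpha> i \<le> (\<Sum>i<N. \<alpha> i)" using \<open>i < N\<close> by (intro member_le_sum) auto
    ultimately show "\<alpha> i \<le> t" by simp
  qed
  ultimately have "card (wset N (\<lambda>_. 1) t) \<le> card (PiE {..<N} (\<lambda>_. {..t}))"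
    by (rule card_inj_on_le) (simp add: finite_PiE)
  then show ?thesis by (simp add: card_PiE)
qed

lemma span_power_mon:
  assumes "f \<in> fs.span (mon N x ` wset N w e)"
  shows "(\<lambda>v. f v ^ k) \<in> fs.span (mon N x ` wset N w (k * e))"
proof (induction k)
  case 0
  then show ?case using span_mon_const[of 1] by simp
next
  case (Suc k)
  from span_mon_mult[OF assms Suc] show ?case by simp
qed

lemma span_mon_of_span:
  assumes "\<And>j. j < M \<Longrightarrow> z j \<in> fs.span (mon N x ` wset N w (d j))"
  shows "mon M z \<alpha> \<in> fs.span (mon N x ` wset N w (\<Sum>j<M. d j * \<alpha> j))"
  using assms
proof (induction M)
  case 0
  then show ?case using span_mon_const[of 1] by (simp add: mon_def)
next
  case (Suc M)
  have "(\<lambda>v. mon M z \<alpha> v * z M v ^ \<alpha> M) \<in> fs.span (mon N x ` wset N w ((\<Sum>j<M. d j * \<alpha> j) + \<alpha> M * d M))"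
    by (rule span_mon_mult[OF Suc.IH span_power_mon]) (use Suc.prems in auto)
  then show ?case by (simp add: mon_def mult.commute)
qed

text \<open>A transcendence-degree count: the \<open>M + 1\<close> polynomials \<open>y j \<circ> \<pi>\<close> and \<open>J\<close> in \<open>M\<close> variables satisfy a
  polynomial relation, and dividing it by a power of \<open>J\<close> leaves a relation whose constant term in \<open>J\<close> is nonzero.\<close>

lemma critical_value_polynomial:
  fixes \<pi> :: "'a::euclidean_space \<Rightarrow> 'b::euclidean_space"
  assumes x: "coords M x" and y: "coords M y"
    and \<pi>: "\<And>j. j < M \<Longrightarrow> (\<lambda>a. y j (\<pi> a)) \<in> polyfun (x ` {..<M})"
    and J: "J \<in> polyfun (x ` {..<M})" "J a0 \<noteq> 0"
  obtains P b where "P \<in> polyfun (y ` {..<M})" "P b \<noteq> 0" "\<And>a. J a = 0 \<Longrightarrow> P (\<pi> a) = 0"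
proof -
  define z where "z = (\<lambda>j a. if j < M then y j (\<pi> a) else J a)"
  have zp: "z j \<in> polyfun (x ` {..<M})" if "j < Suc M" for j
    using that \<pi>[of j] J(1) by (cases "j < M") (auto simp: z_def)
  have "\<exists>e. \<forall>j<Suc M. z j \<in> fs.span (mon M x ` wset M (\<lambda>_. 1) e)"
  proof -
    from zp polyfun_span_mon have "\<forall>j. \<exists>t. j < Suc M \<longrightarrow> z j \<in> fs.span (mon M x ` wset M (\<lambda>_. 1) t)" by blast
    then obtain t where t: "\<And>j. j < Suc M \<Longrightarrow> z j \<in> fs.span (mon M x ` wset M (\<lambda>_. 1) (t j))" by metis
    have "z j \<in> fs.span (mon M x ` wset M (\<lambda>_. 1) (\<Sum>j<Suc M. t j))" if "j < Suc M" for j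
      by (rule span_mon_mono[OF _ t[OF that]]) (use that in \<open>intro member_le_sum, auto\<close>)
    then show ?thesis by blast
  qed
  then obtain e where e: "\<And>j. j < Suc M \<Longrightarrow> z j \<in> fs.span (mon M x ` wset M (\<lambda>_. 1) e)" by blast
  \<comment> \<open>The \<open>T ^ Suc M\<close> monomials with exponents below \<open>T\<close> in
    the functions \<open>z j\<close> lie in a space of dimension at most \<open>(K * T) ^ M\<close>;
    as \<open>T\<close> exceeds \<open>K ^ M\<close>, they are dependent.\<close>
  define K where "K = e * Suc M + 1"
  define T where "T = K ^ M + 1"
  define E where "E = PiE {..<Suc M} (\<lambda>_. {..<T})"
  have E: "mon (Suc M) z \<alpha> \<in> fs.span (mon M x ` wset M (\<lambda>_. 1) (e * Suc M * T))" if a: "\<alpha> \<in> E" for \<alpha>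
  proof (rule span_mon_mono)
    show "mon (Suc M) z \<alpha> \<in> fs.span (mon M x ` wset M (\<lambda>_. 1) (\<Sum>j<Suc M. e * \<alpha> j))"
      by (rule span_mon_of_span[OF e])
    have "(\<Sum>j<Suc M. e * \<alpha> j) \<le> (\<Sum>j<Suc M. e * T)"
      by (intro sum_mono mult_left_mono) (use a in \<open>auto simp: E_def PiE_iff less_imp_le\<close>)
    then show "(\<Sum>j<Suc M. e * \<alpha> j) \<le> e * Suc M * T" by (simp add: mult_ac)
  qed
  have "card (mon M x ` wset M (\<lambda>_. 1) (e * Suc M * T)) \<le> card (wset M (\<lambda>_. 1) (e * Suc M * T))"
    by (rule card_image_le) (simp add: finite_wset)
  also have "\<dots> \<le> (e * Suc M * T + 1) ^ M" by (rule card_wset_box)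
  also have "\<dots> \<le> (K * T) ^ M" by (intro power_mono) (auto simp: K_def T_def distrib_right)
  also have "\<dots> = K ^ M * T ^ M" by (rule power_mult_distrib)
  also have "\<dots> < T * T ^ M" by (intro mult_strict_right_mono) (auto simp: T_def)
  also have "\<dots> = card E" by (simp add: E_def card_PiE)
  finally have "card (mon M x ` wset M (\<lambda>_. 1) (e * Suc M * T)) < card E" .
  from family_dependent[where y = "mon (Suc M) z", OF _ _ E this] obtain c where c: "\<exists>\<alpha>\<in>E. c \<alpha> \<noteq> 0" "\<And>a. (\<Sum>\<alpha>\<in>E. c \<alpha> * mon (Suc M) z \<alpha> a) = 0"
    by (auto simp: E_def finite_PiE finite_wset)
  \<comment> \<open>The lowest power of \<open>J\<close> that occurs with a nonzero coefficient.
    After cancelling \<open>J ^ l\<close>, the terms in \<open>E'\<close> are the only ones that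
    survive on the zero set of \<open>J\<close>.\<close>
  define l where "l = (LEAST l. \<exists>\<alpha>\<in>E. c \<alpha> \<noteq> 0 \<and> \<alpha> M = l)"
  have l: "\<exists>\<alpha>\<in>E. c \<alpha> \<noteq> 0 \<and> \<alpha> M = l" unfolding l_def by (rule LeastI_ex) (use c(1) in blast)
  have lmin: "l \<le> \<alpha> M" if "\<alpha> \<in> E" "c \<alpha> \<noteq> 0" for \<alpha> unfolding l_def by (rule Least_le) (use that in blast)
  define q where "q = (\<lambda>a. \<Sum>\<alpha>\<in>E. c \<alpha> * (mon M z \<alpha> a * J a ^ (\<alpha> M - l)))"
  have zM: "mon (Suc M) z \<alpha> a = mon M z \<alpha> a * J a ^ \<alpha> M" for \<alpha> a by (simp add: mon_def z_def)
  have Jq: "J a ^ l * q a = 0" for a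
  proof -
    have "J a ^ l * q a = (\<Sum>\<alpha>\<in>E. c \<alpha> * mon (Suc M) z \<alpha> a)"
      unfolding q_def sum_distrib_left
    proof (rule sum.cong[OF refl])
      fix \<alpha> assume "\<alpha> \<in> E"
      then have "c \<alpha> = 0 \<or> J a ^ \<alpha> M = J a ^ l * J a ^ (\<alpha> M - l)" using lmin[of \<alpha>] by (cases "c \<alpha> = 0") (simp_all flip: power_add)
      then show "J a ^ l * (c \<alpha> * (mon M z \<alpha> a * J a ^ (\<alpha> M - l))) = c \<alpha> * mon (Suc M) z \<alpha> a"
        by (auto simp: zM)
    qed
    then show ?thesis using c(2) by simp
  qed
  have monz: "mon M z \<alpha> \<in> polyfun (x ` {..<M})" for \<alpha>
    unfolding mon_def by (intro polyfun_prod polyfun_power zp) simp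
  have "q \<in> polyfun (x ` {..<M})"
    unfolding q_def by (intro polyfun_sum polyfun_scale polyfun.mult monz polyfun_power J)
  then have q0: "q a = 0" for a
    using polyfun_mult_nonzero[OF x polyfun_power[OF J(1), of l], of q a0 a] Jq J(2) by auto
  define E' where "E' = {\<alpha>\<in>E. \<alpha> M = l}"
  define r where "r = (\<lambda>\<alpha>::nat\<Rightarrow>nat. \<lambda>i. if i < M then \<alpha> i else 0)"
  have monr: "mon M v (r \<alpha>) = mon M v \<alpha>" for v :: "nat \<Rightarrow> 'c \<Rightarrow> complex" and \<alpha>
    unfolding mon_def r_def by simp
  have injr: "inj_on r E'"
  proof (rule inj_onI)
    fix \<alpha> \<beta> assume ab: "\<alpha> \<in> E'" "\<beta> \<in> E'" "r \<alpha> = r \<beta>"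
    have "\<alpha> i = \<beta> i" for i
    proof (cases "i < M")
      case True then show ?thesis using fun_cong[OF ab(3), of i] by (simp add: r_def)
    next
      case False then show ?thesis using ab(1,2) by (cases "i = M") (auto simp: E'_def E_def PiE_iff extensional_def)
    qed
    then show "\<alpha> = \<beta>" by blast
  qed
  define P where "P = (\<lambda>b. \<Sum>\<alpha>\<in>E'. c \<alpha> * mon M y \<alpha> b)"
  have finE: "finite E" by (simp add: E_def finite_PiE)
  show ?thesis
  proof -
    have "P \<in> polyfun (y ` {..<M})" unfolding P_def by (intro polyfun_sum polyfun_scale mon_polyfun)
    moreover have "\<exists>b. P b \<noteq> 0"
    proof (rule ccontr)
      assume "\<nexists>b. P b \<noteq> 0"
      then have P0: "P b = 0" for b by blast
      obtain \<alpha> where al: "\<alpha> \<in> E'" "c \<alpha> \<noteq> 0" using l by (auto simp: E'_def)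
      have "c (inv_into E' r (r \<alpha>)) = 0"
      proof (rule mon_independent[OF y, of "r ` E'" "\<lambda>\<beta>. c (inv_into E' r \<beta>)"])
        show "finite (r ` E')" using finE by (simp add: E'_def)
        show "r ` E' \<subseteq> {\<alpha>. \<forall>i\<ge>M. \<alpha> i = 0}" by (auto simp: r_def)
        show "r \<alpha> \<in> r ` E'" using al by simp
        fix b
        have "(\<Sum>\<beta>\<in>r ` E'. c (inv_into E' r \<beta>) * mon M y \<beta> b) = P b"
          unfolding P_def sum.reindex[OF injr] by (rule sum.cong) (auto simp: monr inv_into_f_f[OF injr])
        then show "(\<Sum>\<beta>\<in>r ` E'. c (inv_into E' r \<beta>) * mon M y \<beta> b) = 0" using P0 by simp
      qed
      then show False using al by (simp add: inv_into_f_f[OF injr])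
    qed
    moreover have "P (\<pi> a) = 0" if "J a = 0" for a
    proof -
      have "0 = (\<Sum>\<alpha>\<in>E. c \<alpha> * (mon M z \<alpha> a * J a ^ (\<alpha> M - l)))" using q0[of a] by (simp add: q_def)
      also have "\<dots> = (\<Sum>\<alpha>\<in>E'. c \<alpha> * (mon M z \<alpha> a * J a ^ (\<alpha> M - l)))"
      proof (rule sum.mono_neutral_right)
        show "\<forall>i\<in>E - E'. c i * (mon M z i a * J a ^ (i M - l)) = 0"
        proof
          fix \<alpha> assume al: "\<alpha> \<in> E - E'"
          show "c \<alpha> * (mon M z \<alpha> a * J a ^ (\<alpha> M - l)) = 0"
          proof (cases "c \<alpha> = 0")
            case False
            then have "\<alpha> M - l > 0" using lmin[of \<alpha>] al by (auto simp: E'_def)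
            then show ?thesis using that by simp
          qed simp
        qed
      qed (use finE in \<open>auto simp: E'_def\<close>)
      also have "\<dots> = P (\<pi> a)"
        unfolding P_def by (intro sum.cong refl) (auto simp: E'_def mon_def z_def)
      finally show ?thesis by simp
    qed
    ultimately show ?thesis using that by blast
  qed
qed

section \<open>Characteristic polynomials with polynomial coefficients, and local inversion\<close>

lemma polyfun_coeff_pCons:
  assumes "f \<in> polyfun C" "g \<in> polyfun C"
  shows "(\<lambda>v. coeff [: f v, g v :] l) \<in> polyfun C"
proof (cases l)
  case (Suc l')
  then show ?thesis using assms by (cases l') (simp_all add: polyfun.const)
qed (simp add: assms)

lemma coeff_fdet_polyfun:
  assumes "\<And>i j l. i < n \<Longrightarrow> j < n \<Longrightarrow> (\<lambda>v. coeff (E v i j) l) \<in> polyfun C"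
  shows "(\<lambda>v. coeff (fdet n (E v)) l) \<in> polyfun C"
proof -
  define pp where "pp = {e. \<forall>l. (\<lambda>v. coeff (e v) l) \<in> polyfun C}"
  have pp_mult: "(\<lambda>v. e v * f v) \<in> pp" if "e \<in> pp" "f \<in> pp" for e f
    using that by (auto simp: pp_def coeff_mult intro!: polyfun_sum polyfun.mult)
  have pp_const: "(\<lambda>_. c) \<in> pp" for c by (simp add: pp_def polyfun.const)
  have pp_prod: "(\<lambda>v. \<Prod>i\<in>I. e i v) \<in> pp" if "\<And>i. i \<in> I \<Longrightarrow> e i \<in> pp" for I :: "nat set" and e
    using that by (induction I rule: infinite_finite_induct) (simp_all add: pp_const pp_mult)
  have pp_sum: "(\<lambda>v. \<Sum>i\<in>I. e i v) \<in> pp" if "\<And>i. i \<in> I \<Longrightarrow> e i \<in> pp" for I :: "(nat \<Rightarrow> nat) set" and e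
    using that by (auto simp: pp_def coeff_sum intro!: polyfun_sum)
  have "(\<lambda>v. fdet n (E v)) \<in> pp"
    unfolding fdet_def
  proof (intro pp_sum pp_mult pp_prod pp_const)
    fix \<pi> i assume "\<pi> \<in> {\<pi>. \<pi> permutes {..<n}}" "i \<in> {..<n}"
    then have "i < n" "\<pi> i < n" using permutes_less by auto
    then show "(\<lambda>v. E v i (\<pi> i)) \<in> pp" unfolding pp_def using assms by blast
  qed
  then show ?thesis by (simp add: pp_def)
qed

lemma poly_fdet: "poly (fdet n E) s = fdet n (\<lambda>i j. poly (E i j) s)"
  unfolding fdet_def by (simp add: poly_sum poly_prod)

lemma char_poly_fmat: "char_poly (fmat n a) = fdet n (\<lambda>i j. [: - a i j, if i = j then 1 else 0 :])"
  unfolding char_poly_def char_poly_matrix_def fdet_mat[symmetric]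
  by (rule arg_cong[of _ _ Determinant.det]) (auto intro!: eq_matI)

text \<open>Prepares the determinant trick: a matrix with polynomial entries yields a monic
  polynomial in \<open>T\<close> whose coefficients are polynomial functions on the same
  space.\<close>

lemma charpoly_expansion:
  assumes "\<And>a b. a < s \<Longrightarrow> b < s \<Longrightarrow> M a b \<in> polyfun C"
  obtains q where "\<And>l. q l \<in> polyfun C" "q s = (\<lambda>_. 1)"
    "\<And>y T. fdet s (\<lambda>a b. (if a = b then T else 0) - M a b y) = (\<Sum>l\<le>s. q l y * T ^ l)"
proof -
  define A where "A = (\<lambda>y. fmat s (\<lambda>a b. M a b y))"
  define q where "q = (\<lambda>l y. coeff (char_poly (A y)) l)"
  have cA: "A y \<in> carrier_mat s s" for y by (simp add: A_def)
  have cp: "char_poly (A y) = fdet s (\<lambda>a b. [: - M a b y, if a = b then 1 else 0 :])" for y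
    unfolding A_def by (rule char_poly_fmat)
  have 1: "q l \<in> polyfun C" for l
    unfolding q_def cp by (intro coeff_fdet_polyfun polyfun_coeff_pCons polyfun_uminus assms polyfun.const)
  have 2: "q s = (\<lambda>_. 1)"
    using degree_monic_char_poly[OF cA] by (auto simp: q_def fun_eq_iff)
  have 3: "fdet s (\<lambda>a b. (if a = b then T else 0) - M a b y) = (\<Sum>l\<le>s. q l y * T ^ l)" for y T
  proof -
    have "(\<Sum>l\<le>s. q l y * T ^ l) = poly (char_poly (A y)) T"
      unfolding q_def using degree_monic_char_poly[OF cA, of y] by (simp add: poly_altdef)
    also have "\<dots> = fdet s (\<lambda>a b. poly [: - M a b y, if a = b then 1 else 0 :] T)"
      unfolding cp by (rule poly_fdet)
    also have "\<dots> = fdet s (\<lambda>a b. (if a = b then T else 0) - M a b y)"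
      by (rule fdet_cong) simp
    finally show ?thesis by simp
  qed
  show ?thesis by (rule that[OF 1 2 3])
qed

text \<open>Nonvanishing of \<open>D\<close> persists on pairs near \<open>(a, a)\<close> and makes
  the map injective there; invariance of domain, for which the dimensions are compared, then makes
  it open.\<close>

lemma local_homeomorphism:
  fixes \<pi> :: "'a::euclidean_space \<Rightarrow> 'b::euclidean_space"
  assumes "continuous_on UNIV \<pi>" "DIM('b) \<le> DIM('a)" "continuous_on UNIV D" "D (a, a) \<noteq> (0::complex)"
    "\<And>u v. D (u, v) \<noteq> 0 \<Longrightarrow> \<pi> u = \<pi> v \<Longrightarrow> u = v"
  obtains U where "open U" "a \<in> U" "inj_on \<pi> U" "\<And>S. open S \<Longrightarrow> S \<subseteq> U \<Longrightarrow> open (\<pi> ` S)"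
proof -
  have "open (D -` (- {0}))" by (rule open_vimage[OF _ assms(3)]) (simp add: open_Compl)
  moreover have "(a, a) \<in> D -` (- {0})" using assms(4) by simp
  ultimately obtain A B where AB: "open A" "open B" "(a, a) \<in> A \<times> B" "A \<times> B \<subseteq> D -` (- {0})"
    by (rule open_prod_elim)
  have inj: "inj_on \<pi> (A \<inter> B)" using AB(4) assms(5) by (intro inj_onI) auto
  show ?thesis
  proof (rule that[of "A \<inter> B"])
    show "open (\<pi> ` S)" if "open S" "S \<subseteq> A \<inter> B" for S
      by (rule invariance_of_domain_gen[OF that(1) _ _ assms(2)])
        (use assms(1) continuous_on_subset inj inj_on_subset that in blast)+
  qed (use AB inj in auto)
qed

section \<open>The degree of a weighted homogeneous map\<close>

lemma coords_continuous_into: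
  assumes y: "coords N y" and h: "\<And>j. j < N \<Longrightarrow> continuous_on A (\<lambda>k. y j (h k))"
  shows "continuous_on A h"
proof -
  have "\<forall>c j. \<exists>v. \<forall>i<N. y i v = (if i = j then c else 0)" by (intro allI coords_ex[OF y])
  then obtain e where e: "\<And>c j i. i < N \<Longrightarrow> y i (e c j) = (if i = j then c else 0)" by metis
  have eq: "h = (\<lambda>k. \<Sum>j<N. Re (y j (h k)) *\<^sub>R e 1 j + Im (y j (h k)) *\<^sub>R e \<i> j)"
  proof (rule ext, rule coords_inj[OF y])
    fix k i assume i: "i < N"
    have "y i (\<Sum>j<N. Re (y j (h k)) *\<^sub>R e 1 j + Im (y j (h k)) *\<^sub>R e \<i> j)
      = (\<Sum>j<N. if i = j then of_real (Re (y j (h k))) + of_real (Im (y j (h k))) * \<i> else 0)"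
    proof -
      interpret linear "y i" by (rule coords_linear[OF y i])
      show ?thesis
        unfolding sum add scaleR e[OF i] scaleR_conv_of_real by (rule sum.cong) simp_all
    qed
    also have "\<dots> = of_real (Re (y i (h k))) + of_real (Im (y i (h k))) * \<i>" using i by simp
    also have "\<dots> = y i (h k)" by (rule complex_eqI) simp_all
    finally show "y i (h k) = y i (\<Sum>j<N. Re (y j (h k)) *\<^sub>R e 1 j + Im (y j (h k)) *\<^sub>R e \<i> j)" by simp
  qed
  have "continuous_on A (\<lambda>k. \<Sum>j<N. Re (y j (h k)) *\<^sub>R e 1 j + Im (y j (h k)) *\<^sub>R e \<i> j)"
    by (intro continuous_intros h) auto
  then show ?thesis by (subst eq)
qed

lemma coords_hadamard:
  assumes "f \<in> polyfun (x ` {..<N})"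
  shows "\<exists>g. (\<forall>i<N. g i \<in> polyfun (coords_prod N x x ` {..<N + N})) \<and>
    (\<forall>u v. f u - f v = (\<Sum>i<N. g i (u, v) * (x i u - x i v)))"
  using polyfun_hadamard[of f "{}" x N] assms unfolding coords_prod_image by simp

text \<open>A weighted homogeneous finite map in filtered form: \<open>x i\<close> has weight
  \<open>w i\<close>, component \<open>j\<close> of \<open>F\<close> has weight at most
  \<open>d j\<close>, and by \<open>gen\<close> the polynomials on the source are a finite module
  over those on the target, generated by the \<open>v a\<close>. In \<open>gen\<close> the
  coefficients obey the same bound \<open>t\<close> as the monomial, on which the lower count
  relies.\<close>

locale graded_map =
  fixes N :: nat and x :: "nat \<Rightarrow> 'k::euclidean_space \<Rightarrow> complex" and y :: "nat \<Rightarrow> 'f::euclidean_space \<Rightarrow> complex"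
    and w d :: "nat \<Rightarrow> nat" and F :: "'k \<Rightarrow> 'f" and G :: "nat \<Rightarrow> nat \<Rightarrow> 'k \<times> 'k \<Rightarrow> complex"
    and s :: nat and v :: "nat \<Rightarrow> 'k \<Rightarrow> complex"
  assumes x: "coords N x" and y: "coords N y" and dim: "DIM('f) \<le> DIM('k)"
    and w: "\<And>i. i < N \<Longrightarrow> w i > 0" and d: "\<And>i. i < N \<Longrightarrow> d i > 0"
    and F: "\<And>j. j < N \<Longrightarrow> (\<lambda>k. y j (F k)) \<in> fs.span (mon N x ` wset N w (d j))"
    and G: "\<And>i j. i < N \<Longrightarrow> j < N \<Longrightarrow> G j i \<in> polyfun (coords_prod N x x ` {..<N + N})"
    and hadamard: "\<And>j k k'. j < N \<Longrightarrow> y j (F k) - y j (F k') = (\<Sum>i<N. G j i (k, k') * (x i k - x i k'))"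
    and v: "\<And>a. a < s \<Longrightarrow> v a \<in> polyfun (x ` {..<N})"
    and gen: "\<And>\<alpha> t. \<alpha> \<in> wset N w t \<Longrightarrow> \<exists>B. (\<forall>a<s. B a \<in> fs.span (mon N y ` wset N d t)) \<and>
        (\<forall>k. mon N x \<alpha> k = (\<Sum>a<s. B a (F k) * v a k))"
begin

abbreviation "PX \<equiv> polyfun (x ` {..<N})"
abbreviation "PY \<equiv> polyfun (y ` {..<N})"

text \<open>Off the diagonal the quotient matrix depends on the choice of \<open>G\<close>; on the
  diagonal it is the Jacobian matrix of \<open>F\<close>, so \<open>jac (k, k) \<noteq> 0\<close>
  says that \<open>k\<close> is unramified.\<close>

definition jac :: "'k \<times> 'k \<Rightarrow> complex" where
  "jac kk = fdet N (\<lambda>j i. G j i kk)"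

lemma polyfun_x: "i < N \<Longrightarrow> x i \<in> PX" by (simp add: polyfun.base)
lemma polyfun_y: "i < N \<Longrightarrow> y i \<in> PY" by (simp add: polyfun.base)

lemma polyfun_F: "j < N \<Longrightarrow> (\<lambda>k. y j (F k)) \<in> PX"
  by (rule span_mon_polyfun[OF F])

lemma polyfun_comp_F: "q \<in> PY \<Longrightarrow> (\<lambda>k. q (F k)) \<in> PX"
  by (rule polyfun_compose) (auto intro: polyfun_F)

lemma polyfun_left: "g \<in> polyfun (coords_prod N x x ` {..<N + N}) \<Longrightarrow> (\<lambda>k. g (k, z)) \<in> PX"
proof (erule polyfun_compose[where h = "\<lambda>k. (k, z)"])
  fix c assume "c \<in> coords_prod N x x ` {..<N + N}"
  then obtain i where "i < N + N" "c = coords_prod N x x i" by blast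
  then show "(\<lambda>k. c (k, z)) \<in> PX"
    by (cases "i < N") (simp_all add: coords_prod_def polyfun_x polyfun.const)
qed

lemma polyfun_diag: "g \<in> polyfun (coords_prod N x x ` {..<N + N}) \<Longrightarrow> (\<lambda>k. g (k, k)) \<in> PX"
proof (erule polyfun_compose[where h = "\<lambda>k. (k, k)"])
  fix c assume "c \<in> coords_prod N x x ` {..<N + N}"
  then obtain i where "i < N + N" "c = coords_prod N x x i" by blast
  then show "(\<lambda>k. c (k, k)) \<in> PX"
    by (cases "i < N") (simp_all add: coords_prod_def polyfun_x polyfun.const)
qed

lemma jac_polyfun: "jac \<in> polyfun (coords_prod N x x ` {..<N + N})"
  unfolding jac_def by (intro fdet_polyfun G)

lemma continuous_F: "continuous_on UNIV F"
  by (rule coords_continuous_into[OF y]) (rule polyfun_coords_continuous[OF x polyfun_F])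

lemma polyfun_rep:
  assumes "u \<in> PX"
  obtains B where "\<And>a. a < s \<Longrightarrow> B a \<in> PY" "\<And>k. u k = (\<Sum>a<s. B a (F k) * v a k)"
proof -
  obtain t where t: "u \<in> fs.span (mon N x ` wset N w t)" using polyfun_span_mon[OF assms] by blast
  from span_image_sum[OF t finite_wset[OF w]]
  obtain c where c: "\<And>k. u k = (\<Sum>\<alpha>\<in>wset N w t. c \<alpha> * mon N x \<alpha> k)" by blast
  have "\<forall>\<alpha>. \<exists>B. \<alpha> \<in> wset N w t \<longrightarrow> (\<forall>a<s. B a \<in> PY) \<and> (\<forall>k. mon N x \<alpha> k = (\<Sum>a<s. B a (F k) * v a k))"
  proof
    fix \<alpha>
    show "\<exists>B. \<alpha> \<in> wset N w t \<longrightarrow> (\<forall>a<s. B a \<in> PY) \<and> (\<forall>k. mon N x \<alpha> k = (\<Sum>a<s. B a (F k) * v a k))"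
    proof (cases "\<alpha> \<in> wset N w t")
      case True
      then obtain B where B: "\<forall>a<s. B a \<in> fs.span (mon N y ` wset N d t)" "\<forall>k. mon N x \<alpha> k = (\<Sum>a<s. B a (F k) * v a k)"
        using gen by blast
      have "\<forall>a<s. B a \<in> PY" using B(1) span_mon_polyfun by blast
      with B(2) show ?thesis by blast
    qed blast
  qed
  then obtain B where B: "\<And>\<alpha> a. \<alpha> \<in> wset N w t \<Longrightarrow> a < s \<Longrightarrow> B \<alpha> a \<in> PY"
    "\<And>\<alpha> k. \<alpha> \<in> wset N w t \<Longrightarrow> mon N x \<alpha> k = (\<Sum>a<s. B \<alpha> a (F k) * v a k)" by metis
  show ?thesis
  proof (rule that[of "\<lambda>a f. \<Sum>\<alpha>\<in>wset N w t. c \<alpha> * B \<alpha> a f"])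
    show "(\<lambda>f. \<Sum>\<alpha>\<in>wset N w t. c \<alpha> * B \<alpha> a f) \<in> PY" if "a < s" for a
      by (intro polyfun_sum polyfun_scale B that)
    show "u k = (\<Sum>a<s. (\<Sum>\<alpha>\<in>wset N w t. c \<alpha> * B \<alpha> a (F k)) * v a k)" for k
    proof -
      have "u k = (\<Sum>\<alpha>\<in>wset N w t. \<Sum>a<s. c \<alpha> * B \<alpha> a (F k) * v a k)"
        unfolding c by (intro sum.cong refl) (simp add: B sum_distrib_left mult.assoc)
      also have "\<dots> = (\<Sum>a<s. (\<Sum>\<alpha>\<in>wset N w t. c \<alpha> * B \<alpha> a (F k)) * v a k)"
        by (subst sum.swap) (simp add: sum_distrib_right)
      finally show ?thesis .
    qed
  qed
qed

lemma v_nonzero: "\<exists>a<s. v a k \<noteq> 0"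
proof (rule ccontr)
  assume "\<not> ?thesis"
  then have 0: "v a k = 0" if "a < s" for a using that by blast
  obtain B where "\<And>k. (1::complex) = (\<Sum>a<s. B a (F k) * v a k)"
    using polyfun_rep[OF polyfun.const[of 1]] by metis
  from this[of k] show False by (simp add: 0)
qed

text \<open>The determinant trick: multiplication by \<open>u\<close> acts on the generators by a
  matrix \<open>M\<close> over \<open>PY\<close>, and for each \<open>k\<close> the vector of the
  values \<open>v b k\<close>, nonzero by \<open>v_nonzero\<close>, is an eigenvector with
  eigenvalue \<open>u k\<close>. So \<open>u k\<close> is a root of the characteristic
  polynomial.\<close>

lemma integral:
  assumes "u \<in> PX"
  obtains q where "\<And>l. q l \<in> PY" "q s = (\<lambda>_. 1)" "\<And>k. (\<Sum>l\<le>s. q l (F k) * u k ^ l) = 0"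
proof -
  have "\<forall>a. \<exists>B. a < s \<longrightarrow> (\<forall>b<s. B b \<in> PY) \<and> (\<forall>k. u k * v a k = (\<Sum>b<s. B b (F k) * v b k))"
  proof
    fix a
    show "\<exists>B. a < s \<longrightarrow> (\<forall>b<s. B b \<in> PY) \<and> (\<forall>k. u k * v a k = (\<Sum>b<s. B b (F k) * v b k))"
    proof (cases "a < s")
      case True
      have "(\<lambda>k. u k * v a k) \<in> PX" by (intro polyfun.mult assms v True)
      then obtain B where "\<And>a. a < s \<Longrightarrow> B a \<in> PY" "\<And>k. u k * v a k = (\<Sum>a<s. B a (F k) * v a k)"
        by (rule polyfun_rep) blast
      then show ?thesis by blast
    qed blast
  qed
  from choice[OF this] obtain M where
    "\<forall>a. a < s \<longrightarrow> (\<forall>b<s. M a b \<in> PY) \<and> (\<forall>k. u k * v a k = (\<Sum>b<s. M a b (F k) * v b k))" ..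
  then have M: "\<And>a b. a < s \<Longrightarrow> b < s \<Longrightarrow> M a b \<in> PY"
    "\<And>a k. a < s \<Longrightarrow> u k * v a k = (\<Sum>b<s. M a b (F k) * v b k)" by simp_all
  obtain q where q: "\<And>l. q l \<in> PY" "q s = (\<lambda>_. 1)"
    "\<And>f T. fdet s (\<lambda>a b. (if a = b then T else 0) - M a b f) = (\<Sum>l\<le>s. q l f * T ^ l)"
    using charpoly_expansion[of s M, OF M(1)] by blast
  show ?thesis
  proof (rule that[of q, OF q(1) q(2)])
    fix k
    obtain a where a: "a < s" "v a k \<noteq> 0" using v_nonzero by blast
    have "fdet s (\<lambda>a b. (if a = b then u k else 0) - M a b (F k)) = 0"
    proof (rule ccontr)
      assume "fdet s (\<lambda>a b. (if a = b then u k else 0) - M a b (F k)) \<noteq> 0"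
      from fdet_kernel_zero[OF this, of "\<lambda>b. v b k" a] have "v a k = 0"
      proof (rule meta_mp)
        fix i assume "i < s"
        then show "(\<Sum>j<s. ((if i = j then u k else 0) - M i j (F k)) * v j k) = 0"
          using M(2)[of i k] by (simp add: left_diff_distrib sum_subtractf if_distrib[of "\<lambda>z. z * _"] cong: if_cong)
      qed (use a in auto)
      with a show False by simp
    qed
    then show "(\<Sum>l\<le>s. q l (F k) * u k ^ l) = 0" by (simp add: q(3))
  qed
qed

text \<open>The monic relation of \<open>x i\<close> over the target is specialised at
  \<open>f\<close>. Replacing \<open>q l (F k)\<close> by \<open>q l f\<close> costs a combination
  of the \<open>y j (F k) - y j f\<close>; this is the last claim, which places
  \<open>poly p (x i k)\<close> in the ideal of the fibre.\<close>

lemma fiber_coord_poly: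
  assumes "i < N"
  obtains p where "p \<noteq> 0" "\<And>k. F k = f \<Longrightarrow> poly p (x i k) = 0"
    "\<exists>h. (\<forall>j<N. h j \<in> PX) \<and> (\<forall>k. poly p (x i k) = (\<Sum>j<N. (y j (F k) - y j f) * h j k))"
proof -
  obtain q where q: "\<And>l. q l \<in> PY" "q s = (\<lambda>_. 1)" "\<And>k. (\<Sum>l\<le>s. q l (F k) * x i k ^ l) = 0"
    using integral[OF polyfun_x[OF assms]] by blast
  define p where "p = (\<Sum>l\<le>s. monom (q l f) l)"
  have pp: "poly p T = (\<Sum>l\<le>s. q l f * T ^ l)" for T by (simp add: p_def poly_sum poly_monom)
  have "coeff p s = 1" by (simp add: p_def coeff_sum q(2))
  then have "p \<noteq> 0" by auto
  have "\<forall>l. \<exists>g. (\<forall>j<N. g j \<in> polyfun (coords_prod N y y ` {..<N + N})) \<and> (\<forall>f' f. q l f' - q l f = (\<Sum>j<N. g j (f', f) * (y j f' - y j f)))"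
    by (intro allI coords_hadamard q(1))
  from choice[OF this] obtain g where "\<forall>l. (\<forall>j<N. g l j \<in> polyfun (coords_prod N y y ` {..<N + N})) \<and> (\<forall>f' f. q l f' - q l f = (\<Sum>j<N. g l j (f', f) * (y j f' - y j f)))" ..
  then have g: "\<And>l j. j < N \<Longrightarrow> g l j \<in> polyfun (coords_prod N y y ` {..<N + N})"
    "\<And>l f' f. q l f' - q l f = (\<Sum>j<N. g l j (f', f) * (y j f' - y j f))" by blast+
  have gF: "(\<lambda>k. g l j (F k, f)) \<in> PX" if "j < N" for l j
  proof (rule polyfun_compose[OF g(1)[OF that]])
    fix c assume "c \<in> coords_prod N y y ` {..<N + N}"
    then obtain i where "i < N + N" "c = coords_prod N y y i" by blast
    then show "(\<lambda>k. c (F k, f)) \<in> PX"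
      by (cases "i < N") (simp_all add: coords_prod_def polyfun_F polyfun.const)
  qed
  define h where "h = (\<lambda>j k. - (\<Sum>l\<le>s. g l j (F k, f) * x i k ^ l))"
  have "h j \<in> PX" if "j < N" for j
    unfolding h_def by (intro polyfun_uminus polyfun_sum polyfun.mult gF polyfun_power polyfun_x assms that)
  moreover have "poly p (x i k) = (\<Sum>j<N. (y j (F k) - y j f) * h j k)" for k
  proof -
    have "poly p (x i k) = - (\<Sum>l\<le>s. (q l (F k) - q l f) * x i k ^ l)"
      unfolding pp using q(3)[of k] by (simp add: left_diff_distrib sum_subtractf)
    also have "\<dots> = - (\<Sum>l\<le>s. \<Sum>j<N. (y j (F k) - y j f) * (g l j (F k, f) * x i k ^ l))"
      unfolding g(2)[of _ "F k" f] sum_distrib_right by (simp add: mult_ac)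
    also have "\<dots> = (\<Sum>j<N. (y j (F k) - y j f) * h j k)"
      unfolding h_def by (subst sum.swap) (simp add: sum_distrib_left sum_negf)
    finally show ?thesis .
  qed
  ultimately have h: "\<exists>h. (\<forall>j<N. h j \<in> PX) \<and> (\<forall>k. poly p (x i k) = (\<Sum>j<N. (y j (F k) - y j f) * h j k))" by blast
  moreover have "poly p (x i k) = 0" if "F k = f" for k using h that by auto
  ultimately show ?thesis using that \<open>p \<noteq> 0\<close> by blast
qed

lemma finite_fiber: "finite {k. F k = f}"
proof -
  have "\<exists>p. i < N \<longrightarrow> p \<noteq> 0 \<and> (\<forall>k. F k = f \<longrightarrow> poly p (x i k) = 0)" for i
  proof (cases "i < N")
    case True
    then obtain p where "p \<noteq> 0" "\<And>k. F k = f \<Longrightarrow> poly p (x i k) = 0" by (rule fiber_coord_poly[of i f]) blast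
    then show ?thesis by blast
  qed blast
  then obtain p where p: "\<And>i. i < N \<Longrightarrow> p i \<noteq> 0" "\<And>i k. i < N \<Longrightarrow> F k = f \<Longrightarrow> poly (p i) (x i k) = 0" by metis
  define E where "E = PiE {..<N} (\<lambda>i. {z. poly (p i) z = 0})"
  have "finite E" unfolding E_def using p(1) by (intro finite_PiE finite_lessThan poly_roots_finite) simp
  moreover have "(\<lambda>k. restrict (\<lambda>i. x i k) {..<N}) ` {k. F k = f} \<subseteq> E"
    using p(2) by (auto simp: E_def PiE_iff split: if_splits)
  ultimately have "finite ((\<lambda>k. restrict (\<lambda>i. x i k) {..<N}) ` {k. F k = f})" by (rule finite_subset[rotated])
  moreover have "inj_on (\<lambda>k. restrict (\<lambda>i. x i k) {..<N}) {k. F k = f}"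
  proof (rule inj_onI)
    fix k k' assume e: "restrict (\<lambda>i. x i k) {..<N} = restrict (\<lambda>i. x i k') {..<N}"
    show "k = k'"
    proof (rule coords_inj[OF x])
      fix i assume "i < N"
      then show "x i k = x i k'" using fun_cong[OF e, of i] by simp
    qed
  qed
  ultimately show ?thesis by (rule finite_imageD)
qed

text \<open>A minimal algebraic relation of \<open>x i\<close> over the components of \<open>F\<close> is separable, so differentiating it
  along a kernel vector of the Jacobian matrix kills the \<open>i\<close>-th component of that vector.\<close>

lemma separable_relation:
  assumes "i < N"
  obtains m q k where "\<And>l. q l \<in> PY" "\<And>k. (\<Sum>l\<le>m. q l (F k) * x i k ^ l) = 0"
    "(\<Sum>l\<le>m. of_nat l * q l (F k) * x i k ^ (l - 1)) \<noteq> 0"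
proof -
  define R where "R = (\<lambda>m. \<exists>q. (\<forall>l. q l \<in> PY) \<and> (\<exists>k. q m (F k) \<noteq> 0) \<and> (\<forall>k. (\<Sum>l\<le>m. q l (F k) * x i k ^ l) = 0))"
  have "\<exists>m. R m"
  proof -
    obtain q where "\<And>l. q l \<in> PY" "q s = (\<lambda>_. 1)" "\<And>k. (\<Sum>l\<le>s. q l (F k) * x i k ^ l) = 0"
      using integral[OF polyfun_x[OF assms]] by blast
    then have "R s" unfolding R_def by (intro exI[of _ q]) auto
    then show ?thesis ..
  qed
  define m where "m = (LEAST m. R m)"
  have Rm: "R m" unfolding m_def by (rule LeastI_ex) fact
  then obtain q k0 where q: "\<And>l. q l \<in> PY" "q m (F k0) \<noteq> 0" "\<And>k. (\<Sum>l\<le>m. q l (F k) * x i k ^ l) = 0"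
    unfolding R_def by blast
  have "m \<noteq> 0"
  proof
    assume "m = 0"
    then show False using q(2) q(3)[of k0] by simp
  qed
  then obtain m' where m': "m = Suc m'" using not0_implies_Suc by blast
  have "\<exists>k. (\<Sum>l\<le>m. of_nat l * q l (F k) * x i k ^ (l - 1)) \<noteq> 0"
  proof (rule ccontr)
    assume "\<not> ?thesis"
    then have z: "(\<Sum>l\<le>m. of_nat l * q l (F k) * x i k ^ (l - 1)) = 0" for k by blast
    \<comment> \<open>In characteristic 0 the formal derivative keeps a nonzero leading coefficient,
      so an identically vanishing derivative would be a relation of smaller degree.\<close>
    have "R m'"
      unfolding R_def
    proof (intro exI[of _ "\<lambda>l f. of_nat (Suc l) * q (Suc l) f"] conjI allI)
      show "(\<lambda>f. of_nat (Suc l) * q (Suc l) f) \<in> PY" for l by (intro polyfun_scale q)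
      show "\<exists>k. of_nat (Suc m') * q (Suc m') (F k) \<noteq> 0"
        using q(2) m' by (intro exI[of _ k0]) (simp del: of_nat_Suc)
      show "(\<Sum>l\<le>m'. of_nat (Suc l) * q (Suc l) (F k) * x i k ^ l) = 0" for k
        using z[of k] unfolding m' by (subst (asm) sum.atMost_Suc_shift) simp
    qed
    then have "m \<le> m'" unfolding m_def by (rule Least_le)
    then show False using m' by simp
  qed
  then show ?thesis using that q(1,3) by blast
qed

lemma polyfun_prod_nonzero:
  fixes n :: nat
  assumes "\<And>i. i < n \<Longrightarrow> t i \<in> PX" "\<And>i. i < n \<Longrightarrow> \<exists>k. t i k \<noteq> 0"
  shows "\<exists>k. \<forall>i<n. t i k \<noteq> 0"
proof -
  have "\<exists>k. (\<Prod>i<n. t i k) \<noteq> 0"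
    using assms
  proof (induction n)
    case (Suc n)
    then obtain a b where "(\<Prod>i<n. t i a) \<noteq> 0" "t n b \<noteq> 0" by (metis less_Suc_eq)
    then have "\<exists>k. (\<Prod>i<n. t i k) * t n k \<noteq> 0"
      by (intro polyfun_mult_nonzero[OF x, of "\<lambda>k. \<Prod>i<n. t i k" "t n" a b]) (auto intro!: polyfun_prod Suc.prems(1))
    then show ?case by simp
  qed simp
  then show ?thesis by auto
qed

lemma jac_nonzero: "\<exists>k. jac (k, k) \<noteq> 0"
proof -
  have "\<forall>i. \<exists>mq. i < N \<longrightarrow> (\<forall>l. snd mq l \<in> PY) \<and> (\<forall>k. (\<Sum>l\<le>fst mq. snd mq l (F k) * x i k ^ l) = 0) \<and>
    (\<exists>k. (\<Sum>l\<le>fst mq. of_nat l * snd mq l (F k) * x i k ^ (l - 1)) \<noteq> 0)"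
  proof
    fix i
    show "\<exists>mq. i < N \<longrightarrow> (\<forall>l. snd mq l \<in> PY) \<and> (\<forall>k. (\<Sum>l\<le>fst mq. snd mq l (F k) * x i k ^ l) = 0) \<and>
      (\<exists>k. (\<Sum>l\<le>fst mq. of_nat l * snd mq l (F k) * x i k ^ (l - 1)) \<noteq> 0)"
    proof (cases "i < N")
      case True
      then obtain m q k where "\<And>l. q l \<in> PY" "\<And>k. (\<Sum>l\<le>m. q l (F k) * x i k ^ l) = 0"
        "(\<Sum>l\<le>m. of_nat l * q l (F k) * x i k ^ (l - 1)) \<noteq> 0"
        by (rule separable_relation) blast
      then show ?thesis by (intro exI[of _ "(m, q)"]) auto
    qed blast
  qed
  from choice[OF this] obtain mq where mq: "\<forall>i. i < N \<longrightarrow> (\<forall>l. snd (mq i) l \<in> PY) \<and> (\<forall>k. (\<Sum>l\<le>fst (mq i). snd (mq i) l (F k) * x i k ^ l) = 0) \<and>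
    (\<exists>k. (\<Sum>l\<le>fst (mq i). of_nat l * snd (mq i) l (F k) * x i k ^ (l - 1)) \<noteq> 0)" ..
  define m where "m = (\<lambda>i. fst (mq i))"
  define q where "q = (\<lambda>i. snd (mq i))"
  from mq have q: "\<And>i l. i < N \<Longrightarrow> q i l \<in> PY" "\<And>i k. i < N \<Longrightarrow> (\<Sum>l\<le>m i. q i l (F k) * x i k ^ l) = 0"
    "\<And>i. i < N \<Longrightarrow> \<exists>k. (\<Sum>l\<le>m i. of_nat l * q i l (F k) * x i k ^ (l - 1)) \<noteq> 0"
    unfolding m_def q_def by blast+
  have "\<exists>k. \<forall>i<N. (\<Sum>l\<le>m i. of_nat l * q i l (F k) * x i k ^ (l - 1)) \<noteq> 0"
  proof (rule polyfun_prod_nonzero[where t = "\<lambda>i k. \<Sum>l\<le>m i. of_nat l * q i l (F k) * x i k ^ (l - 1)"])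
    fix i assume i: "i < N"
    show "(\<lambda>k. \<Sum>l\<le>m i. of_nat l * q i l (F k) * x i k ^ (l - 1)) \<in> PX"
      by (intro polyfun_sum polyfun.mult polyfun.const polyfun_comp_F[OF q(1)[OF i]] polyfun_power polyfun_x[OF i])
    show "\<exists>k. (\<Sum>l\<le>m i. of_nat l * q i l (F k) * x i k ^ (l - 1)) \<noteq> 0" by (rule q(3)[OF i])
  qed
  then obtain k where k: "\<And>i. i < N \<Longrightarrow> (\<Sum>l\<le>m i. of_nat l * q i l (F k) * x i k ^ (l - 1)) \<noteq> 0" by blast
  have "jac (k, k) \<noteq> 0"
  proof
    assume "jac (k, k) = 0"
    from fdet_zero_kernel[OF this[unfolded jac_def]]
    obtain h where h: "\<exists>i<N. h i \<noteq> 0" "\<And>j. j < N \<Longrightarrow> (\<Sum>i<N. G j i (k, k) * h i) = 0" by blast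
    obtain u where u: "\<And>i. i < N \<Longrightarrow> x i u = h i" using coords_ex[OF x, of h] by blast
    obtain cs where cs: "\<And>i t. i < N \<Longrightarrow> x i (cs t) = t * x i u" "linear cs" "cs 1 = u"
      using coords_complex_scaling[OF x, of u] by blast
    define l where "l = (\<lambda>t. k + cs t)"
    have l0: "l 0 = k" by (simp add: l_def linear_0[OF cs(2)])
    have xl: "x i (l t) = x i k + t * h i" if "i < N" for i t
      using that by (simp add: l_def linear_add[OF coords_linear[OF x]] cs u)
    have lcont: "continuous_on UNIV l"
      unfolding l_def by (intro continuous_intros linear_continuous_on) (use cs(2) linear_conv_bounded_linear in blast)
    \<comment> \<open>Caratheodory's criterion: along the line with direction \<open>h\<close> the
      two-point quotients form a continuous slope function, whose value at \<open>0\<close> vanishes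
      because \<open>h\<close> is in the kernel.\<close>
    have dy: "((\<lambda>t. y j (F (l t))) has_field_derivative 0) (at 0)" if j: "j < N" for j
      unfolding CARAT_DERIV
    proof (intro exI[of _ "\<lambda>t. \<Sum>i<N. G j i (l t, k) * h i"] conjI allI)
      show "y j (F (l t)) - y j (F (l 0)) = (\<Sum>i<N. G j i (l t, k) * h i) * (t - 0)" for t
        using hadamard[OF j, of "l t" k] by (simp add: l0 xl sum_distrib_left sum_distrib_right mult_ac)
      have "continuous_on UNIV (\<lambda>t. G j i (l t, k))" if "i < N" for i
        by (rule continuous_on_compose2[OF polyfun_coords_continuous[OF x polyfun_left[OF G[OF that j]], where A = UNIV] lcont]) simp
      then have "continuous_on UNIV (\<lambda>t. \<Sum>i<N. G j i (l t, k) * h i)" by (intro continuous_intros) auto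
      then show "isCont (\<lambda>t. \<Sum>i<N. G j i (l t, k) * h i) 0" by (simp add: continuous_on_eq_continuous_at)
      show "(\<Sum>i<N. G j i (l 0, k) * h i) = 0" by (simp add: l0 h(2) j)
    qed
    have dq: "((\<lambda>t. g (F (l t))) has_field_derivative 0) (at 0)" if "g \<in> PY" for g
      using that
    proof induction
      case (base f) then show ?case using dy by auto
    next
      case (add f g)
      from DERIV_add[OF add(3,4)] show ?case by simp
    next
      case (mult f g)
      from DERIV_mult[OF mult(3,4)] show ?case by simp
    qed simp
    obtain i where i: "i < N" "h i \<noteq> 0" using h(1) by blast
    have "((\<lambda>t. \<Sum>n\<le>m i. q i n (F (l t)) * (x i k + t * h i) ^ n) has_field_derivative
        (\<Sum>n\<le>m i. q i n (F k) * (of_nat n * x i k ^ (n - 1) * h i))) (at 0)"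
    proof (rule DERIV_sum)
      fix n
      have "((\<lambda>t. (x i k + t * h i) ^ n) has_field_derivative of_nat n * (h i * (x i k + 0 * h i) ^ (n - 1))) (at 0)"
        by (rule derivative_eq_intros refl | simp)+
      from DERIV_mult[OF dq[OF q(1)[OF i(1), of n]] this]
      show "((\<lambda>t. q i n (F (l t)) * (x i k + t * h i) ^ n) has_field_derivative
          q i n (F k) * (of_nat n * x i k ^ (n - 1) * h i)) (at 0)"
        by (simp add: l0 mult_ac)
    qed
    moreover have "(\<Sum>n\<le>m i. q i n (F (l t)) * (x i k + t * h i) ^ n) = 0" for t
      using q(2)[OF i(1), of "l t"] unfolding xl[OF i(1)] .
    ultimately have "((\<lambda>_. 0) has_field_derivative
        (\<Sum>n\<le>m i. q i n (F k) * (of_nat n * x i k ^ (n - 1) * h i))) (at (0::complex))" by (simp only:)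
    then have "(\<Sum>n\<le>m i. q i n (F k) * (of_nat n * x i k ^ (n - 1) * h i)) = 0"
      by (rule DERIV_unique[OF _ DERIV_const])
    moreover have "(\<Sum>n\<le>m i. q i n (F k) * (of_nat n * x i k ^ (n - 1) * h i))
      = (\<Sum>n\<le>m i. of_nat n * q i n (F k) * x i k ^ (n - 1)) * h i"
      unfolding sum_distrib_right by (intro sum.cong refl) (simp add: mult_ac)
    ultimately show False using k[OF i(1)] i(2) by simp
  qed
  then show ?thesis by blast
qed

text \<open>An algebraic substitute for Sard's theorem: the critical values satisfy a nonzero
  polynomial, and any point off its zero set has an unramified fibre.\<close>

lemma exists_regular_value: "\<exists>f. \<forall>k. F k = f \<longrightarrow> jac (k, k) \<noteq> 0"
proof -
  obtain k0 where k0: "jac (k0, k0) \<noteq> 0" using jac_nonzero by blast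
  obtain P b where "P \<in> PY" "P b \<noteq> 0" "\<And>a. jac (a, a) = 0 \<Longrightarrow> P (F a) = 0"
  proof (rule critical_value_polynomial[OF x y, where \<pi> = F and J = "\<lambda>k. jac (k, k)"])
    show "(\<lambda>k. y j (F k)) \<in> PX" if "j < N" for j by (rule polyfun_F[OF that])
    show "(\<lambda>k. jac (k, k)) \<in> PX" by (rule polyfun_diag[OF jac_polyfun])
  qed (use k0 in auto)
  then show ?thesis by (intro exI[of _ b]) auto
qed

lemma jac_inj:
  assumes "jac (k, k') \<noteq> 0" "F k = F k'"
  shows "k = k'"
proof (rule coords_inj[OF x])
  fix i assume i: "i < N"
  have "x i k - x i k' = 0"
    by (rule fdet_kernel_zero[OF assms(1)[unfolded jac_def] _ i, where v = "\<lambda>i. x i k - x i k'"])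
      (use hadamard[of _ k k'] assms(2) in auto)
  then show "x i k = x i k'" by simp
qed

lemma F_local_homeo:
  assumes "jac (k, k) \<noteq> 0"
  obtains U where "open U" "k \<in> U" "\<And>S. open S \<Longrightarrow> S \<subseteq> U \<Longrightarrow> open (F ` S)"
proof -
  have "continuous_on UNIV jac"
    using polyfun_coords_continuous[OF coords_prod[OF x x] jac_polyfun] .
  from local_homeomorphism[OF continuous_F dim this assms jac_inj] show ?thesis using that by metis
qed

text \<open>\<open>fid f\<close> is the ideal of the fibre over \<open>f\<close>.\<close>

definition fid :: "'f \<Rightarrow> ('k \<Rightarrow> complex) set" where
  "fid f = {u. \<exists>h. (\<forall>j<N. h j \<in> PX) \<and> u = (\<lambda>k. \<Sum>j<N. (y j (F k) - y j f) * h j k)}"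

definition is_ideal :: "('k \<Rightarrow> complex) set \<Rightarrow> bool" where
  "is_ideal J \<longleftrightarrow> J \<subseteq> PX \<and> J \<noteq> {} \<and> (\<forall>f\<in>J. \<forall>g\<in>J. (\<lambda>k. f k + g k) \<in> J) \<and> (\<forall>f\<in>J. \<forall>g\<in>PX. (\<lambda>k. f k * g k) \<in> J)"

lemma is_ideal_fid: "is_ideal (fid f)"
  unfolding is_ideal_def
proof (intro conjI ballI)
  show "fid f \<subseteq> PX"
    by (auto simp: fid_def intro!: polyfun_sum polyfun.mult polyfun_diff polyfun_F polyfun.const)
  show "fid f \<noteq> {}" by (auto simp: fid_def intro!: exI[of _ "\<lambda>_ _. 0"] polyfun.const)
  fix u assume "u \<in> fid f"
  then obtain h where h: "\<forall>j<N. h j \<in> PX" "u = (\<lambda>k. \<Sum>j<N. (y j (F k) - y j f) * h j k)" by (auto simp: fid_def)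
  show "(\<lambda>k. u k + g k) \<in> fid f" if g: "g \<in> fid f" for g
  proof -
    obtain h' where "\<forall>j<N. h' j \<in> PX" "g = (\<lambda>k. \<Sum>j<N. (y j (F k) - y j f) * h' j k)" using g by (auto simp: fid_def)
    then show ?thesis unfolding fid_def using h
      by (intro CollectI exI[of _ "\<lambda>j k. h j k + h' j k"]) (auto intro: polyfun.add simp: distrib_left sum.distrib)
  qed
  show "(\<lambda>k. u k * g k) \<in> fid f" if g: "g \<in> PX" for g
    unfolding fid_def using h g
    by (intro CollectI exI[of _ "\<lambda>j k. h j k * g k"]) (auto intro: polyfun.mult simp: sum_distrib_right mult.assoc)
qed

section \<open>Ideals of polynomial functions and a weak Nullstellensatz\<close>

lemma is_ideal_add: "is_ideal J \<Longrightarrow> f \<in> J \<Longrightarrow> g \<in> J \<Longrightarrow> (\<lambda>k. f k + g k) \<in> J"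
  by (simp add: is_ideal_def)

lemma is_ideal_scale:
  assumes "is_ideal J" "u \<in> J" "g \<in> PX"
  shows "(\<lambda>k. g k * u k) \<in> J"
proof -
  have "(\<lambda>k. u k * g k) \<in> J" using assms by (auto simp: is_ideal_def)
  moreover have "(\<lambda>k. u k * g k) = (\<lambda>k. g k * u k)" by (simp add: mult.commute)
  ultimately show ?thesis by simp
qed

lemma is_ideal_adjoin:
  assumes "is_ideal J" "g \<in> PX"
  shows "is_ideal {\<lambda>k. u k + g k * h k |u h. u \<in> J \<and> h \<in> PX}" (is "is_ideal ?A")
  unfolding is_ideal_def
proof (intro conjI ballI)
  show "?A \<subseteq> PX" using assms by (auto simp: is_ideal_def intro!: polyfun.add polyfun.mult)
  show "?A \<noteq> {}" using assms by (auto simp: is_ideal_def intro: polyfun.const)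
  fix a assume "a \<in> ?A"
  then obtain u h where a: "a = (\<lambda>k. u k + g k * h k)" "u \<in> J" "h \<in> PX" by blast
  show "(\<lambda>k. a k + b k) \<in> ?A" if b: "b \<in> ?A" for b
  proof -
    obtain u' h' where b: "b = (\<lambda>k. u' k + g k * h' k)" "u' \<in> J" "h' \<in> PX" using b by blast
    have "(\<lambda>k. a k + b k) = (\<lambda>k. (u k + u' k) + g k * (h k + h' k))" by (simp add: a b algebra_simps)
    moreover have "(\<lambda>k. u k + u' k) \<in> J" using assms a b by (auto simp: is_ideal_def)
    ultimately show ?thesis using polyfun.add[OF a(3) b(3)]
      by (intro CollectI exI[of _ "\<lambda>k. u k + u' k"] exI[of _ "\<lambda>k. h k + h' k"] conjI)
  qed
  show "(\<lambda>k. a k * b k) \<in> ?A" if b: "b \<in> PX" for b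
  proof -
    have "(\<lambda>k. a k * b k) = (\<lambda>k. (u k * b k) + g k * (h k * b k))" by (simp add: a algebra_simps)
    moreover have "(\<lambda>k. u k * b k) \<in> J" using assms a b by (auto simp: is_ideal_def)
    ultimately show ?thesis using polyfun.mult[OF a(3) b]
      by (intro CollectI exI[of _ "\<lambda>k. u k * b k"] exI[of _ "\<lambda>k. h k * b k"] conjI)
  qed
qed

lemma polyfun_poly: "g \<in> PX \<Longrightarrow> (\<lambda>k. poly p (g k)) \<in> PX"
  unfolding poly_altdef by (intro polyfun_sum polyfun_scale polyfun_power)

text \<open>Roots of \<open>p\<close> are split off one at a time. If adjoining \<open>g - c\<close>
  for a root \<open>c\<close> gives the unit ideal, say \<open>1 = u + (g - c) * h\<close>, then for
  \<open>p = (X - c) * r\<close> the element \<open>r(g) = u * r(g) + p(g) * h\<close> is in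
  \<open>J\<close>, and \<open>r\<close> has smaller degree. Degree \<open>0\<close> is excluded
  because \<open>J\<close> contains no nonzero constant.\<close>

lemma ideal_eigenvalue:
  assumes J: "is_ideal J" "(\<lambda>_. 1) \<notin> J" and g: "g \<in> PX" and p: "p \<noteq> 0" "(\<lambda>k. poly p (g k)) \<in> J"
  shows "\<exists>c J'. is_ideal J' \<and> (\<lambda>_. 1) \<notin> J' \<and> J \<subseteq> J' \<and> (\<lambda>k. g k - c) \<in> J'"
  using p
proof (induction "degree p" arbitrary: p)
  case 0
  then obtain c where c: "p = [:c:]" "c \<noteq> 0" by (metis degree_eq_zeroE pCons_0_0)
  have "(\<lambda>k. (1 / c) * poly p (g k)) \<in> J" by (rule is_ideal_scale[OF J(1) 0(3) polyfun.const])
  then have "(\<lambda>_. 1) \<in> J" using c by simp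
  then show ?case using J(2) by simp
next
  case (Suc n)
  have "\<not> constant (poly p)" using Suc(2) by (simp add: constant_degree)
  then obtain c where "poly p c = 0" using fundamental_theorem_of_algebra by blast
  then obtain r where r: "p = [:- c, 1:] * r" by (metis dvdE poly_eq_0_iff_dvd)
  then have r0: "r \<noteq> 0" using Suc(3) by auto
  then have "degree p = 1 + degree r" unfolding r by (subst degree_mult_eq) auto
  then have dr: "n = degree r" using Suc(2) by simp
  let ?g = "\<lambda>k. g k - c"
  have gc: "?g \<in> PX" by (intro polyfun_diff g polyfun.const)
  let ?A = "{\<lambda>k. u k + ?g k * h k |u h. u \<in> J \<and> h \<in> PX}"
  show ?case
  proof (cases "(\<lambda>_. 1) \<in> ?A")
    case False
    have "u \<in> ?A" if "u \<in> J" for u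
      using that by (intro CollectI exI[of _ u] exI[of _ "\<lambda>_. 0"]) (auto intro: polyfun.const)
    moreover obtain z where z: "z \<in> J" using J(1) by (auto simp: is_ideal_def)
    have "(\<lambda>k. 0 * z k) \<in> J" by (rule is_ideal_scale[OF J(1) z polyfun.const])
    then have "?g \<in> ?A"
      by (intro CollectI exI[of _ "\<lambda>_. 0"] exI[of _ "\<lambda>_. 1"]) (auto intro: polyfun.const)
    ultimately show ?thesis using is_ideal_adjoin[OF J(1) gc] False by blast
  next
    case True
    then obtain u h where uh: "u \<in> J" "h \<in> PX" "(\<lambda>_. 1) = (\<lambda>k. u k + ?g k * h k)" by blast
    have "poly r (g k) = u k * poly r (g k) + poly p (g k) * h k" for k
    proof -
      have p: "poly p (g k) = ?g k * poly r (g k)" unfolding r by (simp add: algebra_simps)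
      have "u k * poly r (g k) + poly p (g k) * h k = (u k + ?g k * h k) * poly r (g k)"
        unfolding p by (simp add: algebra_simps)
      then show ?thesis using fun_cong[OF uh(3), of k] by simp
    qed
    then have "(\<lambda>k. poly r (g k)) = (\<lambda>k. u k * poly r (g k) + poly p (g k) * h k)" by blast
    also have "\<dots> \<in> J" using J(1) uh(1,2) polyfun_poly[OF g] Suc(4) by (auto simp: is_ideal_def)
    finally show ?thesis using Suc(1)[OF dr r0] by blast
  qed
qed

text \<open>A value \<open>c i\<close> is fixed for one coordinate after the other, keeping the
  ideal proper. The final ideal contains every \<open>x i - c i\<close>, hence
  \<open>u - u z\<close> for the point \<open>z\<close> with these coordinates; an element with
  \<open>u z \<noteq> 0\<close> would make it the unit ideal.\<close>

lemma weak_nullstellensatz: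
  assumes J: "is_ideal J" "(\<lambda>_. 1) \<notin> J"
    and p: "\<And>i. i < N \<Longrightarrow> \<exists>p. p \<noteq> 0 \<and> (\<lambda>k. poly p (x i k)) \<in> J"
  shows "\<exists>z. \<forall>u\<in>J. u z = 0"
proof -
  have "\<exists>c J'. is_ideal J' \<and> (\<lambda>_. 1) \<notin> J' \<and> J \<subseteq> J' \<and> (\<forall>i<n. (\<lambda>k. x i k - c i) \<in> J')" if "n \<le> N" for n
    using that
  proof (induction n)
    case 0
    then show ?case using J by blast
  next
    case (Suc n)
    then obtain c J' where c: "is_ideal J'" "(\<lambda>_. 1) \<notin> J'" "J \<subseteq> J'" "\<forall>i<n. (\<lambda>k. x i k - c i) \<in> J'" by auto
    obtain p where "p \<noteq> 0" "(\<lambda>k. poly p (x n k)) \<in> J'" using p[of n] Suc.prems c(3) by auto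
    from ideal_eigenvalue[OF c(1,2) polyfun_x this] Suc.prems
    obtain e J'' where e: "is_ideal J''" "(\<lambda>_. 1) \<notin> J''" "J' \<subseteq> J''" "(\<lambda>k. x n k - e) \<in> J''" by auto
    have "\<forall>i<Suc n. (\<lambda>k. x i k - (c(n := e)) i) \<in> J''" using c(4) e(3,4) by (auto simp: less_Suc_eq)
    then show ?case using e c(3) by blast
  qed
  from this[of N] obtain c J' where c: "is_ideal J'" "(\<lambda>_. 1) \<notin> J'" "J \<subseteq> J'" "\<And>i. i < N \<Longrightarrow> (\<lambda>k. x i k - c i) \<in> J'" by auto
  obtain z where z: "\<And>i. i < N \<Longrightarrow> x i z = c i" using coords_ex[OF x] by blast
  have "u z = 0" if u: "u \<in> J" for u
  proof (rule ccontr)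
    assume nz: "u z \<noteq> 0"
    have uX: "u \<in> PX" using u J(1) by (auto simp: is_ideal_def)
    obtain g where g: "\<And>i. i < N \<Longrightarrow> g i \<in> polyfun (coords_prod N x x ` {..<N + N})"
      "\<And>k k'. u k - u k' = (\<Sum>i<N. g i (k, k') * (x i k - x i k'))"
      using coords_hadamard[OF uX] by blast
    have zero: "(\<lambda>_. 0) \<in> J'" using is_ideal_scale[OF c(1) _ polyfun.const[of 0]] u c(3) by fastforce
    have "(\<lambda>k. \<Sum>i<n. g i (k, z) * (x i k - c i)) \<in> J'" if "n \<le> N" for n
      using that
    proof (induction n)
      case 0 then show ?case using zero by simp
    next
      case (Suc n)
      have "(\<lambda>k. g n (k, z) * (x n k - c n)) \<in> J'"
        by (rule is_ideal_scale[OF c(1) c(4) polyfun_left[OF g(1)]]) (use Suc.prems in auto)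
      moreover have "(\<lambda>k. \<Sum>i<n. g i (k, z) * (x i k - c i)) \<in> J'" using Suc by simp
      ultimately show ?case using is_ideal_add[OF c(1)] by simp
    qed
    from this[of N] have "(\<lambda>k. u k - u z) \<in> J'" unfolding g(2) using z by simp
    from is_ideal_scale[OF c(1) this polyfun.const[of "-1"]] have "(\<lambda>k. - 1 * (u k - u z)) \<in> J'" .
    moreover have "u \<in> J'" using u c(3) by blast
    ultimately have "(\<lambda>k. u k + - 1 * (u k - u z)) \<in> J'" by (intro is_ideal_add[OF c(1)])
    then have "(\<lambda>_. u z) \<in> J'" by simp
    from is_ideal_scale[OF c(1) this polyfun.const[of "1 / u z"]] nz have "(\<lambda>_. 1) \<in> J'" by simp
    then show False using c(2) by simp
  qed
  then show ?thesis by blast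
qed

lemma fid_y: "j < N \<Longrightarrow> (\<lambda>k. y j (F k) - y j f) \<in> fid f"
proof -
  assume j: "j < N"
  have "(\<lambda>k. y j (F k) - y j f) = (\<lambda>k. \<Sum>i<N. (y i (F k) - y i f) * (if i = j then 1 else 0))"
    using j by (simp add: if_distrib[of "\<lambda>z. _ * z"] cong: if_cong)
  then show ?thesis unfolding fid_def
    by (intro CollectI exI[of _ "\<lambda>i _. if i = j then 1 else 0"]) (auto intro: polyfun.const)
qed

text \<open>If the fibre is unramified then its ideal is radical: near a fibre point \<open>z\<close>, Cramer's rule
  makes \<open>jac (k, z) * (x i k - x i z)\<close> a combination of the components of \<open>F k - f\<close>.\<close>

lemma fid_radical:
  assumes reg: "\<And>k. F k = f \<Longrightarrow> jac (k, k) \<noteq> 0" and u: "u \<in> PX" "\<And>k. F k = f \<Longrightarrow> u k = 0"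
  shows "u \<in> fid f"
proof (rule ccontr)
  assume nu: "u \<notin> fid f"
  \<comment> \<open>The colon ideal of \<open>fid f\<close> by \<open>u\<close>. It is proper
    because \<open>u\<close> is not in \<open>fid f\<close>, so it has a common zero
    \<open>z\<close>, which lies in the fibre since \<open>J\<close> contains \<open>fid f\<close>.
    But \<open>J\<close> also contains \<open>jac (k, z)\<close>, which is nonzero at
    \<open>k = z\<close>.\<close>
  define J where "J = {g \<in> PX. (\<lambda>k. g k * u k) \<in> fid f}"
  have idJ: "is_ideal J"
    unfolding is_ideal_def
  proof (intro conjI ballI)
    show "J \<subseteq> PX" by (auto simp: J_def)
    obtain a where a: "a \<in> fid f" using is_ideal_fid[of f] by (auto simp: is_ideal_def)
    have "(\<lambda>k. 0 * a k) \<in> fid f" by (rule is_ideal_scale[OF is_ideal_fid a polyfun.const])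
    then have "(\<lambda>_. 0) \<in> J" by (simp add: J_def polyfun.const)
    then show "J \<noteq> {}" by blast
    fix a assume a: "a \<in> J"
    show "(\<lambda>k. a k + b k) \<in> J" if b: "b \<in> J" for b
    proof -
      have "(\<lambda>k. a k * u k + b k * u k) \<in> fid f" using a b by (intro is_ideal_add[where f = "\<lambda>k. a k * u k" and g = "\<lambda>k. b k * u k", OF is_ideal_fid]) (auto simp: J_def)
      then show ?thesis using a b by (simp add: J_def distrib_right polyfun.add)
    qed
    show "(\<lambda>k. a k * b k) \<in> J" if b: "b \<in> PX" for b
    proof -
      have "(\<lambda>k. b k * (a k * u k)) \<in> fid f" using a b by (intro is_ideal_scale[where g = b and u = "\<lambda>k. a k * u k", OF is_ideal_fid]) (auto simp: J_def)
      moreover have "(\<lambda>k. b k * (a k * u k)) = (\<lambda>k. a k * b k * u k)" by (simp add: mult_ac)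
      ultimately show ?thesis using a b by (simp add: J_def polyfun.mult)
    qed
  qed
  have sub: "g \<in> J" if "g \<in> fid f" for g
  proof -
    have "(\<lambda>k. u k * g k) \<in> fid f" by (rule is_ideal_scale[OF is_ideal_fid that u(1)])
    moreover have "(\<lambda>k. u k * g k) = (\<lambda>k. g k * u k)" by (simp add: mult.commute)
    moreover have "g \<in> PX" using that is_ideal_fid[of f] by (auto simp: is_ideal_def)
    ultimately show ?thesis by (simp add: J_def)
  qed
  have "(\<lambda>_. 1) \<notin> J" using nu by (simp add: J_def)
  moreover have "\<exists>p. p \<noteq> 0 \<and> (\<lambda>k. poly p (x i k)) \<in> J" if i: "i < N" for i
  proof -
    obtain p h where "p \<noteq> 0" "\<forall>j<N. h j \<in> PX" "\<forall>k. poly p (x i k) = (\<Sum>j<N. (y j (F k) - y j f) * h j k)"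
      by (rule fiber_coord_poly[OF i, of f]) blast
    then have "(\<lambda>k. poly p (x i k)) \<in> fid f" unfolding fid_def by (intro CollectI exI[of _ h]) auto
    then show ?thesis using sub \<open>p \<noteq> 0\<close> by blast
  qed
  ultimately obtain z where z: "\<And>g. g \<in> J \<Longrightarrow> g z = 0" using weak_nullstellensatz[OF idJ] by blast
  have "F z = f" by (rule coords_inj[OF y]) (use z[OF sub[OF fid_y]] in auto)
  have jz: "(\<lambda>k. jac (k, z)) \<in> J"
    unfolding J_def
  proof (intro CollectI conjI)
    show "(\<lambda>k. jac (k, z)) \<in> PX" by (rule polyfun_left[OF jac_polyfun])
    obtain g where g: "\<And>i. i < N \<Longrightarrow> g i \<in> polyfun (coords_prod N x x ` {..<N + N})"
      "\<And>k k'. u k - u k' = (\<Sum>i<N. g i (k, k') * (x i k - x i k'))"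
      using coords_hadamard[OF u(1)] by blast
    define h where "h = (\<lambda>j k. \<Sum>i<N. g i (k, z) * fadj N (\<lambda>j i. G j i (k, z)) i j)"
    have "h j \<in> PX" if "j < N" for j
      unfolding h_def by (intro polyfun_sum polyfun.mult polyfun_left[OF g(1)] fadj_polyfun polyfun_left[OF G] that) auto
    moreover have "jac (k, z) * u k = (\<Sum>j<N. (y j (F k) - y j f) * h j k)" for k
    proof -
      let ?A = "fadj N (\<lambda>j i. G j i (k, z))"
      have cr: "(\<Sum>j<N. ?A i j * (y j (F k) - y j f)) = jac (k, z) * (x i k - x i z)" if i: "i < N" for i
      proof -
        have "(\<Sum>j<N. ?A i j * (y j (F k) - y j f)) = (\<Sum>j<N. \<Sum>l<N. ?A i j * G j l (k, z) * (x l k - x l z))"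
          by (intro sum.cong refl) (simp add: hadamard \<open>F z = f\<close>[symmetric] sum_distrib_left mult.assoc)
        also have "\<dots> = (\<Sum>l<N. (\<Sum>j<N. ?A i j * G j l (k, z)) * (x l k - x l z))"
          by (subst sum.swap) (simp add: sum_distrib_right)
        also have "\<dots> = (\<Sum>l<N. (if i = l then jac (k, z) else 0) * (x l k - x l z))"
          unfolding jac_def by (intro sum.cong refl arg_cong2[of _ _ _ _ "(*)"] fadj_mult i) simp
        finally show ?thesis using i by (simp add: if_distrib[of "\<lambda>z. z * _"] cong: if_cong)
      qed
      have "jac (k, z) * u k = (\<Sum>i<N. g i (k, z) * (jac (k, z) * (x i k - x i z)))"
        using g(2)[of k z] u(2)[OF \<open>F z = f\<close>] by (simp add: sum_distrib_left mult_ac)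
      also have "\<dots> = (\<Sum>i<N. \<Sum>j<N. g i (k, z) * (?A i j * (y j (F k) - y j f)))"
        by (intro sum.cong refl) (simp add: cr[symmetric] sum_distrib_left)
      also have "\<dots> = (\<Sum>j<N. (y j (F k) - y j f) * h j k)"
        unfolding h_def by (subst sum.swap) (simp add: sum_distrib_left mult_ac)
      finally show ?thesis .
    qed
    ultimately show "(\<lambda>k. jac (k, z) * u k) \<in> fid f" unfolding fid_def by blast
  qed
  show False using z[OF jz] reg[OF \<open>F z = f\<close>] by simp
qed

end

section \<open>Counting the points of an unramified fibre\<close>

context graded_map
begin

lemma interpolation:
  assumes "finite Z"
  obtains U where "\<And>z. U z \<in> PX" "\<And>z z'. z \<in> Z \<Longrightarrow> z' \<in> Z \<Longrightarrow> U z z' = (if z = z' then 1 else 0)"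
proof -
  have "\<exists>i. z \<noteq> z' \<longrightarrow> i < N \<and> x i z \<noteq> x i z'" for z z'
    using coords_inj[OF x, of z z'] by blast
  then obtain i where i: "\<And>z z'. z \<noteq> z' \<Longrightarrow> i z z' < N" "\<And>z z'. z \<noteq> z' \<Longrightarrow> x (i z z') z \<noteq> x (i z z') z'" by metis
  define U where "U = (\<lambda>z k. \<Prod>z'\<in>Z - {z}. (1 / (x (i z z') z - x (i z z') z')) * (x (i z z') k - x (i z z') z'))"
  show ?thesis
  proof (rule that[of U])
    show "U z \<in> PX" for z
      unfolding U_def by (intro polyfun_prod polyfun_scale polyfun_diff polyfun_x polyfun.const i(1)) auto
    fix z z' assume z: "z \<in> Z" "z' \<in> Z"
    show "U z z' = (if z = z' then 1 else 0)"
    proof (cases "z = z'")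
      case True
      have "U z z = 1" unfolding U_def by (rule prod.neutral) (use i(2) in auto)
      then show ?thesis using True by simp
    next
      case False
      have "U z z' = 0" unfolding U_def by (rule prod_zero) (use assms False z in auto)
      then show ?thesis using False by simp
    qed
  qed
qed

lemma mon_F: "mon N (\<lambda>j k. y j (F k)) \<beta> k = mon N y \<beta> (F k)"
  by (simp add: mon_def)

text \<open>The products of \<open>mon N y \<beta> (F k)\<close> and \<open>U z k\<close>, with
  \<open>z\<close> in the fibre and \<open>\<beta>\<close> of weight at most \<open>t\<close>, are
  linearly independent. In a relation with coefficients \<open>A z (F k)\<close>, every
  \<open>\<phi>\<close> near \<open>f\<close> has a preimage near each \<open>z\<close>, where the
  \<open>U z\<close> are almost a Kronecker delta; this forces all \<open>A z\<close> to vanish near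
  \<open>f\<close>, hence identically.\<close>

lemma count_upper:
  assumes reg: "\<And>k. F k = f \<Longrightarrow> jac (k, k) \<noteq> 0"
  shows "\<exists>e. \<forall>t. card {k. F k = f} * card (wset N d t) \<le> card (wset N w (t + e))"
proof -
  define Z where "Z = {k. F k = f}"
  have finZ: "finite Z" unfolding Z_def by (rule finite_fiber)
  obtain U where U: "\<And>z. U z \<in> PX" "\<And>z z'. z \<in> Z \<Longrightarrow> z' \<in> Z \<Longrightarrow> U z z' = (if z = z' then 1 else 0)"
    using interpolation[OF finZ] by blast
  have "\<forall>z. \<exists>t. U z \<in> fs.span (mon N x ` wset N w t)" by (intro allI polyfun_span_mon U(1))
  from choice[OF this] obtain tz where tz: "\<forall>z. U z \<in> fs.span (mon N x ` wset N w (tz z))" ..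
  define e where "e = (\<Sum>z\<in>Z. tz z)"
  have e: "U z \<in> fs.span (mon N x ` wset N w e)" if "z \<in> Z" for z
    by (rule span_mon_mono[OF _ tz[rule_format]]) (use that finZ in \<open>auto simp: e_def intro: member_le_sum\<close>)
  have "card Z * card (wset N d t) \<le> card (wset N w (t + e))" for t
  proof (rule ccontr)
    assume "\<not> ?thesis"
    then have lt: "card (wset N w (t + e)) < card (Z \<times> wset N d t)" by (simp add: card_cartesian_product)
    define E where "E = Z \<times> wset N d t"
    have finE: "finite E" unfolding E_def using finZ finite_wset[OF d] by simp
    define g where "g = (\<lambda>(z, \<beta>) k. mon N (\<lambda>j k. y j (F k)) \<beta> k * U z k)"
    have g: "g p \<in> fs.span (mon N x ` wset N w (t + e))" if p: "p \<in> E" for p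
    proof -
      obtain z \<beta> where zb: "p = (z, \<beta>)" "z \<in> Z" "\<beta> \<in> wset N d t" using p by (auto simp: E_def)
      have "mon N (\<lambda>j k. y j (F k)) \<beta> \<in> fs.span (mon N x ` wset N w (\<Sum>j<N. d j * \<beta> j))"
        by (rule span_mon_of_span[OF F])
      then have "mon N (\<lambda>j k. y j (F k)) \<beta> \<in> fs.span (mon N x ` wset N w t)"
        by (rule span_mon_mono[rotated]) (use zb(3) in \<open>simp add: wset_def\<close>)
      from span_mon_mult[OF this e[OF zb(2)]] show ?thesis by (simp add: g_def zb(1))
    qed
    have "card (mon N x ` wset N w (t + e)) < card E"
    proof -
      have "finite (wset N w (t + e))" by (rule finite_wset[OF w])
      from card_image_le[OF this, of "mon N x"] lt show ?thesis by (simp add: E_def)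
    qed
    from family_dependent[where y = g, OF finE _ g this] finite_wset[OF w]
    obtain c where c: "\<exists>p\<in>E. c p \<noteq> 0" "\<And>k. (\<Sum>p\<in>E. c p * g p k) = 0" by auto
    define A where "A = (\<lambda>z \<phi>. \<Sum>\<beta>\<in>wset N d t. c (z, \<beta>) * mon N y \<beta> \<phi>)"
    have AY: "A z \<in> PY" for z unfolding A_def by (intro polyfun_sum polyfun_scale mon_polyfun)
    have sumA: "(\<Sum>z\<in>Z. A z (F k) * U z k) = 0" for k
    proof -
      have "(\<Sum>z\<in>Z. A z (F k) * U z k) = (\<Sum>z\<in>Z. \<Sum>\<beta>\<in>wset N d t. c (z, \<beta>) * g (z, \<beta>) k)"
        unfolding A_def g_def by (simp add: sum_distrib_right mon_F mult.assoc)
      also have "\<dots> = (\<Sum>p\<in>E. c p * g p k)" unfolding E_def by (simp add: sum.cartesian_product split_def)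
      finally show ?thesis using c(2) by simp
    qed
    \<comment> \<open>Small enough that \<open>card Z * \<delta> \<le> 1 / 2\<close>: the
      coefficient of largest norm is then bounded by half of itself.\<close>
    define \<delta> where "\<delta> = 1 / (2 * (real (card Z) + 1))"
    have \<delta>: "\<delta> > 0" "(real (card Z) + 1) * \<delta> = 1 / 2" by (auto simp: \<delta>_def field_simps)
    define S where "S = (\<lambda>z. \<Inter>z'\<in>Z. {k. norm (U z' k - (if z' = z then 1 else 0)) < \<delta>})"
    have oS: "open (S z)" for z
      unfolding S_def
      by (intro open_INT finZ ballI open_Collect_less continuous_intros polyfun_coords_continuous[OF x U(1)])
    have zS: "z \<in> S z" if "z \<in> Z" for z using U(2)[OF _ that] \<delta>(1) by (auto simp: S_def)
    have "\<exists>W. open W \<and> f \<in> W \<and> W \<subseteq> F ` S z" if z: "z \<in> Z" for z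
    proof -
      have Fz: "F z = f" using z by (simp add: Z_def)
      obtain V where V: "open V" "z \<in> V" "\<And>S. open S \<Longrightarrow> S \<subseteq> V \<Longrightarrow> open (F ` S)"
        using F_local_homeo[OF reg[OF Fz]] by blast
      show ?thesis
        by (rule exI[of _ "F ` (S z \<inter> V)"]) (use V(1,2) V(3)[of "S z \<inter> V"] oS[of z] zS[OF z] Fz in auto)
    qed
    then have "\<forall>z. \<exists>W. z \<in> Z \<longrightarrow> open W \<and> f \<in> W \<and> W \<subseteq> F ` S z" by blast
    from choice[OF this] obtain W where W: "\<forall>z. z \<in> Z \<longrightarrow> open (W z) \<and> f \<in> W z \<and> W z \<subseteq> F ` S z" ..
    have oW: "open (\<Inter>z\<in>Z. W z)" using W finZ by (intro open_INT) auto
    have fW: "f \<in> (\<Inter>z\<in>Z. W z)" using W by auto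
    have zero: "A z \<phi> = 0" if z: "z \<in> Z" and \<phi>: "\<phi> \<in> (\<Inter>z\<in>Z. W z)" for z \<phi>
    proof -
      have ne: "finite ((\<lambda>z. norm (A z \<phi>)) ` Z)" "(\<lambda>z. norm (A z \<phi>)) ` Z \<noteq> {}" using finZ z by auto
      obtain z0 where z0: "z0 \<in> Z" "norm (A z0 \<phi>) = Max ((\<lambda>z. norm (A z \<phi>)) ` Z)" using Max_in[OF ne] by force
      have le: "norm (A z' \<phi>) \<le> norm (A z0 \<phi>)" if "z' \<in> Z" for z' unfolding z0(2) by (rule Max_ge[OF ne(1)]) (use that in auto)
      obtain k where k: "k \<in> S z0" "F k = \<phi>" using W z0(1) \<phi> by blast
      have Uk: "norm (U z' k - (if z' = z0 then 1 else 0)) < \<delta>" if "z' \<in> Z" for z' using k(1) that by (auto simp: S_def)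
      have "A z0 \<phi> = (\<Sum>z'\<in>Z. A z' \<phi> * (if z' = z0 then 1 else 0)) - (\<Sum>z'\<in>Z. A z' \<phi> * U z' k)"
        using sumA[of k] k(2) z0(1) finZ by (simp add: if_distrib[of "\<lambda>z. _ * z"] cong: if_cong)
      from arg_cong[OF this, of norm] have "norm (A z0 \<phi>) =
          norm ((\<Sum>z'\<in>Z. A z' \<phi> * (if z' = z0 then 1 else 0)) - (\<Sum>z'\<in>Z. A z' \<phi> * U z' k))" .
      also have "\<dots>
          = norm (\<Sum>z'\<in>Z. A z' \<phi> * ((if z' = z0 then 1 else 0) - U z' k))"
        by (simp only: sum_subtractf[symmetric] right_diff_distrib)
      also have "\<dots> \<le> (\<Sum>z'\<in>Z. norm (A z0 \<phi>) * \<delta>)"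
      proof (rule order_trans[OF norm_sum], rule sum_mono)
        fix z' assume z': "z' \<in> Z"
        show "norm (A z' \<phi> * ((if z' = z0 then 1 else 0) - U z' k)) \<le> norm (A z0 \<phi>) * \<delta>"
          unfolding norm_mult by (rule mult_mono[OF le[OF z']]) (use Uk[OF z'] in \<open>auto simp: norm_minus_commute\<close>)
      qed
      also have "\<dots> = norm (A z0 \<phi>) * (real (card Z) * \<delta>)" by simp
      also have "\<dots> \<le> norm (A z0 \<phi>) * (1 / 2)"
        by (rule mult_left_mono) (use \<delta> in \<open>simp_all add: distrib_right\<close>)
      finally have "norm (A z0 \<phi>) = 0" by simp
      with le[OF z] show ?thesis by simp
    qed
    have A0: "A z \<phi> = 0" if z: "z \<in> Z" for z \<phi>
    proof (rule ccontr)
      assume "A z \<phi> \<noteq> 0"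
      from polyfun_nonzero_dense[OF y AY this oW fW] zero[OF z] show False by blast
    qed
    obtain z \<beta> where zb: "z \<in> Z" "\<beta> \<in> wset N d t" "c (z, \<beta>) \<noteq> 0" using c(1) by (auto simp: E_def)
    have "c (z, \<beta>) = 0"
      by (rule mon_independent[OF y finite_wset[OF d] _ _ zb(2), where c = "\<lambda>\<beta>. c (z, \<beta>)"])
        (use A0[OF zb(1)] in \<open>auto simp: A_def wset_def\<close>)
    with zb(3) show False by simp
  qed
  then show ?thesis unfolding Z_def by blast
qed

text \<open>Nakayama's lemma made explicit. By radicality each \<open>v a\<close> differs from its
  interpolant on the fibre by a combination of the \<open>v b\<close> whose coefficients
  \<open>C a b\<close> vanish at \<open>f\<close>. The matrix \<open>1 - C\<close> is solved by its
  adjugate, so after multiplication by its determinant \<open>D\<close>, which is \<open>1\<close>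
  at \<open>f\<close>, the interpolation functions \<open>U z\<close> generate everything.\<close>

lemma count_lower:
  assumes reg: "\<And>k. F k = f \<Longrightarrow> jac (k, k) \<noteq> 0"
  shows "\<exists>e. \<forall>t. card (wset N w t) \<le> card {k. F k = f} * card (wset N d (t + e))"
proof -
  define Z where "Z = {k. F k = f}"
  have finZ: "finite Z" unfolding Z_def by (rule finite_fiber)
  obtain U where U: "\<And>z. U z \<in> PX" "\<And>z z'. z \<in> Z \<Longrightarrow> z' \<in> Z \<Longrightarrow> U z z' = (if z = z' then 1 else 0)"
    using interpolation[OF finZ] by blast
  have "\<exists>B. a < s \<longrightarrow> (\<forall>b<s. B b \<in> PY) \<and>
     (\<forall>k. v a k - (\<Sum>z\<in>Z. v a z * U z k) = (\<Sum>b<s. B b (F k) * v b k)) \<and> (\<forall>b<s. B b f = 0)" for a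
  proof (cases "a < s")
    case True
    define u where "u = (\<lambda>k. v a k - (\<Sum>z\<in>Z. v a z * U z k))"
    have uX: "u \<in> PX" unfolding u_def by (intro polyfun_diff v True polyfun_sum polyfun_scale U)
    have "u k = 0" if "F k = f" for k
    proof -
      have k: "k \<in> Z" using that by (simp add: Z_def)
      have "(\<Sum>z\<in>Z. v a z * U z k) = (\<Sum>z\<in>Z. if z = k then v a z else 0)"
        by (intro sum.cong refl) (simp add: U(2) k)
      then show ?thesis using k finZ by (simp add: u_def)
    qed
    then have "u \<in> fid f" using fid_radical[of f u, OF reg uX] by blast
    then obtain h where h: "\<forall>j<N. h j \<in> PX" "u = (\<lambda>k. \<Sum>j<N. (y j (F k) - y j f) * h j k)" by (auto simp: fid_def)
    have "\<forall>j. \<exists>B. j < N \<longrightarrow> (\<forall>b<s. B b \<in> PY) \<and> (\<forall>k. h j k = (\<Sum>b<s. B b (F k) * v b k))"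
    proof
      fix j
      show "\<exists>B. j < N \<longrightarrow> (\<forall>b<s. B b \<in> PY) \<and> (\<forall>k. h j k = (\<Sum>b<s. B b (F k) * v b k))"
      proof (cases "j < N")
        case True
        then have "h j \<in> PX" using h(1) by simp
        then obtain B where "\<And>a. a < s \<Longrightarrow> B a \<in> PY" "\<And>k. h j k = (\<Sum>a<s. B a (F k) * v a k)"
          by (rule polyfun_rep) blast
        then show ?thesis by blast
      qed blast
    qed
    from choice[OF this] obtain B where B: "\<forall>j. j < N \<longrightarrow> (\<forall>b<s. B j b \<in> PY) \<and> (\<forall>k. h j k = (\<Sum>b<s. B j b (F k) * v b k))" ..
    define C where "C = (\<lambda>b \<phi>. \<Sum>j<N. (y j \<phi> - y j f) * B j b \<phi>)"
    have "C b \<in> PY" if "b < s" for b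
      unfolding C_def by (intro polyfun_sum polyfun.mult polyfun_diff polyfun_y polyfun.const) (use B that in auto)
    moreover have "u k = (\<Sum>b<s. C b (F k) * v b k)" for k
    proof -
      have "u k = (\<Sum>j<N. \<Sum>b<s. (y j (F k) - y j f) * B j b (F k) * v b k)"
        unfolding h(2) by (intro sum.cong refl) (simp add: B sum_distrib_left mult.assoc)
      also have "\<dots> = (\<Sum>b<s. C b (F k) * v b k)"
        unfolding C_def by (subst sum.swap) (simp add: sum_distrib_right)
      finally show ?thesis .
    qed
    moreover have "C b f = 0" for b by (simp add: C_def)
    ultimately show ?thesis unfolding u_def by (intro exI[of _ C]) auto
  qed blast
  then have "\<forall>a. \<exists>B. a < s \<longrightarrow> (\<forall>b<s. B b \<in> PY) \<and>
     (\<forall>k. v a k - (\<Sum>z\<in>Z. v a z * U z k) = (\<Sum>b<s. B b (F k) * v b k)) \<and> (\<forall>b<s. B b f = 0)" ..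
  from choice[OF this] obtain C where C: "\<forall>a. a < s \<longrightarrow> (\<forall>b<s. C a b \<in> PY) \<and>
     (\<forall>k. v a k - (\<Sum>z\<in>Z. v a z * U z k) = (\<Sum>b<s. C a b (F k) * v b k)) \<and> (\<forall>b<s. C a b f = 0)" ..
  define M where "M = (\<lambda>\<phi> a b. (if a = b then 1 else 0) - C a b \<phi>)"
  have MY: "(\<lambda>\<phi>. M \<phi> a b) \<in> PY" if "a < s" "b < s" for a b
    unfolding M_def by (intro polyfun_diff polyfun.const) (use C that in auto)
  have Mv: "(\<Sum>b<s. M (F k) a b * v b k) = (\<Sum>z\<in>Z. v a z * U z k)" if a: "a < s" for a k
  proof -
    have "(\<Sum>b<s. M (F k) a b * v b k) = v a k - (\<Sum>b<s. C a b (F k) * v b k)"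
      unfolding M_def using a by (simp add: left_diff_distrib sum_subtractf if_distrib[of "\<lambda>z. z * _"] cong: if_cong)
    also have "(\<Sum>b<s. C a b (F k) * v b k) = v a k - (\<Sum>z\<in>Z. v a z * U z k)" using C a by simp
    finally show ?thesis by simp
  qed
  define D where "D = (\<lambda>\<phi>. fdet s (M \<phi>))"
  have DY: "D \<in> PY" unfolding D_def by (intro fdet_polyfun MY)
  have "D f = fdet s (\<lambda>a b. if a = b then 1 else 0)"
    unfolding D_def by (rule fdet_cong) (use C in \<open>simp add: M_def\<close>)
  also have "\<dots> = 1" by (subst fdet_upper_triangular) auto
  finally have Df: "D f \<noteq> 0" by simp
  define A where "A = (\<lambda>a z \<phi>. \<Sum>b<s. v b z * fadj s (M \<phi>) a b)"
  have AY: "A a z \<in> PY" if "a < s" for a z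
    unfolding A_def by (intro polyfun_sum polyfun_scale fadj_polyfun MY that) auto
  have Dv: "D (F k) * v a k = (\<Sum>z\<in>Z. A a z (F k) * U z k)" if a: "a < s" for a k
  proof -
    let ?A = "fadj s (M (F k))"
    have "D (F k) * v a k = (\<Sum>c<s. (if a = c then D (F k) else 0) * v c k)"
      using a by (simp add: if_distrib[of "\<lambda>z. z * _"] cong: if_cong)
    also have "\<dots> = (\<Sum>c<s. (\<Sum>b<s. ?A a b * M (F k) b c) * v c k)"
      unfolding D_def by (intro sum.cong refl arg_cong2[of _ _ _ _ "(*)"] fadj_mult[symmetric] a) simp
    also have "\<dots> = (\<Sum>b<s. ?A a b * (\<Sum>c<s. M (F k) b c * v c k))"
      unfolding sum_distrib_left sum_distrib_right by (subst sum.swap) (simp add: mult.assoc)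
    also have "\<dots> = (\<Sum>b<s. \<Sum>z\<in>Z. ?A a b * (v b z * U z k))"
      by (intro sum.cong refl) (simp add: Mv sum_distrib_left)
    also have "\<dots> = (\<Sum>z\<in>Z. A a z (F k) * U z k)"
      unfolding A_def by (subst sum.swap) (simp add: sum_distrib_left sum_distrib_right mult_ac)
    finally show ?thesis .
  qed
  have "\<forall>az. \<exists>t. fst az < s \<longrightarrow> A (fst az) (snd az) \<in> fs.span (mon N y ` wset N d t)"
    using polyfun_span_mon[OF AY] by blast
  from choice[OF this] obtain tt where tt: "\<forall>az. fst az < s \<longrightarrow> A (fst az) (snd az) \<in> fs.span (mon N y ` wset N d (tt az))" ..
  define e where "e = (\<Sum>az\<in>{..<s} \<times> Z. tt az)"
  have Ae: "A a z \<in> fs.span (mon N y ` wset N d e)" if az: "a < s" "z \<in> Z" for a z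
  proof (rule span_mon_mono)
    show "A a z \<in> fs.span (mon N y ` wset N d (tt (a, z)))" using tt[rule_format, of "(a, z)"] az by simp
    show "tt (a, z) \<le> e" unfolding e_def by (rule member_le_sum) (use az finZ in auto)
  qed
  have "card (wset N w t) \<le> card Z * card (wset N d (t + e))" for t
  proof (rule ccontr)
    assume nle: "\<not> ?thesis"
    define g where "g = (\<lambda>(z, \<beta>) k. U z k * mon N y \<beta> (F k))"
    define T where "T = g ` (Z \<times> wset N d (t + e))"
    have finT: "finite T" unfolding T_def using finZ finite_wset[OF d] by simp
    have "card T \<le> card (Z \<times> wset N d (t + e))"
      unfolding T_def by (rule card_image_le) (use finZ finite_wset[OF d] in simp)
    then have lt: "card T < card (wset N w t)" using nle by (simp add: card_cartesian_product)
    \<comment> \<open>Multiplication by \<open>D (F k)\<close> moves every monomial of weight at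
      most \<open>t\<close> into the span of \<open>T\<close>. It is injective because
      \<open>D\<close> does not vanish on the whole image of \<open>F\<close>, so a dependence among
      the products is one among the monomials.\<close>
    define q where "q = (\<lambda>\<alpha> k. D (F k) * mon N x \<alpha> k)"
    have q: "q \<alpha> \<in> fs.span T" if al: "\<alpha> \<in> wset N w t" for \<alpha>
    proof -
      obtain B where B: "\<forall>a<s. B a \<in> fs.span (mon N y ` wset N d t)" "\<forall>k. mon N x \<alpha> k = (\<Sum>a<s. B a (F k) * v a k)"
        using gen[OF al] by blast
      have eq: "q \<alpha> = (\<lambda>k. \<Sum>a<s. \<Sum>z\<in>Z. U z k * (B a (F k) * A a z (F k)))"
      proof
        fix k
        have "q \<alpha> k = (\<Sum>a<s. B a (F k) * (D (F k) * v a k))"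
          unfolding q_def using B(2) by (simp add: sum_distrib_left mult_ac)
        also have "\<dots> = (\<Sum>a<s. \<Sum>z\<in>Z. U z k * (B a (F k) * A a z (F k)))"
          by (intro sum.cong refl) (simp add: Dv sum_distrib_left mult_ac)
        finally show "q \<alpha> k = (\<Sum>a<s. \<Sum>z\<in>Z. U z k * (B a (F k) * A a z (F k)))" .
      qed
      show ?thesis
        unfolding eq
      proof (intro span_sum_fun)
        fix a z assume a: "a \<in> {..<s}" and z: "z \<in> Z"
        have "(\<lambda>\<phi>. B a \<phi> * A a z \<phi>) \<in> fs.span (mon N y ` wset N d (t + e))"
          by (rule span_mon_mult) (use B(1) Ae a z in auto)
        from span_compose[OF this, of F]
        have 1: "(\<lambda>k. B a (F k) * A a z (F k)) \<in> fs.span ((\<lambda>b k. b (F k)) ` mon N y ` wset N d (t + e))" .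
        show "(\<lambda>k. U z k * (B a (F k) * A a z (F k))) \<in> fs.span T"
        proof (rule span_mult[OF fs.span_base[of "U z" "{U z}"] 1])
          fix a' b' assume "a' \<in> {U z}" "b' \<in> (\<lambda>b k. b (F k)) ` mon N y ` wset N d (t + e)"
          then obtain \<beta> where "\<beta> \<in> wset N d (t + e)" "a' = U z" "b' = (\<lambda>k. mon N y \<beta> (F k))" by auto
          then have "(\<lambda>k. a' k * b' k) = g (z, \<beta>)" "(z, \<beta>) \<in> Z \<times> wset N d (t + e)" using z by (auto simp: g_def)
          then show "(\<lambda>k. a' k * b' k) \<in> fs.span T" unfolding T_def by (intro fs.span_base) (metis imageI)
        qed simp
      qed
    qed
    from family_dependent[where y = q, OF finite_wset[OF w] finT q lt]
    obtain c where c: "\<exists>\<alpha>\<in>wset N w t. c \<alpha> \<noteq> 0" "\<And>k. (\<Sum>\<alpha>\<in>wset N w t. c \<alpha> * q \<alpha> k) = 0" by auto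
    define r where "r = (\<lambda>k. \<Sum>\<alpha>\<in>wset N w t. c \<alpha> * mon N x \<alpha> k)"
    have rX: "r \<in> PX" unfolding r_def by (intro polyfun_sum polyfun_scale mon_polyfun)
    have Dr: "D (F k) * r k = 0" for k
      using c(2)[of k] by (simp add: q_def r_def sum_distrib_left mult_ac)
    obtain k0 where "jac (k0, k0) \<noteq> 0" using jac_nonzero by blast
    then obtain V where V: "open V" "k0 \<in> V" "\<And>S. open S \<Longrightarrow> S \<subseteq> V \<Longrightarrow> open (F ` S)" using F_local_homeo by blast
    have "\<exists>\<phi>\<in>F ` V. D \<phi> \<noteq> 0"
      by (rule polyfun_nonzero_dense[OF y DY Df V(3)[OF V(1)], of "F k0"]) (use V(2) in auto)
    then obtain k1 where k1: "D (F k1) \<noteq> 0" by auto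
    have r0: "r k = 0" for k
    proof (rule ccontr)
      assume "r k \<noteq> 0"
      from polyfun_mult_nonzero[OF x polyfun_comp_F[OF DY] rX, OF k1 this] Dr show False by auto
    qed
    obtain \<alpha> where al: "\<alpha> \<in> wset N w t" "c \<alpha> \<noteq> 0" using c(1) by blast
    have "c \<alpha> = 0"
      by (rule mon_independent[OF x finite_wset[OF w] _ _ al(1), where c = c]) (use r0 in \<open>auto simp: r_def wset_def\<close>)
    with al(2) show False by simp
  qed
  then show ?thesis unfolding Z_def by blast
qed

theorem fiber_card:
  assumes "\<And>k. F k = f \<Longrightarrow> jac (k, k) \<noteq> 0"
  shows "card {k. F k = f} * (\<Prod>i<N. w i) = (\<Prod>i<N. d i)"
proof -
  obtain e where "\<And>t. card {k. F k = f} * card (wset N d t) \<le> card (wset N w (t + e))" using count_upper[OF assms] by blast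
  moreover obtain e' where "\<And>t. card (wset N w t) \<le> card {k. F k = f} * card (wset N d (t + e'))" using count_lower[OF assms] by blast
  ultimately show ?thesis using weighted_count_eq[of N w d, OF w d] by blast
qed

end

section \<open>Families of polynomial maps\<close>

lemma finite_disjoint_balls:
  fixes Z :: "'a::metric_space set"
  assumes "finite Z" "closed T" "Z \<inter> T = {}"
  obtains r where "r > 0" "\<And>z z'. z \<in> Z \<Longrightarrow> z' \<in> Z \<Longrightarrow> z \<noteq> z' \<Longrightarrow> cball z r \<inter> cball z' r = {}"
    "\<And>z. z \<in> Z \<Longrightarrow> cball z r \<inter> T = {}"
proof -
  have "\<exists>r>0. \<forall>z'\<in>Z. z' \<noteq> z \<longrightarrow> r < dist z z'" for z
  proof -
    obtain d where "d > 0" "\<forall>x\<in>Z. x \<noteq> z \<longrightarrow> d \<le> dist z x" using finite_set_avoid[OF assms(1), of z] by blast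
    then show ?thesis by (intro exI[of _ "d / 2"]) force
  qed
  then obtain d where d: "\<And>z. d z > 0" "\<And>z z'. z' \<in> Z \<Longrightarrow> z' \<noteq> z \<Longrightarrow> d z < dist z z'" by metis
  have "\<exists>e>0. ball z e \<inter> T = {}" if z: "z \<in> Z" for z
  proof -
    have "z \<in> - T" using z assms(3) by auto
    then obtain e where "e > 0" "ball z e \<subseteq> - T" using assms(2) openE[of "- T" z] by (auto simp: open_Compl)
    then show ?thesis by blast
  qed
  then obtain e where e: "\<And>z. z \<in> Z \<Longrightarrow> e z > 0" "\<And>z. z \<in> Z \<Longrightarrow> ball z (e z) \<inter> T = {}" by metis
  define r where "r = Min (insert 1 ((\<lambda>z. min (d z) (e z)) ` Z)) / 3"
  have fin: "finite (insert 1 ((\<lambda>z. min (d z) (e z)) ` Z))" using assms(1) by simp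
  have r0: "r > 0" unfolding r_def using fin d(1) e(1) by (simp add: Min_gr_iff)
  have r1: "3 * r \<le> d z" "3 * r \<le> e z" if "z \<in> Z" for z
  proof -
    have "Min (insert 1 ((\<lambda>z. min (d z) (e z)) ` Z)) \<le> min (d z) (e z)"
      by (rule Min_le[OF fin]) (use that in blast)
    then show "3 * r \<le> d z" "3 * r \<le> e z" by (simp_all add: r_def)
  qed
  show ?thesis
  proof (rule that[OF r0])
    fix z z' assume z: "z \<in> Z" "z' \<in> Z" "z \<noteq> z'"
    show "cball z r \<inter> cball z' r = {}"
    proof (rule ccontr)
      assume "cball z r \<inter> cball z' r \<noteq> {}"
      then obtain p where "dist z p \<le> r" "dist z' p \<le> r" by auto
      then have "dist z z' \<le> 2 * r" using dist_triangle2[of z z' p] by linarith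
      moreover have "d z < dist z z'" using z(3) by (intro d(2) z(2)) simp
      ultimately show False using r1(1)[OF z(1)] r0 by simp
    qed
  next
    fix z assume z: "z \<in> Z"
    have "cball z r \<subseteq> ball z (e z)" using r1(2)[OF z] r0 by auto
    then show "cball z r \<inter> T = {}" using e(2)[OF z] by blast
  qed
qed

locale polynomial_family =
  fixes M N :: nat and xs :: "nat \<Rightarrow> 's::euclidean_space \<Rightarrow> complex" and x :: "nat \<Rightarrow> 'k::euclidean_space \<Rightarrow> complex"
    and y :: "nat \<Rightarrow> 'f::euclidean_space \<Rightarrow> complex" and F :: "'s \<Rightarrow> 'k \<Rightarrow> 'f"
  assumes xs: "coords M xs" and x: "coords N x" and y: "coords N y" and dim: "DIM('f) = DIM('k)"
    and F: "\<And>j. j < N \<Longrightarrow> (\<lambda>p. y j (F (fst p) (snd p))) \<in> polyfun (coords_prod M xs x ` {..<M + N})"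
begin

abbreviation "X \<equiv> coords_prod M xs x"
abbreviation "Y \<equiv> coords_prod M xs y"
abbreviation "XX \<equiv> coords_prod (M + N) X X"

lemma cX: "coords (M + N) X" by (rule coords_prod[OF xs x])
lemma cY: "coords (M + N) Y" by (rule coords_prod[OF xs y])
lemma cXX: "coords (M + N + (M + N)) XX" by (rule coords_prod[OF cX cX])

text \<open>Carrying the parameter \<open>s\<close> along gives a map between spaces of equal
  dimension, so invariance of domain yields openness jointly in \<open>s\<close> and
  \<open>f\<close>.\<close>

definition \<pi> :: "'s \<times> 'k \<Rightarrow> 's \<times> 'f" where "\<pi> p = (fst p, F (fst p) (snd p))"

lemma \<pi>_simp [simp]: "\<pi> (s, k) = (s, F s k)" by (simp add: \<pi>_def)

lemma Y_\<pi>_polyfun: "j < M + N \<Longrightarrow> (\<lambda>p. Y j (\<pi> p)) \<in> polyfun (X ` {..<M + N})"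
proof (cases "j < M")
  case True
  then have "(\<lambda>p. Y j (\<pi> p)) = X j" by (simp add: coords_prod_def \<pi>_def fun_eq_iff)
  then show ?thesis using True by (auto intro!: polyfun.base)
next
  case False
  assume "j < M + N"
  then have "j - M < N" using False by simp
  from F[OF this] False show ?thesis by (simp add: coords_prod_def \<pi>_def)
qed

lemma continuous_\<pi>: "continuous_on A \<pi>"
  by (rule coords_continuous_into[OF cY]) (rule polyfun_coords_continuous[OF cX Y_\<pi>_polyfun])

lemma hadamard_ex:
  "\<exists>G. \<forall>j<N. (\<forall>i<N. G j i \<in> polyfun (XX ` {..<M + N + (M + N)})) \<and>
    (\<forall>s k k'. y j (F s k) - y j (F s k') = (\<Sum>i<N. G j i ((s, k), (s, k')) * (x i k - x i k')))"
proof -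
  have img: "X ` {..<M + N} = (\<lambda>c v. c (fst v)) ` xs ` {..<M} \<union> (\<lambda>i v. x i (snd v)) ` {..<N}"
    unfolding coords_prod_image by (simp add: image_image)
  have "\<exists>g. j < N \<longrightarrow> (\<forall>i<N. g i \<in> polyfun (XX ` {..<M + N + (M + N)})) \<and>
    (\<forall>s k k'. y j (F s k) - y j (F s k') = (\<Sum>i<N. g i ((s, k), (s, k')) * (x i k - x i k')))" for j
  proof (cases "j < N")
    case True
    from polyfun_hadamard[OF F[OF True, unfolded img]] obtain g where g:
      "\<And>i. i < N \<Longrightarrow> g i \<in> polyfun ((\<lambda>c uv. c (fst uv)) ` X ` {..<M + N} \<union> (\<lambda>c uv. c (snd uv)) ` X ` {..<M + N})"
      "\<And>u v. (\<forall>c\<in>(\<lambda>c v. c (fst v)) ` xs ` {..<M}. c u = c v) \<Longrightarrow>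
        y j (F (fst u) (snd u)) - y j (F (fst v) (snd v)) = (\<Sum>i<N. g i (u, v) * (x i (snd u) - x i (snd v)))"
      unfolding img by blast
    have "y j (F s k) - y j (F s k') = (\<Sum>i<N. g i ((s, k), (s, k')) * (x i k - x i k'))" for s k k'
      using g(2)[of "(s, k)" "(s, k')"] by auto
    then show ?thesis using g(1) unfolding coords_prod_image[symmetric] by blast
  qed blast
  then have "\<forall>j. \<exists>g. j < N \<longrightarrow> (\<forall>i<N. g i \<in> polyfun (XX ` {..<M + N + (M + N)})) \<and>
    (\<forall>s k k'. y j (F s k) - y j (F s k') = (\<Sum>i<N. g i ((s, k), (s, k')) * (x i k - x i k')))" ..
  from choice[OF this] show ?thesis by blast
qed

definition G :: "nat \<Rightarrow> nat \<Rightarrow> ('s \<times> 'k) \<times> ('s \<times> 'k) \<Rightarrow> complex" where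
  "G = (SOME G. \<forall>j<N. (\<forall>i<N. G j i \<in> polyfun (XX ` {..<M + N + (M + N)})) \<and>
    (\<forall>s k k'. y j (F s k) - y j (F s k') = (\<Sum>i<N. G j i ((s, k), (s, k')) * (x i k - x i k'))))"

lemma G_polyfun: "i < N \<Longrightarrow> j < N \<Longrightarrow> G j i \<in> polyfun (XX ` {..<M + N + (M + N)})"
  and G_hadamard: "j < N \<Longrightarrow> y j (F s k) - y j (F s k') = (\<Sum>i<N. G j i ((s, k), (s, k')) * (x i k - x i k'))"
  using someI_ex[OF hadamard_ex, folded G_def] by blast+

definition J :: "('s \<times> 'k) \<times> ('s \<times> 'k) \<Rightarrow> complex" where "J uv = fdet N (\<lambda>j i. G j i uv)"

definition simple :: "'s \<Rightarrow> 'k \<Rightarrow> bool" where "simple s k \<longleftrightarrow> J ((s, k), (s, k)) \<noteq> 0"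

definition fiber :: "'s \<Rightarrow> 'f \<Rightarrow> 'k set" where "fiber s f = {k. F s k = f}"

lemma J_polyfun: "J \<in> polyfun (XX ` {..<M + N + (M + N)})"
  unfolding J_def by (intro fdet_polyfun G_polyfun)

lemma J_inj:
  assumes "J (u, v) \<noteq> 0" "\<pi> u = \<pi> v"
  shows "u = v"
proof -
  obtain s k k' where uv: "u = (s, k)" "v = (s, k')" "F s k = F s k'"
    using assms(2) by (cases u, cases v) auto
  have "k = k'"
  proof (rule coords_inj[OF x])
    fix i assume i: "i < N"
    have "x i k - x i k' = 0"
      by (rule fdet_kernel_zero[OF assms(1)[unfolded J_def] _ i, where v = "\<lambda>i. x i k - x i k'"])
        (use G_hadamard[of _ s k k'] uv in auto)
    then show "x i k = x i k'" by simp
  qed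
  then show ?thesis by (simp add: uv)
qed

lemma \<pi>_local_homeo:
  assumes "simple s k"
  obtains U where "open U" "(s, k) \<in> U" "inj_on \<pi> U" "\<And>S. open S \<Longrightarrow> S \<subseteq> U \<Longrightarrow> open (\<pi> ` S)"
proof (rule local_homeomorphism[of \<pi> J "(s, k)"])
  show "continuous_on UNIV \<pi>" by (rule continuous_\<pi>)
  show "DIM('s \<times> 'f) \<le> DIM('s \<times> 'k)" using dim by simp
  show "continuous_on UNIV J" by (rule polyfun_coords_continuous[OF cXX J_polyfun])
  show "J ((s, k), (s, k)) \<noteq> 0" using assms by (simp add: simple_def)
qed (use J_inj that in blast)+

text \<open>Simplicity is asked only of the fibre itself; the bound is uniform over a neighbourhood
  of \<open>(s, f)\<close>, so that solutions over neighbouring pairs cannot escape to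
  infinity.\<close>

definition good :: "'s \<Rightarrow> 'f \<Rightarrow> bool" where
  "good s f \<longleftrightarrow> (\<forall>k\<in>fiber s f. simple s k) \<and>
    (\<exists>W b. open W \<and> (s, f) \<in> W \<and> (\<forall>p\<in>W. \<forall>k\<in>fiber (fst p) (snd p). norm k \<le> b))"

lemma continuous_F: "continuous_on A (\<lambda>k. F s k)"
proof -
  have "continuous_on A (\<lambda>k. snd (\<pi> (s, k)))"
    by (intro continuous_intros continuous_on_compose2[OF continuous_\<pi>[of UNIV]]) auto
  then show ?thesis by simp
qed

lemma closed_fiber: "closed (fiber s f)"
  unfolding fiber_def using continuous_closed_vimage[of "{f}" "F s"] continuous_F[of UNIV s]
  by (auto simp: vimage_def continuous_on_eq_continuous_at)

lemma good_finite:
  assumes "good s f"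
  shows "finite (fiber s f)"
proof (rule finite_not_islimpt_in_compact[of "fiber s f" "fiber s f", simplified])
  obtain W b where "(s, f) \<in> W" "\<forall>p\<in>W. \<forall>k\<in>fiber (fst p) (snd p). norm k \<le> b" using assms by (auto simp: good_def)
  then have "\<forall>k\<in>fiber s f. norm k \<le> b" by fastforce
  then have "bounded (fiber s f)" unfolding bounded_iff by blast
  then show "compact (fiber s f)" using closed_fiber by (simp add: compact_eq_bounded_closed)
  fix z assume z: "z \<in> fiber s f"
  then obtain U where U: "open U" "(s, z) \<in> U" "inj_on \<pi> U" using assms \<pi>_local_homeo by (metis good_def)
  obtain A B where AB: "open A" "open B" "(s, z) \<in> A \<times> B" "A \<times> B \<subseteq> U" using open_prod_elim[OF U(1,2)] by metis
  have "k = z" if "k \<in> fiber s f" "k \<in> B" for k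
  proof -
    have "\<pi> (s, k) = \<pi> (s, z)" using that(1) z by (simp add: fiber_def)
    then show ?thesis using U(3) AB that(2) by (auto dest: inj_onD[of \<pi> U "(s, k)" "(s, z)"])
  qed
  then show "\<not> z islimpt fiber s f" using AB(2,3) unfolding islimpt_def by blast
qed

text \<open>Each fibre point has a neighbourhood \<open>V z\<close> on which \<open>\<pi>\<close> is
  injective with open image. Any other solution nearby would lie, by boundedness, in the compact set
  \<open>Kc\<close>, whose image is closed and misses \<open>(s0, f0)\<close>; away from that image
  each \<open>V z\<close> contains exactly one solution and nothing else does.\<close>

lemma good_locally_constant:
  assumes good: "good s0 f0"
  obtains W where "open W" "(s0, f0) \<in> W"
    "\<And>s f. (s, f) \<in> W \<Longrightarrow> finite (fiber s f) \<and> card (fiber s f) = card (fiber s0 f0)"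
proof -
  define Z where "Z = fiber s0 f0"
  have finZ: "finite Z" unfolding Z_def by (rule good_finite[OF good])
  obtain Wb b where Wb: "open Wb" "(s0, f0) \<in> Wb" "\<forall>p\<in>Wb. \<forall>k\<in>fiber (fst p) (snd p). norm k \<le> b"
    using good by (auto simp: good_def)
  obtain r where r: "r > 0" "\<And>z z'. z \<in> Z \<Longrightarrow> z' \<in> Z \<Longrightarrow> z \<noteq> z' \<Longrightarrow> cball z r \<inter> cball z' r = {}"
    using finite_disjoint_balls[OF finZ closed_empty] by auto
  have "\<exists>V. z \<in> Z \<longrightarrow> open V \<and> (s0, z) \<in> V \<and> inj_on \<pi> V \<and> open (\<pi> ` V) \<and> V \<subseteq> UNIV \<times> ball z r" for z
  proof (cases "z \<in> Z")
    case True
    then have "simple s0 z" using good by (simp add: good_def Z_def)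
    then obtain U where U: "open U" "(s0, z) \<in> U" "inj_on \<pi> U" "\<And>S. open S \<Longrightarrow> S \<subseteq> U \<Longrightarrow> open (\<pi> ` S)"
      by (rule \<pi>_local_homeo) blast
    have o: "open (U \<inter> UNIV \<times> ball z r)" using U(1) by (intro open_Int open_Times) auto
    show ?thesis
      by (rule exI[of _ "U \<inter> UNIV \<times> ball z r"]) (use U o r(1) inj_on_subset[OF U(3)] in auto)
  qed blast
  then have "\<forall>z. \<exists>V. z \<in> Z \<longrightarrow> open V \<and> (s0, z) \<in> V \<and> inj_on \<pi> V \<and> open (\<pi> ` V) \<and> V \<subseteq> UNIV \<times> ball z r" ..
  from choice[OF this] obtain V where V: "\<forall>z. z \<in> Z \<longrightarrow> open (V z) \<and> (s0, z) \<in> V z \<and> inj_on \<pi> (V z) \<and> open (\<pi> ` V z) \<and> V z \<subseteq> UNIV \<times> ball z r" ..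
  define Kc where "Kc = (cball s0 1 \<times> cball 0 b) - (\<Union>z\<in>Z. V z)"
  have "compact Kc" unfolding Kc_def using V by (intro compact_diff compact_Times) auto
  then have "closed (\<pi> ` Kc)" by (intro compact_imp_closed compact_continuous_image continuous_\<pi>)
  have notin: "(s0, f0) \<notin> \<pi> ` Kc"
  proof
    assume "(s0, f0) \<in> \<pi> ` Kc"
    then obtain k where k: "(s0, k) \<in> Kc" "F s0 k = f0" by (auto simp: \<pi>_def)
    then have "k \<in> Z" by (simp add: Z_def fiber_def)
    then show False using k V by (auto simp: Kc_def)
  qed
  define W where "W = - (\<pi> ` Kc) \<inter> Wb \<inter> (ball s0 1 \<times> UNIV) \<inter> (\<Inter>z\<in>Z. \<pi> ` V z)"
  show ?thesis
  proof (rule that[of W])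
    show "open W" unfolding W_def using \<open>closed (\<pi> ` Kc)\<close> Wb(1) V finZ
      by (intro open_Int open_INT open_Times) (auto simp: open_Compl)
    have "(s0, f0) \<in> \<pi> ` V z" if z: "z \<in> Z" for z
    proof (rule image_eqI)
      show "(s0, z) \<in> V z" using V z by blast
      show "(s0, f0) = \<pi> (s0, z)" using z by (simp add: Z_def fiber_def)
    qed
    then show "(s0, f0) \<in> W" using notin Wb(2) by (auto simp: W_def)
    fix s f assume sf: "(s, f) \<in> W"
    have "\<exists>k. z \<in> Z \<longrightarrow> (s, k) \<in> V z \<and> F s k = f" for z
    proof (cases "z \<in> Z")
      case True
      then have "(s, f) \<in> \<pi> ` V z" using sf by (simp add: W_def)
      then show ?thesis by (auto simp: \<pi>_def)
    qed blast
    then have "\<forall>z. \<exists>k. z \<in> Z \<longrightarrow> (s, k) \<in> V z \<and> F s k = f" ..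
    from choice[OF this] obtain \<kappa> where \<kappa>: "\<forall>z. z \<in> Z \<longrightarrow> (s, \<kappa> z) \<in> V z \<and> F s (\<kappa> z) = f" ..
    have "bij_betw \<kappa> Z (fiber s f)"
      unfolding bij_betw_def
    proof
      show "inj_on \<kappa> Z"
      proof (rule inj_onI, rule ccontr)
        fix z z' assume z: "z \<in> Z" "z' \<in> Z" "\<kappa> z = \<kappa> z'" "z \<noteq> z'"
        have "\<kappa> z \<in> ball z r" "\<kappa> z' \<in> ball z' r" using \<kappa> V z(1,2) by (metis SigmaD2 subsetD)+
        then have "\<kappa> z \<in> cball z r \<inter> cball z' r" using z(3) by auto
        then show False using r(2)[OF z(1,2,4)] by blast
      qed
      show "\<kappa> ` Z = fiber s f"
      proof
        show "\<kappa> ` Z \<subseteq> fiber s f" using \<kappa> by (auto simp: fiber_def)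
        show "fiber s f \<subseteq> \<kappa> ` Z"
        proof
          fix k assume k: "k \<in> fiber s f"
          then have "norm k \<le> b" using Wb(3) sf by (auto simp: W_def)
          moreover have "dist s0 s < 1" using sf by (auto simp: W_def)
          moreover have "(s, k) \<notin> Kc"
          proof
            assume "(s, k) \<in> Kc"
            then have "\<pi> (s, k) \<in> \<pi> ` Kc" by (rule imageI)
            then show False using sf k by (simp add: W_def fiber_def)
          qed
          ultimately obtain z where z: "z \<in> Z" "(s, k) \<in> V z" by (auto simp: Kc_def)
          have "\<pi> (s, k) = \<pi> (s, \<kappa> z)" using k \<kappa> z(1) by (simp add: fiber_def)
          then have "(s, k) = (s, \<kappa> z)" using V z \<kappa> by (meson inj_onD)
          then show "k \<in> \<kappa> ` Z" using z(1) by auto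
        qed
      qed
    qed
    then show "finite (fiber s f) \<and> card (fiber s f) = card (fiber s0 f0)"
      using finZ bij_betw_finite bij_betw_same_card unfolding Z_def by metis
  qed
qed

lemma good_connected_constant:
  assumes "connected U" "\<And>s f. (s, f) \<in> U \<Longrightarrow> good s f" "(s, f) \<in> U" "(s', f') \<in> U"
  shows "card (fiber s f) = card (fiber s' f')"
proof -
  let ?c = "\<lambda>p. card (fiber (fst p) (snd p))"
  have "?c (s, f) = ?c (s', f')"
  proof (rule connected_local_const[OF assms(1,3,4)], rule ballI)
    fix p assume "p \<in> U"
    then have "good (fst p) (snd p)" using assms(2) by simp
    then obtain W where W: "open W" "p \<in> W" "\<And>s f. (s, f) \<in> W \<Longrightarrow> card (fiber s f) = ?c p"
      using good_locally_constant by (metis prod.collapse)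
    show "eventually (\<lambda>q. ?c p = ?c q) (at p within U)"
      unfolding eventually_at_topological by (rule exI[of _ W]) (use W(1,2) W(3)[symmetric] in \<open>auto\<close>)
  qed
  then show ?thesis by simp
qed

lemma polyfun_\<pi>: "q \<in> polyfun (Y ` {..<M + N}) \<Longrightarrow> (\<lambda>p. q (\<pi> p)) \<in> polyfun (X ` {..<M + N})"
  by (erule polyfun_compose) (auto intro: Y_\<pi>_polyfun)

lemma polyfun_\<pi>_nonzero:
  assumes "q \<in> polyfun (Y ` {..<M + N})" "q a \<noteq> 0" "simple s k"
  shows "\<exists>p. q (\<pi> p) \<noteq> 0"
proof -
  obtain U where U: "open U" "(s, k) \<in> U" "\<And>S. open S \<Longrightarrow> S \<subseteq> U \<Longrightarrow> open (\<pi> ` S)"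
    using \<pi>_local_homeo[OF assms(3)] by metis
  have "\<exists>v\<in>\<pi> ` U. q v \<noteq> 0"
    by (rule polyfun_nonzero_dense[OF cY assms(1,2) U(3)[OF U(1) subset_refl] imageI[OF U(2)]])
  then show ?thesis by blast
qed

text \<open>\<open>\<Delta>\<close> is the product of \<open>g\<close>, which excludes escape to
  infinity, and a polynomial vanishing at all critical values. It may vanish at the reference pair
  \<open>(s0, f0)\<close>; local constancy carries the number to a nearby pair off the hypersurface,
  and connectedness carries it to all others.\<close>

theorem count_polynomial:
  assumes g: "g \<in> polyfun (xs ` {..<M})"
    and bound: "\<And>s. g s \<noteq> 0 \<Longrightarrow> \<exists>W C. open W \<and> s \<in> W \<and> (\<forall>s'\<in>W. \<forall>k. norm k \<le> C * (1 + norm (F s' k)))"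
    and s0: "g s0 \<noteq> 0" "\<And>k. k \<in> fiber s0 f0 \<Longrightarrow> simple s0 k" and k0: "simple s0 k0"
  obtains \<Delta> a where "\<Delta> \<in> polyfun (Y ` {..<M + N})" "\<Delta> a \<noteq> 0"
    "\<And>s f. \<Delta> (s, f) \<noteq> 0 \<Longrightarrow> (\<forall>k\<in>fiber s f. simple s k) \<and> finite (fiber s f) \<and> card (fiber s f) = card (fiber s0 f0)"
proof -
  have good: "good s f" if gs: "g s \<noteq> 0" and si: "\<And>k. k \<in> fiber s f \<Longrightarrow> simple s k" for s f
    unfolding good_def
  proof (intro conjI ballI si)
    obtain W C where W: "open W" "s \<in> W" "\<forall>s'\<in>W. \<forall>k. norm k \<le> C * (1 + norm (F s' k))" using bound[OF gs] by blast
    show "\<exists>W b. open W \<and> (s, f) \<in> W \<and> (\<forall>p\<in>W. \<forall>k\<in>fiber (fst p) (snd p). norm k \<le> b)"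
    proof (intro exI[of _ "W \<times> ball f 1"] exI[of _ "\<bar>C\<bar> * (2 + norm f)"] conjI ballI)
      show "open (W \<times> ball f 1)" using W(1) by (intro open_Times) auto
      show "(s, f) \<in> W \<times> ball f 1" using W(2) by simp
      fix p k assume p: "p \<in> W \<times> ball f 1" and k: "k \<in> fiber (fst p) (snd p)"
      have "norm (snd p) \<le> norm f + 1"
      proof -
        have "dist f (snd p) < 1" using p by auto
        then show ?thesis using norm_triangle_sub[of "snd p" f] by (simp add: dist_norm norm_minus_commute)
      qed
      moreover have "norm k \<le> C * (1 + norm (snd p))" using W(3) p k by (auto simp: fiber_def)
      moreover have "C * (1 + norm (snd p)) \<le> \<bar>C\<bar> * (1 + norm (snd p))" by (rule mult_right_mono) auto
      moreover have "\<bar>C\<bar> * (1 + norm (snd p)) \<le> \<bar>C\<bar> * (2 + norm f)" by (rule mult_left_mono) (use calculation(1) in auto)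
      ultimately show "norm k \<le> \<bar>C\<bar> * (2 + norm f)" by linarith
    qed
  qed
  have Jd: "(\<lambda>p. J (p, p)) \<in> polyfun (X ` {..<M + N})"
  proof (rule polyfun_compose[OF J_polyfun])
    fix c assume "c \<in> XX ` {..<M + N + (M + N)}"
    then obtain i where i: "i < M + N + (M + N)" "c = XX i" by blast
    have "X i \<in> polyfun (X ` {..<M + N})" if "i < M + N" for i using that by (auto intro: polyfun.base)
    then show "(\<lambda>p. c (p, p)) \<in> polyfun (X ` {..<M + N})"
      using i unfolding coords_prod_def[of "M + N"] by (cases "i < M + N") auto
  qed
  have "J ((s0, k0), (s0, k0)) \<noteq> 0" using k0 by (simp add: simple_def)
  then obtain P b where P: "P \<in> polyfun (Y ` {..<M + N})" "P b \<noteq> 0" "\<And>p. J (p, p) = 0 \<Longrightarrow> P (\<pi> p) = 0"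
    using critical_value_polynomial[OF cX cY Y_\<pi>_polyfun Jd] by blast
  define \<Delta> where "\<Delta> = (\<lambda>p. g (fst p) * P p)"
  have gY: "(\<lambda>p. g (fst p)) \<in> polyfun (Y ` {..<M + N})"
  proof (rule polyfun_compose[OF g])
    fix c assume "c \<in> xs ` {..<M}"
    then obtain i where i: "i < M" "c = xs i" by blast
    then have "(\<lambda>p. c (fst p)) = Y i" by (simp add: coords_prod_def fun_eq_iff)
    then show "(\<lambda>p. c (fst p)) \<in> polyfun (Y ` {..<M + N})" using i by (auto intro!: polyfun.base)
  qed
  have \<Delta>Y: "\<Delta> \<in> polyfun (Y ` {..<M + N})" unfolding \<Delta>_def by (rule polyfun.mult[OF gY P(1)])
  have "\<exists>a. \<Delta> a \<noteq> 0"
    unfolding \<Delta>_def using polyfun_mult_nonzero[OF cY gY P(1), of "(s0, f0)" b] s0(1) P(2) by simp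
  then obtain a where a: "\<Delta> a \<noteq> 0" by blast
  have si: "simple s k" if "\<Delta> (s, f) \<noteq> 0" "k \<in> fiber s f" for s f k
    using P(3)[of "(s, k)"] that by (auto simp: simple_def \<Delta>_def fiber_def)
  have gd: "good s f" if "\<Delta> (s, f) \<noteq> 0" for s f
    by (rule good) (use that si in \<open>auto simp: \<Delta>_def\<close>)
  obtain W where W: "open W" "(s0, f0) \<in> W" "\<And>s f. (s, f) \<in> W \<Longrightarrow> card (fiber s f) = card (fiber s0 f0)"
    using good_locally_constant[OF good[OF s0]] by metis
  obtain s1 f1 where sf1: "(s1, f1) \<in> W" "\<Delta> (s1, f1) \<noteq> 0"
    using polyfun_nonzero_dense[OF cY \<Delta>Y a W(1,2)] by force
  have con: "connected {p. \<Delta> p \<noteq> 0}"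
    using connected_polyfun_nonzero[OF cY \<Delta>Y, of UNIV] by simp
  have "card (fiber s f) = card (fiber s0 f0)" if "\<Delta> (s, f) \<noteq> 0" for s f
    using good_connected_constant[OF con _ , of s f s1 f1] gd that sf1 W(3)[OF sf1(1)] by auto
  then show ?thesis using that[OF \<Delta>Y a] si gd good_finite by blast
qed

text \<open>About \<open>(s0, f0)\<close> it is known only that its fibre has the generic number
  \<open>c\<close> of points. Small balls around them each catch a solution of every generic pair
  nearby, so the balls use up all \<open>c\<close> solutions; a solution in \<open>T\<close>, moved
  to a generic pair, would be one too many.\<close>

lemma fiber_avoids_closed:
  assumes \<Delta>: "\<Delta> \<in> polyfun (Y ` {..<M + N})" "\<Delta> a \<noteq> 0"
    "\<And>s f. \<Delta> (s, f) \<noteq> 0 \<Longrightarrow> (\<forall>k\<in>fiber s f. simple s k) \<and> finite (fiber s f) \<and> card (fiber s f) = c"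
    and simple: "simple s1 k1"
    and fin: "finite (fiber s0 f0)" "card (fiber s0 f0) = c"
    and T: "closed T" "fiber s0 f0 \<inter> T = {}"
  obtains e where "e > 0" "\<And>s k. dist s s0 < e \<Longrightarrow> k \<in> T \<Longrightarrow> F s k \<noteq> f0"
proof -
  define Z where "Z = fiber s0 f0"
  obtain r where r: "r > 0" "\<And>z z'. z \<in> Z \<Longrightarrow> z' \<in> Z \<Longrightarrow> z \<noteq> z' \<Longrightarrow> cball z r \<inter> cball z' r = {}"
    "\<And>z. z \<in> Z \<Longrightarrow> cball z r \<inter> T = {}"
    using finite_disjoint_balls[OF fin(1) T] unfolding Z_def by metis
  have finZ: "finite Z" using fin by (simp add: Z_def)
  \<comment> \<open>No solution over \<open>(s0, f0)\<close> lies on the spheres, and by compactness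
    none does over nearby pairs: solutions cannot cross the boundary of a ball.\<close>
  define B where "B = cball s0 1 \<times> (\<Union>z\<in>Z. sphere z r)"
  have "compact B" unfolding B_def using finZ by (intro compact_Times compact_UN) auto
  then have cB: "closed (\<pi> ` B)" by (intro compact_imp_closed compact_continuous_image continuous_\<pi>)
  have nB: "(s0, f0) \<notin> \<pi> ` B"
  proof
    assume "(s0, f0) \<in> \<pi> ` B"
    then obtain k z where k: "z \<in> Z" "dist z k = r" "k \<in> Z" by (auto simp: \<pi>_def B_def Z_def fiber_def)
    then have "z \<noteq> k" using r(1) by auto
    from r(2)[OF k(1,3) this] k(2) r(1) show False by auto
  qed
  have "open (- (\<pi> ` B) \<inter> (ball s0 1 \<times> UNIV))" using cB by (intro open_Int open_Times) (auto simp: open_Compl)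
  moreover have "(s0, f0) \<in> - (\<pi> ` B) \<inter> (ball s0 1 \<times> UNIV)" using nB by simp
  ultimately obtain \<epsilon> where \<epsilon>: "\<epsilon> > 0" "ball (s0, f0) \<epsilon> \<subseteq> - (\<pi> ` B) \<inter> (ball s0 1 \<times> UNIV)"
    using open_contains_ball by blast
  define W where "W = ball (s0, f0) \<epsilon>"
  define U where "U = W \<inter> {p. \<Delta> p \<noteq> 0}"
  have conU: "connected U"
    unfolding U_def W_def by (rule connected_polyfun_nonzero[OF cY \<Delta>(1)]) auto
  obtain p1 where p1: "\<Delta> (\<pi> p1) \<noteq> 0" using polyfun_\<pi>_nonzero[OF \<Delta>(1,2) simple] by blast
  note dense = polyfun_nonzero_dense[OF cX polyfun_\<pi>[OF \<Delta>(1)], of p1, OF p1]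
  have oW: "open (\<pi> -` W)" unfolding W_def by (rule open_vimage[OF _ continuous_\<pi>]) simp
  have each: "\<exists>k\<in>ball z r. F s k = f" if z: "z \<in> Z" and sf: "(s, f) \<in> U" for z s f
  proof -
    \<comment> \<open>The pairs with a solution in the ball around \<open>z\<close> form an open
      set, because generic solutions are simple, and a closed one, because over \<open>U\<close> the
      open and the closed ball contain the same solutions. Connectedness of \<open>U\<close> does
      the rest.\<close>
    define E where "E = {p \<in> U. \<exists>k\<in>ball z r. F (fst p) k = snd p}"
    have 1: "openin (top_of_set U) E"
      unfolding openin_subopen[of _ E]
    proof
      fix p assume p: "p \<in> E"
      then obtain k where k: "k \<in> ball z r" "F (fst p) k = snd p" by (auto simp: E_def)
      have pU: "p \<in> U" using p by (simp add: E_def)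
      have "simple (fst p) k" using \<Delta>(3)[of "fst p" "snd p"] pU k(2) by (auto simp: U_def fiber_def)
      then obtain V where V: "open V" "(fst p, k) \<in> V" "\<And>S. open S \<Longrightarrow> S \<subseteq> V \<Longrightarrow> open (\<pi> ` S)"
        using \<pi>_local_homeo by metis
      let ?S = "\<pi> ` (V \<inter> (UNIV \<times> ball z r))"
      have "open ?S" using V(1) by (intro V(3) open_Int open_Times) auto
      moreover have "p \<in> ?S" by (rule image_eqI[of _ _ "(fst p, k)"]) (use V(2) k in auto)
      moreover have "U \<inter> ?S \<subseteq> E" by (auto simp: E_def \<pi>_def)
      ultimately show "\<exists>T. openin (top_of_set U) T \<and> p \<in> T \<and> T \<subseteq> E"
        using pU by (intro exI[of _ "U \<inter> ?S"]) (auto simp: openin_open)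
    qed
    have "E = U \<inter> \<pi> ` (cball s0 1 \<times> cball z r)"
    proof
      show "E \<subseteq> U \<inter> \<pi> ` (cball s0 1 \<times> cball z r)"
      proof
        fix p assume p: "p \<in> E"
        then obtain k where k: "k \<in> ball z r" "F (fst p) k = snd p" by (auto simp: E_def)
        have "p \<in> ball s0 1 \<times> UNIV" using p \<epsilon>(2) by (auto simp: E_def U_def W_def)
        then have "p = \<pi> (fst p, k)" "(fst p, k) \<in> cball s0 1 \<times> cball z r" using k by (auto simp: mem_Times_iff)
        then show "p \<in> U \<inter> \<pi> ` (cball s0 1 \<times> cball z r)" using p unfolding E_def by blast
      qed
      show "U \<inter> \<pi> ` (cball s0 1 \<times> cball z r) \<subseteq> E"
      proof
        fix p assume p: "p \<in> U \<inter> \<pi> ` (cball s0 1 \<times> cball z r)"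
        then obtain s k where k: "p = (s, F s k)" "s \<in> cball s0 1" "k \<in> cball z r" by auto
        have "(s, k) \<notin> B"
        proof
          assume "(s, k) \<in> B"
          then have "p \<in> \<pi> ` B" using k(1) by (intro image_eqI[of _ _ "(s, k)"]) auto
          moreover have "p \<notin> \<pi> ` B" using p \<epsilon>(2) unfolding U_def W_def by blast
          ultimately show False by simp
        qed
        then have "k \<in> ball z r" using k z by (auto simp: B_def)
        then show "p \<in> E" using p k(1) by (auto simp: E_def)
      qed
    qed
    moreover have "closed (\<pi> ` (cball s0 1 \<times> cball z r))"
      by (intro compact_imp_closed compact_continuous_image continuous_\<pi> compact_Times) auto
    ultimately have 2: "closedin (top_of_set U) E" by (auto simp: closedin_closed)
    \<comment> \<open>\<open>z\<close> may fail to be simple, so nonemptiness comes from perturbing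
      \<open>(s0, z)\<close> in the total space to a point whose image is off the
      hypersurface.\<close>
    have "\<exists>v\<in>\<pi> -` W \<inter> (UNIV \<times> ball z r). \<Delta> (\<pi> v) \<noteq> 0"
      by (rule dense[of _ "(s0, z)"])
        (use oW z r(1) \<epsilon>(1) in \<open>auto intro!: open_Int open_Times simp: W_def Z_def fiber_def\<close>)
    then have 3: "E \<noteq> {}" by (force simp: E_def U_def \<pi>_def)
    have "E = U" using conU 1 2 3 unfolding connected_clopen by blast
    then have "(s, f) \<in> E" using sf by simp
    then show ?thesis unfolding E_def by simp
  qed
  have avoid: "F s k \<noteq> f" if sf: "(s, f) \<in> W" and k: "k \<in> T" for s f k
  proof
    assume "F s k = f"
    \<comment> \<open>An open neighbourhood of the offending point \<open>(s, k)\<close> outside all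
      balls. It contains a point whose image is generic, and that solution is not among those caught
      by the balls.\<close>
    define C where "C = \<pi> -` W \<inter> (UNIV \<times> - (\<Union>z\<in>Z. cball z r))"
    have oC: "open C" unfolding C_def using oW finZ by (intro open_Int open_Times) (auto simp: open_Compl closed_UN)
    have "k \<notin> (\<Union>z\<in>Z. cball z r)" using k r(3) by blast
    then have inC: "(s, k) \<in> C" unfolding C_def using sf \<open>F s k = f\<close> by simp
    obtain s' k' where sk: "(s', k') \<in> C" "\<Delta> (\<pi> (s', k')) \<noteq> 0" using dense[OF oC inC] by force
    let ?f = "F s' k'"
    have inU: "(s', ?f) \<in> U" using sk by (auto simp: C_def U_def)
    have "\<exists>k. z \<in> Z \<longrightarrow> k \<in> ball z r \<and> F s' k = ?f" for z using each[OF _ inU] by blast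
    then have "\<forall>z. \<exists>k. z \<in> Z \<longrightarrow> k \<in> ball z r \<and> F s' k = ?f" ..
    from choice[OF this] obtain \<kappa> where \<kappa>: "\<forall>z. z \<in> Z \<longrightarrow> \<kappa> z \<in> ball z r \<and> F s' (\<kappa> z) = ?f" ..
    have inj: "inj_on \<kappa> Z"
    proof (rule inj_onI, rule ccontr)
      fix z z' assume z: "z \<in> Z" "z' \<in> Z" "\<kappa> z = \<kappa> z'" "z \<noteq> z'"
      have "\<kappa> z \<in> cball z r \<inter> cball z' r" using \<kappa> z(1,2,3) ball_subset_cball by (metis IntI subsetD)
      then show False using r(2)[OF z(1,2,4)] by blast
    qed
    have D: "finite (fiber s' ?f)" "card (fiber s' ?f) = c" using \<Delta>(3)[of s' ?f] inU by (auto simp: U_def)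
    have sub: "\<kappa> ` Z \<subseteq> fiber s' ?f" using \<kappa> by (auto simp: fiber_def)
    have "card (\<kappa> ` Z) = card (fiber s' ?f)" using card_image[OF inj] fin(2) D(2) by (simp add: Z_def)
    then have "\<kappa> ` Z = fiber s' ?f" by (rule card_subset_eq[OF D(1) sub])
    then obtain z where "z \<in> Z" "k' = \<kappa> z" by (auto simp: fiber_def)
    then have "k' \<in> cball z r" "z \<in> Z" using \<kappa> ball_subset_cball by blast+
    then show False using sk(1) by (auto simp: C_def)
  qed
  show ?thesis
  proof (rule that[OF \<epsilon>(1)])
    fix s k assume s: "dist s s0 < \<epsilon>" "k \<in> T"
    have "(s, f0) \<in> W" using s(1) by (simp add: W_def dist_Pair_Pair dist_commute)
    from avoid[OF this s(2)] show "F s k \<noteq> f0" .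
  qed
qed

end

section \<open>Straightening and Pluecker coordinates\<close>

text \<open>The letters stand for the minors. In a product of two letters of equal rank, either the
  parameter of that rank absorbs one factor, or the two letters are traded for one of lower and one
  of higher rank with the same total.\<close>

locale straightening =
  fixes L :: "'l set" and rk :: "'l \<Rightarrow> nat" and pl :: "'l \<Rightarrow> 'a \<Rightarrow> complex" and ell :: "nat \<Rightarrow> 'a \<Rightarrow> complex" and n :: nat
  assumes finite_L: "finite L" and rk_le: "\<And>f. f \<in> L \<Longrightarrow> rk f \<le> n"
    and exchange: "\<And>f g. f \<in> L \<Longrightarrow> g \<in> L \<Longrightarrow> rk f = rk g \<Longrightarrow> (\<lambda>a. pl f a * pl g a) \<in> fs.span
      ({\<lambda>a. ell (rk f) a * pl h a |h. h \<in> L \<and> rk h = rk f} \<union>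
       {\<lambda>a. pl h a * pl h' a |h h'. h \<in> L \<and> h' \<in> L \<and> rk h + rk h' = 2 * rk f \<and> rk h < rk f})"
begin

definition wd :: "'l multiset \<Rightarrow> 'a \<Rightarrow> complex" where "wd M a = (\<Prod>f\<in>#M. pl f a)"

definition wt :: "'l multiset \<Rightarrow> nat" where "wt M = (\<Sum>f\<in>#M. rk f)"

lemma wd_add [simp]: "wd (add_mset f M) a = pl f a * wd M a" and wd_empty [simp]: "wd {#} a = 1"
  and wt_add [simp]: "wt (add_mset f M) = rk f + wt M" and wt_empty [simp]: "wt {#} = 0"
  by (simp_all add: wd_def wt_def)

text \<open>The terms straightening should produce: one of the \<open>k\<close> factors is a
  parameter, and the total weight, counting \<open>r\<close> for \<open>ell r\<close>, is
  kept.\<close>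

definition Tset :: "nat \<Rightarrow> nat \<Rightarrow> ('a \<Rightarrow> complex) set" where
  "Tset k \<omega> = {\<lambda>a. ell r a * wd U a |r U. r \<le> n \<and> set_mset U \<subseteq> L \<and> Suc (size U) = k \<and> r + wt U = \<omega>}"

text \<open>Induction on \<open>r\<close> with a counting invariant. Exchanging two letters of rank
  \<open>r\<close> removes both and creates one letter below \<open>r\<close> and one above, so
  \<open>A W + B W div 2\<close> is unchanged while \<open>B W\<close> drops. From
  \<open>2 ^ Suc r\<close> letters of rank at most \<open>r\<close> one thus reaches terms with a
  parameter or words with \<open>2 ^ r\<close> letters of rank below \<open>r\<close>. At
  \<open>r = 0\<close> the latter are impossible.\<close>

lemma straighten_rank:
  "set_mset W \<subseteq> L \<Longrightarrow> 2 ^ r \<le> size (filter_mset (\<lambda>f. rk f < r) W) \<Longrightarrow> wd W \<in> fs.span (Tset (size W) (wt W))"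
proof (induction r arbitrary: W)
  case 0
  then show ?case by simp
next
  case (Suc r)
  define A where "A = (\<lambda>W. size (filter_mset (\<lambda>f. rk f < r) W))"
  define B where "B = (\<lambda>W. size (filter_mset (\<lambda>f. rk f = r) W))"
  have *: "wd W \<in> fs.span (Tset (size W) (wt W))" if "set_mset W \<subseteq> L" "2 ^ r \<le> A W + B W div 2" for W
    using that
  proof (induction "B W" arbitrary: W rule: less_induct)
    case less
    show ?case
    proof (cases "2 ^ r \<le> A W")
      case True
      then show ?thesis using Suc.IH less.prems(1) by (simp add: A_def)
    next
      case False
      then have B2: "B W \<ge> 2" using less.prems(2) by (cases "B W < 2") auto
      then have "size (filter_mset (\<lambda>f. rk f = r) W) \<noteq> 0" unfolding B_def by linarith
      then have "filter_mset (\<lambda>f. rk f = r) W \<noteq> {#}" by (metis size_empty)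
      then obtain f where "f \<in># filter_mset (\<lambda>f. rk f = r) W" by (metis multiset_nonemptyE)
      then have f: "f \<in># W" "rk f = r" by auto
      define W1 where "W1 = W - {#f#}"
      have W1: "W = add_mset f W1" using f(1) by (simp add: W1_def)
      have "B W1 \<ge> 1" using B2 f(2) by (simp add: W1 B_def)
      then have "size (filter_mset (\<lambda>f. rk f = r) W1) \<noteq> 0" unfolding B_def by linarith
      then have "filter_mset (\<lambda>f. rk f = r) W1 \<noteq> {#}" by (metis size_empty)
      then obtain g where "g \<in># filter_mset (\<lambda>f. rk f = r) W1" by (metis multiset_nonemptyE)
      then have g: "g \<in># W1" "rk g = r" by auto
      define U where "U = W1 - {#g#}"
      have U: "W = add_mset f (add_mset g U)" using g(1) by (simp add: U_def W1)
      have inL: "f \<in> L" "g \<in> L" "set_mset U \<subseteq> L" using less.prems(1) by (auto simp: U)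
      have "(\<lambda>a. (pl f a * pl g a) * wd U a) \<in> fs.span (Tset (size W) (wt W))"
      proof (rule span_mult[OF exchange[OF inL(1,2)] fs.span_base[of "wd U" "{wd U}"]])
        fix h b assume h: "h \<in> {\<lambda>a. ell (rk f) a * pl h a |h. h \<in> L \<and> rk h = rk f} \<union>
          {\<lambda>a. pl h a * pl h' a |h h'. h \<in> L \<and> h' \<in> L \<and> rk h + rk h' = 2 * rk f \<and> rk h < rk f}" and b: "b \<in> {wd U}"
        from h show "(\<lambda>a. h a * b a) \<in> fs.span (Tset (size W) (wt W))"
        proof
          assume "h \<in> {\<lambda>a. ell (rk f) a * pl h a |h. h \<in> L \<and> rk h = rk f}"
          then obtain h' where h': "h = (\<lambda>a. ell (rk f) a * pl h' a)" "h' \<in> L" "rk h' = rk f" by blast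
          have "(\<lambda>a. h a * b a) = (\<lambda>a. ell r a * wd (add_mset h' U) a)" using h'(1) b f(2) by (simp add: mult.assoc)
          also have "\<dots> \<in> Tset (size W) (wt W)"
            unfolding Tset_def using h' inL rk_le[OF inL(1)] f(2) g(2) by (intro CollectI exI[of _ r] exI[of _ "add_mset h' U"]) (auto simp: U)
          finally show ?thesis by (rule fs.span_base)
        next
          assume "h \<in> {\<lambda>a. pl h a * pl h' a |h h'. h \<in> L \<and> h' \<in> L \<and> rk h + rk h' = 2 * rk f \<and> rk h < rk f}"
          then obtain h1 h2 where h12: "h = (\<lambda>a. pl h1 a * pl h2 a)" "h1 \<in> L" "h2 \<in> L" "rk h1 + rk h2 = 2 * rk f" "rk h1 < rk f" by blast
          define V where "V = add_mset h1 (add_mset h2 U)"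
          have "rk h2 > r" using h12 f(2) by linarith
          then have BV: "B V + 2 = B W" and AV: "A V = A W + 1" using h12 f(2) g(2) by (simp_all add: V_def A_def B_def U)
          have "wd V \<in> fs.span (Tset (size V) (wt V))"
            by (rule less.hyps) (use BV AV h12 inL less.prems(2) in \<open>auto simp: V_def\<close>)
          moreover have "size V = size W" "wt V = wt W" using h12(4) f(2) g(2) by (simp_all add: V_def U)
          moreover have "(\<lambda>a. h a * b a) = wd V" using h12(1) b by (simp add: V_def mult.assoc fun_eq_iff)
          ultimately show ?thesis by simp
        qed
      qed (use f g in simp_all)
      moreover have "(\<lambda>a. (pl f a * pl g a) * wd U a) = wd W" by (simp add: U mult.assoc fun_eq_iff)
      ultimately show ?thesis by simp
    qed
  qed
  have "filter_mset (\<lambda>f. rk f < Suc r) W = filter_mset (\<lambda>f. rk f < r) W + filter_mset (\<lambda>f. rk f = r) W"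
    by (induction W) (auto simp: less_Suc_eq)
  then have "size (filter_mset (\<lambda>f. rk f < Suc r) W) = A W + B W" by (simp add: A_def B_def)
  with Suc.prems(2) have "2 ^ r \<le> A W + B W div 2" by simp
  then show ?case by (rule *[OF Suc.prems(1)])
qed

text \<open>Ranks are at most \<open>n\<close>, hence below \<open>Suc n\<close>, and
  \<open>2 ^ Suc n\<close> is the number of letters that \<open>straighten_rank\<close> requires at
  that level.\<close>

definition D :: nat where "D = 2 ^ Suc n"

lemma straighten:
  assumes "set_mset W \<subseteq> L" "D \<le> size W"
  shows "wd W \<in> fs.span (Tset (size W) (wt W))"
proof (rule straighten_rank[OF assms(1), of "Suc n"])
  have "filter_mset (\<lambda>f. rk f < Suc n) W = W"
    using assms(1) rk_le by (intro filter_mset_eq_conv[THEN iffD2]) (force simp: less_Suc_eq_le)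
  then show "2 ^ Suc n \<le> size (filter_mset (\<lambda>f. rk f < Suc n) W)" using assms(2) by (simp add: D_def)
qed

definition words :: "nat \<Rightarrow> 'l multiset set" where "words k = {W. set_mset W \<subseteq> L \<and> size W = k}"

lemma finite_words: "finite (words k)"
proof (rule finite_subset)
  show "words k \<subseteq> mset ` {xs. set xs \<subseteq> L \<and> length xs = k}"
  proof
    fix W assume W: "W \<in> words k"
    obtain xs where "mset xs = W" using ex_mset by blast
    then show "W \<in> mset ` {xs. set xs \<subseteq> L \<and> length xs = k}" using W by (auto simp: words_def intro!: image_eqI[of _ _ xs])
  qed
qed (simp add: finite_lists_length_eq finite_L)

text \<open>Long words lose a letter to a parameter, so induction on the length expresses every word
  through those shorter than \<open>D\<close>, with coefficients polynomial in the parameters.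
  Coordinate \<open>r - 1\<close> of \<open>F\<close> is the parameter of weight \<open>r\<close>,
  hence the weight function \<open>Suc\<close>; \<open>ell 0 = 1\<close> adds no weight.\<close>

lemma graded_rep:
  assumes F: "\<And>r a. 0 < r \<Longrightarrow> r \<le> n \<Longrightarrow> y (r - 1) (F a) = ell r a" and ell0: "\<And>a. ell 0 a = 1"
    and W: "set_mset W \<subseteq> L"
  shows "\<exists>B. (\<forall>U\<in>(\<Union>k<D. words k). B U \<in> fs.span (mon n y ` wset n Suc (wt W))) \<and>
    (\<forall>a. wd W a = (\<Sum>U\<in>(\<Union>k<D. words k). B U (F a) * wd U a))"
  using W
proof (induction "size W" arbitrary: W rule: less_induct)
  case less
  define V where "V = (\<Union>k<D. words k)"
  have finV: "finite V" unfolding V_def by (intro finite_UN_I finite_words) auto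
  define Rep where "Rep = (\<lambda>t h. \<exists>B. (\<forall>U\<in>V. B U \<in> fs.span (mon n y ` wset n Suc t)) \<and> (\<forall>a. h a = (\<Sum>U\<in>V. B U (F a) * wd U a)))"
  have Rep0: "Rep t 0" for t
    unfolding Rep_def by (rule exI[of _ "\<lambda>_. 0"]) (simp add: fs.span_zero)
  have Rep_step: "Rep t ((\<lambda>a. c * b a) + h)" if b: "Rep t b" and h: "Rep t h" for t c b h
  proof -
    obtain B where B: "\<forall>U\<in>V. B U \<in> fs.span (mon n y ` wset n Suc t)" "\<forall>a. b a = (\<Sum>U\<in>V. B U (F a) * wd U a)"
      using b unfolding Rep_def by blast
    obtain C where C: "\<forall>U\<in>V. C U \<in> fs.span (mon n y ` wset n Suc t)" "\<forall>a. h a = (\<Sum>U\<in>V. C U (F a) * wd U a)"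
      using h unfolding Rep_def by blast
    show ?thesis
      unfolding Rep_def
    proof (intro exI[of _ "\<lambda>U. (\<lambda>v. c * B U v) + C U"] conjI ballI allI)
      fix U assume "U \<in> V"
      then show "(\<lambda>v. c * B U v) + C U \<in> fs.span (mon n y ` wset n Suc t)"
        using B(1) C(1) by (intro fs.span_add fs.span_scale) auto
    next
      fix a
      show "((\<lambda>a. c * b a) + h) a = (\<Sum>U\<in>V. ((\<lambda>v. c * B U v) + C U) (F a) * wd U a)"
        using B(2) C(2) by (simp add: distrib_right sum.distrib sum_distrib_left mult.assoc)
    qed
  qed
  have "Rep (wt W) (wd W)"
  proof (cases "size W < D")
    case True
    then have WV: "W \<in> V" using less.prems by (auto simp: V_def words_def)
    show ?thesis
      unfolding Rep_def
    proof (intro exI[of _ "\<lambda>U _. if U = W then 1 else 0"] conjI ballI allI)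
      show "(\<lambda>_. if U = W then 1 else 0) \<in> fs.span (mon n y ` wset n Suc (wt W))" for U by (rule span_mon_const)
      show "wd W a = (\<Sum>U\<in>V. (if U = W then 1 else 0) * wd U a)" for a
        using WV finV by (simp add: if_distrib[of "\<lambda>z. z * _"] cong: if_cong)
    qed
  next
    case False
    then have "wd W \<in> fs.span (Tset (size W) (wt W))" using straighten less.prems by simp
    then show ?thesis
    proof (induction rule: fs.span_induct_alt)
      case base
      show ?case by (rule Rep0)
    next
      case (step c b h)
      obtain r U where rU: "b = (\<lambda>a. ell r a * wd U a)" "r \<le> n" "set_mset U \<subseteq> L" "Suc (size U) = size W" "r + wt U = wt W"
        using step(1) unfolding Tset_def by blast
      obtain B where B: "\<forall>U'\<in>V. B U' \<in> fs.span (mon n y ` wset n Suc (wt U))" "\<forall>a. wd U a = (\<Sum>U'\<in>V. B U' (F a) * wd U' a)"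
        using less.hyps[of U] rU(3,4) unfolding V_def by auto
      have "Rep (wt W) b"
      proof (cases "r = 0")
        case True
        then show ?thesis using B rU ell0 unfolding Rep_def by auto
      next
        case False
        show ?thesis
          unfolding Rep_def
        proof (intro exI[of _ "\<lambda>U' v. y (r - 1) v * B U' v"] conjI ballI allI)
          fix U' assume U': "U' \<in> V"
          have "y (r - 1) \<in> fs.span (mon n y ` wset n Suc r)" by (rule span_mon_coord) (use False rU(2) in auto)
          from span_mon_mult[OF this, of "B U'" "wt U"] B(1) U' rU(5)
          show "(\<lambda>v. y (r - 1) v * B U' v) \<in> fs.span (mon n y ` wset n Suc (wt W))" by simp
        next
          fix a
          show "b a = (\<Sum>U'\<in>V. y (r - 1) (F a) * B U' (F a) * wd U' a)"
            using B(2) rU(1) F[of r a] False rU(2) by (simp add: sum_distrib_left mult.assoc)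
        qed
      qed
      then show ?case by (rule Rep_step[OF _ step(2)])
    qed
  qed
  then show ?case unfolding Rep_def V_def .
qed

end

section \<open>Maximal minors as letters\<close>

lemma sum_lessThan_card_le:
  fixes A :: "nat set"
  assumes "finite A"
  shows "(\<Sum>i<card A. i) \<le> \<Sum>A"
  using assms
proof (induction "card A" arbitrary: A)
  case (Suc k)
  then have ne: "A \<noteq> {}" by auto
  define a where "a = Max A"
  have a: "a \<in> A" using ne Suc.prems by (simp add: a_def)
  have "A \<subseteq> {..a}" using Suc.prems by (auto simp: a_def)
  then have "card A \<le> card {..a}" by (rule card_mono[rotated]) simp
  then have ka: "k \<le> a" using Suc.hyps(2) by simp
  have "k = card (A - {a})" using Suc.hyps(2) a Suc.prems by simp
  then have "(\<Sum>i<k. i) \<le> \<Sum>(A - {a})" using Suc.hyps(1)[of "A - {a}"] Suc.prems by simp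
  moreover have "\<Sum>A = a + \<Sum>(A - {a})" using a Suc.prems by (simp add: sum.remove)
  ultimately show ?case using ka unfolding Suc.hyps(2)[symmetric] by simp
qed simp

text \<open>Ordered selections of \<open>m\<close> distinct columns instead of increasing ones: no
  sorting is ever needed, at the price of \<open>m!\<close> letters per minor, equal up to sign.
  Extensionality lets the values determine the letter.\<close>

definition letters :: "nat \<Rightarrow> nat \<Rightarrow> (nat \<Rightarrow> nat) set" where
  "letters m p = {f \<in> {..<m} \<rightarrow>\<^sub>E {..<m + p}. inj_on f {..<m}}"

text \<open>The number of boxes of the partition attached to the column set. On letters the
  subtraction is never truncated, since \<open>m\<close> distinct columns sum to at least
  \<open>0 + ... + (m - 1)\<close>.\<close>

definition rank :: "nat \<Rightarrow> (nat \<Rightarrow> nat) \<Rightarrow> nat" where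
  "rank m f = (\<Sum>i<m. f i) - (\<Sum>i<m. i)"

text \<open>The \<open>m\<close> by \<open>m + p\<close> matrix \<open>[I, -K]\<close> and its maximal minors.\<close>

definition xent :: "nat \<Rightarrow> (nat \<Rightarrow> nat \<Rightarrow> complex) \<Rightarrow> nat \<Rightarrow> nat \<Rightarrow> complex" where
  "xent m K i q = (if q < m then (if q = i then 1 else 0) else - K i (q - m))"

definition pluecker :: "nat \<Rightarrow> (nat \<Rightarrow> nat) \<Rightarrow> (nat \<Rightarrow> nat \<Rightarrow> complex) \<Rightarrow> complex" where
  "pluecker m f K = fdet m (\<lambda>i k. xent m K i (f k))"

lemma finite_letters: "finite (letters m p)"
  unfolding letters_def by (rule finite_subset[of _ "{..<m} \<rightarrow>\<^sub>E {..<m + p}"]) (auto intro: finite_PiE)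

lemma letters_sum_ge:
  fixes f :: "nat \<Rightarrow> nat"
  assumes "inj_on f {..<m}"
  shows "(\<Sum>i<m. i) \<le> (\<Sum>i<m. f i)"
  using sum_lessThan_card_le[of "f ` {..<m}"] card_image[OF assms] by (simp add: sum.reindex[OF assms])

lemma rank_eq: "f \<in> letters m p \<Longrightarrow> rank m f + (\<Sum>i<m. i) = (\<Sum>i<m. f i)"
  using letters_sum_ge[of f m] by (simp add: letters_def rank_def)

text \<open>The reflection \<open>q \<mapsto> m + p - 1 - q\<close> of the columns turns the lower
  bound for sums of distinct columns into the upper bound.\<close>

lemma rank_le:
  assumes f: "f \<in> letters m p"
  shows "rank m f \<le> m * p"
proof -
  have lt: "f i \<le> m + p - 1" if "i < m" for i
  proof -
    have "f i < m + p" using f that by (auto simp: letters_def PiE_iff)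
    then show ?thesis by simp
  qed
  have inj: "inj_on (\<lambda>i. m + p - 1 - f i) {..<m}"
  proof (rule inj_onI)
    fix i j assume ij: "i \<in> {..<m}" "j \<in> {..<m}" "m + p - 1 - f i = m + p - 1 - f j"
    then have "f i = f j" using lt[of i] lt[of j] by simp
    then show "i = j" using f ij(1,2) by (auto simp: letters_def dest: inj_onD)
  qed
  have "(\<Sum>i<m. i) \<le> (\<Sum>i<m. m + p - 1 - f i)" by (rule letters_sum_ge[OF inj])
  moreover have "(\<Sum>i<m. m + p - 1 - f i) + (\<Sum>i<m. f i) = (\<Sum>i<m. m + p - 1)"
    unfolding sum.distrib[symmetric]
  proof (rule sum.cong[OF refl])
    fix i assume "i \<in> {..<m}"
    then show "m + p - 1 - f i + f i = m + p - 1" using lt[of i] by simp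
  qed
  moreover have "(\<Sum>i<m. i) + (\<Sum>i<m. i) = m * (m - 1)"
    by (induction m) (auto simp: algebra_simps)
  moreover have "(\<Sum>i<m. m + p - 1) = m * (m - 1) + m * p" by (cases m) (auto simp: algebra_simps)
  ultimately show ?thesis using rank_eq[OF f] by linarith
qed

lemma pluecker_permute:
  assumes "\<sigma> permutes {..<m}"
  shows "pluecker m (f \<circ> \<sigma>) K = of_int (sign \<sigma>) * pluecker m f K"
  unfolding pluecker_def
  using fdet_permute_rows[OF assms, of "\<lambda>k i. xent m K i (f k)"]
  unfolding fdet_transpose[of m "\<lambda>i k. xent m K i (f k)"] fdet_transpose[of m "\<lambda>i k. xent m K i ((f \<circ> \<sigma>) k)", symmetric]
  by simp

lemma pluecker_not_inj:
  assumes "\<not> inj_on f {..<m}"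
  shows "pluecker m f K = 0"
proof -
  obtain i j where "i < m" "j < m" "i \<noteq> j" "f i = f j" using assms by (auto simp: inj_on_def)
  then have "fdet m (\<lambda>k i. xent m K i (f k)) = 0" by (intro fdet_identical_rows[of i m j]) auto
  then show ?thesis unfolding pluecker_def fdet_transpose[of m "\<lambda>i k. xent m K i (f k)", symmetric] by simp
qed

lemma letters_same_image:
  assumes f: "f \<in> letters m p" and g: "g \<in> letters m p" and im: "g ` {..<m} = f ` {..<m}"
  obtains \<sigma> where "\<sigma> permutes {..<m}" "g = f \<circ> \<sigma>"
proof -
  define \<sigma> where "\<sigma> = (\<lambda>k. if k < m then inv_into {..<m} f (g k) else k)"
  have bf: "bij_betw f {..<m} (f ` {..<m})" and bg: "bij_betw g {..<m} (f ` {..<m})"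
    using f g im by (auto simp: letters_def bij_betw_def)
  have "bij_betw (inv_into {..<m} f \<circ> g) {..<m} {..<m}"
    by (rule bij_betw_trans[OF bg bij_betw_inv_into[OF bf]])
  then have "bij_betw \<sigma> {..<m} {..<m}"
    by (subst bij_betw_cong[of _ _ "inv_into {..<m} f \<circ> g"]) (auto simp: \<sigma>_def)
  then have "\<sigma> permutes {..<m}" by (rule bij_imp_permutes) (simp add: \<sigma>_def)
  moreover have "g k = (f \<circ> \<sigma>) k" for k
  proof (cases "k < m")
    case True
    then have "g k \<in> f ` {..<m}" using im by auto
    then show ?thesis using True by (simp add: \<sigma>_def f_inv_into_f)
  next
    case False
    then show ?thesis using f g by (auto simp: \<sigma>_def letters_def PiE_iff extensional_def)
  qed
  ultimately show ?thesis using that by blast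
qed

lemma sum_fun_upd:
  fixes f :: "nat \<Rightarrow> nat"
  assumes "k < m"
  shows "(\<Sum>i<m. (f(k := c)) i) + f k = (\<Sum>i<m. f i) + c"
  using assms by (simp add: sum.remove[of "{..<m}" k])

text \<open>Some column \<open>f a\<close> does not occur in \<open>g\<close>; it is exchanged with
  each \<open>g k\<close> in turn. A swap shifts the two ranks by opposite nonzero amounts, so one
  of them drops below \<open>rank m f\<close>; a swap that repeats a column of \<open>f\<close>
  contributes a zero minor.\<close>

lemma pluecker_exchange:
  assumes f: "f \<in> letters m p" and g: "g \<in> letters m p" and r: "rank m f = rank m g" and im: "g ` {..<m} \<noteq> f ` {..<m}"
  shows "(\<lambda>K. pluecker m f K * pluecker m g K) \<in> fs.span
    {\<lambda>K. pluecker m h K * pluecker m h' K |h h'. h \<in> letters m p \<and> h' \<in> letters m p \<and>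
      rank m h + rank m h' = 2 * rank m f \<and> rank m h < rank m f}" (is "_ \<in> fs.span ?S")
proof -
  have injf: "inj_on f {..<m}" and injg: "inj_on g {..<m}" using f g by (auto simp: letters_def)
  have "\<not> f ` {..<m} \<subseteq> g ` {..<m}"
  proof
    assume "f ` {..<m} \<subseteq> g ` {..<m}"
    then have "f ` {..<m} = g ` {..<m}" by (rule card_subset_eq[rotated]) (simp_all add: card_image injf injg)
    then show False using im by simp
  qed
  then obtain a where a: "a < m" "f a \<notin> g ` {..<m}" by auto
  have eq: "pluecker m f K * pluecker m g K = (\<Sum>k<m. pluecker m (f(a := g k)) K * pluecker m (g(k := f a)) K)" for K
  proof -
    let ?u = "\<lambda>k i. xent m K i (f k)" and ?v = "\<lambda>k i. xent m K i (g k)"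
    have "pluecker m h K = fdet m (\<lambda>k i. xent m K i (h k))" for h
      unfolding pluecker_def fdet_transpose[of m "\<lambda>i k. xent m K i (h k)"] ..
    moreover have "?u(a := ?v k) = (\<lambda>l i. xent m K i ((f(a := g k)) l))" "?v(k := ?u a) = (\<lambda>l i. xent m K i ((g(k := f a)) l))" for k
      by (auto simp: fun_eq_iff)
    ultimately show ?thesis using fdet_replace_expand[OF a(1), of ?u ?v] by simp
  qed
  have trm: "(\<lambda>K. pluecker m (f(a := g k)) K * pluecker m (g(k := f a)) K) \<in> fs.span ?S" if k: "k < m" for k
  proof (cases "inj_on (f(a := g k)) {..<m}")
    case False
    have "(\<lambda>K. pluecker m (f(a := g k)) K * pluecker m (g(k := f a)) K) = 0"
      using pluecker_not_inj[OF False] by (simp add: fun_eq_iff)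
    then show ?thesis by (simp add: fs.span_zero)
  next
    case True
    have h1: "f(a := g k) \<in> letters m p" using True f g a(1) k by (auto simp: letters_def PiE_iff extensional_def)
    have "inj_on (g(k := f a)) {..<m}"
      by (rule inj_on_fun_updI[OF injg a(2)])
    then have h2: "g(k := f a) \<in> letters m p" using f g a(1) k by (auto simp: letters_def PiE_iff extensional_def)
    have ne: "f a \<noteq> g k" using a(2) k by auto
    have s1: "rank m (f(a := g k)) + f a = rank m f + g k"
      using rank_eq[OF h1] rank_eq[OF f] sum_fun_upd[OF a(1), of f "g k"] by linarith
    have s2: "rank m (g(k := f a)) + g k = rank m g + f a"
      using rank_eq[OF h2] rank_eq[OF g] sum_fun_upd[OF k, of g "f a"] by linarith
    have "rank m (f(a := g k)) < rank m f \<or> rank m (g(k := f a)) < rank m f" using s1 s2 ne r by linarith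
    then show ?thesis
    proof
      assume "rank m (f(a := g k)) < rank m f"
      then show ?thesis using h1 h2 s1 s2 r by (intro fs.span_base CollectI exI[of _ "f(a := g k)"] exI[of _ "g(k := f a)"]) auto
    next
      assume "rank m (g(k := f a)) < rank m f"
      then show ?thesis using h1 h2 s1 s2 r by (intro fs.span_base CollectI exI[of _ "g(k := f a)"] exI[of _ "f(a := g k)"]) (auto simp: mult.commute)
    qed
  qed
  show ?thesis unfolding eq by (rule span_sum_fun) (use trm in auto)
qed

definition level :: "nat \<Rightarrow> nat \<Rightarrow> ((nat \<Rightarrow> nat) \<Rightarrow> complex) \<Rightarrow> nat \<Rightarrow> (nat \<Rightarrow> nat \<Rightarrow> complex) \<Rightarrow> complex" where
  "level m p \<kappa> r K = (\<Sum>f | f \<in> letters m p \<and> rank m f = r. \<kappa> f * pluecker m f K)"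

text \<open>The level sums of the minors form a system of parameters: two minors of equal rank multiply into
  lower ranks unless they agree up to sign, and a square is recovered from the level sum.\<close>

lemma straightening_pluecker:
  assumes alt: "\<And>f \<sigma>. f \<in> letters m p \<Longrightarrow> \<sigma> permutes {..<m} \<Longrightarrow> \<kappa> (f \<circ> \<sigma>) = of_int (sign \<sigma>) * \<kappa> f"
    and nz: "\<And>f. f \<in> letters m p \<Longrightarrow> \<kappa> f \<noteq> 0"
  shows "straightening (letters m p) (rank m) (pluecker m) (level m p \<kappa>) (m * p)"
proof
  show "finite (letters m p)" by (rule finite_letters)
  show "rank m f \<le> m * p" if "f \<in> letters m p" for f by (rule rank_le[OF that])
  fix f g assume f: "f \<in> letters m p" and g: "g \<in> letters m p" and r: "rank m f = rank m g"
  let ?S1 = "{\<lambda>a. level m p \<kappa> (rank m f) a * pluecker m h a |h. h \<in> letters m p \<and> rank m h = rank m f}"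
  let ?S2 = "{\<lambda>a. pluecker m h a * pluecker m h' a |h h'. h \<in> letters m p \<and> h' \<in> letters m p \<and>
      rank m h + rank m h' = 2 * rank m f \<and> rank m h < rank m f}"
  have ex: "(\<lambda>K. pluecker m f K * pluecker m h K) \<in> fs.span (?S1 \<union> ?S2)"
    if "h \<in> letters m p" "rank m f = rank m h" "h ` {..<m} \<noteq> f ` {..<m}" for h
    by (rule subsetD[OF fs.span_mono pluecker_exchange[OF f that]]) blast
  show "(\<lambda>K. pluecker m f K * pluecker m g K) \<in> fs.span (?S1 \<union> ?S2)"
  proof (cases "g ` {..<m} = f ` {..<m}")
    case False
    then show ?thesis using ex[OF g r] by simp
  next
    case True
    then obtain \<sigma> where \<sigma>: "\<sigma> permutes {..<m}" "g = f \<circ> \<sigma>" using letters_same_image[OF f g] by blast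
    define H where "H = {h \<in> letters m p. rank m h = rank m f}"
    \<comment> \<open>The letters with the same columns as \<open>f\<close>. Their terms
      \<open>\<kappa> h * pluecker m h K\<close> all agree, both factors changing by the same sign;
      solving the level sum for them isolates the square of the minor.\<close>
    define H1 where "H1 = {h \<in> H. h ` {..<m} = f ` {..<m}}"
    have finH: "finite H" unfolding H_def by (simp add: finite_letters)
    have fH1: "f \<in> H1" using f by (simp add: H1_def H_def)
    have same: "\<kappa> h * pluecker m h K = \<kappa> f * pluecker m f K" if h: "h \<in> H1" for h K
    proof -
      obtain \<tau> where \<tau>: "\<tau> permutes {..<m}" "h = f \<circ> \<tau>"
        using letters_same_image[OF f, of h] h by (auto simp: H1_def H_def)
      have "(of_int (sign \<tau>) :: complex) * of_int (sign \<tau>) = 1" by (simp add: sign_def)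
      then show ?thesis unfolding \<tau>(2) alt[OF f \<tau>(1)] pluecker_permute[OF \<tau>(1)]
        by (simp add: mult_ac)
    qed
    have eq: "of_nat (card H1) * \<kappa> f * (pluecker m f K * pluecker m f K) =
        level m p \<kappa> (rank m f) K * pluecker m f K - (\<Sum>h\<in>H - H1. \<kappa> h * (pluecker m f K * pluecker m h K))" for K
    proof -
      have "level m p \<kappa> (rank m f) K = (\<Sum>h\<in>H1. \<kappa> h * pluecker m h K) + (\<Sum>h\<in>H - H1. \<kappa> h * pluecker m h K)"
        unfolding level_def H_def[symmetric] by (rule sum.subset_diff[THEN trans]) (auto simp: H1_def finH add.commute)
      also have "(\<Sum>h\<in>H1. \<kappa> h * pluecker m h K) = of_nat (card H1) * (\<kappa> f * pluecker m f K)" by (simp add: same)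
      finally show ?thesis by (simp add: algebra_simps sum_distrib_left)
    qed
    have c0: "of_nat (card H1) * \<kappa> f \<noteq> 0" using fH1 nz[OF f] finH by (auto simp: H1_def card_eq_0_iff)
    have 1: "(\<lambda>K. level m p \<kappa> (rank m f) K * pluecker m f K) \<in> fs.span (?S1 \<union> ?S2)"
      by (rule fs.span_base) (use f in blast)
    have 2: "(\<lambda>K. \<Sum>h\<in>H - H1. \<kappa> h * (pluecker m f K * pluecker m h K)) \<in> fs.span (?S1 \<union> ?S2)"
      by (intro span_sum_fun fs.span_scale ex) (auto simp: H_def H1_def)
    have "(\<lambda>K. of_int (sign \<sigma>) / (of_nat (card H1) * \<kappa> f) * (((\<lambda>K. level m p \<kappa> (rank m f) K * pluecker m f K)
        - (\<lambda>K. \<Sum>h\<in>H - H1. \<kappa> h * (pluecker m f K * pluecker m h K))) K)) \<in> fs.span (?S1 \<union> ?S2)"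
      by (intro fs.span_scale fs.span_diff 1 2)
    moreover have "of_int (sign \<sigma>) / (of_nat (card H1) * \<kappa> f) * (((\<lambda>K. level m p \<kappa> (rank m f) K * pluecker m f K)
        - (\<lambda>K. \<Sum>h\<in>H - H1. \<kappa> h * (pluecker m f K * pluecker m h K))) K) = pluecker m f K * pluecker m g K" for K
      unfolding fun_diff_def eq[symmetric] \<sigma>(2) pluecker_permute[OF \<sigma>(1)] using c0 by simp
    ultimately show ?thesis by simp
  qed
qed

section \<open>Properness in a family, deduced from straightening\<close>

context straightening
begin

lemma norm_wd_le:
  assumes "\<And>f. f \<in> L \<Longrightarrow> norm (pl f a) \<le> \<mu>" "set_mset U \<subseteq> L"
  shows "norm (wd U a) \<le> \<mu> ^ size U"
  using assms(2)
proof (induction U)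
  case (add f U)
  have f: "norm (pl f a) \<le> \<mu>" using assms(1) add.prems by simp
  have "0 \<le> \<mu>" by (rule order_trans[OF norm_ge_zero f])
  then have "norm (pl f a) * norm (wd U a) \<le> \<mu> * \<mu> ^ size U"
    using f add by (intro mult_mono) auto
  then show ?case by (simp add: norm_mult)
qed simp

lemma wd_replicate: "wd (replicate_mset k f) a = pl f a ^ k"
  by (induction k) auto

lemma straighten_coefficients:
  obtains t where "\<And>W a. W \<in> words D \<Longrightarrow> wd W a = (\<Sum>(r, U)\<in>{..n} \<times> words (D - 1). t W (r, U) * (ell r a * wd U a))"
proof -
  let ?R = "{..n} \<times> words (D - 1)"
  let ?y = "\<lambda>rU a. ell (fst rU) a * wd (snd rU) a"
  have "\<exists>t. W \<in> words D \<longrightarrow> (\<forall>a. wd W a = (\<Sum>rU\<in>?R. t rU * ?y rU a))" for W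
  proof (cases "W \<in> words D")
    case True
    have sub: "Tset (size W) (wt W) \<subseteq> ?y ` ?R"
    proof
      fix h assume "h \<in> Tset (size W) (wt W)"
      then obtain r U where "h = (\<lambda>a. ell r a * wd U a)" "r \<le> n" "set_mset U \<subseteq> L" "Suc (size U) = size W"
        unfolding Tset_def by blast
      then show "h \<in> ?y ` ?R" using True by (intro image_eqI[of _ _ "(r, U)"]) (auto simp: words_def)
    qed
    have "wd W \<in> fs.span (Tset (size W) (wt W))" by (rule straighten) (use True in \<open>auto simp: words_def\<close>)
    then have "wd W \<in> fs.span (?y ` ?R)" using fs.span_mono[OF sub] by blast
    from span_image_sum[OF this] finite_words show ?thesis by blast
  qed blast
  then have "\<forall>W. \<exists>t. W \<in> words D \<longrightarrow> (\<forall>a. wd W a = (\<Sum>rU\<in>?R. t rU * ?y rU a))" ..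
  from choice[OF this] obtain t where "\<forall>W. W \<in> words D \<longrightarrow> (\<forall>a. wd W a = (\<Sum>rU\<in>?R. t W rU * ?y rU a))" ..
  then show ?thesis by (intro that[of t]) (auto simp: split_def)
qed

text \<open>The straightening relations at \<open>s0\<close>, read with the coefficients of \<open>s\<close>, express the words of length \<open>D\<close>
  by the parameters \<open>elS s r\<close> as soon as a determinant that equals \<open>1\<close> at \<open>s0\<close> does not vanish. The resulting
  linear bound says that the map given by the \<open>elS s r\<close> is proper.\<close>

lemma generic_bound:
  fixes elS :: "'s::topological_space \<Rightarrow> nat \<Rightarrow> 'a \<Rightarrow> complex"
  assumes elS: "\<And>s r a. r \<le> n \<Longrightarrow> elS s r a = (\<Sum>f\<in>L. c r f s * pl f a)"
    and c: "\<And>r f. r \<le> n \<Longrightarrow> f \<in> L \<Longrightarrow> c r f \<in> polyfun Cs"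
    and Cs: "\<And>h. h \<in> Cs \<Longrightarrow> continuous_on UNIV h"
    and s0: "\<And>r a. r \<le> n \<Longrightarrow> elS s0 r a = ell r a"
    and one: "f1 \<in> L" "\<And>a. pl f1 a = 1"
  obtains g where "g \<in> polyfun Cs" "g s0 \<noteq> 0"
    "\<And>s. g s \<noteq> 0 \<Longrightarrow> \<exists>W C. open W \<and> s \<in> W \<and> (\<forall>s'\<in>W. \<forall>a. \<forall>f\<in>L. norm (pl f a) \<le> C * (\<Sum>r\<le>n. norm (elS s' r a)))"
proof -
  define q where "q = card (words D)"
  obtain e where e: "bij_betw e {..<q} (words D)"
    using ex_bij_betw_nat_finite[OF finite_words[of D]] by (auto simp: q_def atLeast0LessThan)
  let ?R = "{..n} \<times> words (D - 1)"
  obtain t where t: "\<And>W a. W \<in> words D \<Longrightarrow> wd W a = (\<Sum>(r, U)\<in>?R. t W (r, U) * (ell r a * wd U a))"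
    using straighten_coefficients by blast
  have eW: "e i \<in> words D" if "i < q" for i using e that by (auto simp: bij_betw_def)
  \<comment> \<open>The straightened form of the word \<open>e i\<close>, with the parameters of
    \<open>s\<close> in place of those of \<open>s0\<close>; \<open>\<tau> s\<close> rewrites it as
    a matrix acting on the words of length \<open>D\<close>.\<close>
  define \<rho> where "\<rho> = (\<lambda>s i a. \<Sum>(r, U)\<in>?R. t (e i) (r, U) * (elS s r a * wd U a))"
  define \<tau> where "\<tau> = (\<lambda>s i j. \<Sum>(r, U)\<in>?R. \<Sum>f\<in>L. t (e i) (r, U) * c r f s * (if e j = add_mset f U then 1 else 0))"
  have Dpos: "Suc (D - 1) = D" by (simp add: D_def)
  have \<rho>\<tau>: "\<rho> s i a = (\<Sum>j<q. \<tau> s i j * wd (e j) a)" for s i a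
  proof -
    have *: "(\<Sum>j<q. (if e j = V then 1 else 0) * wd (e j) a) = wd V a" if V: "V \<in> words D" for V
    proof -
      have "(\<Sum>j<q. (if e j = V then 1 else 0) * wd (e j) a) = (\<Sum>W\<in>words D. (if W = V then 1 else 0) * wd W a)"
        by (rule sum.reindex_bij_betw[OF e])
      also have "\<dots> = wd V a" using V finite_words by (simp add: if_distrib[of "\<lambda>z. z * _"] cong: if_cong)
      finally show ?thesis .
    qed
    have "(\<Sum>j<q. \<tau> s i j * wd (e j) a)
      = (\<Sum>j<q. \<Sum>rU\<in>?R. \<Sum>f\<in>L. t (e i) rU * c (fst rU) f s * ((if e j = add_mset f (snd rU) then 1 else 0) * wd (e j) a))"
      unfolding \<tau>_def by (simp add: sum_distrib_right split_def mult.assoc)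
    also have "\<dots> = (\<Sum>rU\<in>?R. \<Sum>f\<in>L. t (e i) rU * c (fst rU) f s * (\<Sum>j<q. (if e j = add_mset f (snd rU) then 1 else 0) * wd (e j) a))"
      unfolding sum_distrib_left by (subst sum.swap, intro sum.cong refl, rule sum.swap)
    also have "\<dots> = (\<Sum>rU\<in>?R. \<Sum>f\<in>L. t (e i) rU * c (fst rU) f s * wd (add_mset f (snd rU)) a)"
      using Dpos by (intro sum.cong refl arg_cong2[of _ _ _ _ "(*)"] *) (auto simp: words_def)
    also have "\<dots> = (\<Sum>rU\<in>?R. t (e i) rU * (elS s (fst rU) a * wd (snd rU) a))"
      by (intro sum.cong refl) (auto simp: elS sum_distrib_left sum_distrib_right mult_ac)
    also have "\<dots> = \<rho> s i a" unfolding \<rho>_def by (simp add: split_def)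
    finally show ?thesis by simp
  qed
  have \<rho>0: "\<rho> s0 i a = wd (e i) a" if "i < q" for i a
    unfolding t[OF eW[OF that]] \<rho>_def by (rule sum.cong) (auto simp: s0)
  \<comment> \<open>The words may satisfy linear relations, so \<open>\<tau> s0\<close> acts as the
    identity on their values without having to be the identity matrix. Correcting by it gives a
    matrix that still produces \<open>\<rho> s i\<close> in row \<open>i\<close> and is the identity
    at \<open>s0\<close>.\<close>
  define T where "T = (\<lambda>s i j. (if i = j then 1 else 0) + \<tau> s i j - \<tau> s0 i j)"
  have Trow: "(\<Sum>j<q. T s i j * wd (e j) a) = \<rho> s i a" if i: "i < q" for s i a
  proof -
    have "(\<Sum>j<q. T s i j * wd (e j) a) = wd (e i) a + \<rho> s i a - \<rho> s0 i a"
    proof -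
      have "(\<Sum>j<q. (if i = j then 1 else 0) * wd (e j) a) = wd (e i) a"
        using i by (simp add: if_distrib[of "\<lambda>z. z * _"] cong: if_cong)
      then show ?thesis
        unfolding T_def \<rho>\<tau> left_diff_distrib distrib_right sum_subtractf sum.distrib by simp
    qed
    then show ?thesis by (simp add: \<rho>0 i)
  qed
  have \<tau>p: "(\<lambda>s. \<tau> s i j) \<in> polyfun Cs" for i j
    unfolding \<tau>_def split_def
    by (intro polyfun_sum polyfun.mult polyfun.const c) auto
  have Tp: "(\<lambda>s. T s i j) \<in> polyfun Cs" for i j
    unfolding T_def by (intro polyfun_diff polyfun.add polyfun.const \<tau>p)
  define g where "g = (\<lambda>s. fdet q (T s))"
  have gp: "g \<in> polyfun Cs" unfolding g_def by (intro fdet_polyfun Tp)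
  have "g s0 = fdet q (\<lambda>i j. if i = j then 1 else 0)" unfolding g_def T_def by (rule fdet_cong) simp
  also have "\<dots> = 1" by (subst fdet_upper_triangular) auto
  finally have g0: "g s0 \<noteq> 0" by simp
  define h where "h = (\<lambda>s. \<Sum>b<q. \<Sum>i<q. norm (fadj q (T s) b i) * (\<Sum>rU\<in>?R. norm (t (e i) rU)))"
  have adjcont: "continuous_on UNIV (\<lambda>s. fadj q (T s) b i)" if "b < q" "i < q" for b i
    by (rule polyfun_continuous[OF fadj_polyfun[OF Tp that] Cs])
  have hcont: "continuous_on UNIV h"
    unfolding h_def
    by (intro continuous_on_sum continuous_on_mult continuous_on_norm continuous_on_const adjcont) auto
  have gcont: "continuous_on UNIV g" by (rule polyfun_continuous[OF gp Cs])
  have key: "norm (g s) * norm (pl f a) \<le> h s * (\<Sum>r\<le>n. norm (elS s r a))" if f: "f \<in> L" for s f a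
  proof -
    \<comment> \<open>The largest minor at \<open>a\<close>: its \<open>D\<close>-th power is, in
      norm, the value of a word, while the straightened terms contain only \<open>D - 1\<close>
      letters. As the letter \<open>f1\<close> has value \<open>1\<close>,
      \<open>\<mu> \<ge> 1\<close> and \<open>\<mu> ^ (D - 1)\<close> can be cancelled.\<close>
    define \<mu> where "\<mu> = Max ((\<lambda>f. norm (pl f a)) ` L)"
    have fin: "finite ((\<lambda>f. norm (pl f a)) ` L)" using finite_L by simp
    have \<mu>: "norm (pl f a) \<le> \<mu>" if "f \<in> L" for f unfolding \<mu>_def using fin that by (intro Max_ge) auto
    obtain f0 where f0: "f0 \<in> L" "norm (pl f0 a) = \<mu>" using Max_in[OF fin] f unfolding \<mu>_def by force
    have \<mu>1: "\<mu> \<ge> 1" using \<mu>[OF one(1)] one(2) by simp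
    define E where "E = (\<Sum>r\<le>n. norm (elS s r a))"
    have E: "norm (elS s r a) \<le> E" if "r \<le> n" for r unfolding E_def using that by (intro member_le_sum) auto
    have E0: "E \<ge> 0" unfolding E_def by (intro sum_nonneg) simp
    have "replicate_mset D f0 \<in> words D" using f0(1) by (auto simp: words_def)
    then obtain b where b: "b < q" "e b = replicate_mset D f0" using e by (auto simp: bij_betw_def) (metis imageE lessThan_iff)
    have "g s * wd (e b) a = (\<Sum>j<q. (if b = j then g s else 0) * wd (e j) a)"
      using b(1) by (simp add: if_distrib[of "\<lambda>z. z * _"] cong: if_cong)
    also have "\<dots> = (\<Sum>j<q. (\<Sum>i<q. fadj q (T s) b i * T s i j) * wd (e j) a)"
      unfolding g_def by (intro sum.cong refl arg_cong2[of _ _ _ _ "(*)"] fadj_mult[symmetric] b(1)) simp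
    also have "\<dots> = (\<Sum>i<q. fadj q (T s) b i * (\<Sum>j<q. T s i j * wd (e j) a))"
      unfolding sum_distrib_left sum_distrib_right by (subst sum.swap) (simp add: mult.assoc)
    also have "\<dots> = (\<Sum>i<q. fadj q (T s) b i * \<rho> s i a)" by (intro sum.cong refl) (simp add: Trow)
    finally have eq: "g s * wd (e b) a = (\<Sum>i<q. fadj q (T s) b i * \<rho> s i a)" .
    have \<rho>le: "norm (\<rho> s i a) \<le> (\<Sum>rU\<in>?R. norm (t (e i) rU)) * (E * \<mu> ^ (D - 1))" for i
      unfolding \<rho>_def split_def sum_distrib_right
    proof (rule order_trans[OF norm_sum], rule sum_mono)
      fix rU assume rU: "rU \<in> ?R"
      have "norm (elS s (fst rU) a) * norm (wd (snd rU) a) \<le> E * \<mu> ^ (D - 1)"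
        by (rule mult_mono) (use rU E[of "fst rU"] E0 norm_wd_le[of a \<mu> "snd rU", OF \<mu>] in \<open>auto simp: words_def\<close>)
      then show "norm (t (e i) (fst rU, snd rU) * (elS s (fst rU) a * wd (snd rU) a)) \<le> norm (t (e i) rU) * (E * \<mu> ^ (D - 1))"
        by (simp add: norm_mult mult_left_mono)
    qed
    have "norm (g s) * \<mu> ^ D = norm (g s * wd (e b) a)"
      using f0(2) by (simp add: b(2) wd_replicate norm_mult norm_power)
    also have "\<dots> \<le> (\<Sum>i<q. norm (fadj q (T s) b i) * ((\<Sum>rU\<in>?R. norm (t (e i) rU)) * (E * \<mu> ^ (D - 1))))"
      unfolding eq by (rule order_trans[OF norm_sum], rule sum_mono)
        (unfold norm_mult, rule mult_left_mono[OF \<rho>le norm_ge_zero])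
    also have "\<dots> = (\<Sum>i<q. norm (fadj q (T s) b i) * (\<Sum>rU\<in>?R. norm (t (e i) rU))) * (E * \<mu> ^ (D - 1))"
      by (simp add: sum_distrib_right mult.assoc)
    also have "\<dots> \<le> h s * (E * \<mu> ^ (D - 1))"
    proof (rule mult_right_mono)
      show "(\<Sum>i<q. norm (fadj q (T s) b i) * (\<Sum>rU\<in>?R. norm (t (e i) rU))) \<le> h s"
        unfolding h_def by (rule member_le_sum[of b "{..<q}"]) (use b(1) in \<open>auto intro!: sum_nonneg mult_nonneg_nonneg\<close>)
      show "0 \<le> E * \<mu> ^ (D - 1)" using E0 \<mu>1 by simp
    qed
    finally have "norm (g s) * (\<mu> * \<mu> ^ (D - 1)) \<le> h s * (E * \<mu> ^ (D - 1))"
      using Dpos by (metis power_Suc)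
    then have "(norm (g s) * \<mu>) * \<mu> ^ (D - 1) \<le> (h s * E) * \<mu> ^ (D - 1)" by (simp add: mult.assoc)
    then have "norm (g s) * \<mu> \<le> h s * E" by (rule mult_right_le_imp_le) (use \<mu>1 in simp)
    moreover have "norm (g s) * norm (pl f a) \<le> norm (g s) * \<mu>" by (rule mult_left_mono[OF \<mu>[OF f]]) simp
    ultimately show ?thesis unfolding E_def by linarith
  qed
  show ?thesis
  proof (rule that[OF gp g0])
    fix s assume gs: "g s \<noteq> 0"
    define W where "W = {s'. norm (g s) / 2 < norm (g s')} \<inter> {s'. h s' < h s + 1}"
    have "open W" unfolding W_def
      by (intro open_Int open_Collect_less continuous_intros gcont hcont)
    moreover have "s \<in> W" using gs by (simp add: W_def)
    moreover have "norm (pl f a) \<le> (h s + 1) / (norm (g s) / 2) * (\<Sum>r\<le>n. norm (elS s' r a))"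
      if s': "s' \<in> W" and f: "f \<in> L" for s' a f
    proof -
      have gpos: "norm (g s) / 2 > 0" using gs by simp
      have "norm (g s) / 2 * norm (pl f a) \<le> norm (g s') * norm (pl f a)"
        by (rule mult_right_mono) (use s' in \<open>auto simp: W_def\<close>)
      also have "\<dots> \<le> h s' * (\<Sum>r\<le>n. norm (elS s' r a))" by (rule key[OF f])
      also have "\<dots> \<le> (h s + 1) * (\<Sum>r\<le>n. norm (elS s' r a))"
        by (rule mult_right_mono) (use s' in \<open>auto simp: W_def intro!: sum_nonneg\<close>)
      finally show ?thesis using gpos by (simp add: field_simps)
    qed
    ultimately show "\<exists>W C. open W \<and> s \<in> W \<and> (\<forall>s'\<in>W. \<forall>a. \<forall>f\<in>L. norm (pl f a) \<le> C * (\<Sum>r\<le>n. norm (elS s' r a)))"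
      by blast
  qed
qed

end

section \<open>The Laplace expansion of the closed loop\<close>

lemma sum_lessThan_add: "(\<Sum>k<a + b::nat. g k) = (\<Sum>k<a. g k) + (\<Sum>k<b. g (a + k) :: 'a::comm_monoid_add)"
  by (induction b) (simp_all add: add.assoc)

text \<open>The matrix of the closed loop \<open>u = K y\<close>, \<open>y = C x\<close>, \<open>s x = A x + B u\<close> in the unknowns \<open>(u, y, x)\<close>.\<close>

definition loop_mat :: "nat \<Rightarrow> nat \<Rightarrow> (nat \<Rightarrow> nat \<Rightarrow> complex) \<Rightarrow> (nat \<Rightarrow> nat \<Rightarrow> complex) \<Rightarrow> (nat \<Rightarrow> nat \<Rightarrow> complex) \<Rightarrow>
    (nat \<Rightarrow> nat \<Rightarrow> complex) \<Rightarrow> complex \<Rightarrow> nat \<Rightarrow> nat \<Rightarrow> complex" where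
  "loop_mat m p A B C K s i j =
    (if i < m then (if j < m + p then xent m K i j else 0)
     else if i < m + p then (if j < m + p then (if i = j then 1 else 0) else - C (i - m) (j - (m + p)))
     else if j < m then - B (i - (m + p)) j
     else if j < m + p then 0 else (if i = j then s else 0) - A (i - (m + p)) (j - (m + p)))"

text \<open>A Schur complement: the unipotent lower triangular \<open>L\<close> eliminates
  \<open>u\<close> and \<open>y\<close> from the state equations, leaving a block upper triangular
  matrix with a unipotent block and the closed-loop matrix.\<close>

lemma fdet_loop_mat:
  "fdet (m + p + n) (loop_mat m p A B C K s) =
    fdet n (\<lambda>i j. (if i = j then s else 0) - (A i j + (\<Sum>a<m. \<Sum>b<p. B i a * K a b * C b j)))"
proof -
  let ?Z = "loop_mat m p A B C K s"
  define L where "L = (\<lambda>i k. if i < m + p then (if i = k then 1 else 0)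
    else if k < m then B (i - (m + p)) k else if k < m + p then (\<Sum>a<m. B (i - (m + p)) a * K a (k - m))
    else (if i = k then 1 else (0::complex)))"
  define Q where "Q = (\<lambda>i j. \<Sum>k<m + p + n. L i k * ?Z k j)"
  have "fdet (m + p + n) L = (\<Prod>i<m + p + n. L i i)" by (rule fdet_lower_triangular) (auto simp: L_def)
  also have "\<dots> = 1" by (rule prod.neutral) (auto simp: L_def)
  finally have "fdet (m + p + n) ?Z = fdet (m + p + n) Q" unfolding Q_def fdet_mult by simp
  have Q1: "Q i j = ?Z i j" if "i < m + p" for i j
    using that unfolding Q_def L_def by (simp add: if_distrib[of "\<lambda>z. z * _"] cong: if_cong)
  have Q2: "Q (m + p + i) j = (\<Sum>k<m. B i k * ?Z k j) + (\<Sum>k<p. (\<Sum>a<m. B i a * K a k) * ?Z (m + k) j) + ?Z (m + p + i) j"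
    if "i < n" for i j
    using that unfolding Q_def sum_lessThan_add L_def by (simp add: if_distrib[of "\<lambda>z. z * _"] cong: if_cong)
  have z: "Q i j = 0" if i: "m + p \<le> i" "i < m + p + n" and j: "j < m + p" for i j
  proof -
    obtain i' where i': "i = m + p + i'" "i' < n" using i by (metis le_iff_add nat_add_left_cancel_less)
    show ?thesis
    proof (cases "j < m")
      case True
      have "(\<Sum>k<m. B i' k * ?Z k j) = B i' j"
        using True by (simp add: loop_mat_def xent_def if_distrib[of "\<lambda>z. _ * z"] cong: if_cong)
      moreover have "(\<Sum>k<p. (\<Sum>a<m. B i' a * K a k) * ?Z (m + k) j) = 0"
        using True by (intro sum.neutral) (auto simp: loop_mat_def)
      ultimately show ?thesis using True unfolding i'(1) Q2[OF i'(2)] by (simp add: loop_mat_def)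
    next
      case False
      then obtain j' where j': "j = m + j'" "j' < p" using j by (metis le_iff_add linorder_not_less nat_add_left_cancel_less)
      have "(\<Sum>k<m. B i' k * ?Z k j) = - (\<Sum>k<m. B i' k * K k j')"
        using j' by (simp add: loop_mat_def xent_def sum_negf)
      moreover have "(\<Sum>k<p. (\<Sum>a<m. B i' a * K a k) * ?Z (m + k) j) = (\<Sum>a<m. B i' a * K a j')"
        using j' by (simp add: loop_mat_def if_distrib[of "\<lambda>z. _ * z"] cong: if_cong)
      ultimately show ?thesis using j' unfolding i'(1) Q2[OF i'(2)] by (simp add: loop_mat_def)
    qed
  qed
  have "fdet (m + p + n) Q = fdet (m + p) Q * fdet n (\<lambda>i j. Q (i + (m + p)) (j + (m + p)))"
    by (rule fdet_block_lower_zero) (rule z)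
  moreover have "fdet (m + p) Q = 1"
  proof -
    have "fdet (m + p) Q = (\<Prod>i<m + p. Q i i)"
      by (rule fdet_upper_triangular) (auto simp: Q1 loop_mat_def xent_def)
    also have "\<dots> = 1" by (rule prod.neutral) (auto simp: Q1 loop_mat_def xent_def)
    finally show ?thesis .
  qed
  moreover have "fdet n (\<lambda>i j. Q (i + (m + p)) (j + (m + p))) =
    fdet n (\<lambda>i j. (if i = j then s else 0) - (A i j + (\<Sum>a<m. \<Sum>b<p. B i a * K a b * C b j)))"
  proof (rule fdet_cong)
    fix i j assume ij: "i < n" "j < n"
    have "(\<Sum>k<m. B i k * ?Z k (m + p + j)) = 0" by (intro sum.neutral) (auto simp: loop_mat_def)
    moreover have "(\<Sum>k<p. (\<Sum>a<m. B i a * K a k) * ?Z (m + k) (m + p + j)) = - (\<Sum>a<m. \<Sum>b<p. B i a * K a b * C b j)"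
    proof -
      have "(\<Sum>k<p. (\<Sum>a<m. B i a * K a k) * ?Z (m + k) (m + p + j)) = - (\<Sum>k<p. \<Sum>a<m. B i a * K a k * C k j)"
        by (simp add: loop_mat_def sum_negf sum_distrib_right)
      then show ?thesis by (simp add: sum.swap[of _ "{..<p}"])
    qed
    moreover have "?Z (m + p + i) (m + p + j) = (if i = j then s else 0) - A i j" by (simp add: loop_mat_def)
    ultimately show "Q (i + (m + p)) (j + (m + p)) = (if i = j then s else 0) - (A i j + (\<Sum>a<m. \<Sum>b<p. B i a * K a b * C b j))"
      using Q2[OF ij(1), of "m + p + j"] by (simp add: add.commute)
  qed
  ultimately show ?thesis using \<open>fdet (m + p + n) ?Z = fdet (m + p + n) Q\<close> by simp
qed

text \<open>The coefficient of the minor \<open>pluecker m f K\<close> in \<open>m!\<close> times the closed-loop characteristic polynomial.\<close>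

definition loop_coeff :: "nat \<Rightarrow> nat \<Rightarrow> nat \<Rightarrow> (nat \<Rightarrow> nat \<Rightarrow> complex) \<Rightarrow> (nat \<Rightarrow> nat \<Rightarrow> complex) \<Rightarrow> (nat \<Rightarrow> nat \<Rightarrow> complex) \<Rightarrow>
    (nat \<Rightarrow> nat) \<Rightarrow> complex poly" where
  "loop_coeff m p n A B C f = fdet (m + p + n) (\<lambda>i j.
    if i < m then (if j = f i then 1 else 0)
     else if i < m + p then (if j < m + p then (if i = j then 1 else 0) else [: - C (i - m) (j - (m + p)) :])
     else if j < m then [: - B (i - (m + p)) j :]
     else if j < m + p then 0 else [: - A (i - (m + p)) (j - (m + p)), if i = j then 1 else 0 :])"

lemma sum_letters:
  "(\<Sum>f\<in>{..<m} \<rightarrow>\<^sub>E {..<m + p}. pluecker m f K * c f) = (\<Sum>f\<in>letters m p. pluecker m f K * c f)"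
  by (rule sum.mono_neutral_right) (auto simp: letters_def pluecker_not_inj finite_PiE)

text \<open>Only the first \<open>m\<close> rows contain \<open>K\<close>. Expanding them over
  ordered column selections and symmetrising produces the minors; the factor \<open>fact m\<close>
  is the price of the ordering.\<close>

lemma loop_laplace:
  "of_nat (fact m) * fdet (m + p + n) (loop_mat m p A B C K s) =
    (\<Sum>f\<in>letters m p. pluecker m f K * poly (loop_coeff m p n A B C f) s)"
proof -
  let ?Z = "loop_mat m p A B C K s"
  define c where "c = (\<lambda>f. fdet (m + p + n) (\<lambda>i j. if i < m then (if j = f i then 1 else 0) else ?Z i j))"
  have c: "poly (loop_coeff m p n A B C f) s = c f" for f
    unfolding loop_coeff_def poly_fdet c_def by (rule fdet_cong) (auto simp: loop_mat_def)
  have "fdet (m + p + n) ?Z = fdet (m + p + n) (\<lambda>i j. if i < m then \<Sum>q<m + p. xent m K i q * (if j = q then 1 else 0) else ?Z i j)"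
    by (rule fdet_cong) (auto simp: loop_mat_def if_distrib[of "\<lambda>z. _ * z"] cong: if_cong)
  also have "\<dots> = (\<Sum>f\<in>{..<m} \<rightarrow>\<^sub>E {..<m + p}. (\<Prod>i<m. xent m K i (f i)) * c f)"
    unfolding c_def by (rule fdet_expand_rows) simp
  finally have "of_nat (fact m) * fdet (m + p + n) ?Z =
      of_nat (fact m) * (\<Sum>f\<in>{..<m} \<rightarrow>\<^sub>E {..<m + p}. (\<Prod>i<m. xent m K i (f i)) * c f)" by simp
  also have "\<dots> = (\<Sum>f\<in>{..<m} \<rightarrow>\<^sub>E {..<m + p}. fdet m (\<lambda>i k. xent m K i (f k)) * c f)"
  proof (rule PiE_alternating_sum)
    fix f \<sigma> assume \<sigma>: "\<sigma> permutes {..<m}"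
    have \<sigma>': "\<sigma> permutes {..<m + p + n}" by (rule permutes_subset[OF \<sigma>]) auto
    define e where "e = (\<lambda>i j. if i < m then (if j = f i then 1 else 0) else ?Z i j)"
    have "c (f \<circ> \<sigma>) = fdet (m + p + n) (\<lambda>i. e (\<sigma> i))"
      unfolding c_def e_def
    proof (rule fdet_cong)
      fix i j
      show "(if i < m then if j = (f \<circ> \<sigma>) i then 1 else 0 else ?Z i j) =
        (if \<sigma> i < m then if j = f (\<sigma> i) then 1 else 0 else ?Z (\<sigma> i) j)"
        using permutes_less[OF \<sigma>, of i] permutes_not_in[OF \<sigma>, of i] by auto
    qed
    also have "\<dots> = of_int (sign \<sigma>) * fdet (m + p + n) e" by (rule fdet_permute_rows[OF \<sigma>'])
    finally show "c (f \<circ> \<sigma>) = of_int (sign \<sigma>) * c f" by (simp only: c_def e_def)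
  qed
  also have "\<dots> = (\<Sum>f\<in>letters m p. pluecker m f K * c f)"
    unfolding pluecker_def[symmetric] by (rule sum_letters)
  finally show ?thesis by (simp only: c)
qed

section \<open>A system with weighted homogeneous pole placement map\<close>

text \<open>A sparse polynomial cannot vanish to high order at \<open>1\<close>. A power of the
  variable, which is harmless at \<open>1\<close>, is divided out; differentiation then removes
  exactly the constant term and lowers a positive order by exactly one.\<close>

lemma order_one_less_card_support:
  fixes q :: "complex poly"
  assumes "q \<noteq> 0"
  shows "order 1 q < card {i. coeff q i \<noteq> 0}"
  using assms
proof (induction "order 1 q" arbitrary: q rule: less_induct)
  case less
  have fin: "finite {i. coeff q i \<noteq> 0}" for q :: "complex poly"
    by (rule finite_subset[of _ "{..degree q}"]) (auto intro: le_degree)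
  define a where "a = (LEAST i. coeff q i \<noteq> 0)"
  have a: "coeff q a \<noteq> 0" unfolding a_def
    by (rule LeastI_ex) (use less.prems in \<open>auto simp: poly_eq_iff\<close>)
  have a0: "coeff q i = 0" if "i < a" for i using not_less_Least[OF that[unfolded a_def]] by simp
  define r where "r = poly_shift a q"
  have cr: "coeff r i = coeff q (i + a)" for i by (simp add: r_def coeff_poly_shift)
  have q: "q = monom 1 a * r"
    by (rule poly_eqI) (auto simp: coeff_monom_mult cr a0)
  have r0: "r \<noteq> 0" "coeff r 0 \<noteq> 0" using q less.prems cr[of 0] a by auto
  have "order 1 (monom 1 a :: complex poly) = 0" by (rule order_0I) (simp add: poly_monom)
  then have ord: "order 1 q = order 1 r"
    using q less.prems by (metis add_0 order_mult)
  have "{i. coeff q i \<noteq> 0} = (\<lambda>i. i + a) ` {i. coeff r i \<noteq> 0}"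
  proof
    show "{i. coeff q i \<noteq> 0} \<subseteq> (\<lambda>i. i + a) ` {i. coeff r i \<noteq> 0}"
    proof
      fix i assume "i \<in> {i. coeff q i \<noteq> 0}"
      then have "a \<le> i" "coeff q i \<noteq> 0" using a0[of i] by (auto simp: not_less[symmetric])
      then show "i \<in> (\<lambda>i. i + a) ` {i. coeff r i \<noteq> 0}" by (intro image_eqI[of _ _ "i - a"]) (auto simp: cr)
    qed
  qed (auto simp: cr)
  then have cs: "card {i. coeff q i \<noteq> 0} = card {i. coeff r i \<noteq> 0}" by (simp add: card_image)
  show ?case
  proof (cases "order 1 r = 0")
    case True
    have "{i. coeff r i \<noteq> 0} \<noteq> {}" using r0(2) by blast
    then show ?thesis using True ord cs fin[of r] by (simp add: card_gt_0_iff)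
  next
    case False
    have pd: "pderiv r \<noteq> 0"
    proof
      assume "pderiv r = 0"
      then obtain c where "r = [:c:]" using pderiv_eq_0_iff degree_eq_zeroE by metis
      then have "order 1 r = 0" using r0(1) by (intro order_0I) auto
      with False show False by simp
    qed
    have o: "order 1 r = Suc (order 1 (pderiv r))" using order_pderiv[OF r0(1)] order_root[of r 1] False by blast
    with pd have "order 1 (pderiv r) < card {i. coeff (pderiv r) i \<noteq> 0}" using less.hyps[of "pderiv r"] ord by simp
    moreover have "{i. coeff r i \<noteq> 0} = insert 0 (Suc ` {i. coeff (pderiv r) i \<noteq> 0})"
    proof
      show "{i. coeff r i \<noteq> 0} \<subseteq> insert 0 (Suc ` {i. coeff (pderiv r) i \<noteq> 0})"
      proof
        fix i assume "i \<in> {i. coeff r i \<noteq> 0}"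
        then show "i \<in> insert 0 (Suc ` {i. coeff (pderiv r) i \<noteq> 0})" by (cases i) (auto simp: coeff_pderiv simp del: of_nat_Suc)
      qed
    qed (use r0(2) in \<open>auto simp: coeff_pderiv\<close>)
    moreover have "card (insert 0 (Suc ` {i. coeff (pderiv r) i \<noteq> 0})) = Suc (card {i. coeff (pderiv r) i \<noteq> 0})"
      using fin[of "pderiv r"] by (subst card_insert_disjoint) (auto simp: card_image)
    ultimately show ?thesis using o ord cs by simp
  qed
qed

text \<open>The coefficient of \<open>x ^ q\<close> in \<open>(s - x) ^ p * x ^ i\<close> is \<open>osc p q i * s ^ (p + i - q)\<close>: these polynomials
  span the osculating spaces of the rational normal curve.\<close>

definition osc :: "nat \<Rightarrow> nat \<Rightarrow> nat \<Rightarrow> complex" where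
  "osc p q i = (if i \<le> q \<and> q \<le> i + p then (-1) ^ (q - i) * of_nat (p choose (q - i)) else 0)"

definition osc_minor :: "nat \<Rightarrow> nat \<Rightarrow> (nat \<Rightarrow> nat) \<Rightarrow> complex" where
  "osc_minor m p f = fdet m (\<lambda>i j. osc p (f i) j)"

lemma osc_minor_permute:
  "\<sigma> permutes {..<m} \<Longrightarrow> osc_minor m p (f \<circ> \<sigma>) = of_int (sign \<sigma>) * osc_minor m p f"
  unfolding osc_minor_def using fdet_permute_rows[of \<sigma> m "\<lambda>i j. osc p (f i) j"] by simp

lemma coeff_one_minus_power: "coeff ([:1, -1:] ^ p) l = ((-1) ^ l * of_nat (p choose l) :: complex)"
proof (induction p arbitrary: l)
  case 0
  then show ?case by (cases l) auto
next
  case (Suc p)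
  show ?case by (cases l) (simp_all add: Suc coeff_pCons algebra_simps)
qed

text \<open>A kernel vector would be a nonzero polynomial \<open>a\<close> of degree below
  \<open>m\<close> such that \<open>(1 - X) ^ p * a\<close> has zero coefficients in the
  \<open>m\<close> positions \<open>f i\<close>. At most \<open>p\<close> coefficients remain, yet
  the product vanishes at \<open>1\<close> to order at least \<open>p\<close>, against
  \<open>order_one_less_card_support\<close>.\<close>

lemma osc_minor_nonzero:
  assumes f: "f \<in> letters m p"
  shows "osc_minor m p f \<noteq> 0"
proof
  assume "osc_minor m p f = 0"
  from fdet_zero_kernel[OF this[unfolded osc_minor_def]]
  obtain v where v: "\<exists>j<m. v j \<noteq> 0" "\<And>i. i < m \<Longrightarrow> (\<Sum>j<m. osc p (f i) j * v j) = 0" by blast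
  define a where "a = (\<Sum>j<m. monom (v j) j)"
  have ca: "coeff a j = (if j < m then v j else 0)" for j by (simp add: a_def coeff_sum)
  have a0: "a \<noteq> 0" using v(1) ca by (metis coeff_0)
  define q where "q = [:1, -1:] ^ p * a"
  have q0: "q \<noteq> 0" using a0 by (simp add: q_def)
  have cq: "coeff q i = (\<Sum>j<m. osc p i j * v j)" for i
  proof -
    have "coeff q i = (\<Sum>j\<le>i. coeff a j * coeff ([:1, -1:] ^ p) (i - j))" by (simp add: q_def mult.commute[of _ a] coeff_mult)
    also have "\<dots> = (\<Sum>j\<in>{..i} \<inter> {..<m}. v j * ((-1) ^ (i - j) * of_nat (p choose (i - j))))"
      by (rule sum.mono_neutral_cong_right) (auto simp: ca coeff_one_minus_power)
    also have "\<dots> = (\<Sum>j<m. osc p i j * v j)"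
    proof (rule sum.mono_neutral_cong_left)
      show "\<forall>j\<in>{..<m} - {..i} \<inter> {..<m}. osc p i j * v j = 0" by (auto simp: osc_def)
      fix j assume "j \<in> {..i} \<inter> {..<m}"
      then show "v j * ((-1) ^ (i - j) * of_nat (p choose (i - j))) = osc p i j * v j"
        by (auto simp: osc_def binomial_eq_0)
    qed auto
    finally show ?thesis .
  qed
  have "{i. coeff q i \<noteq> 0} \<subseteq> {..<m + p} - f ` {..<m}"
  proof
    fix i assume i: "i \<in> {i. coeff q i \<noteq> 0}"
    then have "i \<notin> f ` {..<m}" using v(2) by (auto simp: cq)
    moreover have "i < m + p"
    proof (rule ccontr)
      assume "\<not> i < m + p"
      then have "coeff q i = 0" unfolding cq by (intro sum.neutral) (auto simp: osc_def)
      then show False using i by simp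
    qed
    ultimately show "i \<in> {..<m + p} - f ` {..<m}" by simp
  qed
  then have "card {i. coeff q i \<noteq> 0} \<le> card ({..<m + p} - f ` {..<m})" by (rule card_mono[rotated]) simp
  also have "\<dots> = card {..<m + p} - card (f ` {..<m})" using f by (intro card_Diff_subset) (auto simp: letters_def PiE_iff)
  also have "card (f ` {..<m}) = m" using f by (simp add: letters_def card_image)
  finally have "card {i. coeff q i \<noteq> 0} \<le> p" by simp
  moreover have "order 1 q < card {i. coeff q i \<noteq> 0}" by (rule order_one_less_card_support[OF q0])
  moreover have "p \<le> order 1 q"
  proof -
    have "[:1, -1:] = Polynomial.smult (-1) [:- 1, 1 :: complex:]" by simp
    then have "[:1, -1:] ^ p = Polynomial.smult ((-1) ^ p) ([:- 1, 1 :: complex:] ^ p)" by (simp only: smult_power)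
    then have "[:- 1, 1:] ^ p dvd q" unfolding q_def by (simp add: dvd_smult dvd_mult2)
    then show ?thesis using q0 by (simp add: order_divides)
  qed
  ultimately show False by simp
qed

text \<open>Every nonvanishing term of the expansion carries the same total power of
  \<open>s\<close>. Where the subtraction \<open>p + j - f i\<close> would be truncated, the factor
  \<open>osc\<close> is \<open>0\<close>.\<close>

lemma osc_scaled_minor:
  assumes f: "f \<in> letters m p" and s: "s \<noteq> 0"
  shows "fdet m (\<lambda>i j. osc p (f i) j * s ^ (p + j - f i)) = osc_minor m p f * s ^ (m * p - rank m f)"
  unfolding fdet_def osc_minor_def sum_distrib_right
proof (rule sum.cong[OF refl])
  fix \<pi> assume "\<pi> \<in> {\<pi>. \<pi> permutes {..<m}}"
  then have \<pi>: "\<pi> permutes {..<m}" by simp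
  show "of_int (sign \<pi>) * (\<Prod>i<m. osc p (f i) (\<pi> i) * s ^ (p + \<pi> i - f i))
    = of_int (sign \<pi>) * (\<Prod>i<m. osc p (f i) (\<pi> i)) * s ^ (m * p - rank m f)"
  proof (cases "\<forall>i<m. f i \<le> p + \<pi> i")
    case True
    have "(\<Sum>i<m. p + \<pi> i - f i) + (\<Sum>i<m. f i) = (\<Sum>i<m. p + \<pi> i)"
      unfolding sum.distrib[symmetric] by (rule sum.cong) (use True in auto)
    moreover have "(\<Sum>i<m. p + \<pi> i) = m * p + (\<Sum>i<m. i)"
      unfolding sum.distrib using sum.permute[OF \<pi>, of id] by simp
    ultimately have "(\<Sum>i<m. p + \<pi> i - f i) = m * p - rank m f" using rank_eq[OF f] by linarith
    then show ?thesis by (simp add: prod.distrib mult.assoc power_sum[symmetric])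
  next
    case False
    then obtain i where i: "i < m" "\<not> f i \<le> p + \<pi> i" by blast
    then have z: "osc p (f i) (\<pi> i) = 0" by (simp add: osc_def)
    have z1: "(\<Prod>i<m. osc p (f i) (\<pi> i) * s ^ (p + \<pi> i - f i)) = 0" by (rule prod_zero) (use i(1) z in auto)
    have z2: "(\<Prod>i<m. osc p (f i) (\<pi> i)) = 0" by (rule prod_zero) (use i(1) z in auto)
    show ?thesis unfolding z1 z2 by simp
  qed
qed

text \<open>State \<open>l\<close> of the special system is the \<open>(l mod p)\<close>-th derivative in the chain of input
  \<open>m - 1 - l div p\<close>; with this numbering \<open>A\<close> is strictly upper triangular.\<close>

definition sysA :: "nat \<Rightarrow> nat \<Rightarrow> nat \<Rightarrow> nat \<Rightarrow> complex" where
  "sysA m p l l' = (if Suc (l mod p) < p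
    then (if l' div p = l div p \<and> l' mod p = Suc (l mod p) then 1 else 0)
    else (if m - 1 - l' div p < m - 1 - l div p \<and> l' mod p + (m - 1 - l div p) = p + (m - 1 - l' div p)
      then - osc p (m - 1 - l div p) (m - 1 - l' div p) else 0))"

definition sysB :: "nat \<Rightarrow> nat \<Rightarrow> nat \<Rightarrow> nat \<Rightarrow> complex" where
  "sysB m p l a = (if Suc (l mod p) = p \<and> a = m - 1 - l div p then 1 else 0)"

definition sysC :: "nat \<Rightarrow> nat \<Rightarrow> nat \<Rightarrow> nat \<Rightarrow> complex" where
  "sysC m p b l = (if l mod p + m + b = p + (m - 1 - l div p) then osc p (m + b) (m - 1 - l div p) else 0)"

text \<open>Column \<open>a\<close> lists \<open>1, s, ..., s ^ (p - 1)\<close> along the chain of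
  input \<open>a\<close>. If \<open>D\<close> and \<open>N\<close> are the first \<open>m\<close>
  and the last \<open>p\<close> rows of the matrix with entries
  \<open>osc p q a * s ^ (p + a - q)\<close>, then \<open>(s - A) Psi = B D\<close> and
  \<open>C Psi = N\<close>: a polynomial matrix fraction description of the system.\<close>

definition sysPsi :: "nat \<Rightarrow> nat \<Rightarrow> complex \<Rightarrow> nat \<Rightarrow> nat \<Rightarrow> complex" where
  "sysPsi m p s l a = (if a = m - 1 - l div p then s ^ (l mod p) else 0)"

lemma sum_blocks: "(\<Sum>l<m * p :: nat. g l) = (\<Sum>c<m. \<Sum>k<p. g (c * p + k) :: 'a::comm_monoid_add)"
proof (induction m)
  case (Suc m)
  have "(\<Sum>l<Suc m * p. g l) = (\<Sum>l<m * p + p. g l)" by (simp add: add.commute)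
  then show ?case using Suc by (simp add: sum_lessThan_add)
qed simp

lemma prod_blocks: "(\<Prod>l<m * p :: nat. g l) = (\<Prod>c<m. \<Prod>k<p. g (c * p + k) :: 'a::comm_monoid_mult)"
proof (induction m)
  case (Suc m)
  have "(\<Prod>l<a + b. g l) = (\<Prod>l<a. g l) * (\<Prod>k<b. g (a + k))" for a b :: nat
    by (induction b) (simp_all add: mult.assoc)
  then have "(\<Prod>l<m * p + p. g l) = (\<Prod>l<m * p. g l) * (\<Prod>k<p. g (m * p + k))" by blast
  then show ?case using Suc by (simp add: add.commute)
qed simp

lemma sum_sysPsi:
  assumes a: "a < m"
  shows "(\<Sum>l<m * p. g l * sysPsi m p s l a) = (\<Sum>k<p. g ((m - 1 - a) * p + k) * s ^ k)"
proof -
  have "(\<Sum>l<m * p. g l * sysPsi m p s l a) = (\<Sum>c<m. if c = m - 1 - a then \<Sum>k<p. g (c * p + k) * s ^ k else 0)"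
    unfolding sum_blocks
  proof (rule sum.cong[OF refl])
    fix c assume "c \<in> {..<m}"
    then have "a = m - 1 - c \<longleftrightarrow> c = m - 1 - a" using a by auto
    then show "(\<Sum>k<p. g (c * p + k) * sysPsi m p s (c * p + k) a) = (if c = m - 1 - a then \<Sum>k<p. g (c * p + k) * s ^ k else 0)"
      by (auto simp: sysPsi_def)
  qed
  also have "\<dots> = (\<Sum>k<p. g ((m - 1 - a) * p + k) * s ^ k)" using a by simp
  finally show ?thesis .
qed

lemma sysC_Psi:
  assumes a: "a < m" and b: "b < p"
  shows "(\<Sum>l<m * p. sysC m p b l * sysPsi m p s l a) = osc p (m + b) a * s ^ (p + a - (m + b))"
proof -
  have i: "m - 1 - (m - 1 - a) = a" using a by simp
  have "(\<Sum>l<m * p. sysC m p b l * sysPsi m p s l a) = (\<Sum>k<p. if k = p + a - (m + b) then (if m + b \<le> p + a then osc p (m + b) a * s ^ k else 0) else 0)"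
    unfolding sum_sysPsi[OF a]
  proof (rule sum.cong[OF refl])
    fix k assume "k \<in> {..<p}"
    then have dm: "((m - 1 - a) * p + k) div p = m - 1 - a" "((m - 1 - a) * p + k) mod p = k" by simp_all
    have "k + m + b = p + a \<longleftrightarrow> k = p + a - (m + b) \<and> m + b \<le> p + a" by linarith
    then show "sysC m p b ((m - 1 - a) * p + k) * s ^ k = (if k = p + a - (m + b) then (if m + b \<le> p + a then osc p (m + b) a * s ^ k else 0) else 0)"
      unfolding sysC_def dm i by simp
  qed
  also have "\<dots> = osc p (m + b) a * s ^ (p + a - (m + b))" using a b by (auto simp: osc_def)
  finally show ?thesis .
qed

text \<open>Inside a chain \<open>A\<close> passes to the next derivative and both sides vanish. In
  the last row of a chain, \<open>s ^ p\<close> is the diagonal entry of the lower triangular matrix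
  \<open>D\<close>, and the entries of \<open>A\<close> there feed back its remaining terms.\<close>

lemma sysA_Psi:
  assumes a: "a < m" and l: "l < m * p"
  shows "(\<Sum>l'<m * p. ((if l = l' then s else 0) - sysA m p l l') * sysPsi m p s l' a)
    = (\<Sum>i<m. sysB m p l i * (osc p i a * s ^ (p + a - i)))"
proof -
  define c where "c = l div p"
  define i where "i = m - 1 - c"
  have p: "p > 0" using l by (cases p) auto
  have c: "c < m" using l p by (simp add: c_def div_less_iff_less_mult)
  have lk: "l mod p < p" using p by simp
  have bk: "m - 1 - (m - 1 - a) = a" using a by simp
  have ai: "m - 1 - a = c \<longleftrightarrow> a = i" using a c by (auto simp: i_def)
  have e1: "(\<Sum>l'<m * p. ((if l = l' then s else 0) - sysA m p l l') * sysPsi m p s l' a)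
     = s * sysPsi m p s l a - (\<Sum>l'<m * p. sysA m p l l' * sysPsi m p s l' a)"
    using l by (simp add: left_diff_distrib sum_subtractf if_distrib[of "\<lambda>z. z * _"] cong: if_cong)
  have e2: "sysPsi m p s l a = (if a = i then s ^ (l mod p) else 0)" by (simp add: sysPsi_def i_def c_def)
  have e3: "(\<Sum>i'<m. sysB m p l i' * (osc p i' a * s ^ (p + a - i'))) = (if Suc (l mod p) = p then osc p i a * s ^ (p + a - i) else 0)"
  proof -
    have "(\<Sum>i'<m. sysB m p l i' * (osc p i' a * s ^ (p + a - i'))) = (\<Sum>i'<m. if i' = i then (if Suc (l mod p) = p then osc p i' a * s ^ (p + a - i') else 0) else 0)"
      by (rule sum.cong[OF refl]) (auto simp: sysB_def i_def c_def)
    also have "\<dots> = (if Suc (l mod p) = p then osc p i a * s ^ (p + a - i) else 0)" using c by (simp add: i_def)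
    finally show ?thesis .
  qed
  show ?thesis
  proof (cases "Suc (l mod p) < p")
    case True
    have "(\<Sum>l'<m * p. sysA m p l l' * sysPsi m p s l' a) = (\<Sum>k<p. if k = Suc (l mod p) then (if a = i then s ^ k else 0) else 0)"
      unfolding sum_sysPsi[OF a]
    proof (rule sum.cong[OF refl])
      fix k assume "k \<in> {..<p}"
      then show "sysA m p l ((m - 1 - a) * p + k) * s ^ k = (if k = Suc (l mod p) then (if a = i then s ^ k else 0) else 0)"
        using True ai by (auto simp: sysA_def c_def)
    qed
    also have "\<dots> = (if a = i then s ^ Suc (l mod p) else 0)" using True by simp
    finally show ?thesis unfolding e1 e2 e3 using True by auto
  next
    case False
    then have Sp: "Suc (l mod p) = p" using lk by simp
    have "(\<Sum>l'<m * p. sysA m p l l' * sysPsi m p s l' a) = (\<Sum>k<p. if k = p + a - i then (if a < i \<and> i \<le> p + a then - osc p i a * s ^ k else 0) else 0)"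
      unfolding sum_sysPsi[OF a]
    proof (rule sum.cong[OF refl])
      fix k assume k: "k \<in> {..<p}"
      have "sysA m p l ((m - 1 - a) * p + k) = (if a < i \<and> k + i = p + a then - osc p i a else 0)"
      proof -
        have dm: "((m - 1 - a) * p + k) div p = m - 1 - a" "((m - 1 - a) * p + k) mod p = k" using k by simp_all
        show ?thesis unfolding sysA_def dm bk i_def c_def using False by simp
      qed
      then show "sysA m p l ((m - 1 - a) * p + k) * s ^ k = (if k = p + a - i then (if a < i \<and> i \<le> p + a then - osc p i a * s ^ k else 0) else 0)"
        using k by auto
    qed
    also have "\<dots> = (if a < i \<and> i \<le> p + a then - osc p i a * s ^ (p + a - i) else 0)" using p by auto
    finally have A: "(\<Sum>l'<m * p. sysA m p l l' * sysPsi m p s l' a) = (if a < i \<and> i \<le> p + a then - osc p i a * s ^ (p + a - i) else 0)" .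
    have "s * s ^ (l mod p) = s ^ p" using Sp by (metis power_Suc)
    then show ?thesis unfolding e1 e2 e3 A using Sp by (auto simp: osc_def)
  qed
qed

lemma sysA_upper:
  assumes l: "l < m * p" and l': "l' < m * p" and nz: "sysA m p l l' \<noteq> 0"
  shows "l < l'"
proof -
  have p: "p > 0" using l by (cases p) auto
  have c: "l div p < m" "l' div p < m" using l l' p by (simp_all add: div_less_iff_less_mult)
  show ?thesis
  proof (cases "Suc (l mod p) < p")
    case True
    then have "l' div p = l div p" "l' mod p = Suc (l mod p)" using nz by (auto simp: sysA_def split: if_splits)
    then show ?thesis by (metis div_mult_mod_eq less_add_Suc1 lessI nat_add_left_cancel_less)
  next
    case False
    then have "m - 1 - l' div p < m - 1 - l div p" using nz by (auto simp: sysA_def split: if_splits)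
    then have "l div p < l' div p" by simp
    then show ?thesis by (meson div_le_mono leD leI)
  qed
qed

text \<open>Multiplying the closed-loop matrix by the kernel vectors \<open>(D, N, Psi)\<close> of its last two block rows
  reduces the characteristic polynomial of the special system to an \<open>m\<close> by \<open>m\<close> determinant.\<close>

lemma sys_charpoly:
  assumes s: "s \<noteq> 0"
  shows "fdet (m + p + m * p) (loop_mat m p (sysA m p) (sysB m p) (sysC m p) K s) =
    fdet m (\<lambda>i j. \<Sum>q<m + p. xent m K i q * (osc p q j * s ^ (p + j - q)))"
proof -
  define n where "n = m * p"
  let ?Z = "loop_mat m p (sysA m p) (sysB m p) (sysC m p) K s"
  let ?W = "\<lambda>q j. osc p q j * s ^ (p + j - q)"
  \<comment> \<open>The kernel vectors completed by unit columns, so that the determinant of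
    \<open>V\<close> is that of \<open>D\<close>, namely \<open>s ^ n\<close>. The product with the
    loop matrix is block upper triangular and contributes another \<open>s ^ n\<close> through
    \<open>s - A\<close>; the two cancel as \<open>s \<noteq> 0\<close>.\<close>
  define V where "V = (\<lambda>i j. if j < m then (if i < m + p then ?W i j else sysPsi m p s (i - (m + p)) j) else if i = j then 1 else 0)"
  define Q where "Q = (\<lambda>i j. \<Sum>k<m + p + n. ?Z i k * V k j)"
  have Q1: "Q i j = (\<Sum>k<m. ?Z i k * ?W k j) + (\<Sum>k<p. ?Z i (m + k) * ?W (m + k) j) + (\<Sum>k<n. ?Z i (m + p + k) * sysPsi m p s k j)"
    if "j < m" for i j
    using that unfolding Q_def sum_lessThan_add V_def by simp
  have Q2: "Q i j = ?Z i j" if "m \<le> j" "j < m + p + n" for i j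
    using that unfolding Q_def V_def by (simp add: if_distrib[of "\<lambda>z. _ * z"] cong: if_cong)
  have zero: "Q i j = 0" if i: "m \<le> i" "i < m + (p + n)" and j: "j < m" for i j
  proof (cases "i < m + p")
    case True
    then obtain b where b: "i = m + b" "b < p" using i(1) by (metis le_iff_add nat_add_left_cancel_less)
    have "(\<Sum>k<m. ?Z i k * ?W k j) = 0" using b by (intro sum.neutral) (auto simp: loop_mat_def)
    moreover have "(\<Sum>k<p. ?Z i (m + k) * ?W (m + k) j) = ?W (m + b) j"
      using b by (simp add: loop_mat_def if_distrib[of "\<lambda>z. z * _"] cong: if_cong)
    moreover have "(\<Sum>k<n. ?Z i (m + p + k) * sysPsi m p s k j) = - ?W (m + b) j"
      using b sysC_Psi[OF j b(2), of s] by (simp add: loop_mat_def sum_negf n_def)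
    ultimately show ?thesis unfolding Q1[OF j] by simp
  next
    case False
    then obtain l where l: "i = m + p + l" "l < n" using i(2) by (metis add.assoc le_iff_add linorder_not_less nat_add_left_cancel_less)
    have "(\<Sum>k<m. ?Z i k * ?W k j) = - (\<Sum>k<m. sysB m p l k * ?W k j)"
      using l by (simp add: loop_mat_def sum_negf)
    moreover have "(\<Sum>k<p. ?Z i (m + k) * ?W (m + k) j) = 0" using l by (intro sum.neutral) (auto simp: loop_mat_def)
    moreover have "(\<Sum>k<n. ?Z i (m + p + k) * sysPsi m p s k j) = (\<Sum>k<n. ((if l = k then s else 0) - sysA m p l k) * sysPsi m p s k j)"
      using l by (simp add: loop_mat_def)
    moreover have "\<dots> = (\<Sum>k<m. sysB m p l k * ?W k j)"
      unfolding n_def by (rule sysA_Psi[OF j]) (use l in \<open>simp add: n_def\<close>)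
    ultimately show ?thesis unfolding Q1[OF j] by simp
  qed
  have detQ: "fdet (m + (p + n)) Q = fdet m Q * fdet (p + n) (\<lambda>i j. Q (i + m) (j + m))"
    by (rule fdet_block_lower_zero) (rule zero)
  have Qtop: "fdet m Q = fdet m (\<lambda>i j. \<Sum>q<m + p. xent m K i q * ?W q j)"
  proof (rule fdet_cong)
    fix i j assume ij: "i < m" "j < m"
    have "(\<Sum>k<n. ?Z i (m + p + k) * sysPsi m p s k j) = 0" using ij by (intro sum.neutral) (auto simp: loop_mat_def)
    then show "Q i j = (\<Sum>q<m + p. xent m K i q * ?W q j)"
      unfolding Q1[OF ij(2)] sum_lessThan_add using ij by (simp add: loop_mat_def)
  qed
  have "fdet (p + n) (\<lambda>i j. Q (i + m) (j + m)) = fdet p (\<lambda>i j. Q (i + m) (j + m)) * fdet n (\<lambda>i j. Q (i + p + m) (j + p + m))"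
    by (rule fdet_block_lower_zero[where a = "\<lambda>i j. Q (i + m) (j + m)"]) (auto simp: Q2 loop_mat_def)
  moreover have "fdet p (\<lambda>i j. Q (i + m) (j + m)) = fdet p (\<lambda>i j. if i = j then 1 else 0)"
    by (rule fdet_cong) (auto simp: Q2 loop_mat_def)
  moreover have "\<dots> = 1" by (subst fdet_upper_triangular) auto
  moreover have "fdet n (\<lambda>i j. Q (i + p + m) (j + p + m)) = (\<Prod>i<n. Q (i + p + m) (i + p + m))"
  proof (rule fdet_upper_triangular)
    fix i j assume ij: "j < i" "i < n"
    then have "sysA m p i j = 0" using sysA_upper[of i m p j] by (auto simp: n_def)
    then show "Q (i + p + m) (j + p + m) = 0" using ij by (simp add: Q2 loop_mat_def)
  qed
  moreover have "(\<Prod>i<n. Q (i + p + m) (i + p + m)) = (\<Prod>i<n. s)"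
  proof (rule prod.cong[OF refl])
    fix i assume i: "i \<in> {..<n}"
    then have "sysA m p i i = 0" using sysA_upper[of i m p i] by (auto simp: n_def)
    then show "Q (i + p + m) (i + p + m) = s" using i by (simp add: Q2 loop_mat_def)
  qed
  ultimately have detQ': "fdet (m + (p + n)) Q = fdet m (\<lambda>i j. \<Sum>q<m + p. xent m K i q * ?W q j) * s ^ n"
    unfolding detQ Qtop by simp
  have "fdet (m + (p + n)) V = fdet m V * fdet (p + n) (\<lambda>i j. V (i + m) (j + m))"
    by (rule fdet_block_upper_zero) (auto simp: V_def)
  moreover have "fdet (p + n) (\<lambda>i j. V (i + m) (j + m)) = 1"
    by (subst fdet_upper_triangular) (auto simp: V_def)
  moreover have "fdet m V = (\<Prod>i<m. V i i)" by (rule fdet_lower_triangular) (auto simp: V_def osc_def)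
  moreover have "(\<Prod>i<m. V i i) = s ^ n" by (simp add: V_def osc_def n_def mult.commute flip: power_mult)
  ultimately have detV: "fdet (m + (p + n)) V = s ^ n" by simp
  have "fdet (m + (p + n)) ?Z * s ^ n = fdet (m + (p + n)) Q"
    unfolding Q_def detV[symmetric] by (simp only: fdet_mult add.assoc)
  then show ?thesis using detQ' s by (simp add: n_def add.assoc)
qed

lemma sys_charpoly_pluecker:
  assumes s: "s \<noteq> 0"
  shows "of_nat (fact m) * fdet (m + p + m * p) (loop_mat m p (sysA m p) (sysB m p) (sysC m p) K s) =
    (\<Sum>f\<in>letters m p. pluecker m f K * (osc_minor m p f * s ^ (m * p - rank m f)))"
proof -
  define c where "c = (\<lambda>f. fdet m (\<lambda>i j. osc p (f i) j * s ^ (p + j - f i)))"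
  have "fdet m (\<lambda>i j. \<Sum>q<m + p. xent m K i q * (osc p q j * s ^ (p + j - q)))
     = fdet m (\<lambda>i j. if i < m then \<Sum>q<m + p. xent m K i q * (osc p q j * s ^ (p + j - q)) else 0)"
    by (rule fdet_cong) simp
  also have "\<dots> = (\<Sum>f\<in>{..<m} \<rightarrow>\<^sub>E {..<m + p}. (\<Prod>i<m. xent m K i (f i)) *
      fdet m (\<lambda>i j. if i < m then osc p (f i) j * s ^ (p + j - f i) else 0))"
    by (rule fdet_expand_rows[OF order_refl])
  also have "\<dots> = (\<Sum>f\<in>{..<m} \<rightarrow>\<^sub>E {..<m + p}. (\<Prod>i<m. xent m K i (f i)) * c f)"
    unfolding c_def by (intro sum.cong refl arg_cong2[of _ _ _ _ "(*)"] fdet_cong) simp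
  finally have "of_nat (fact m) * fdet (m + p + m * p) (loop_mat m p (sysA m p) (sysB m p) (sysC m p) K s) =
      of_nat (fact m) * (\<Sum>f\<in>{..<m} \<rightarrow>\<^sub>E {..<m + p}. (\<Prod>i<m. xent m K i (f i)) * c f)"
    unfolding sys_charpoly[OF s] by simp
  also have "\<dots> = (\<Sum>f\<in>{..<m} \<rightarrow>\<^sub>E {..<m + p}. fdet m (\<lambda>i k. xent m K i (f k)) * c f)"
  proof (rule PiE_alternating_sum)
    fix f \<sigma> assume \<sigma>: "\<sigma> permutes {..<m}"
    show "c (f \<circ> \<sigma>) = of_int (sign \<sigma>) * c f"
      unfolding c_def using fdet_permute_rows[OF \<sigma>, of "\<lambda>i j. osc p (f i) j * s ^ (p + j - f i)"] by simp
  qed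
  also have "\<dots> = (\<Sum>f\<in>letters m p. pluecker m f K * c f)"
    unfolding pluecker_def[symmetric] by (rule sum_letters)
  also have "\<dots> = (\<Sum>f\<in>letters m p. pluecker m f K * (osc_minor m p f * s ^ (m * p - rank m f)))"
    unfolding c_def by (intro sum.cong refl) (simp add: osc_scaled_minor s)
  finally show ?thesis .
qed

text \<open>The expansion is known for \<open>s \<noteq> 0\<close>, which is enough points to
  identify the two polynomials. Ranks up to \<open>m * p\<close> give distinct exponents
  \<open>m * p - r\<close>, so each coefficient collects exactly one level.\<close>

lemma sys_charpoly_coeff:
  assumes q: "\<And>s. poly q s = fdet (m + p + m * p) (loop_mat m p (sysA m p) (sysB m p) (sysC m p) K s)" and r: "r \<le> m * p"
  shows "coeff q (m * p - r) = level m p (\<lambda>f. osc_minor m p f / of_nat (fact m)) r K"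
proof -
  define h where "h = (\<Sum>f\<in>letters m p. monom (pluecker m f K * osc_minor m p f) (m * p - rank m f))"
  have "Polynomial.smult (of_nat (fact m)) q = h"
  proof (rule ccontr)
    assume "Polynomial.smult (of_nat (fact m)) q \<noteq> h"
    then have fin: "finite {s. poly (Polynomial.smult (of_nat (fact m)) q - h) s = 0}" by (intro poly_roots_finite) simp
    have "poly (Polynomial.smult (of_nat (fact m)) q) s = poly h s" if "s \<noteq> 0" for s
      using sys_charpoly_pluecker[OF that, of m p K] by (simp add: q h_def poly_sum poly_monom mult.assoc)
    then have "- {0} \<subseteq> {s. poly (Polynomial.smult (of_nat (fact m)) q - h) s = 0}" by auto
    then have "finite (- {0 :: complex})" using fin finite_subset by blast
    then show False using infinite_UNIV_char_0[where 'a = complex] by (simp add: Compl_eq_Diff_UNIV)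
  qed
  from arg_cong[OF this, of "\<lambda>q. coeff q (m * p - r)"]
  have "of_nat (fact m) * coeff q (m * p - r) = coeff h (m * p - r)" by simp
  also have "\<dots> = (\<Sum>f\<in>letters m p. if rank m f = r then pluecker m f K * osc_minor m p f else 0)"
    unfolding h_def coeff_sum
  proof (rule sum.cong[OF refl])
    fix f assume "f \<in> letters m p"
    then have "m * p - rank m f = m * p - r \<longleftrightarrow> rank m f = r" using rank_le[of f m p] r by auto
    then show "coeff (monom (pluecker m f K * osc_minor m p f) (m * p - rank m f)) (m * p - r) =
      (if rank m f = r then pluecker m f K * osc_minor m p f else 0)" by simp
  qed
  also have "\<dots> = (\<Sum>f | f \<in> letters m p \<and> rank m f = r. pluecker m f K * osc_minor m p f)"
    by (simp add: sum.inter_filter finite_letters)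
  also have "\<dots> = of_nat (fact m) * level m p (\<lambda>f. osc_minor m p f / of_nat (fact m)) r K"
    unfolding level_def sum_distrib_left by (rule sum.cong) auto
  finally show ?thesis by simp
qed

section \<open>The complex pole placement map\<close>

definition en :: "nat \<Rightarrow> 'a::finite" where "en = (SOME b. bij_betw b {..<CARD('a)} UNIV)"

definition ix :: "'a::finite \<Rightarrow> nat" where "ix = the_inv_into {..<CARD('a)} en"

lemma en_bij: "bij_betw (en :: nat \<Rightarrow> 'a::finite) {..<CARD('a)} UNIV"
proof -
  have "\<exists>b. bij_betw b {..<CARD('a)} (UNIV :: 'a set)"
    using ex_bij_betw_nat_finite[of "UNIV :: 'a set"] by (simp add: atLeast0LessThan)
  then show ?thesis unfolding en_def by (rule someI_ex)
qed

lemma ix_less [simp]: "ix (a :: 'a::finite) < CARD('a)"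
  using the_inv_into_into[of en "{..<CARD('a)}" a "{..<CARD('a)}"] en_bij[where 'a = 'a]
  by (auto simp: ix_def bij_betw_def)

lemma en_ix [simp]: "en (ix (a :: 'a::finite)) = a"
  using f_the_inv_into_f_bij_betw[OF en_bij, of a] by (simp add: ix_def)

lemma ix_en [simp]: "i < CARD('a) \<Longrightarrow> ix (en i :: 'a::finite) = i"
  using the_inv_into_f_f[of en "{..<CARD('a)}" i] en_bij[where 'a = 'a] by (auto simp: ix_def bij_betw_def)

lemma sum_en: "(\<Sum>a\<in>UNIV. g (a :: 'a::finite)) = (\<Sum>i<CARD('a). g (en i) :: 'b::comm_monoid_add)"
  by (rule sum.reindex_bij_betw[OF en_bij, symmetric])

definition ent :: "'a ^ 'c ^ 'r \<Rightarrow> nat \<Rightarrow> nat \<Rightarrow> 'a" where "ent A i j = A $ en i $ en j"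

definition vco :: "nat \<Rightarrow> complex ^ 'n \<Rightarrow> complex" where "vco j v = v $ en j"

text \<open>Row-major numbering; for a feedback, index \<open>l\<close> then carries the weight
  \<open>m + l mod p - l div p\<close>.\<close>

definition mco :: "nat \<Rightarrow> complex ^ 'c ^ 'r \<Rightarrow> complex" where
  "mco l A = ent A (l div CARD('c)) (l mod CARD('c))"

lemma coords_vco: "coords CARD('n) (vco :: nat \<Rightarrow> complex ^ 'n \<Rightarrow> complex)"
  unfolding coords_def
proof (intro conjI allI impI)
  show "linear (vco i :: complex ^ 'n \<Rightarrow> complex)" for i by (rule linearI) (simp_all add: vco_def)
  show "\<exists>v :: complex ^ 'n. \<forall>i<CARD('n). vco i v = c i" for c
    by (intro exI[of _ "\<chi> a. c (ix a)"]) (simp add: vco_def)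
  fix v :: "complex ^ 'n" assume v: "\<forall>i<CARD('n). vco i v = 0"
  have "v $ a = 0" for a using v[rule_format, OF ix_less, of a] by (simp add: vco_def)
  then show "v = 0" by (simp add: Finite_Cartesian_Product.vec_eq_iff)
qed

lemma mco_index: "mco (ix i * CARD('c) + ix j) (A :: complex ^ 'c ^ 'r) = A $ i $ j"
  by (simp add: mco_def ent_def)

lemma index_less: "i < a \<Longrightarrow> j < b \<Longrightarrow> i * b + j < a * (b::nat)"
  using mult_le_mono1[of "Suc i" a b] by simp

lemma coords_mco: "coords (CARD('r) * CARD('c)) (mco :: nat \<Rightarrow> complex ^ 'c ^ 'r \<Rightarrow> complex)"
  unfolding coords_def
proof (intro conjI allI impI)
  show "linear (mco i :: complex ^ 'c ^ 'r \<Rightarrow> complex)" for i by (rule linearI) (simp_all add: mco_def ent_def)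
  show "\<exists>v :: complex ^ 'c ^ 'r. \<forall>i<CARD('r) * CARD('c). mco i v = c i" for c
  proof (intro exI[of _ "\<chi> a b. c (ix a * CARD('c) + ix b)"] allI impI)
    fix i assume "i < CARD('r) * CARD('c)"
    then have "i div CARD('c) < CARD('r)" "i mod CARD('c) < CARD('c)" by (simp_all add: div_less_iff_less_mult)
    then show "mco i (\<chi> (a :: 'r) (b :: 'c). c (ix a * CARD('c) + ix b)) = c i" by (simp add: mco_def ent_def)
  qed
  fix v :: "complex ^ 'c ^ 'r" assume v: "\<forall>i<CARD('r) * CARD('c). mco i v = 0"
  have "v $ a $ b = 0" for a b using v[rule_format, OF index_less[OF ix_less ix_less], of a b] by (simp add: mco_index)
  then show "v = 0" by (simp add: Finite_Cartesian_Product.vec_eq_iff)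
qed

lemma mco_ent: "i < CARD('r) \<Longrightarrow> j < CARD('c) \<Longrightarrow> mco (i * CARD('c) + j) (A :: complex ^ 'c ^ 'r) = ent A i j"
  by (simp add: mco_def)

lemma charpoly_fdet:
  "charpoly (M :: 'a::comm_ring_1 ^ 'n ^ 'n) = fdet CARD('n) (\<lambda>i j. [: - ent M i j, if i = j then 1 else 0 :])"
proof -
  have "charpoly M = fdet CARD('n) (\<lambda>i j. (Finite_Cartesian_Product.mat [:0, 1:] - map_matrix (\<lambda>x. [:x:]) M) $ en i $ (en j :: 'n))"
    unfolding charpoly_def by (rule vec_det_fdet[OF en_bij])
  also have "\<dots> = fdet CARD('n) (\<lambda>i j. [: - ent M i j, if i = j then 1 else 0 :])"
  proof (rule fdet_cong)
    fix i j assume "i < CARD('n)" "j < CARD('n)"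
    then have "(en i :: 'n) = en j \<longleftrightarrow> i = j" using ix_en by metis
    then show "(Finite_Cartesian_Product.mat [:0, 1:] - map_matrix (\<lambda>x. [:x:]) M) $ en i $ (en j :: 'n) = [: - ent M i j, if i = j then 1 else 0 :]"
      by (simp add: Finite_Cartesian_Product.mat_def map_matrix_def ent_def)
  qed
  finally show ?thesis .
qed

lemma charpoly_monic: "charpoly (M :: 'a::comm_ring_1 ^ 'n ^ 'n) \<in> monic_polys CARD('n)"
proof -
  let ?A = "fmat CARD('n) (ent M)"
  have "charpoly M = char_poly ?A" by (simp only: charpoly_fdet char_poly_fmat)
  moreover have "degree (char_poly ?A) = CARD('n) \<and> coeff (char_poly ?A) CARD('n) = 1"
    by (rule degree_monic_char_poly) simp
  ultimately show ?thesis by (simp add: monic_polys_def)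
qed

lemma pole_placement_monic:
  "pole_placement (S :: ('a::comm_ring_1, 'n::finite, 'm::finite, 'p::finite) linsys) K \<in> monic_polys CARD('n)"
  by (simp add: pole_placement_def charpoly_monic split: prod.split)

lemma ent_loop:
  fixes A :: "'a::comm_ring_1 ^ 'n ^ 'n" and B :: "'a ^ 'm ^ 'n" and K :: "'a ^ 'p ^ 'm" and C :: "'a ^ 'n ^ 'p"
  shows "ent (A + B ** K ** C) i j = ent A i j + (\<Sum>a<CARD('m). \<Sum>b<CARD('p). ent B i a * ent K a b * ent C b j)"
proof -
  have "ent (A + B ** K ** C) i j = ent A i j + (\<Sum>b<CARD('p). (\<Sum>a<CARD('m). ent B i a * ent K a b) * ent C b j)"
    by (simp add: ent_def matrix_matrix_mult_def sum_en)
  then show ?thesis by (simp add: sum_distrib_right sum.swap[of _ "{..<CARD('p)}"])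
qed

lemma poly_pole_placement:
  fixes A :: "complex ^ 'n ^ 'n" and B :: "complex ^ 'm ^ 'n" and K :: "complex ^ 'p ^ 'm" and C :: "complex ^ 'n ^ 'p"
  shows "poly (pole_placement (A, B, C) K) s =
    fdet (CARD('m) + CARD('p) + CARD('n)) (loop_mat CARD('m) CARD('p) (ent A) (ent B) (ent C) (ent K) s)"
  unfolding fdet_loop_mat pole_placement_def prod.case charpoly_fdet poly_fdet
  by (rule fdet_cong) (simp add: ent_loop)

lemma coeff_pole_placement:
  fixes A :: "complex ^ 'n ^ 'n" and B :: "complex ^ 'm ^ 'n" and K :: "complex ^ 'p ^ 'm" and C :: "complex ^ 'n ^ 'p"
  shows "of_nat (fact CARD('m)) * coeff (pole_placement (A, B, C) K) l = (\<Sum>f\<in>letters CARD('m) CARD('p).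
    pluecker CARD('m) f (ent K) * coeff (loop_coeff CARD('m) CARD('p) CARD('n) (ent A) (ent B) (ent C) f) l)"
proof -
  have "poly (Polynomial.smult (of_nat (fact CARD('m))) (pole_placement (A, B, C) K)) s =
    poly (\<Sum>f\<in>letters CARD('m) CARD('p). Polynomial.smult (pluecker CARD('m) f (ent K))
      (loop_coeff CARD('m) CARD('p) CARD('n) (ent A) (ent B) (ent C) f)) s" for s
    using loop_laplace[of "CARD('m)" "CARD('p)" "CARD('n)" "ent A" "ent B" "ent C" "ent K" s]
    by (simp add: poly_pole_placement poly_sum)
  then have "Polynomial.smult (of_nat (fact CARD('m))) (pole_placement (A, B, C) K) =
    (\<Sum>f\<in>letters CARD('m) CARD('p). Polynomial.smult (pluecker CARD('m) f (ent K))
      (loop_coeff CARD('m) CARD('p) CARD('n) (ent A) (ent B) (ent C) f))"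
    using poly_eq_poly_eq_iff by blast
  from arg_cong[OF this, of "\<lambda>q. coeff q l"] show ?thesis by (simp add: coeff_sum)
qed

text \<open>Coefficients in descending order without the leading \<open>1\<close>: component
  \<open>j\<close>, counted from \<open>0\<close>, belongs to \<open>s ^ (n - 1 - j)\<close> and so
  has weight \<open>j + 1\<close>.\<close>

definition pvec :: "'a::comm_ring_1 poly \<Rightarrow> 'a ^ 'n" where
  "pvec q = (\<chi> i. coeff q (CARD('n) - 1 - ix i))"

lemma vco_pvec: "j < CARD('n) \<Longrightarrow> vco j (pvec q :: complex ^ 'n) = coeff q (CARD('n) - 1 - j)"
  by (simp add: vco_def pvec_def)

lemma pvec_inj:
  assumes q: "q \<in> monic_polys CARD('n)" "q' \<in> monic_polys CARD('n)" and e: "(pvec q :: 'a::comm_ring_1 ^ 'n) = pvec q'"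
  shows "q = q'"
proof (rule poly_eqI)
  fix l
  show "coeff q l = coeff q' l"
  proof (cases "l < CARD('n)")
    case True
    then have "pvec q $ (en (CARD('n) - 1 - l) :: 'n) = coeff q l" "pvec q' $ (en (CARD('n) - 1 - l) :: 'n) = coeff q' l"
      by (simp_all add: pvec_def)
    then show ?thesis using e by simp
  next
    case False
    then show ?thesis using q by (cases "l = CARD('n)") (auto simp: monic_polys_def coeff_eq_0)
  qed
qed

definition vpoly :: "'a::comm_ring_1 ^ 'n \<Rightarrow> 'a poly" where
  "vpoly v = monom 1 CARD('n) + (\<Sum>i<CARD('n). monom (v $ en (CARD('n) - 1 - i)) i)"

lemma coeff_vpoly: "coeff (vpoly (v :: 'a::comm_ring_1 ^ 'n)) l =
  (if l < CARD('n) then v $ en (CARD('n) - 1 - l) else if l = CARD('n) then 1 else 0)"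
  by (auto simp: vpoly_def coeff_sum)

lemma vpoly_monic: "vpoly (v :: 'a::comm_ring_1 ^ 'n) \<in> monic_polys CARD('n)"
proof -
  have "degree (vpoly v) \<le> CARD('n)" by (rule degree_le) (simp add: coeff_vpoly)
  moreover have "CARD('n) \<le> degree (vpoly v)" by (rule le_degree) (simp add: coeff_vpoly)
  ultimately show ?thesis by (simp add: monic_polys_def coeff_vpoly)
qed

lemma pvec_vpoly [simp]: "pvec (vpoly v) = (v :: 'a::comm_ring_1 ^ 'n)"
  using ix_less[where 'a = 'n] by (simp add: Finite_Cartesian_Product.vec_eq_iff pvec_def coeff_vpoly Suc_leI)

definition Fmap :: "(complex, 'n::finite, 'm::finite, 'p::finite) linsys \<Rightarrow> complex ^ 'p ^ 'm \<Rightarrow> complex ^ 'n" where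
  "Fmap S K = pvec (pole_placement S K)"

lemma Fmap_eq_iff:
  fixes S :: "(complex, 'n::finite, 'm::finite, 'p::finite) linsys"
  assumes "q \<in> monic_polys CARD('n)"
  shows "Fmap S K = pvec q \<longleftrightarrow> pole_placement S K = q"
  unfolding Fmap_def using pvec_inj[OF pole_placement_monic assms, of S K] by auto

abbreviation sco :: "nat \<Rightarrow> (complex, 'n::finite, 'm::finite, 'p::finite) linsys \<Rightarrow> complex" where
  "sco \<equiv> coords_prod (CARD('n) * CARD('n)) mco (coords_prod (CARD('n) * CARD('m)) mco mco)"

lemma coords_sco: "coords (CARD('n) * CARD('n) + (CARD('n) * CARD('m) + CARD('p) * CARD('n)))
    (sco :: nat \<Rightarrow> (complex, 'n::finite, 'm::finite, 'p::finite) linsys \<Rightarrow> complex)"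
  by (intro coords_prod coords_mco)

lemma polyfun_ent:
  assumes "i < CARD('r)" "j < CARD('c)"
  shows "(\<lambda>A. ent A i j) \<in> polyfun ((mco :: nat \<Rightarrow> complex ^ 'c ^ 'r \<Rightarrow> complex) ` {..<CARD('r) * CARD('c)})"
proof -
  have "(\<lambda>A :: complex ^ 'c ^ 'r. ent A i j) = mco (i * CARD('c) + j)" by (rule ext) (simp add: mco_ent assms)
  then show ?thesis using index_less[OF assms] by (simp add: polyfun.base)
qed

lemma polyfun_fst: "f \<in> polyfun (x ` {..<M}) \<Longrightarrow> (\<lambda>v. f (fst v)) \<in> polyfun (coords_prod M x y ` {..<M + N})"
  by (erule polyfun_compose) (auto simp: coords_prod_image intro!: polyfun.base)

lemma polyfun_snd: "f \<in> polyfun (y ` {..<N}) \<Longrightarrow> (\<lambda>v. f (snd v)) \<in> polyfun (coords_prod M x y ` {..<M + N})"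
  by (erule polyfun_compose) (auto simp: coords_prod_image intro!: polyfun.base)

lemma polyfun_sys_ent:
  defines "P \<equiv> polyfun ((sco :: nat \<Rightarrow> (complex, 'n::finite, 'm::finite, 'p::finite) linsys \<Rightarrow> complex) `
    {..<CARD('n) * CARD('n) + (CARD('n) * CARD('m) + CARD('p) * CARD('n))})"
  shows "i < CARD('n) \<Longrightarrow> j < CARD('n) \<Longrightarrow> (\<lambda>S. ent (fst S) i j) \<in> P"
    and "i < CARD('n) \<Longrightarrow> j < CARD('m) \<Longrightarrow> (\<lambda>S. ent (fst (snd S)) i j) \<in> P"
    and "i < CARD('p) \<Longrightarrow> j < CARD('n) \<Longrightarrow> (\<lambda>S. ent (snd (snd S)) i j) \<in> P"
proof -
  show "i < CARD('n) \<Longrightarrow> j < CARD('n) \<Longrightarrow> (\<lambda>S. ent (fst S) i j) \<in> P"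
    unfolding P_def by (rule polyfun_fst[OF polyfun_ent])
  show "i < CARD('n) \<Longrightarrow> j < CARD('m) \<Longrightarrow> (\<lambda>S. ent (fst (snd S)) i j) \<in> P"
    unfolding P_def by (rule polyfun_snd[OF polyfun_fst[OF polyfun_ent]])
  show "i < CARD('p) \<Longrightarrow> j < CARD('n) \<Longrightarrow> (\<lambda>S. ent (snd (snd S)) i j) \<in> P"
    unfolding P_def by (rule polyfun_snd[OF polyfun_snd[OF polyfun_ent]])
qed

lemma Fmap_polyfun:
  fixes x :: "nat \<Rightarrow> complex ^ 'p ^ 'm \<Rightarrow> complex"
  defines "M \<equiv> CARD('n) * CARD('n) + (CARD('n) * CARD('m) + CARD('p) * CARD('n))" and "N \<equiv> CARD('m) * CARD('p)"
  shows "(\<lambda>q. coeff (pole_placement (fst q :: (complex, 'n::finite, 'm::finite, 'p::finite) linsys) (snd q)) l)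
    \<in> polyfun (coords_prod M sco mco ` {..<M + N})"
proof -
  let ?P = "polyfun (coords_prod M (sco :: nat \<Rightarrow> (complex, 'n, 'm, 'p) linsys \<Rightarrow> complex) (mco :: nat \<Rightarrow> complex ^ 'p ^ 'm \<Rightarrow> complex) ` {..<M + N})"
  have eq: "pole_placement (fst q) (snd q) = fdet CARD('n) (\<lambda>i j. [: - (ent (fst (fst q)) i j +
      (\<Sum>a<CARD('m). \<Sum>b<CARD('p). ent (fst (snd (fst q))) i a * ent (snd q) a b * ent (snd (snd (fst q))) b j)),
      if i = j then 1 else 0 :])" for q :: "(complex, 'n, 'm, 'p) linsys \<times> (complex ^ 'p ^ 'm)"
    by (simp add: pole_placement_def split_def charpoly_fdet ent_loop)
  show ?thesis
    unfolding eq
  proof (rule coeff_fdet_polyfun, rule polyfun_coeff_pCons)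
    fix i j assume ij: "i < CARD('n)" "j < CARD('n)"
    show "(\<lambda>q. - (ent (fst (fst q)) i j + (\<Sum>a<CARD('m). \<Sum>b<CARD('p). ent (fst (snd (fst q))) i a * ent (snd q) a b *
        ent (snd (snd (fst q))) b j))) \<in> ?P"
    proof (intro polyfun_uminus polyfun.add polyfun_sum polyfun.mult)
      show "(\<lambda>q. ent (fst (fst q)) i j) \<in> ?P" unfolding M_def by (rule polyfun_fst[OF polyfun_sys_ent(1)[OF ij]])
      fix a b assume "a \<in> {..<CARD('m)}" "b \<in> {..<CARD('p)}"
      then have ab: "a < CARD('m)" "b < CARD('p)" by auto
      show "(\<lambda>q. ent (fst (snd (fst q))) i a) \<in> ?P" unfolding M_def by (rule polyfun_fst[OF polyfun_sys_ent(2)[OF ij(1) ab(1)]])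
      show "(\<lambda>q. ent (snd (snd (fst q))) b j) \<in> ?P" unfolding M_def by (rule polyfun_fst[OF polyfun_sys_ent(3)[OF ab(2) ij(2)]])
      show "(\<lambda>q. ent (snd q) a b) \<in> ?P" unfolding N_def by (rule polyfun_snd[OF polyfun_ent[OF ab]])
    qed
    show "(\<lambda>q. if i = j then 1 else 0) \<in> ?P" by (rule polyfun.const)
  qed
qed

section \<open>The special system as a weighted homogeneous map\<close>

lemma straightening_compose:
  assumes "straightening L rk pl ell n"
  shows "straightening L rk (\<lambda>f a. pl f (h a)) (\<lambda>r a. ell r (h a)) n"
proof -
  interpret straightening L rk pl ell n by fact
  show ?thesis
  proof
    show "finite L" by (rule finite_L)
    show "rk f \<le> n" if "f \<in> L" for f by (rule rk_le[OF that])
    fix f g assume fg: "f \<in> L" "g \<in> L" "rk f = rk g"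
    show "(\<lambda>a. pl f (h a) * pl g (h a)) \<in> fs.span
      ({\<lambda>a. ell (rk f) (h a) * pl k (h a) |k. k \<in> L \<and> rk k = rk f} \<union>
       {\<lambda>a. pl k (h a) * pl k' (h a) |k k'. k \<in> L \<and> k' \<in> L \<and> rk k + rk k' = 2 * rk f \<and> rk k < rk f})"
      by (rule subsetD[OF fs.span_mono span_compose[OF exchange[OF fg], of h]]) blast
  qed
qed

text \<open>A permutation other than the identity moves at least two points, so it sends some point
  to a different column that is not \<open>i\<close> either.\<close>

lemma fdet_identity_but_column:
  assumes M: "\<And>a k. a < m \<Longrightarrow> k < m \<Longrightarrow> a \<noteq> k \<Longrightarrow> k \<noteq> i \<Longrightarrow> M a k = 0"
  shows "fdet m M = (\<Prod>a<m. M a a)"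
proof -
  have "fdet m M = (\<Sum>\<pi>\<in>{id}. of_int (sign \<pi>) * (\<Prod>a<m. M a (\<pi> a)))"
    unfolding fdet_def
  proof (rule sum.mono_neutral_right)
    show "\<forall>\<pi>\<in>{\<pi>. \<pi> permutes {..<m}} - {id}. of_int (sign \<pi>) * (\<Prod>a<m. M a (\<pi> a)) = 0"
    proof
      fix \<pi> assume "\<pi> \<in> {\<pi>. \<pi> permutes {..<m}} - {id}"
      then have p: "\<pi> permutes {..<m}" "\<pi> \<noteq> id" by auto
      then obtain b where b: "\<pi> b \<noteq> b" by (auto simp: fun_eq_iff)
      have "\<exists>a. \<pi> a \<noteq> a \<and> \<pi> a \<noteq> i"
      proof (cases "\<pi> b = i")
        case True
        then have "\<pi> i \<noteq> i" using b permutes_inj[OF p(1)] by (auto dest: injD)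
        then show ?thesis by blast
      qed (use b in blast)
      then obtain a where a: "\<pi> a \<noteq> a" "\<pi> a \<noteq> i" by blast
      then have am: "a < m" using permutes_not_in[OF p(1), of a] by auto
      have "M a (\<pi> a) = 0" by (rule M) (use a am permutes_less[OF p(1)] in auto)
      then have "(\<Prod>a<m. M a (\<pi> a)) = 0" by (intro prod_zero) (use am in auto)
      then show "of_int (sign \<pi>) * (\<Prod>a<m. M a (\<pi> a)) = 0" by simp
    qed
  qed (auto simp: finite_permutes permutes_id)
  then show ?thesis by simp
qed

text \<open>The minor of this letter is \<open>- K i j\<close>, so the coordinates themselves occur
  among the letters up to sign; its rank is the origin of the weight
  \<open>m + j - i\<close>.\<close>

definition flet :: "nat \<Rightarrow> nat \<Rightarrow> nat \<Rightarrow> nat \<Rightarrow> nat" where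
  "flet m i j = restrict (\<lambda>k. if k = i then m + j else k) {..<m}"

lemma flet_letters: "j < p \<Longrightarrow> flet m i j \<in> letters m p"
  by (auto simp: letters_def flet_def inj_on_def)

lemma pluecker_flet:
  assumes "i < m"
  shows "pluecker m (flet m i j) K = - K i j"
proof -
  have "pluecker m (flet m i j) K = (\<Prod>a<m. xent m K a (flet m i j a))"
    unfolding pluecker_def by (rule fdet_identity_but_column[where i = i]) (auto simp: flet_def xent_def)
  also have "\<dots> = (\<Prod>a<m. if a = i then - K i j else 1)"
    by (rule prod.cong) (auto simp: flet_def xent_def)
  finally show ?thesis using assms by simp
qed

lemma rank_flet:
  assumes "i < m"
  shows "rank m (flet m i j) = m + j - i"
proof -
  have "(\<Sum>k<m. flet m i j k) + i = (\<Sum>k<m. flet m i j k + (if k = i then i else 0))"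
    using assms by (simp add: sum.distrib)
  also have "\<dots> = (\<Sum>k<m. k + (if k = i then m + j else 0))"
    by (rule sum.cong) (auto simp: flet_def)
  also have "\<dots> = (\<Sum>k<m. k) + (m + j)" using assms by (simp add: sum.distrib)
  finally show ?thesis unfolding rank_def using assms by linarith
qed

lemma pluecker_id: "restrict id {..<m} \<in> letters m p" "pluecker m (restrict id {..<m}) K = 1"
proof -
  show "restrict id {..<m} \<in> letters m p" by (auto simp: letters_def)
  have "pluecker m (restrict id {..<m}) K = (\<Prod>a<m. xent m K a (restrict id {..<m} a))"
    unfolding pluecker_def by (rule fdet_upper_triangular) (auto simp: xent_def)
  also have "\<dots> = 1" by (rule prod.neutral) (auto simp: xent_def)
  finally show "pluecker m (restrict id {..<m}) K = 1" .
qed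

text \<open>In a term that does not vanish, the factor of row \<open>i\<close> is either the
  \<open>1\<close> of the identity block at \<open>f (\<pi> i) = i\<close> or an entry of
  \<open>- K\<close>, and in both cases has weight \<open>f (\<pi> i) - i\<close>. These differences
  add up to the rank for every permutation.\<close>

lemma pluecker_weighted:
  assumes f: "f \<in> letters CARD('m) CARD('p)" and w: "\<And>i b. i < CARD('m) \<Longrightarrow> b < CARD('p) \<Longrightarrow> w (i * CARD('p) + b) = CARD('m) + b - i"
  shows "(\<lambda>K :: complex ^ 'p ^ 'm. pluecker CARD('m) f (ent K)) \<in>
    fs.span (mon (CARD('m) * CARD('p)) mco ` wset (CARD('m) * CARD('p)) w (rank CARD('m) f))"
proof -
  let ?m = "CARD('m)" and ?p = "CARD('p)"
  let ?S = "\<lambda>t. fs.span (mon (?m * ?p) (mco :: nat \<Rightarrow> complex ^ 'p ^ 'm \<Rightarrow> complex) ` wset (?m * ?p) w t)"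
  have "(\<lambda>K :: complex ^ 'p ^ 'm. \<Prod>i<?m. xent ?m (ent K) i (f (\<pi> i))) \<in> ?S (rank ?m f)" if \<pi>: "\<pi> permutes {..<?m}" for \<pi>
  proof (cases "\<exists>i<?m. f (\<pi> i) < ?m \<and> f (\<pi> i) \<noteq> i")
    case True
    then obtain i where i: "i < ?m" "f (\<pi> i) < ?m" "f (\<pi> i) \<noteq> i" by blast
    have "(\<Prod>i<?m. xent ?m (ent K) i (f (\<pi> i))) = 0" for K :: "complex ^ 'p ^ 'm"
      by (rule prod_zero) (use i in \<open>auto simp: xent_def\<close>)
    then show ?thesis using span_mon_const[of 0 "?m * ?p" mco w] by (simp only:)
  next
    case False
    have ge: "i \<le> f (\<pi> i)" if "i < ?m" for i using False that by (cases "f (\<pi> i) < ?m") auto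
    have "(\<lambda>K :: complex ^ 'p ^ 'm. \<Prod>i<k. xent ?m (ent K) i (f (\<pi> i))) \<in> ?S (\<Sum>i<k. f (\<pi> i) - i)" if "k \<le> ?m" for k
      using that
    proof (induction k)
      case 0
      then show ?case using span_mon_const[of 1 "?m * ?p" mco w] by simp
    next
      case (Suc k)
      have k: "k < ?m" using Suc.prems by simp
      have "(\<lambda>K :: complex ^ 'p ^ 'm. xent ?m (ent K) k (f (\<pi> k))) \<in> ?S (f (\<pi> k) - k)"
      proof (cases "f (\<pi> k) < ?m")
        case True
        then show ?thesis using False k span_mon_const[of 1 "?m * ?p" mco w] by (auto simp: xent_def)
      next
        case c: False
        define b where "b = f (\<pi> k) - ?m"
        have "f (\<pi> k) < ?m + ?p" using f permutes_less[OF \<pi> k] by (auto simp: letters_def PiE_iff)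
        then have b: "f (\<pi> k) = ?m + b" "b < ?p" using c by (auto simp: b_def)
        have "xent ?m (ent K) k (f (\<pi> k)) = (-1) * mco (k * ?p + b) K" for K :: "complex ^ 'p ^ 'm"
          by (simp add: b xent_def mco_ent[OF k b(2)])
        moreover have "(\<lambda>K :: complex ^ 'p ^ 'm. (-1) * mco (k * ?p + b) K) \<in> ?S (f (\<pi> k) - k)"
          by (intro fs.span_scale span_mon_coord) (use k b index_less[OF k b(2)] w[OF k b(2)] in auto)
        ultimately show ?thesis by simp
      qed
      from span_mon_mult[OF Suc.IH this] k show ?case by simp
    qed
    from this[of ?m] have "(\<lambda>K :: complex ^ 'p ^ 'm. \<Prod>i<?m. xent ?m (ent K) i (f (\<pi> i))) \<in> ?S (\<Sum>i<?m. f (\<pi> i) - i)" by simp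
    moreover have "(\<Sum>i<?m. f (\<pi> i) - i) = rank ?m f"
    proof -
      have "(\<Sum>i<?m. f (\<pi> i) - i) + (\<Sum>i<?m. i) = (\<Sum>i<?m. f (\<pi> i))"
        unfolding sum.distrib[symmetric] by (rule sum.cong) (use ge in auto)
      also have "\<dots> = (\<Sum>i<?m. f i)" using sum.permute[OF \<pi>, of f] by (simp add: comp_def)
      finally show ?thesis unfolding rank_def by simp
    qed
    ultimately show ?thesis by simp
  qed
  then show ?thesis
    unfolding pluecker_def fdet_def by (intro span_sum_fun fs.span_scale) simp
qed

definition sys0 :: "(complex, 'n::finite, 'm::finite, 'p::finite) linsys" where
  "sys0 = ((\<chi> i j. sysA CARD('m) CARD('p) (ix i) (ix j)), (\<chi> i a. sysB CARD('m) CARD('p) (ix i) (ix a)),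
     (\<chi> b j. sysC CARD('m) CARD('p) (ix b) (ix j)))"

abbreviation lev :: "nat \<Rightarrow> complex ^ 'p ^ 'm \<Rightarrow> complex" where
  "lev r K \<equiv> level CARD('m) CARD('p) (\<lambda>f. osc_minor CARD('m) CARD('p) f / of_nat (fact CARD('m))) r (ent K)"

lemma coeff_sys0:
  assumes n: "CARD('n) = CARD('m) * CARD('p)" and r: "r \<le> CARD('n)"
  shows "coeff (pole_placement (sys0 :: (complex, 'n::finite, 'm::finite, 'p::finite) linsys) K) (CARD('n) - r) = lev r K"
  unfolding n
proof (rule sys_charpoly_coeff)
  show "r \<le> CARD('m) * CARD('p)" using r n by simp
  fix s
  show "poly (pole_placement (sys0 :: (complex, 'n, 'm, 'p) linsys) K) s =
    fdet (CARD('m) + CARD('p) + CARD('m) * CARD('p)) (loop_mat CARD('m) CARD('p) (sysA CARD('m) CARD('p))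
      (sysB CARD('m) CARD('p)) (sysC CARD('m) CARD('p)) (ent K) s)"
    unfolding sys0_def poly_pole_placement n[symmetric]
    by (rule fdet_cong) (auto simp: loop_mat_def ent_def)
qed

lemma straightening_sys0:
  "straightening (letters CARD('m) CARD('p)) (rank CARD('m)) (\<lambda>f K. pluecker CARD('m) f (ent K))
    (lev :: nat \<Rightarrow> complex ^ 'p ^ 'm \<Rightarrow> complex) (CARD('m) * CARD('p))"
  by (rule straightening_compose[OF straightening_pluecker]) (simp_all add: osc_minor_permute osc_minor_nonzero)

lemma prod_fact_shift: "(\<Prod>c<m. m + k - c) * fact k = (fact (m + k) :: nat)"
proof (induction m)
  case (Suc m)
  have "(\<Prod>c<Suc m. Suc m + k - c) = (Suc m + k) * (\<Prod>c<m. m + k - c)"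
    unfolding prod.lessThan_Suc_shift by simp
  then show ?case using Suc by (simp add: algebra_simps)
qed simp

text \<open>Grouped by the output index \<open>k\<close>, the weights of the entries multiply to
  \<open>(m + k)! / k!\<close>; the weights of the coefficients multiply to
  \<open>(m * p)!\<close>.\<close>

lemma grassmann_degree_eqI:
  assumes m: "m > 0" and p: "p > 0" and c: "c * (\<Prod>l<m * p. m + l mod p - l div p) = (\<Prod>l<m * p. Suc l)"
  shows "c = grassmann_degree m p"
proof -
  have "(\<Prod>l<m * p. m + l mod p - l div p) = (\<Prod>c<m. \<Prod>k<p. m + k - c)"
    unfolding prod_blocks by (intro prod.cong refl) simp
  also have "\<dots> = (\<Prod>k<p. \<Prod>c<m. m + k - c)" by (rule prod.swap)
  finally have w: "(\<Prod>l<m * p. m + l mod p - l div p) * (\<Prod>k<p. fact k) = (\<Prod>k<p. fact (m + k))"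
    by (simp add: prod.distrib[symmetric] prod_fact_shift)
  have f: "(\<Prod>l<m * p. Suc l) = fact (m * p)" by (simp add: fact_prod_Suc atLeast0LessThan)
  have k: "(\<Prod>k<p. fact k) = (\<Prod>k=1..<p. fact k :: nat)"
  proof -
    have "{..<p} = insert 0 {1..<p}" using p by auto
    then show ?thesis by simp
  qed
  have "c * (\<Prod>k<p. fact (m + k)) = (\<Prod>k=1..<p. fact k) * fact (m * p)"
    unfolding w[symmetric] k[symmetric] f[symmetric] c[symmetric] by (simp only: mult_ac)
  moreover have "(\<Prod>k<p. fact (m + k) :: nat) > 0" by (rule prod_pos) simp
  ultimately show ?thesis unfolding grassmann_degree_def by (metis nonzero_mult_div_cancel_right not_gr_zero)
qed

lemma polynomial_family_Fmap:
  assumes n: "CARD('n::finite) = CARD('m::finite) * CARD('p::finite)"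
  shows "polynomial_family (CARD('n) * CARD('n) + (CARD('n) * CARD('m) + CARD('p) * CARD('n))) CARD('n) sco mco vco
    (Fmap :: (complex, 'n, 'm, 'p) linsys \<Rightarrow> complex ^ 'p ^ 'm \<Rightarrow> complex ^ 'n)"
proof
  show "coords (CARD('n) * CARD('n) + (CARD('n) * CARD('m) + CARD('p) * CARD('n)))
    (sco :: nat \<Rightarrow> (complex, 'n, 'm, 'p) linsys \<Rightarrow> complex)" by (rule coords_sco)
  show "coords CARD('n) (mco :: nat \<Rightarrow> complex ^ 'p ^ 'm \<Rightarrow> complex)" unfolding n by (rule coords_mco)
  show "coords CARD('n) (vco :: nat \<Rightarrow> complex ^ 'n \<Rightarrow> complex)" by (rule coords_vco)
  show "DIM(complex ^ 'n) = DIM(complex ^ 'p ^ 'm)" by (simp add: n)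
  fix j assume "j < CARD('n)"
  then show "(\<lambda>q. vco j (Fmap (fst q :: (complex, 'n, 'm, 'p) linsys) (snd q))) \<in>
    polyfun (coords_prod (CARD('n) * CARD('n) + (CARD('n) * CARD('m) + CARD('p) * CARD('n))) sco mco `
      {..<CARD('n) * CARD('n) + (CARD('n) * CARD('m) + CARD('p) * CARD('n)) + CARD('n)})"
    using Fmap_polyfun[where 'n = 'n and 'm = 'm and 'p = 'p, of "CARD('n) - 1 - j"] by (simp add: Fmap_def vco_pvec n)
qed

text \<open>The generators are the words shorter than \<open>D\<close>. A monomial in the entries of
  \<open>K\<close> is, up to the sign \<open>\<epsilon>\<close>, itself a word in the letters
  \<open>flet\<close> with the same weight, so \<open>graded_rep\<close> applies to it.\<close>

lemma generation_sys0:
  assumes n: "CARD('n::finite) = CARD('m::finite) * CARD('p::finite)"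
    and w: "\<And>i b. i < CARD('m) \<Longrightarrow> b < CARD('p) \<Longrightarrow> w (i * CARD('p) + b) = CARD('m) + b - i"
  obtains q :: nat and v where
    "\<And>a. a < q \<Longrightarrow> v a \<in> polyfun ((mco :: nat \<Rightarrow> complex ^ 'p ^ 'm \<Rightarrow> complex) ` {..<CARD('n)})"
    "\<And>\<alpha> t. \<alpha> \<in> wset CARD('n) w t \<Longrightarrow> \<exists>B. (\<forall>a<q. B a \<in> fs.span (mon CARD('n) vco ` wset CARD('n) Suc t)) \<and>
      (\<forall>k. mon CARD('n) mco \<alpha> k = (\<Sum>a<q. B a (Fmap (sys0 :: (complex, 'n, 'm, 'p) linsys) k) * v a k))"
proof -
  let ?m = "CARD('m)" and ?p = "CARD('p)" and ?n = "CARD('n)"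
  define F where "F = Fmap (sys0 :: (complex, 'n, 'm, 'p) linsys)"
  interpret straightening "letters ?m ?p" "rank ?m" "\<lambda>f K. pluecker ?m f (ent K)" "lev :: nat \<Rightarrow> complex ^ 'p ^ 'm \<Rightarrow> complex" ?n
    unfolding n by (rule straightening_sys0)
  have F: "vco (r - 1) (F K) = lev r K" if "0 < r" "r \<le> ?n" for r and K :: "complex ^ 'p ^ 'm"
    using that coeff_sys0[OF n that(2), of K] by (simp add: F_def Fmap_def vco_pvec)
  have lev0: "lev 0 K = 1" for K :: "complex ^ 'p ^ 'm"
  proof -
    have "coeff (pole_placement (sys0 :: (complex, 'n, 'm, 'p) linsys) K) CARD('n) = 1"
      using pole_placement_monic[of "sys0 :: (complex, 'n, 'm, 'p) linsys" K] by (auto simp: monic_polys_def)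
    then show ?thesis using coeff_sys0[OF n, of 0 K] by (simp only: diff_zero le0)
  qed
  define V where "V = (\<Union>k<D. words k)"
  have finV: "finite V" by (simp add: V_def finite_words)
  obtain e where e: "bij_betw e {..<card V} V"
    using ex_bij_betw_nat_finite[OF finV] by (auto simp: atLeast0LessThan)
  have eV: "e a \<in> V" if "a < card V" for a using e that by (auto simp: bij_betw_def)
  show ?thesis
  proof (rule that[of "card V" "\<lambda>a. wd (e a)"])
    fix a assume "a < card V"
    then have "set_mset (e a) \<subseteq> letters ?m ?p" using eV by (auto simp: V_def words_def)
    moreover have "wd W \<in> polyfun (mco ` {..<?n})" if "set_mset W \<subseteq> letters ?m ?p" for W
      using that
    proof (induction W)
      case empty
      then show ?case by (simp add: wd_def polyfun.const)
    next
      case (add f W)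
      have "(\<lambda>K :: complex ^ 'p ^ 'm. pluecker ?m f (ent K)) \<in> polyfun (mco ` {..<?n})"
        using span_mon_polyfun[OF pluecker_weighted[OF _ w]] add.prems by (simp add: n)
      with add have "(\<lambda>K. pluecker ?m f (ent K) * wd W K) \<in> polyfun (mco ` {..<?n})"
        by (intro polyfun.mult) auto
      then show ?case by (simp only: wd_add[abs_def])
    qed
    ultimately show "wd (e a) \<in> polyfun (mco ` {..<?n})" by blast
  next
    fix \<alpha> t assume \<alpha>: "\<alpha> \<in> wset ?n w t"
    define W where "W = (\<Sum>l<?n. replicate_mset (\<alpha> l) (flet ?m (l div ?p) (l mod ?p)))"
    have fl: "flet ?m (l div ?p) (l mod ?p) \<in> letters ?m ?p" for l by (rule flet_letters) simp
    have ld: "l div ?p < ?m" if "l < ?n" for l using that by (simp add: n div_less_iff_less_mult)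
    have W: "set_mset W \<subseteq> letters ?m ?p" using fl by (auto simp: W_def set_mset_sum)
    have wt_sum: "wt (\<Sum>l<k. X l) = (\<Sum>l<k. wt (X l))" and wd_sum: "wd (\<Sum>l<k. X l) K = (\<Prod>l<k. wd (X l) K)" for k :: nat and X and K :: "complex ^ 'p ^ 'm"
      by (induction k) (simp_all add: wt_def wd_def)
    have "wt W = (\<Sum>l<?n. w l * \<alpha> l)"
      unfolding W_def wt_sum
    proof (rule sum.cong[OF refl])
      fix l assume "l \<in> {..<?n}"
      then have "rank ?m (flet ?m (l div ?p) (l mod ?p)) = w l"
        using rank_flet[OF ld, of l "l mod ?p"] w[OF ld, of l "l mod ?p"] by simp
      then show "wt (replicate_mset (\<alpha> l) (flet ?m (l div ?p) (l mod ?p))) = w l * \<alpha> l" by (simp add: wt_def)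
    qed
    then have wt: "wt W \<le> t" using \<alpha> by (simp add: wset_def)
    define \<epsilon> where "\<epsilon> = (\<Prod>l<?n. (- 1 :: complex) ^ \<alpha> l)"
    have \<epsilon>: "\<epsilon> * \<epsilon> = 1" unfolding \<epsilon>_def prod.distrib[symmetric] by (rule prod.neutral) (simp flip: power_mult_distrib)
    have "wd W K = \<epsilon> * mon ?n mco \<alpha> K" for K
      unfolding W_def wd_sum mon_def \<epsilon>_def prod.distrib[symmetric]
    proof (rule prod.cong[OF refl])
      fix l assume "l \<in> {..<?n}"
      then have "pluecker ?m (flet ?m (l div ?p) (l mod ?p)) (ent K) = - mco l K"
        using pluecker_flet[OF ld] by (simp add: mco_def)
      then show "wd (replicate_mset (\<alpha> l) (flet ?m (l div ?p) (l mod ?p))) K = (- 1) ^ \<alpha> l * mco l K ^ \<alpha> l"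
        by (simp add: wd_replicate flip: power_mult_distrib)
    qed
    then have mW: "mon ?n mco \<alpha> K = \<epsilon> * wd W K" for K using \<epsilon> by (simp add: mult.assoc[symmetric])
    obtain B where B: "\<And>U. U \<in> V \<Longrightarrow> B U \<in> fs.span (mon ?n vco ` wset ?n Suc (wt W))"
      "\<And>K. wd W K = (\<Sum>U\<in>V. B U (F K) * wd U K)"
      using graded_rep[where y = vco and F = F, OF F lev0 W] unfolding V_def by blast
    show "\<exists>B. (\<forall>a<card V. B a \<in> fs.span (mon ?n vco ` wset ?n Suc t)) \<and>
      (\<forall>k. mon ?n mco \<alpha> k = (\<Sum>a<card V. B a (Fmap (sys0 :: (complex, 'n, 'm, 'p) linsys) k) * wd (e a) k))"
    proof (intro exI[of _ "\<lambda>a v. \<epsilon> * B (e a) v"] conjI allI impI)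
      show "(\<lambda>v. \<epsilon> * B (e a) v) \<in> fs.span (mon ?n vco ` wset ?n Suc t)" if "a < card V" for a
        by (intro fs.span_scale span_mon_mono[OF wt] B(1) eV that)
      fix k
      have "mon ?n mco \<alpha> k = (\<Sum>U\<in>V. \<epsilon> * B U (F k) * wd U k)"
        unfolding mW B(2) sum_distrib_left by (simp only: mult.assoc)
      also have "\<dots> = (\<Sum>a<card V. \<epsilon> * B (e a) (F k) * wd (e a) k)"
        by (rule sum.reindex_bij_betw[OF e, symmetric])
      finally show "mon ?n mco \<alpha> k = (\<Sum>a<card V. \<epsilon> * B (e a) (Fmap (sys0 :: (complex, 'n, 'm, 'p) linsys) k) * wd (e a) k)"
        by (simp only: F_def)
    qed
  qed
qed

lemma graded_map_sys0:
  assumes n: "CARD('n::finite) = CARD('m::finite) * CARD('p::finite)"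
  defines "M \<equiv> CARD('n) * CARD('n) + (CARD('n) * CARD('m) + CARD('p) * CARD('n))"
    and "F \<equiv> Fmap :: (complex, 'n, 'm, 'p) linsys \<Rightarrow> complex ^ 'p ^ 'm \<Rightarrow> complex ^ 'n"
  shows "\<exists>f. (\<forall>k. F sys0 k = f \<longrightarrow> polynomial_family.simple M CARD('n) sco mco vco F sys0 k) \<and>
      card {k. F sys0 k = f} = grassmann_degree CARD('m) CARD('p)"
    and "\<exists>k. polynomial_family.simple M CARD('n) sco mco vco F sys0 k"
proof -
  let ?m = "CARD('m)" and ?p = "CARD('p)" and ?n = "CARD('n)"
  let ?x = "mco :: nat \<Rightarrow> complex ^ 'p ^ 'm \<Rightarrow> complex" and ?y = "vco :: nat \<Rightarrow> complex ^ 'n \<Rightarrow> complex"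
  define w where "w = (\<lambda>l. ?m + l mod ?p - l div ?p)"
  have w: "w (i * ?p + b) = ?m + b - i" if "i < ?m" "b < ?p" for i b using that by (simp add: w_def)
  obtain q :: nat and v where v: "\<And>a. a < q \<Longrightarrow> v a \<in> polyfun (?x ` {..<?n})"
    and gen: "\<And>\<alpha> t. \<alpha> \<in> wset ?n w t \<Longrightarrow> \<exists>B. (\<forall>a<q. B a \<in> fs.span (mon ?n ?y ` wset ?n Suc t)) \<and>
      (\<forall>k. mon ?n ?x \<alpha> k = (\<Sum>a<q. B a (F sys0 k) * v a k))"
    using generation_sys0[where 'n = 'n and 'm = 'm and 'p = 'p and w = w, OF n w] unfolding F_def by blast
  interpret pf: polynomial_family M ?n sco ?x ?y F
    unfolding M_def F_def by (rule polynomial_family_Fmap[OF n])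
  \<comment> \<open>Both points are placed over the fixed system \<open>sys0\<close>, so that the
    Jacobian of the single map and that of the family are the same function.\<close>
  define h where "h = (\<lambda>kk :: (complex ^ 'p ^ 'm) \<times> (complex ^ 'p ^ 'm). ((sys0 :: (complex, 'n, 'm, 'p) linsys, fst kk), (sys0 :: (complex, 'n, 'm, 'p) linsys, snd kk)))"
  define G where "G = (\<lambda>j i kk. pf.G j i (h kk))"
  interpret gm: graded_map ?n ?x ?y w Suc "F sys0" G q v
  proof
    show "coords ?n ?x" by (rule pf.x)
    show "coords ?n ?y" by (rule pf.y)
    show "DIM(complex ^ 'n) \<le> DIM(complex ^ 'p ^ 'm)" by (simp add: n)
    show "0 < w i" if "i < ?n" for i
    proof -
      have "i div ?p < ?m" using that by (simp add: n div_less_iff_less_mult)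
      then show ?thesis by (simp add: w_def)
    qed
    show "(\<lambda>k. ?y j (F sys0 k)) \<in> fs.span (mon ?n ?x ` wset ?n w (Suc j))" if j: "j < ?n" for j
    proof -
      have "?y j (F sys0 k) = lev (Suc j) k" for k
        using j coeff_sys0[OF n, of "Suc j" k] by (simp add: F_def Fmap_def vco_pvec)
      moreover have "(lev :: nat \<Rightarrow> complex ^ 'p ^ 'm \<Rightarrow> complex) (Suc j) \<in> fs.span (mon ?n ?x ` wset ?n w (Suc j))"
        unfolding level_def
      proof (intro span_sum_fun fs.span_scale)
        fix f assume f: "f \<in> {f \<in> letters ?m ?p. rank ?m f = Suc j}"
        then have "(\<lambda>K :: complex ^ 'p ^ 'm. pluecker ?m f (ent K)) \<in> fs.span (mon ?n ?x ` wset ?n w (rank ?m f))"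
          unfolding n by (intro pluecker_weighted w) auto
        then show "(\<lambda>K :: complex ^ 'p ^ 'm. pluecker ?m f (ent K)) \<in> fs.span (mon ?n ?x ` wset ?n w (Suc j))"
          using f by simp
      qed
      ultimately show ?thesis by simp
    qed
    show "G j i \<in> polyfun (coords_prod ?n ?x ?x ` {..<?n + ?n})" if ij: "i < ?n" "j < ?n" for i j
      unfolding G_def
    proof (rule polyfun_compose[OF pf.G_polyfun[OF ij]])
      fix c assume "c \<in> pf.XX ` {..<M + ?n + (M + ?n)}"
      then show "(\<lambda>kk. c (h kk)) \<in> polyfun (coords_prod ?n ?x ?x ` {..<?n + ?n})"
        unfolding coords_prod_image by (auto simp: h_def image_image intro: polyfun.const polyfun.base)
    qed
    show "?y j (F sys0 k) - ?y j (F sys0 k') = (\<Sum>i<?n. G j i (k, k') * (?x i k - ?x i k'))" if "j < ?n" for j k k'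
      unfolding G_def h_def using pf.G_hadamard[OF that, of sys0 k k'] by simp
    show "v a \<in> polyfun (?x ` {..<?n})" if "a < q" for a by (rule v[OF that])
    show "\<exists>B. (\<forall>a<q. B a \<in> fs.span (mon ?n ?y ` wset ?n Suc t)) \<and>
      (\<forall>k. mon ?n ?x \<alpha> k = (\<Sum>a<q. B a (F sys0 k) * v a k))" if "\<alpha> \<in> wset ?n w t" for \<alpha> t
      by (rule gen[OF that])
  qed simp
  have simple: "pf.simple sys0 k \<longleftrightarrow> gm.jac (k, k) \<noteq> 0" for k
    unfolding pf.simple_def pf.J_def gm.jac_def by (simp add: G_def h_def)
  show "\<exists>k. pf.simple sys0 k" unfolding simple by (rule gm.jac_nonzero)
  obtain f where f: "\<And>k. F sys0 k = f \<Longrightarrow> gm.jac (k, k) \<noteq> 0" using gm.exists_regular_value by blast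
  from gm.fiber_card[OF f] have "card {k. F sys0 k = f} = grassmann_degree ?m ?p"
    by (intro grassmann_degree_eqI) (simp_all add: w_def flip: n)
  then show "\<exists>f. (\<forall>k. F sys0 k = f \<longrightarrow> pf.simple sys0 k) \<and> card {k. F sys0 k = f} = grassmann_degree ?m ?p"
    using f simple by blast
qed

section \<open>Properness and fibre count for generic systems\<close>

lemma norm_matrix_le: "norm (K :: complex ^ 'p ^ 'm) \<le> (\<Sum>i\<in>UNIV. \<Sum>j\<in>UNIV. norm (K $ i $ j))"
proof -
  have "norm K \<le> (\<Sum>i\<in>UNIV. norm (K $ i))" unfolding norm_vec_def by (rule L2_set_le_sum) simp
  also have "\<dots> \<le> (\<Sum>i\<in>UNIV. \<Sum>j\<in>UNIV. norm (K $ i $ j))"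
    by (rule sum_mono) (simp add: norm_vec_def L2_set_le_sum)
  finally show ?thesis .
qed

text \<open>The entries of \<open>K\<close> are minors up to sign, so bounding all minors bounds
  \<open>K\<close>. The coefficients of the characteristic polynomial are linear in the minors, with
  factors polynomial in the system, and serve as parameters; the leading one is \<open>1\<close>,
  which explains \<open>1 + norm (Fmap S' K)\<close>.\<close>

lemma pole_placement_bound:
  assumes n: "CARD('n::finite) = CARD('m::finite) * CARD('p::finite)"
  obtains g where "g \<in> polyfun ((sco :: nat \<Rightarrow> (complex, 'n, 'm, 'p) linsys \<Rightarrow> complex) `
      {..<CARD('n) * CARD('n) + (CARD('n) * CARD('m) + CARD('p) * CARD('n))})" "g sys0 \<noteq> 0"
    "\<And>S. g S \<noteq> 0 \<Longrightarrow> \<exists>W C. open W \<and> S \<in> W \<and> (\<forall>S'\<in>W. \<forall>K. norm K \<le> C * (1 + norm (Fmap S' K)))"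
proof -
  let ?m = "CARD('m)" and ?p = "CARD('p)" and ?n = "CARD('n)"
  let ?M = "?n * ?n + (?n * ?m + ?p * ?n)"
  let ?Cs = "(sco :: nat \<Rightarrow> (complex, 'n, 'm, 'p) linsys \<Rightarrow> complex) ` {..<?M}"
  define el where "el = (\<lambda>(S :: (complex, 'n, 'm, 'p) linsys) r K. coeff (pole_placement S K) (?n - r))"
  define c where "c = (\<lambda>r f (S :: (complex, 'n, 'm, 'p) linsys).
    1 / of_nat (fact ?m) * coeff (loop_coeff ?m ?p ?n (ent (fst S)) (ent (fst (snd S))) (ent (snd (snd S))) f) (?n - r))"
  interpret straightening "letters ?m ?p" "rank ?m" "\<lambda>f K. pluecker ?m f (ent K)" "lev :: nat \<Rightarrow> complex ^ 'p ^ 'm \<Rightarrow> complex" ?n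
    unfolding n by (rule straightening_sys0)
  have el: "el S r K = (\<Sum>f\<in>letters ?m ?p. c r f S * pluecker ?m f (ent K))" for S r K
  proof -
    obtain A B C where S: "S = (A, B, C)" by (cases S)
    have "of_nat (fact ?m) * el S r K = of_nat (fact ?m) * (\<Sum>f\<in>letters ?m ?p. c r f S * pluecker ?m f (ent K))"
      unfolding el_def S coeff_pole_placement c_def sum_distrib_left by (rule sum.cong) simp_all
    then show ?thesis by simp
  qed
  have cP: "c r f \<in> polyfun ?Cs" for r f
    unfolding c_def loop_coeff_def
  proof (intro polyfun_scale coeff_fdet_polyfun)
    fix i j l assume ij: "i < ?m + ?p + ?n" "j < ?m + ?p + ?n"
    have k: "(\<lambda>_. z) \<in> polyfun ?Cs" for z by (rule polyfun.const)
    show "(\<lambda>S :: (complex, 'n, 'm, 'p) linsys. coeff (if i < ?m then if j = f i then 1 else 0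
        else if i < ?m + ?p then if j < ?m + ?p then if i = j then 1 else 0
          else [:- ent (snd (snd S)) (i - ?m) (j - (?m + ?p)):]
        else if j < ?m then [:- ent (fst (snd S)) (i - (?m + ?p)) j:]
        else if j < ?m + ?p then 0
        else [:- ent (fst S) (i - (?m + ?p)) (j - (?m + ?p)), if i = j then 1 else 0:]) l) \<in> polyfun ?Cs"
    proof (cases "i < ?m \<or> (i < ?m + ?p \<and> j < ?m + ?p) \<or> (\<not> i < ?m + ?p \<and> \<not> j < ?m \<and> j < ?m + ?p)")
      case True
      then show ?thesis by (cases "i < ?m"; cases "j < ?m + ?p") (auto simp: k)
    next
      case F: False
      have j1: "\<not> j < ?m + ?p \<Longrightarrow> j - (?m + ?p) < ?n" using ij by linarith
      have i1: "\<not> i < ?m + ?p \<Longrightarrow> i - (?m + ?p) < ?n" using ij by linarith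
      have i2: "\<not> i < ?m \<Longrightarrow> i < ?m + ?p \<Longrightarrow> i - ?m < ?p" by linarith
      consider "\<not> i < ?m" "i < ?m + ?p" "\<not> j < ?m + ?p" | "\<not> i < ?m + ?p" "j < ?m" | "\<not> i < ?m + ?p" "\<not> j < ?m + ?p"
        using F by fastforce
      then show ?thesis
      proof cases
        case 1
        then show ?thesis
          using polyfun_coeff_pCons[OF polyfun_uminus[OF polyfun_sys_ent(3)[OF i2 j1, where 'm = 'm]] k[of 0]] by simp
      next
        case 2
        then show ?thesis
          using polyfun_coeff_pCons[OF polyfun_uminus[OF polyfun_sys_ent(2)[OF i1 2(2), where 'p = 'p]] k[of 0]] by simp
      next
        case 3
        then show ?thesis
          using polyfun_coeff_pCons[OF polyfun_uminus[OF polyfun_sys_ent(1)[OF i1 j1, where 'm = 'm and 'p = 'p]] k[of "if i = j then 1 else 0"]] by simp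
      qed
    qed
  qed
  have cont: "continuous_on UNIV h" if "h \<in> ?Cs" for h
    using that coords_continuous[OF coords_sco] by blast
  have el0: "el sys0 r K = lev r K" if "r \<le> ?n" for r K unfolding el_def by (rule coeff_sys0[OF n that])
  obtain g where g: "g \<in> polyfun ?Cs" "g sys0 \<noteq> 0"
    "\<And>S. g S \<noteq> 0 \<Longrightarrow> \<exists>W C. open W \<and> S \<in> W \<and> (\<forall>S'\<in>W. \<forall>K. \<forall>f\<in>letters ?m ?p.
      norm (pluecker ?m f (ent K)) \<le> C * (\<Sum>r\<le>?n. norm (el S' r K)))"
    using generic_bound[where elS = el and c = c and Cs = ?Cs and ?s0.0 = sys0 and ?f1.0 = "restrict id {..<?m}",
      OF el cP cont el0 pluecker_id(1) pluecker_id(2)] by blast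
  show ?thesis
  proof (rule that[OF g(1,2)])
    fix S assume "g S \<noteq> 0"
    from g(3)[OF this] obtain W C where W: "open W" "S \<in> W" and C: "\<And>S' K f. S' \<in> W \<Longrightarrow> f \<in> letters ?m ?p \<Longrightarrow>
      norm (pluecker ?m f (ent K)) \<le> C * (\<Sum>r\<le>?n. norm (el S' r K))" by blast
    have "norm K \<le> (real ?m * real ?p * \<bar>C\<bar> * real (Suc ?n)) * (1 + norm (Fmap S' K))" if S': "S' \<in> W" for S' K
    proof -
      have l: "norm (el S' r K) \<le> 1 + norm (Fmap S' K)" if r: "r \<le> ?n" for r
      proof (cases r)
        case 0
        have "coeff (pole_placement S' K) ?n = 1" using pole_placement_monic[of S' K] by (auto simp: monic_polys_def)
        then show ?thesis using 0 by (simp add: el_def)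
      next
        case (Suc r')
        then have "el S' r K = vco r' (Fmap S' K)" using r by (simp add: el_def Fmap_def vco_pvec)
        also have "norm \<dots> \<le> norm (Fmap S' K)" unfolding vco_def by (rule Finite_Cartesian_Product.norm_nth_le)
        finally show ?thesis by simp
      qed
      have s: "(\<Sum>r\<le>?n. norm (el S' r K)) \<le> real (Suc ?n) * (1 + norm (Fmap S' K))"
        using sum_bounded_above[of "{..?n}" "\<lambda>r. norm (el S' r K)", OF l] by simp
      have k: "norm (K $ i $ j) \<le> \<bar>C\<bar> * (real (Suc ?n) * (1 + norm (Fmap S' K)))" for i j
      proof -
        have "norm (K $ i $ j) = norm (pluecker ?m (flet ?m (ix i) (ix j)) (ent K))"
          by (simp add: pluecker_flet ent_def)
        also have "\<dots> \<le> C * (\<Sum>r\<le>?n. norm (el S' r K))" by (rule C[OF S' flet_letters]) simp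
        also have "\<dots> \<le> \<bar>C\<bar> * (\<Sum>r\<le>?n. norm (el S' r K))" by (intro mult_right_mono sum_nonneg) auto
        also have "\<dots> \<le> \<bar>C\<bar> * (real (Suc ?n) * (1 + norm (Fmap S' K)))" by (intro mult_left_mono s) simp
        finally show ?thesis .
      qed
      have "norm K \<le> (\<Sum>i\<in>(UNIV :: 'm set). \<Sum>j\<in>(UNIV :: 'p set). norm (K $ i $ j))" by (rule norm_matrix_le)
      also have "\<dots> \<le> (\<Sum>i\<in>(UNIV :: 'm set). \<Sum>j\<in>(UNIV :: 'p set). \<bar>C\<bar> * (real (Suc ?n) * (1 + norm (Fmap S' K))))"
        by (intro sum_mono k)
      finally show ?thesis by (simp add: mult_ac)
    qed
    then show "\<exists>W C. open W \<and> S \<in> W \<and> (\<forall>S'\<in>W. \<forall>K. norm K \<le> C * (1 + norm (Fmap S' K)))" using W by blast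
  qed
qed

text \<open>The last conclusion does not refer to \<open>\<Delta>\<close>: it covers every pair
  whose fibre happens to have \<open>d(m, p)\<close> points, which is all that is known of a given
  fibre.\<close>

lemma generic_fiber_card:
  assumes n: "CARD('n::finite) = CARD('m::finite) * CARD('p::finite)"
  defines "M \<equiv> CARD('n) * CARD('n) + (CARD('n) * CARD('m) + CARD('p) * CARD('n))"
  obtains g :: "(complex, 'n::finite, 'm::finite, 'p::finite) linsys \<Rightarrow> complex" and \<Delta> :: "(complex, 'n, 'm, 'p) linsys \<times> (complex ^ 'n) \<Rightarrow> complex" and S0 a
  where "g \<in> polyfun (sco ` {..<M})" "g S0 \<noteq> 0"
    "\<And>S. g S \<noteq> 0 \<Longrightarrow> \<exists>C. \<forall>K. norm K \<le> C * (1 + norm (Fmap S K))"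
    "\<Delta> \<in> polyfun (coords_prod M sco vco ` {..<M + CARD('n)})" "\<Delta> a \<noteq> 0"
    "\<And>S f. \<Delta> (S, f) \<noteq> 0 \<Longrightarrow> finite {K. Fmap S K = f} \<and> card {K. Fmap S K = f} = grassmann_degree CARD('m) CARD('p)"
    "\<And>(S :: (complex, 'n, 'm, 'p) linsys) f T. finite {K. Fmap S K = f} \<Longrightarrow> card {K. Fmap S K = f} = grassmann_degree CARD('m) CARD('p) \<Longrightarrow>
      closed T \<Longrightarrow> {K. Fmap S K = f} \<inter> T = {} \<Longrightarrow> \<exists>e>0. \<forall>S' K. dist S' S < e \<longrightarrow> K \<in> T \<longrightarrow> Fmap S' K \<noteq> f"
proof -
  let ?F = "Fmap :: (complex, 'n, 'm, 'p) linsys \<Rightarrow> complex ^ 'p ^ 'm \<Rightarrow> complex ^ 'n"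
  interpret pf: polynomial_family M "CARD('n)" sco mco vco ?F
    unfolding M_def by (rule polynomial_family_Fmap[OF n])
  obtain g where g: "g \<in> polyfun ((sco :: nat \<Rightarrow> (complex, 'n, 'm, 'p) linsys \<Rightarrow> complex) ` {..<M})" "g sys0 \<noteq> 0"
    "\<And>S. g S \<noteq> 0 \<Longrightarrow> \<exists>W C. open W \<and> S \<in> W \<and> (\<forall>S'\<in>W. \<forall>K. norm K \<le> C * (1 + norm (?F S' K)))"
    using pole_placement_bound[OF n] unfolding M_def by metis
  obtain f0 where f0: "\<And>k. ?F sys0 k = f0 \<Longrightarrow> pf.simple sys0 k" "card {k. ?F sys0 k = f0} = grassmann_degree CARD('m) CARD('p)"
    using graded_map_sys0(1)[where 'n = 'n and 'm = 'm and 'p = 'p, OF n] unfolding M_def by blast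
  obtain k0 where k0: "pf.simple sys0 k0"
    using graded_map_sys0(2)[where 'n = 'n and 'm = 'm and 'p = 'p, OF n] unfolding M_def by blast
  have s0: "pf.simple sys0 k" if "k \<in> pf.fiber sys0 f0" for k using that f0(1) by (simp add: pf.fiber_def)
  obtain \<Delta> a where \<Delta>: "\<Delta> \<in> polyfun (pf.Y ` {..<M + CARD('n)})" "\<Delta> a \<noteq> 0"
    "\<And>s f. \<Delta> (s, f) \<noteq> 0 \<Longrightarrow> (\<forall>k\<in>pf.fiber s f. pf.simple s k) \<and> finite (pf.fiber s f) \<and> card (pf.fiber s f) = card (pf.fiber sys0 f0)"
    using pf.count_polynomial[OF g(1,3,2) s0 k0] by metis
  have d: "card (pf.fiber sys0 f0) = grassmann_degree CARD('m) CARD('p)" using f0(2) by (simp add: pf.fiber_def)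
  show ?thesis
  proof (rule that[OF g(1,2) _ \<Delta>(1,2)])
    show "\<exists>C. \<forall>K. norm K \<le> C * (1 + norm (?F S K))" if "g S \<noteq> 0" for S using g(3)[OF that] by blast
    show "finite {K. ?F S K = f} \<and> card {K. ?F S K = f} = grassmann_degree CARD('m) CARD('p)" if "\<Delta> (S, f) \<noteq> 0" for S f
      using \<Delta>(3)[OF that] d by (simp add: pf.fiber_def)
    fix S f T
    assume a: "finite {K. ?F S K = f}" "card {K. ?F S K = f} = grassmann_degree CARD('m) CARD('p)"
      "closed T" "{K. ?F S K = f} \<inter> T = {}"
    show "\<exists>e>0. \<forall>S' K. dist S' S < e \<longrightarrow> K \<in> T \<longrightarrow> ?F S' K \<noteq> f"
      using pf.fiber_avoids_closed[OF \<Delta>(1,2,3) k0 _ _ a(3), of S f] a d unfolding pf.fiber_def by metis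
  qed
qed

section \<open>Real points\<close>

text \<open>Real points in sufficient supply: a nonzero polynomial function cannot vanish on the
  whole image of \<open>e\<close>.\<close>

definition real_form :: "nat \<Rightarrow> (nat \<Rightarrow> 'a::euclidean_space \<Rightarrow> complex) \<Rightarrow> ('b::euclidean_space \<Rightarrow> 'a) \<Rightarrow> bool" where
  "real_form N x e \<longleftrightarrow> linear e \<and> (\<forall>r. \<exists>v. \<forall>i<N. x i (e v) = of_real (r i))"

lemma real_form_ex: "real_form N x e \<Longrightarrow> \<exists>v. \<forall>i<N. x i (e v) = of_real (r i)"
  by (simp add: real_form_def)

lemma real_form_prod:
  assumes "real_form M x e" "real_form N y e'"
  shows "real_form (M + N) (coords_prod M x y) (map_prod e e')"
  unfolding real_form_def
proof (intro conjI allI)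
  interpret e: linear e using assms by (simp add: real_form_def)
  interpret e': linear e' using assms by (simp add: real_form_def)
  show "linear (map_prod e e')"
    by (rule linearI) (auto simp: e.add e'.add e.scaleR e'.scaleR)
  fix r :: "nat \<Rightarrow> real"
  obtain v where v: "\<And>i. i < M \<Longrightarrow> x i (e v) = of_real (r i)" using real_form_ex[OF assms(1), of r] by blast
  obtain v' where v': "\<And>i. i < N \<Longrightarrow> y i (e' v') = of_real (r (i + M))"
    using real_form_ex[OF assms(2), of "\<lambda>i. r (i + M)"] by blast
  show "\<exists>u. \<forall>i<M + N. coords_prod M x y i (map_prod e e' u) = of_real (r i)"
  proof (intro exI[of _ "(v, v')"] allI impI)
    fix i assume "i < M + N"
    then show "coords_prod M x y i (map_prod e e' (v, v')) = of_real (r i)"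
      using v[of i] v'[of "i - M"] by (auto simp: coords_prod_def)
  qed
qed

lemma poly_nonzero_real:
  assumes "q \<noteq> 0" "infinite A"
  shows "\<exists>r\<in>A. poly q (of_real r + c :: complex) \<noteq> 0"
proof (rule ccontr)
  assume n: "\<not> ?thesis"
  have inj: "inj_on (\<lambda>r. of_real r + c :: complex) A" by (rule inj_onI) simp
  have "(\<lambda>r. of_real r + c) ` A \<subseteq> {z. poly q z = 0}" using n by auto
  then have "finite ((\<lambda>r. of_real r + c) ` A)" by (rule finite_subset[OF _ poly_roots_finite[OF assms(1)]])
  then show False using assms(2) finite_imageD[OF _ inj] by simp
qed

text \<open>The coordinates are made real one at a time. Along the complex line in direction
  \<open>k\<close> the restriction of \<open>h\<close> is a nonzero polynomial, and the parameters
  \<open>r - x k b\<close> with real \<open>r\<close>, which turn coordinate \<open>k\<close> into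
  \<open>r\<close>, are infinitely many.\<close>

lemma real_form_nonzero:
  assumes x: "coords N x" and e: "real_form N x e" and h: "h \<in> polyfun (x ` {..<N})" "h a \<noteq> 0"
  shows "\<exists>v. h (e v) \<noteq> 0"
proof -
  have "\<exists>b. h b \<noteq> 0 \<and> (\<forall>i<k. x i b \<in> \<real>)" if "k \<le> N" for k
    using that
  proof (induction k)
    case (Suc k)
    then obtain b where b: "h b \<noteq> 0" "\<forall>i<k. x i b \<in> \<real>" by auto
    obtain u where u: "\<And>i. i < N \<Longrightarrow> x i u = (if i = k then 1 else 0)"
      using coords_ex[OF x, of "\<lambda>i. if i = k then 1 else 0"] by blast
    obtain cs where cs: "\<And>i t. i < N \<Longrightarrow> x i (cs t) = t * x i u" "linear cs" "cs 1 = u"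
      using coords_complex_scaling[OF x] by metis
    obtain q where q: "\<And>t. h (b + cs t) = poly q t" using polyfun_complex_line[OF x h(1) cs(2,1)] by blast
    have "poly q 0 \<noteq> 0" using b(1) linear_0[OF cs(2)] by (simp flip: q)
    then have "q \<noteq> 0" by auto
    then obtain r :: real where r: "poly q (of_real r + (- x k b)) \<noteq> 0" using poly_nonzero_real[of q UNIV "- x k b"] infinite_UNIV_char_0 by blast
    have "x i (b + cs (of_real r + (- x k b))) = (if i = k then of_real r else x i b)" if "i < N" for i
      using that cs(1)[OF that] u[OF that] by (simp add: linear_add[OF coords_linear[OF x that]])
    then show ?case using r b(2) Suc.prems
      by (intro exI[of _ "b + cs (of_real r + (- x k b))"]) (auto simp: q less_Suc_eq)
  qed (use h(2) in auto)
  then obtain b where b: "h b \<noteq> 0" "\<And>i. i < N \<Longrightarrow> x i b \<in> \<real>" by blast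
  obtain v where v: "\<And>i. i < N \<Longrightarrow> x i (e v) = of_real (Re (x i b))"
    using real_form_ex[OF e, of "\<lambda>i. Re (x i b)"] by blast
  have "e v = b" by (rule coords_inj[OF x]) (simp add: v b(2) of_real_Re)
  then show ?thesis using b by blast
qed

text \<open>The real line from \<open>w\<close> to a point \<open>v\<close> with
  \<open>h (e v) \<noteq> 0\<close> maps into a complex line on which \<open>h\<close> has finitely
  many zeros, so arbitrarily small positive \<open>t\<close> avoid them.\<close>

lemma real_form_dense:
  assumes x: "coords N x" and e: "real_form N x e" and h: "h \<in> polyfun (x ` {..<N})" "h a \<noteq> 0"
    and W: "open W" "w \<in> W"
  shows "\<exists>v\<in>W. h (e v) \<noteq> 0"
proof -
  interpret e: linear e using e by (simp add: real_form_def)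
  obtain v where v: "h (e v) \<noteq> 0" using real_form_nonzero[OF x e h] by blast
  obtain cs where cs: "\<And>i t. i < N \<Longrightarrow> x i (cs t) = t * x i (e (v - w))" "linear cs" "cs 1 = e (v - w)"
    using coords_complex_scaling[OF x] by metis
  obtain q where q: "\<And>t. h (e w + cs t) = poly q t" using polyfun_complex_line[OF x h(1) cs(2,1)] by blast
  have line: "h (e (w + t *\<^sub>R (v - w))) = poly q (of_real t)" for t
  proof -
    have "cs (of_real t) = t *\<^sub>R e (v - w)"
      using linear_scale[OF cs(2), of t 1] cs(3) by (simp add: scaleR_conv_of_real)
    then show ?thesis by (simp only: e.add e.scaleR flip: q)
  qed
  have "poly q (of_real 1) \<noteq> 0" using v unfolding line[symmetric] by simp
  then have "q \<noteq> 0" by auto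
  have "((\<lambda>t. w + t *\<^sub>R (v - w)) \<longlongrightarrow> w + 0 *\<^sub>R (v - w)) (at 0)" by (intro tendsto_intros)
  then have "\<forall>\<^sub>F t in at 0. w + t *\<^sub>R (v - w) \<in> W" using W by (intro topological_tendstoD) auto
  then obtain d where d: "d > 0" "\<And>t. t \<noteq> 0 \<Longrightarrow> \<bar>t\<bar> < d \<Longrightarrow> w + t *\<^sub>R (v - w) \<in> W"
    unfolding eventually_at by (auto simp: dist_real_def)
  obtain t where "t \<in> {0<..<d}" "poly q (of_real t) \<noteq> 0"
    using poly_nonzero_real[OF \<open>q \<noteq> 0\<close>, of "{0<..<d}" 0] d(1) by auto
  then show ?thesis using d(2)[of t] by (intro bexI[of _ "w + t *\<^sub>R (v - w)"]) (auto simp: line)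
qed

lemma real_polynomial_function_Re_Im:
  assumes "h \<in> polyfun C" "\<And>c. c \<in> C \<Longrightarrow> linear c" "linear (e :: 'b::euclidean_space \<Rightarrow> 'a::euclidean_space)"
  shows "real_polynomial_function (\<lambda>v. Re (h (e v))) \<and> real_polynomial_function (\<lambda>v. Im (h (e v)))"
  using assms(1)
proof induction
  case (base c)
  have l: "linear (\<lambda>v. c (e v))" using linear_compose[OF assms(3) assms(2)[OF base]] by (simp add: comp_def)
  then have bl: "bounded_linear (\<lambda>v. c (e v))" by (simp add: linear_conv_bounded_linear)
  show ?case
    by (intro conjI real_polynomial_function.intros(1) bounded_linear_compose[OF bounded_linear_Re bl]
      bounded_linear_compose[OF bounded_linear_Im bl])
qed (auto intro: real_polynomial_function.intros real_polynomial_function_diff)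

lemma real_polynomial_function_line:
  assumes "real_polynomial_function f"
  shows "\<exists>q. \<forall>t. f (a + t *\<^sub>R v) = poly q t"
  using assms
proof induction
  case (linear f)
  then interpret bounded_linear f .
  show ?case by (intro exI[of _ "[:f a, f v:]"]) (simp add: add scaleR)
next
  case (const c)
  show ?case by (intro exI[of _ "[:c:]"]) simp
next
  case (add f g)
  then obtain q r where "\<And>t. f (a + t *\<^sub>R v) = poly q t" "\<And>t. g (a + t *\<^sub>R v) = poly r t" by blast
  then show ?case by (intro exI[of _ "q + r"]) simp
next
  case (mult f g)
  then obtain q r where "\<And>t. f (a + t *\<^sub>R v) = poly q t" "\<And>t. g (a + t *\<^sub>R v) = poly r t" by blast
  then show ?case by (intro exI[of _ "q * r"]) simp
qed

text \<open>On the line from \<open>a\<close> to \<open>b\<close> the function is a polynomial in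
  \<open>t\<close> with infinitely many zeros near \<open>0\<close>, hence it vanishes at
  \<open>t = 1\<close> too.\<close>

lemma real_polynomial_function_zero_on_ball:
  assumes f: "real_polynomial_function f" and e: "e > 0" and z: "\<And>x. dist x a < e \<Longrightarrow> f x = 0"
  shows "f b = 0"
proof -
  obtain q where q: "\<And>t. f (a + t *\<^sub>R (b - a)) = poly q t" using real_polynomial_function_line[OF f] by blast
  define d where "d = e / (1 + norm (b - a))"
  have d: "d > 0" using e by (simp add: d_def add_pos_nonneg)
  have "{0<..<d} \<subseteq> {t. poly q t = 0}"
  proof
    fix t assume t: "t \<in> {0<..<d}"
    have "t * norm (b - a) \<le> t * (1 + norm (b - a))" using t by (intro mult_left_mono) auto
    also have "\<dots> < d * (1 + norm (b - a))" using t by (intro mult_strict_right_mono) (auto simp: add_pos_nonneg)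
    also have "\<dots> = e" by (simp add: d_def add_pos_nonneg pos_less_divide_eq add_nonneg_eq_0_iff)
    finally have "f (a + t *\<^sub>R (b - a)) = 0" using t by (intro z) (simp add: dist_norm)
    then show "t \<in> {t. poly q t = 0}" by (simp add: q)
  qed
  moreover have "infinite {0<..<d}" using d by simp
  ultimately have "q = 0" using poly_roots_finite finite_subset by blast
  then show ?thesis using q[of 1] by simp
qed

section \<open>Complexification of real systems, feedbacks and polynomials\<close>

lemma map_poly_of_real_linear:
  "map_poly complex_of_real [:a:] = [:of_real a:]" "map_poly complex_of_real [:a, b:] = [:of_real a, of_real b:]"
  by (rule poly_eqI, simp add: coeff_map_poly coeff_pCons split: nat.split)+

lemma map_poly_of_real_fdet:
  "map_poly complex_of_real (fdet n E) = fdet n (\<lambda>i j. map_poly complex_of_real (E i j))"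
proof -
  let ?r = "map_poly complex_of_real"
  have mult: "?r (p * q) = ?r p * ?r q" for p q
    by (rule poly_eqI) (simp add: coeff_map_poly coeff_mult)
  have one: "?r 1 = 1" by (simp add: map_poly_1')
  have int: "?r (of_int k) = of_int k" for k :: int by (simp add: of_int_poly map_poly_of_real_linear)
  have prod: "?r (\<Prod>i\<in>I. g i) = (\<Prod>i\<in>I. ?r (g i))" for I :: "nat set" and g
    by (induction I rule: infinite_finite_induct) (simp_all add: one mult)
  have sum: "?r (\<Sum>i\<in>I. g i) = (\<Sum>i\<in>I. ?r (g i))" for I :: "(nat \<Rightarrow> nat) set" and g
    by (rule poly_eqI) (simp add: coeff_map_poly coeff_sum)
  show ?thesis unfolding fdet_def sum mult prod int ..
qed

lemma ent_complexify: "ent (complexify_matrix A) i j = complex_of_real (ent A i j)"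
  by (simp add: ent_def complexify_matrix_def map_matrix_def)

lemma pole_placement_complexify:
  fixes S :: "(real, 'n::finite, 'm::finite, 'p::finite) linsys"
  shows "pole_placement (complexify_sys S) (complexify_matrix K) = map_poly complex_of_real (pole_placement S K)"
proof -
  obtain A B C where S: "S = (A, B, C)" by (cases S)
  show ?thesis
    unfolding S complexify_sys_def pole_placement_def prod.case charpoly_fdet map_poly_of_real_fdet
    by (rule fdet_cong) (simp add: ent_loop ent_complexify map_poly_of_real_linear)
qed

definition cvec :: "real ^ 'n \<Rightarrow> complex ^ 'n" where "cvec v = (\<chi> i. complex_of_real (v $ i))"

lemma pvec_complexify: "pvec (map_poly complex_of_real q) = cvec (pvec q)"
  by (simp add: Finite_Cartesian_Product.vec_eq_iff pvec_def cvec_def coeff_map_poly)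

lemma Fmap_complexify:
  fixes S :: "(real, 'n::finite, 'm::finite, 'p::finite) linsys"
  shows "Fmap (complexify_sys S) (complexify_matrix K) = cvec (pvec (pole_placement S K))"
  by (simp add: Fmap_def pole_placement_complexify pvec_complexify)

lemma inj_cvec: "inj cvec"
  by (rule injI) (simp add: cvec_def Finite_Cartesian_Product.vec_eq_iff)

lemma Fmap_eq_cvec_iff:
  fixes S :: "(real, 'n::finite, 'm::finite, 'p::finite) linsys"
  assumes "\<phi> \<in> monic_polys CARD('n)"
  shows "Fmap (complexify_sys S) K = cvec (pvec \<phi>) \<longleftrightarrow> K \<in> complex_fiber S \<phi>"
proof -
  have "map_poly complex_of_real \<phi> \<in> monic_polys CARD('n)"
    using assms by (auto simp: monic_polys_def coeff_map_poly degree_map_poly)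
  from Fmap_eq_iff[OF this, of "complexify_sys S" K] show ?thesis
    by (simp add: pvec_complexify complex_fiber_def)
qed

lemma real_form_cvec: "real_form CARD('n) vco (cvec :: real ^ 'n \<Rightarrow> complex ^ 'n)"
  unfolding real_form_def
proof (intro conjI allI)
  show "linear (cvec :: real ^ 'n \<Rightarrow> complex ^ 'n)"
    by (rule linearI) (simp_all add: cvec_def Finite_Cartesian_Product.vec_eq_iff scaleR_conv_of_real[where 'a = complex])
  show "\<exists>v. \<forall>i<CARD('n). vco i (cvec v :: complex ^ 'n) = of_real (r i)" for r
    by (intro exI[of _ "\<chi> i. r (ix i)"]) (simp add: vco_def cvec_def)
qed

lemma real_form_complexify_matrix:
  "real_form (CARD('r) * CARD('c)) mco (complexify_matrix :: real ^ 'c ^ 'r \<Rightarrow> complex ^ 'c ^ 'r)"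
  unfolding real_form_def
proof (intro conjI allI)
  show "linear (complexify_matrix :: real ^ 'c ^ 'r \<Rightarrow> complex ^ 'c ^ 'r)"
    by (rule linearI) (simp_all add: complexify_matrix_def map_matrix_def Finite_Cartesian_Product.vec_eq_iff scaleR_conv_of_real[where 'a = complex])
  show "\<exists>v. \<forall>i<CARD('r) * CARD('c). mco i (complexify_matrix v :: complex ^ 'c ^ 'r) = of_real (r i)" for r
  proof (intro exI[of _ "\<chi> a b. r (ix a * CARD('c) + ix b)"] allI impI)
    fix i assume "i < CARD('r) * CARD('c)"
    then have "i div CARD('c) < CARD('r)" "i mod CARD('c) < CARD('c)" by (simp_all add: div_less_iff_less_mult)
    then show "mco i (complexify_matrix (\<chi> (a :: 'r) (b :: 'c). r (ix a * CARD('c) + ix b))) = complex_of_real (r i)"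
      unfolding mco_def ent_complexify by (simp add: ent_def)
  qed
qed

lemma real_form_complexify_sys:
  "real_form (CARD('n) * CARD('n) + (CARD('n) * CARD('m) + CARD('p) * CARD('n))) sco
    (complexify_sys :: (real, 'n::finite, 'm::finite, 'p::finite) linsys \<Rightarrow> (complex, 'n, 'm, 'p) linsys)"
proof -
  have eq: "(complexify_sys :: (real, 'n, 'm, 'p) linsys \<Rightarrow> (complex, 'n, 'm, 'p) linsys) = map_prod complexify_matrix (map_prod complexify_matrix complexify_matrix)"
    by (auto simp: complexify_sys_def)
  show ?thesis unfolding eq by (intro real_form_prod real_form_complexify_matrix)
qed

lemma closed_range_complexify_matrix: "closed (range (complexify_matrix :: real ^ 'c ^ 'r \<Rightarrow> complex ^ 'c ^ 'r))"
proof -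
  have "linear (complexify_matrix :: real ^ 'c ^ 'r \<Rightarrow> complex ^ 'c ^ 'r)"
    using real_form_complexify_matrix unfolding real_form_def by (rule conjunct1)
  then have "subspace (range (complexify_matrix :: real ^ 'c ^ 'r \<Rightarrow> complex ^ 'c ^ 'r))"
    by (rule linear_subspace_image[OF _ subspace_UNIV])
  then show ?thesis by (rule closed_subspace)
qed

theorem theorem2p3:
  assumes n: "CARD('n::finite) = CARD('m::finite) * CARD('p::finite)"
    and even: "even (grassmann_degree CARD('m) CARD('p))"
  shows "\<not> generic {S :: (real, 'n, 'm, 'p) linsys. pole_placement_surj S} \<longleftrightarrow>
    (\<exists>(S :: (real, 'n, 'm, 'p) linsys) \<phi>.
       \<phi> \<in> monic_polys CARD('n) \<and>
       finite (complex_fiber S \<phi>) \<and>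
       card (complex_fiber S \<phi>) = grassmann_degree CARD('m) CARD('p) \<and>
       (\<forall>K \<in> complex_fiber S \<phi>. K \<notin> range complexify_matrix))"
    (is "?L \<longleftrightarrow> ?R")
proof -
  let ?M = "CARD('n) * CARD('n) + (CARD('n) * CARD('m) + CARD('p) * CARD('n))" and ?d = "grassmann_degree CARD('m) CARD('p)"
  let ?c = "complexify_sys :: (real, 'n, 'm, 'p) linsys \<Rightarrow> (complex, 'n, 'm, 'p) linsys"
  let ?T = "range complexify_matrix :: (complex ^ 'p ^ 'm) set"
  obtain g :: "(complex, 'n, 'm, 'p) linsys \<Rightarrow> complex" and \<Delta> :: "(complex, 'n, 'm, 'p) linsys \<times> (complex ^ 'n) \<Rightarrow> complex" and S0 a
  where g: "g \<in> polyfun (sco ` {..<?M})" "g S0 \<noteq> 0"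
    and proper: "\<And>S. g S \<noteq> 0 \<Longrightarrow> \<exists>C. \<forall>K. norm K \<le> C * (1 + norm (Fmap S K))"
    and \<Delta>: "\<Delta> \<in> polyfun (coords_prod ?M sco vco ` {..<?M + CARD('n)})" "\<Delta> a \<noteq> 0"
    and count: "\<And>S f. \<Delta> (S, f) \<noteq> 0 \<Longrightarrow> finite {K. Fmap S K = f} \<and> card {K. Fmap S K = f} = ?d"
    and avoid: "\<And>(S :: (complex, 'n, 'm, 'p) linsys) f T. finite {K. Fmap S K = f} \<Longrightarrow> card {K. Fmap S K = f} = ?d \<Longrightarrow>
      closed T \<Longrightarrow> {K. Fmap S K = f} \<inter> T = {} \<Longrightarrow> \<exists>e>0. \<forall>S' K. dist S' S < e \<longrightarrow> K \<in> T \<longrightarrow> Fmap S' K \<noteq> f"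
    by (rule generic_fiber_card[where 'n = 'n and 'm = 'm and 'p = 'p, OF n], rule that)
  have lin_c: "linear ?c" using real_form_complexify_sys unfolding real_form_def by (rule conjunct1)
  have fiber: "{K. Fmap (?c S) K = cvec (pvec \<phi>)} = complex_fiber S \<phi>" if "\<phi> \<in> monic_polys CARD('n)" for S \<phi>
    using Fmap_eq_cvec_iff[OF that, of S] by blast
  show ?thesis
  proof
    assume ?R
    then obtain S :: "(real, 'n, 'm, 'p) linsys" and \<phi> where \<phi>: "\<phi> \<in> monic_polys CARD('n)" and fin: "finite (complex_fiber S \<phi>)" "card (complex_fiber S \<phi>) = ?d"
      and nr: "\<And>K. K \<in> complex_fiber S \<phi> \<Longrightarrow> K \<notin> ?T" by blast
    have "complex_fiber S \<phi> \<inter> ?T = {}" using nr by blast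
    \<comment> \<open>The closed set to be avoided is the linear subspace of real feedbacks; the
      conclusion holds for all systems near \<open>?c S\<close>, in particular for the complexified
      real ones.\<close>
    from avoid[of "?c S" "cvec (pvec \<phi>)" ?T, unfolded fiber[OF \<phi>], OF fin closed_range_complexify_matrix this]
    obtain e where e: "e > 0" "\<And>S' K. dist S' (?c S) < e \<Longrightarrow> K \<in> ?T \<Longrightarrow> Fmap S' K \<noteq> cvec (pvec \<phi>)" by blast
    have "continuous_on UNIV ?c" using lin_c unfolding linear_conv_bounded_linear by (rule linear_continuous_on)
    then obtain d where d: "d > 0" "\<And>S'. dist S' S < d \<Longrightarrow> dist (?c S') (?c S) < e"
      using e(1) unfolding continuous_on_iff by (meson UNIV_I)
    have nonsurj: "\<not> pole_placement_surj S'" if "dist S' S < d" for S'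
    proof
      assume "pole_placement_surj S'"
      then obtain K where "pole_placement S' K = \<phi>" using \<phi> unfolding pole_placement_surj_def by (metis imageE)
      then have "Fmap (?c S') (complexify_matrix K) = cvec (pvec \<phi>)" by (simp add: Fmap_complexify)
      then show False using e(2)[OF d(2)[OF that]] by blast
    qed
    show ?L
    proof
      assume "generic {S :: (real, 'n, 'm, 'p) linsys. pole_placement_surj S}"
      then obtain f :: "(real, 'n, 'm, 'p) linsys \<Rightarrow> real" and x where f: "real_polynomial_function f" "f x \<noteq> 0"
        "\<And>S. \<not> pole_placement_surj S \<Longrightarrow> f S = 0"
        unfolding generic_def by blast
      have "f x = 0" by (rule real_polynomial_function_zero_on_ball[OF f(1) d(1)]) (rule f(3)[OF nonsurj])
      then show False using f(2) by simp
    qed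
  next
    assume L: ?L
    obtain a1 a2 where a: "a = (a1, a2)" by (cases a)
    have \<Delta>1: "(\<lambda>S. \<Delta> (S, a2)) \<in> polyfun (sco ` {..<?M})"
      by (rule polyfun_compose[OF \<Delta>(1)]) (auto simp: coords_prod_image intro: polyfun.const polyfun.base)
    have \<Delta>2: "(\<lambda>f. \<Delta> (S, f)) \<in> polyfun (vco ` {..<CARD('n)})" for S
      by (rule polyfun_compose[OF \<Delta>(1)]) (auto simp: coords_prod_image intro: polyfun.const polyfun.base)
    \<comment> \<open>\<open>g\<close> secures properness, and the slice of \<open>\<Delta>\<close>
      at \<open>a2\<close> ensures that \<open>\<Delta>\<close> does not vanish identically over the
      system that will be found.\<close>
    define h where "h = (\<lambda>S. g S * \<Delta> (S, a2))"
    have hP: "h \<in> polyfun (sco ` {..<?M})" unfolding h_def by (rule polyfun.mult[OF g(1) \<Delta>1])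
    obtain v where "h v \<noteq> 0"
      using polyfun_mult_nonzero[OF coords_sco g(1) \<Delta>1 g(2), of a1] \<Delta>(2) unfolding a h_def by blast
    then obtain x where x: "h (?c x) \<noteq> 0" using real_form_nonzero[OF coords_sco real_form_complexify_sys hP] by blast
    \<comment> \<open>The squared modulus of \<open>h\<close> on real systems: a real polynomial
      with the same zeros. Failure of genericity, tested against it, gives a non-surjective system
      where \<open>h\<close> is nonzero.\<close>
    define R where "R = (\<lambda>S. Re (h (?c S)) * Re (h (?c S)) + Im (h (?c S)) * Im (h (?c S)))"
    have R0: "R S = 0 \<longleftrightarrow> h (?c S) = 0" for S
      unfolding R_def by (simp add: sum_squares_eq_zero_iff complex_eq_iff)
    have "linear c" if "c \<in> sco ` {..<?M}" for c :: "(complex, 'n, 'm, 'p) linsys \<Rightarrow> complex"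
      using that coords_linear[OF coords_sco] by blast
    from real_polynomial_function_Re_Im[OF hP this lin_c] have "real_polynomial_function R"
      unfolding R_def by (intro real_polynomial_function.intros(3,4)) auto
    moreover have "R x \<noteq> 0" using x R0 by blast
    ultimately obtain S where S: "\<not> pole_placement_surj S" "h (?c S) \<noteq> 0"
      using L R0 unfolding generic_def by blast
    then have gS: "g (?c S) \<noteq> 0" and \<Delta>S: "\<Delta> (?c S, a2) \<noteq> 0" by (auto simp: h_def)
    obtain \<phi>0 where \<phi>0: "\<phi>0 \<in> monic_polys CARD('n)" "\<phi>0 \<notin> range (pole_placement S)"
      using S(1) pole_placement_monic[of S] unfolding pole_placement_surj_def by blast
    obtain C where C: "\<And>K. norm K \<le> C * (1 + norm (Fmap (?c S) K))" using proper[OF gS] by blast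
    define z where "z = (cvec (pvec \<phi>0) :: complex ^ 'n)"
    \<comment> \<open>By properness this compact set contains every real feedback whose value has
      distance below \<open>1\<close> from \<open>z\<close>, because such a value has norm at most
      \<open>1 + norm z\<close>. Removing its image from the unit ball therefore leaves an open set
      without real solutions.\<close>
    define B where "B = ?T \<inter> cball 0 (\<bar>C\<bar> * (2 + norm z))"
    define W where "W = ball z 1 - Fmap (?c S) ` B"
    have cont: "continuous_on B (Fmap (?c S))"
      by (rule polynomial_family.continuous_F[OF polynomial_family_Fmap[OF n]])
    have "compact B" unfolding B_def by (intro closed_Int_compact closed_range_complexify_matrix compact_cball)
    then have "compact (Fmap (?c S) ` B)" by (rule compact_continuous_image[OF cont])
    then have "open W" unfolding W_def by (intro open_Diff open_ball compact_imp_closed)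
    have miss: "Fmap (?c S) (complexify_matrix K) \<noteq> z" for K
    proof
      assume "Fmap (?c S) (complexify_matrix K) = z"
      then have "pvec (pole_placement S K) = (pvec \<phi>0 :: real ^ 'n)"
        unfolding Fmap_complexify z_def by (rule injD[OF inj_cvec])
      then show False using pvec_inj[OF pole_placement_monic \<phi>0(1), of S K] \<phi>0(2) by auto
    qed
    have "z \<in> W" using miss by (auto simp: W_def B_def)
    have disj: "Fmap (?c S) (complexify_matrix K) \<notin> W" for K
    proof
      let ?K = "complexify_matrix K"
      assume W: "Fmap (?c S) ?K \<in> W"
      then have "dist z (Fmap (?c S) ?K) < 1" by (simp add: W_def)
      then have "norm (Fmap (?c S) ?K) \<le> 1 + norm z"
        using norm_triangle_sub[of "Fmap (?c S) ?K" z] by (simp add: dist_norm norm_minus_commute)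
      then have "C * (1 + norm (Fmap (?c S) ?K)) \<le> \<bar>C\<bar> * (2 + norm z)" by (intro mult_mono) auto
      then have "?K \<in> B" using C[of ?K] by (auto simp: B_def)
      then show False using W by (auto simp: W_def)
    qed
    have "open (cvec -` W :: (real ^ 'n) set)"
    proof (rule open_vimage[OF \<open>open W\<close>])
      show "continuous_on UNIV (cvec :: real ^ 'n \<Rightarrow> complex ^ 'n)"
        using conjunct1[OF real_form_cvec[unfolded real_form_def]] unfolding linear_conv_bounded_linear by (rule linear_continuous_on)
    qed
    moreover have "pvec \<phi>0 \<in> (cvec -` W :: (real ^ 'n) set)" using \<open>z \<in> W\<close> by (simp add: z_def)
    ultimately obtain v where v: "cvec v \<in> W" "\<Delta> (?c S, cvec v) \<noteq> 0"
      using real_form_dense[OF coords_vco real_form_cvec \<Delta>2 \<Delta>S] by blast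
    have "K \<notin> ?T" if "K \<in> complex_fiber S (vpoly v)" for K
    proof
      assume "K \<in> ?T"
      then obtain K' where K': "K = complexify_matrix K'" by blast
      have "Fmap (?c S) K = cvec v" using Fmap_eq_cvec_iff[OF vpoly_monic, of S K v] that by simp
      then show False using disj[of K'] v(1) by (simp add: K')
    qed
    moreover have "finite (complex_fiber S (vpoly v))" "card (complex_fiber S (vpoly v)) = ?d"
      using count[OF v(2)] fiber[OF vpoly_monic, of S v] by simp_all
    ultimately show ?R using vpoly_monic by blast
  qed
qed

end
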